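(* Let $(\mathcal{S}_1,\mathcal{A}_1)\xrightarrow{(\phi_1,\pi_1)}(\mathcal{S}_2,\mathcal{A}_2)\xrightarrow{(\phi_2,\pi_2)}(\mathcal{S}_3,\mathcal{A}_3)\xrightarrow{(\phi_3,\pi_3)}\cdots$ be an inductive system in the category $\mathbf{OC^*S}$ of operator C*-systems and operator C*-system homomorphisms. Let $\widehat{\mathcal{S}}_\infty$ be the completion of $\mathcal{S}_\infty=\varinjlim_{\mathbf{OS}}\mathcal{S}_k$, let $\widehat{\mathcal{A}}_\infty=\varinjlim_{\mathbf{C}^*}\mathcal{A}_k$, equip $\widehat{\mathcal{S}}_\infty$ with the $\widehat{\mathcal{A}}_\infty$-bimodule structure described in the context, and let $\phi_{k,\infty}:\mathcal{S}_k\to\widehat{\mathcal{S}}_\infty$, $\pi_{k,\infty}:\mathcal{A}_k\to\widehat{\mathcal{A}}_\infty$ be the canonical maps. Then $(\widehat{\mathcal{S}}_\infty,\widehat{\mathcal{A}}_\infty)$, together with $\{(\phi_{k,\infty},\pi_{k,\infty})\}_{k\in\mathbb{N}}$, is an inductive limit of this inductive system in $\mathbf{OC^*S}$.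
   Context: An operator system is a matrix ordered $*$-vector space with an Archimedean matrix order unit; $\mathbf{OS}$ is the category of operator systems and unital completely positive maps. Operator C*-system: a pair $(\mathcal{S},\mathcal{A})$, where $\mathcal{S}$ is a complete operator system with unit $e$, $\mathcal{A}$ is a unital C*-algebra, $\mathcal{S}$ is an $\mathcal{A}$-bimodule (action denoted $\cdot$), $a\cdot e=e\cdot a$ for all $a\in\mathcal{A}$, and $A^*\cdot X\cdot A\in M_n(\mathcal{S})^+$ whenever $n\in\mathbb{N}$, $X\in M_n(\mathcal{S})^+$ and $A\in M_n(\mathcal{A})$, where $M_n(\mathcal{A})$ acts on $M_n(\mathcal{S})$ by $(a_{i,j})\cdot(s_{i,j})=(\sum_ka_{i,k}\cdot s_{k,j})$ and $(s_{i,j})\cdot(a_{i,j})=(\sum_ks_{i,k}\cdot a_{k,j})$. An operator C*-system homomorphism $(\phi,\pi):(\mathcal{S},\mathcal{A})\to(\mathcal{T},\mathcal{B})$ consists of a unital completely positive map $\phi:\mathcal{S}\to\mathcal{T}$ and a unital $*$-homomorphism $\pi:\mathcal{A}\to\mathcal{B}$ with $\phi(a_1\cdot s\cdot a_2)=\pi(a_1)\cdot\phi(s)\cdot\pi(a_2)$ for all $a_1,a_2\in\mathcal{A}$, $s\in\mathcal{S}$. These are the objects and morphisms of $\mathbf{OC^*S}$ (composition componentwise). Inductive limit of a system $(\{A_k\},\{\alpha_k\})$ in a category: an object $A$ with morphisms $\alpha_{k,\infty}:A_k\to A$ such that $\alpha_{k+1,\infty}\circ\alpha_k=\alpha_{k,\infty}$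 and, for any morphisms $\beta_k:A_k\to B$ with $\beta_{k+1}\circ\alpha_k=\beta_k$ for all $k$, there is a unique morphism $\mu:A\to B$ with $\mu\circ\alpha_{k,\infty}=\beta_k$ for all $k$. Inductive limits exist in $\mathbf{OS}$ and in the category $\mathbf{C}^*$ of unital C*-algebras and unital $*$-homomorphisms; $\mathcal{S}_\infty=\bigcup_k\phi_{k,\infty}(\mathcal{S}_k)$, and $\bigcup_k\pi_{k,\infty}(\mathcal{A}_k)$ is dense in $\widehat{\mathcal{A}}_\infty$. The completion of an operator system is its norm completion with matrix cones the closures of the original matrix cones; it is an operator system. Bimodule structure: any $a,b\in\widehat{\mathcal{A}}_\infty$ and $s\in\widehat{\mathcal{S}}_\infty$ can be written $a=\lim_n\pi_{m_n,\infty}(a_{m_n})$, $b=\lim_n\pi_{m_n,\infty}(b_{m_n})$, $s=\lim_n\phi_{m_n,\infty}(s_{m_n})$ with a common sequence $(m_n)$ and $a_{m_n},b_{m_n}\in\mathcal{A}_{m_n}$, $s_{m_n}\in\mathcal{S}_{m_n}$; one sets $a\cdot s=\lim_n\phi_{m_n,\infty}(a_{m_n}\cdot s_{m_n})$ and $s\cdot b=\lim_n\phi_{m_n,\infty}(s_{m_n}\cdot b_{m_n})$, which is well defined. *)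

theory Defs
  imports Complex_Main "HOL-Algebra.Ring" "HOL-Algebra.Module" "Jordan_Normal_Form.Matrix"
begin

text \<open>
  All spaces are carrier based, so that the members of an inductive system may differ although they
  live in one HOL type. Vector spaces over the complex numbers are HOL-Algebra modules over
  the ring below; in the records for operator systems the fields \<open>mult\<close> and \<open>one\<close> inherited
  from \<open>module\<close> carry no meaning.
\<close>

definition complex_ring :: "complex ring" where
  "complex_ring = \<lparr>carrier = UNIV, mult = (*), one = 1, zero = 0, add = (+)\<rparr>"

record 'a star_space = "(complex, 'a) module" +
  invol :: "'a \<Rightarrow> 'a"

locale star_vector_space = module complex_ring V for V (structure) +
  assumes invol_closed: "x \<in> carrier V \<Longrightarrow> invol V x \<in> carrier V"
    and invol_invol: "x \<in> carrier V \<Longrightarrow> invol V (invol V x) = x"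
    and invol_add: "\<lbrakk>x \<in> carrier V; y \<in> carrier V\<rbrakk> \<Longrightarrow> invol V (x \<oplus> y) = invol V x \<oplus> invol V y"
    and invol_smult: "x \<in> carrier V \<Longrightarrow> invol V (c \<odot>\<^bsub>V\<^esub> x) = cnj c \<odot>\<^bsub>V\<^esub> invol V x"

definition complex_linear ::
  "(complex, 'a, 'm) module_scheme \<Rightarrow> (complex, 'b, 'n) module_scheme \<Rightarrow> ('a \<Rightarrow> 'b) \<Rightarrow> bool" where
  "complex_linear V W f \<longleftrightarrow>
     f \<in> carrier V \<rightarrow> carrier W \<and>
     (\<forall>x\<in>carrier V. \<forall>y\<in>carrier V. f (x \<oplus>\<^bsub>V\<^esub> y) = f x \<oplus>\<^bsub>W\<^esub> f y) \<and>
     (\<forall>c. \<forall>x\<in>carrier V. f (c \<odot>\<^bsub>V\<^esub> x) = c \<odot>\<^bsub>W\<^esub> f x)"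


section \<open>Unital C*-algebras\<close>

record 'a cstar = "'a star_space" +
  nrm :: "'a \<Rightarrow> real"

locale cstar_algebra = ring A + star_vector_space A for A :: "'a cstar" (structure) +
  assumes smult_mult_left: "\<lbrakk>x \<in> carrier A; y \<in> carrier A\<rbrakk> \<Longrightarrow> (c \<odot>\<^bsub>A\<^esub> x) \<otimes> y = c \<odot>\<^bsub>A\<^esub> (x \<otimes> y)"
    and smult_mult_right: "\<lbrakk>x \<in> carrier A; y \<in> carrier A\<rbrakk> \<Longrightarrow> x \<otimes> (c \<odot>\<^bsub>A\<^esub> y) = c \<odot>\<^bsub>A\<^esub> (x \<otimes> y)"
    and invol_mult: "\<lbrakk>x \<in> carrier A; y \<in> carrier A\<rbrakk> \<Longrightarrow> invol A (x \<otimes> y) = invol A y \<otimes> invol A x"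
    and nrm_nonneg: "x \<in> carrier A \<Longrightarrow> 0 \<le> nrm A x"
    and nrm_eq_zero: "x \<in> carrier A \<Longrightarrow> nrm A x = 0 \<longleftrightarrow> x = \<zero>"
    and nrm_triangle: "\<lbrakk>x \<in> carrier A; y \<in> carrier A\<rbrakk> \<Longrightarrow> nrm A (x \<oplus> y) \<le> nrm A x + nrm A y"
    and nrm_smult: "x \<in> carrier A \<Longrightarrow> nrm A (c \<odot>\<^bsub>A\<^esub> x) = cmod c * nrm A x"
    and nrm_mult: "\<lbrakk>x \<in> carrier A; y \<in> carrier A\<rbrakk> \<Longrightarrow> nrm A (x \<otimes> y) \<le> nrm A x * nrm A y"
    and cstar_identity: "x \<in> carrier A \<Longrightarrow> nrm A (invol A x \<otimes> x) = (nrm A x)\<^sup>2"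
    and complete: "\<lbrakk>\<And>n. f n \<in> carrier A;
        \<forall>\<epsilon>>0. \<exists>N. \<forall>m\<ge>N. \<forall>n\<ge>N. nrm A (f m \<ominus> f n) < \<epsilon>\<rbrakk>
      \<Longrightarrow> \<exists>x\<in>carrier A. (\<lambda>n. nrm A (f n \<ominus> x)) \<longlonglongrightarrow> 0"

definition cstar_hom :: "'a cstar \<Rightarrow> 'b cstar \<Rightarrow> ('a \<Rightarrow> 'b) \<Rightarrow> bool" where
  "cstar_hom A B \<pi> \<longleftrightarrow> \<pi> \<in> ring_hom A B \<and> complex_linear A B \<pi> \<and>
     (\<forall>a\<in>carrier A. \<pi> (invol A a) = invol B (\<pi> a))"

definition cstar_lim :: "'a cstar \<Rightarrow> (nat \<Rightarrow> 'a) \<Rightarrow> 'a \<Rightarrow> bool" where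
  "cstar_lim A f a \<longleftrightarrow> (\<lambda>n. nrm A (f n \<ominus>\<^bsub>A\<^esub> a)) \<longlonglongrightarrow> 0"


section \<open>Operator systems\<close>

text \<open>\<open>pos S n\<close> is the cone of positive n by n matrices over \<open>S\<close>, \<open>ounit S\<close> the unit.\<close>

record 's opsys = "'s star_space" +
  ounit :: 's
  pos :: "nat \<Rightarrow> 's mat set"

definition mats :: "('s, 'm) ring_scheme \<Rightarrow> nat \<Rightarrow> 's mat set" where
  "mats S n = {X \<in> carrier_mat n n. elements_mat X \<subseteq> carrier S}"

definition mat_invol :: "('s, 'm) star_space_scheme \<Rightarrow> 's mat \<Rightarrow> 's mat" where
  "mat_invol S X = mat (dim_col X) (dim_row X) (\<lambda>(i, j). invol S (X $$ (j, i)))"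

definition herm :: "('s, 'm) star_space_scheme \<Rightarrow> nat \<Rightarrow> 's mat set" where
  "herm S n = {X \<in> mats S n. mat_invol S X = X}"

definition madd :: "('s, 'm) ring_scheme \<Rightarrow> 's mat \<Rightarrow> 's mat \<Rightarrow> 's mat" where
  "madd S X Y = mat (dim_row X) (dim_col X) (\<lambda>ij. X $$ ij \<oplus>\<^bsub>S\<^esub> Y $$ ij)"

definition msub :: "('s, 'm) ring_scheme \<Rightarrow> 's mat \<Rightarrow> 's mat \<Rightarrow> 's mat" where
  "msub S X Y = mat (dim_row X) (dim_col X) (\<lambda>ij. X $$ ij \<ominus>\<^bsub>S\<^esub> Y $$ ij)"

definition mscale :: "(complex, 's, 'm) module_scheme \<Rightarrow> real \<Rightarrow> 's mat \<Rightarrow> 's mat" where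
  "mscale S r X = map_mat (\<lambda>x. complex_of_real r \<odot>\<^bsub>S\<^esub> x) X"

definition mzero :: "('s, 'm) ring_scheme \<Rightarrow> nat \<Rightarrow> 's mat" where
  "mzero S n = mat n n (\<lambda>_. \<zero>\<^bsub>S\<^esub>)"

definition munit :: "'s opsys \<Rightarrow> nat \<Rightarrow> 's mat" where
  "munit S n = mat n n (\<lambda>(i, j). if i = j then ounit S else \<zero>\<^bsub>S\<^esub>)"

text \<open>The compression of \<open>X\<close> by a scalar matrix \<open>\<alpha>\<close>: the conjugate transpose of \<open>\<alpha>\<close>, times \<open>X\<close>,
  times \<open>\<alpha>\<close>.\<close>

definition compress :: "(complex, 's, 'm) module_scheme \<Rightarrow> complex mat \<Rightarrow> 's mat \<Rightarrow> 's mat" where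
  "compress S \<alpha> X = mat (dim_col \<alpha>) (dim_col \<alpha>) (\<lambda>(i, j).
     \<Oplus>\<^bsub>S\<^esub>k\<in>{..<dim_row \<alpha>}. \<Oplus>\<^bsub>S\<^esub>l\<in>{..<dim_row \<alpha>}.
       (cnj (\<alpha> $$ (k, i)) * \<alpha> $$ (l, j)) \<odot>\<^bsub>S\<^esub> X $$ (k, l))"

text \<open>The size 0 is harmless here and below: the axioms force \<open>pos S 0\<close> to consist of the empty matrix.\<close>

locale operator_system = star_vector_space S for S :: "'s opsys" (structure) +
  assumes pos_herm: "pos S n \<subseteq> herm S n"
    and pos_zero: "mzero S n \<in> pos S n"
    and pos_add: "\<lbrakk>X \<in> pos S n; Y \<in> pos S n\<rbrakk> \<Longrightarrow> madd S X Y \<in> pos S n"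
    and pos_scale: "\<lbrakk>X \<in> pos S n; 0 \<le> r\<rbrakk> \<Longrightarrow> mscale S r X \<in> pos S n"
    and pos_proper: "\<lbrakk>X \<in> pos S n; msub S (mzero S n) X \<in> pos S n\<rbrakk> \<Longrightarrow> X = mzero S n"
    and pos_compress: "\<lbrakk>X \<in> pos S n; \<alpha> \<in> carrier_mat n m\<rbrakk> \<Longrightarrow> compress S \<alpha> X \<in> pos S m"
    and ounit_closed: "ounit S \<in> carrier S"
    and ounit_herm: "invol S (ounit S) = ounit S"
    and order_unit: "X \<in> herm S n \<Longrightarrow> \<exists>r>0. msub S (mscale S r (munit S n)) X \<in> pos S n"
    and archimedean: "\<lbrakk>X \<in> herm S n; \<And>r. r > 0 \<Longrightarrow> madd S (mscale S r (munit S n)) X \<in> pos S n\<rbrakk>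
      \<Longrightarrow> X \<in> pos S n"

definition ucp :: "'s opsys \<Rightarrow> 't opsys \<Rightarrow> ('s \<Rightarrow> 't) \<Rightarrow> bool" where
  "ucp S T \<phi> \<longleftrightarrow> complex_linear S T \<phi> \<and> \<phi> (ounit S) = ounit T \<and>
     (\<forall>n. \<forall>X\<in>pos S n. map_mat \<phi> X \<in> pos T n)"

text \<open>The (matrix) norm of an operator system is the one defined by its matrix order.\<close>

definition mnorm :: "'s opsys \<Rightarrow> 's mat \<Rightarrow> real" where
  "mnorm S X = (let n = dim_row X; R = (\<lambda>r. mscale S r (munit S n)) in
     Inf {r. 0 \<le> r \<and> four_block_mat (R r) X (mat_invol S X) (R r) \<in> pos S (2 * n)})"

definition os_norm :: "'s opsys \<Rightarrow> 's \<Rightarrow> real" where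
  "os_norm S x = mnorm S (mat 1 1 (\<lambda>_. x))"

definition os_lim :: "'s opsys \<Rightarrow> (nat \<Rightarrow> 's) \<Rightarrow> 's \<Rightarrow> bool" where
  "os_lim S f x \<longleftrightarrow> (\<lambda>n. os_norm S (f n \<ominus>\<^bsub>S\<^esub> x)) \<longlonglongrightarrow> 0"

definition os_complete :: "'s opsys \<Rightarrow> bool" where
  "os_complete S \<longleftrightarrow> (\<forall>f. (\<forall>n. f n \<in> carrier S) \<longrightarrow>
     (\<forall>\<epsilon>>0. \<exists>N. \<forall>m\<ge>N. \<forall>n\<ge>N. os_norm S (f m \<ominus>\<^bsub>S\<^esub> f n) < \<epsilon>) \<longrightarrow>
     (\<exists>x\<in>carrier S. os_lim S f x))"

text \<open>\<open>T\<close>, with the embedding \<open>\<iota>\<close>, is the completion of \<open>S\<close>: the norm completion, with the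
  closures of the matrix cones of \<open>S\<close> as matrix cones. As the norm of \<open>T\<close> is derived from its matrix
  order, the isometry condition says that this order induces the norm of the completion.\<close>

definition os_completion :: "'s opsys \<Rightarrow> ('s \<Rightarrow> 't) \<Rightarrow> 't opsys \<Rightarrow> bool" where
  "os_completion S \<iota> T \<longleftrightarrow>
     operator_system T \<and> os_complete T \<and>
     complex_linear S T \<iota> \<and>
     (\<forall>x\<in>carrier S. \<iota> (invol S x) = invol T (\<iota> x)) \<and>
     \<iota> (ounit S) = ounit T \<and>
     (\<forall>x\<in>carrier S. os_norm T (\<iota> x) = os_norm S x) \<and>
     (\<forall>t\<in>carrier T. \<exists>f. (\<forall>n. f n \<in> carrier S) \<and> os_lim T (\<lambda>n. \<iota> (f n)) t) \<and>
     (\<forall>n. pos T n = {X \<in> mats T n. \<exists>Y. (\<forall>k. Y k \<in> pos S n) \<and>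
        (\<lambda>k. mnorm T (msub T (map_mat \<iota> (Y k)) X)) \<longlonglongrightarrow> 0})"


section \<open>Operator C*-systems\<close>

record ('s, 'a) ocsys =
  osys :: "'s opsys"
  calg :: "'a cstar"
  lact :: "'a \<Rightarrow> 's \<Rightarrow> 's"
  ract :: "'s \<Rightarrow> 'a \<Rightarrow> 's"

locale bimodule =
  A: cstar_algebra A + S: star_vector_space S
  for A :: "'a cstar" and S :: "'s opsys" and l :: "'a \<Rightarrow> 's \<Rightarrow> 's" and r :: "'s \<Rightarrow> 'a \<Rightarrow> 's" +
  assumes l_closed: "\<lbrakk>a \<in> carrier A; s \<in> carrier S\<rbrakk> \<Longrightarrow> l a s \<in> carrier S"
    and r_closed: "\<lbrakk>a \<in> carrier A; s \<in> carrier S\<rbrakk> \<Longrightarrow> r s a \<in> carrier S"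
    and l_add_right: "\<lbrakk>a \<in> carrier A; s \<in> carrier S; t \<in> carrier S\<rbrakk>
      \<Longrightarrow> l a (s \<oplus>\<^bsub>S\<^esub> t) = l a s \<oplus>\<^bsub>S\<^esub> l a t"
    and l_add_left: "\<lbrakk>a \<in> carrier A; b \<in> carrier A; s \<in> carrier S\<rbrakk>
      \<Longrightarrow> l (a \<oplus>\<^bsub>A\<^esub> b) s = l a s \<oplus>\<^bsub>S\<^esub> l b s"
    and r_add_left: "\<lbrakk>a \<in> carrier A; s \<in> carrier S; t \<in> carrier S\<rbrakk>
      \<Longrightarrow> r (s \<oplus>\<^bsub>S\<^esub> t) a = r s a \<oplus>\<^bsub>S\<^esub> r t a"
    and r_add_right: "\<lbrakk>a \<in> carrier A; b \<in> carrier A; s \<in> carrier S\<rbrakk>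
      \<Longrightarrow> r s (a \<oplus>\<^bsub>A\<^esub> b) = r s a \<oplus>\<^bsub>S\<^esub> r s b"
    and l_smult_left: "\<lbrakk>a \<in> carrier A; s \<in> carrier S\<rbrakk> \<Longrightarrow> l (c \<odot>\<^bsub>A\<^esub> a) s = c \<odot>\<^bsub>S\<^esub> l a s"
    and l_smult_right: "\<lbrakk>a \<in> carrier A; s \<in> carrier S\<rbrakk> \<Longrightarrow> l a (c \<odot>\<^bsub>S\<^esub> s) = c \<odot>\<^bsub>S\<^esub> l a s"
    and r_smult_left: "\<lbrakk>a \<in> carrier A; s \<in> carrier S\<rbrakk> \<Longrightarrow> r (c \<odot>\<^bsub>S\<^esub> s) a = c \<odot>\<^bsub>S\<^esub> r s a"
    and r_smult_right: "\<lbrakk>a \<in> carrier A; s \<in> carrier S\<rbrakk> \<Longrightarrow> r s (c \<odot>\<^bsub>A\<^esub> a) = c \<odot>\<^bsub>S\<^esub> r s a"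
    and l_mult: "\<lbrakk>a \<in> carrier A; b \<in> carrier A; s \<in> carrier S\<rbrakk> \<Longrightarrow> l (a \<otimes>\<^bsub>A\<^esub> b) s = l a (l b s)"
    and r_mult: "\<lbrakk>a \<in> carrier A; b \<in> carrier A; s \<in> carrier S\<rbrakk> \<Longrightarrow> r s (a \<otimes>\<^bsub>A\<^esub> b) = r (r s a) b"
    and l_r: "\<lbrakk>a \<in> carrier A; b \<in> carrier A; s \<in> carrier S\<rbrakk> \<Longrightarrow> r (l a s) b = l a (r s b)"
    and l_one: "s \<in> carrier S \<Longrightarrow> l \<one>\<^bsub>A\<^esub> s = s"
    and r_one: "s \<in> carrier S \<Longrightarrow> r s \<one>\<^bsub>A\<^esub> = s"

definition mat_lact :: "('s, 'a) ocsys \<Rightarrow> 'a mat \<Rightarrow> 's mat \<Rightarrow> 's mat" where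
  "mat_lact X M Y = mat (dim_row M) (dim_col Y) (\<lambda>(i, j).
     \<Oplus>\<^bsub>osys X\<^esub>k\<in>{..<dim_row Y}. lact X (M $$ (i, k)) (Y $$ (k, j)))"

definition mat_ract :: "('s, 'a) ocsys \<Rightarrow> 's mat \<Rightarrow> 'a mat \<Rightarrow> 's mat" where
  "mat_ract X Y M = mat (dim_row Y) (dim_col M) (\<lambda>(i, j).
     \<Oplus>\<^bsub>osys X\<^esub>k\<in>{..<dim_col Y}. ract X (Y $$ (i, k)) (M $$ (k, j)))"

definition ocs :: "('s, 'a) ocsys \<Rightarrow> bool" where
  "ocs X \<longleftrightarrow>
     operator_system (osys X) \<and> os_complete (osys X) \<and> cstar_algebra (calg X) \<and>
     bimodule (calg X) (osys X) (lact X) (ract X) \<and>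
     (\<forall>a\<in>carrier (calg X). lact X a (ounit (osys X)) = ract X (ounit (osys X)) a) \<and>
     (\<forall>n. \<forall>Y\<in>pos (osys X) n. \<forall>M\<in>mats (calg X) n.
        mat_ract X (mat_lact X (mat_invol (calg X) M) Y) M \<in> pos (osys X) n)"

definition ocs_hom ::
  "('s, 'a) ocsys \<Rightarrow> ('t, 'b) ocsys \<Rightarrow> ('s \<Rightarrow> 't) \<Rightarrow> ('a \<Rightarrow> 'b) \<Rightarrow> bool" where
  "ocs_hom X Y \<phi> \<pi> \<longleftrightarrow>
     ucp (osys X) (osys Y) \<phi> \<and> cstar_hom (calg X) (calg Y) \<pi> \<and>
     (\<forall>a1\<in>carrier (calg X). \<forall>a2\<in>carrier (calg X). \<forall>s\<in>carrier (osys X).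
        \<phi> (ract X (lact X a1 s) a2) = ract Y (lact Y (\<pi> a1) (\<phi> s)) (\<pi> a2))"


section \<open>Inductive limits\<close>

text \<open>In each of the three categories, the first argument fixes the HOL type(s) of the objects against
  which the universal property is tested, since HOL formulas cannot quantify over types.
  For a limit that is given, its own type and the type \<open>(nat \<Rightarrow> 's) set\<close> suffice to characterise
  it up to isomorphism: sets of sequences host the concrete construction, by eventually coherent
  sequences modulo null sequences for operator systems and, for C*-algebras, by the closure of these
  in the algebra of bounded sequences modulo null sequences.
  Morphisms are identified when they agree on the carriers.\<close>

definition os_inductive_limit ::
  "'t itself \<Rightarrow> (nat \<Rightarrow> 's opsys) \<Rightarrow> (nat \<Rightarrow> 's \<Rightarrow> 's) \<Rightarrow> 'u opsys \<Rightarrow> (nat \<Rightarrow> 's \<Rightarrow> 'u) \<Rightarrow> bool" where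
  "os_inductive_limit _ S \<phi> L \<phi>i \<longleftrightarrow>
     operator_system L \<and>
     (\<forall>k. ucp (S k) L (\<phi>i k)) \<and>
     (\<forall>k. \<forall>s\<in>carrier (S k). \<phi>i (Suc k) (\<phi> k s) = \<phi>i k s) \<and>
     (\<forall>(T :: 't opsys) \<beta>.
        operator_system T \<and> (\<forall>k. ucp (S k) T (\<beta> k)) \<and>
        (\<forall>k. \<forall>s\<in>carrier (S k). \<beta> (Suc k) (\<phi> k s) = \<beta> k s) \<longrightarrow>
        (\<exists>\<mu>. ucp L T \<mu> \<and> (\<forall>k. \<forall>s\<in>carrier (S k). \<mu> (\<phi>i k s) = \<beta> k s) \<and>
           (\<forall>\<mu>'. ucp L T \<mu>' \<and> (\<forall>k. \<forall>s\<in>carrier (S k). \<mu>' (\<phi>i k s) = \<beta> k s) \<longrightarrow>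
              (\<forall>x\<in>carrier L. \<mu>' x = \<mu> x))))"

definition cstar_inductive_limit ::
  "'b itself \<Rightarrow> (nat \<Rightarrow> 'a cstar) \<Rightarrow> (nat \<Rightarrow> 'a \<Rightarrow> 'a) \<Rightarrow> 'w cstar \<Rightarrow> (nat \<Rightarrow> 'a \<Rightarrow> 'w) \<Rightarrow> bool" where
  "cstar_inductive_limit _ A \<pi> L \<pi>i \<longleftrightarrow>
     cstar_algebra L \<and>
     (\<forall>k. cstar_hom (A k) L (\<pi>i k)) \<and>
     (\<forall>k. \<forall>a\<in>carrier (A k). \<pi>i (Suc k) (\<pi> k a) = \<pi>i k a) \<and>
     (\<forall>(B :: 'b cstar) \<beta>.
        cstar_algebra B \<and> (\<forall>k. cstar_hom (A k) B (\<beta> k)) \<and>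
        (\<forall>k. \<forall>a\<in>carrier (A k). \<beta> (Suc k) (\<pi> k a) = \<beta> k a) \<longrightarrow>
        (\<exists>\<mu>. cstar_hom L B \<mu> \<and> (\<forall>k. \<forall>a\<in>carrier (A k). \<mu> (\<pi>i k a) = \<beta> k a) \<and>
           (\<forall>\<mu>'. cstar_hom L B \<mu>' \<and> (\<forall>k. \<forall>a\<in>carrier (A k). \<mu>' (\<pi>i k a) = \<beta> k a) \<longrightarrow>
              (\<forall>x\<in>carrier L. \<mu>' x = \<mu> x))))"

definition ocs_inductive_system ::
  "(nat \<Rightarrow> ('s, 'a) ocsys) \<Rightarrow> (nat \<Rightarrow> 's \<Rightarrow> 's) \<Rightarrow> (nat \<Rightarrow> 'a \<Rightarrow> 'a) \<Rightarrow> bool" where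
  "ocs_inductive_system X \<phi> \<pi> \<longleftrightarrow>
     (\<forall>k. ocs (X k)) \<and> (\<forall>k. ocs_hom (X k) (X (Suc k)) (\<phi> k) (\<pi> k))"

definition ocs_inductive_limit ::
  "'t itself \<Rightarrow> 'b itself \<Rightarrow>
   (nat \<Rightarrow> ('s, 'a) ocsys) \<Rightarrow> (nat \<Rightarrow> 's \<Rightarrow> 's) \<Rightarrow> (nat \<Rightarrow> 'a \<Rightarrow> 'a) \<Rightarrow>
   ('v, 'w) ocsys \<Rightarrow> (nat \<Rightarrow> 's \<Rightarrow> 'v) \<Rightarrow> (nat \<Rightarrow> 'a \<Rightarrow> 'w) \<Rightarrow> bool" where
  "ocs_inductive_limit _ _ X \<phi> \<pi> L \<phi>i \<pi>i \<longleftrightarrow>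
     ocs L \<and>
     (\<forall>k. ocs_hom (X k) L (\<phi>i k) (\<pi>i k)) \<and>
     (\<forall>k. (\<forall>s\<in>carrier (osys (X k)). \<phi>i (Suc k) (\<phi> k s) = \<phi>i k s) \<and>
          (\<forall>a\<in>carrier (calg (X k)). \<pi>i (Suc k) (\<pi> k a) = \<pi>i k a)) \<and>
     (\<forall>(Y :: ('t, 'b) ocsys) \<beta> \<rho>.
        ocs Y \<and> (\<forall>k. ocs_hom (X k) Y (\<beta> k) (\<rho> k)) \<and>
        (\<forall>k. (\<forall>s\<in>carrier (osys (X k)). \<beta> (Suc k) (\<phi> k s) = \<beta> k s) \<and>
             (\<forall>a\<in>carrier (calg (X k)). \<rho> (Suc k) (\<pi> k a) = \<rho> k a)) \<longrightarrow>
        (\<exists>\<mu> \<nu>. ocs_hom L Y \<mu> \<nu> \<and>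
           (\<forall>k. (\<forall>s\<in>carrier (osys (X k)). \<mu> (\<phi>i k s) = \<beta> k s) \<and>
                (\<forall>a\<in>carrier (calg (X k)). \<nu> (\<pi>i k a) = \<rho> k a)) \<and>
           (\<forall>\<mu>' \<nu>'. ocs_hom L Y \<mu>' \<nu>' \<and>
              (\<forall>k. (\<forall>s\<in>carrier (osys (X k)). \<mu>' (\<phi>i k s) = \<beta> k s) \<and>
                   (\<forall>a\<in>carrier (calg (X k)). \<nu>' (\<pi>i k a) = \<rho> k a)) \<longrightarrow>
              (\<forall>x\<in>carrier (osys L). \<mu>' x = \<mu> x) \<and>
              (\<forall>a\<in>carrier (calg L). \<nu>' a = \<nu> a))))"

text \<open>The actions of the limit algebra \<open>A\<close> on the completed limit \<open>S\<close>, by joint approximation.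
  Here \<open>\<phi>i\<close> and \<open>\<pi>i\<close> are the canonical maps into \<open>S\<close> and \<open>A\<close>.\<close>

definition approximates ::
  "(nat \<Rightarrow> ('s, 'a) ocsys) \<Rightarrow> 'v opsys \<Rightarrow> (nat \<Rightarrow> 's \<Rightarrow> 'v) \<Rightarrow> 'w cstar \<Rightarrow> (nat \<Rightarrow> 'a \<Rightarrow> 'w) \<Rightarrow>
   (nat \<Rightarrow> nat) \<Rightarrow> (nat \<Rightarrow> 'a) \<Rightarrow> (nat \<Rightarrow> 's) \<Rightarrow> 'w \<Rightarrow> 'v \<Rightarrow> bool" where
  "approximates X S \<phi>i A \<pi>i m f g a s \<longleftrightarrow>
     (\<forall>n. f n \<in> carrier (calg (X (m n))) \<and> g n \<in> carrier (osys (X (m n)))) \<and>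
     cstar_lim A (\<lambda>n. \<pi>i (m n) (f n)) a \<and> os_lim S (\<lambda>n. \<phi>i (m n) (g n)) s"

definition lim_lact ::
  "(nat \<Rightarrow> ('s, 'a) ocsys) \<Rightarrow> 'v opsys \<Rightarrow> (nat \<Rightarrow> 's \<Rightarrow> 'v) \<Rightarrow> 'w cstar \<Rightarrow> (nat \<Rightarrow> 'a \<Rightarrow> 'w) \<Rightarrow>
   'w \<Rightarrow> 'v \<Rightarrow> 'v" where
  "lim_lact X S \<phi>i A \<pi>i a s = (THE t. t \<in> carrier S \<and>
     (\<exists>m f g. approximates X S \<phi>i A \<pi>i m f g a s \<and>
        os_lim S (\<lambda>n. \<phi>i (m n) (lact (X (m n)) (f n) (g n))) t))"

definition lim_ract ::
  "(nat \<Rightarrow> ('s, 'a) ocsys) \<Rightarrow> 'v opsys \<Rightarrow> (nat \<Rightarrow> 's \<Rightarrow> 'v) \<Rightarrow> 'w cstar \<Rightarrow> (nat \<Rightarrow> 'a \<Rightarrow> 'w) \<Rightarrow>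
   'v \<Rightarrow> 'w \<Rightarrow> 'v" where
  "lim_ract X S \<phi>i A \<pi>i s a = (THE t. t \<in> carrier S \<and>
     (\<exists>m f g. approximates X S \<phi>i A \<pi>i m f g a s \<and>
        os_lim S (\<lambda>n. \<phi>i (m n) (ract (X (m n)) (g n) (f n))) t))"

definition ocs_limit_object ::
  "(nat \<Rightarrow> ('s, 'a) ocsys) \<Rightarrow> 'v opsys \<Rightarrow> (nat \<Rightarrow> 's \<Rightarrow> 'v) \<Rightarrow> 'w cstar \<Rightarrow> (nat \<Rightarrow> 'a \<Rightarrow> 'w) \<Rightarrow>
   ('v, 'w) ocsys" where
  "ocs_limit_object X S \<phi>i A \<pi>i =
     \<lparr>osys = S, calg = A, lact = lim_lact X S \<phi>i A \<pi>i, ract = lim_ract X S \<phi>i A \<pi>i\<rparr>"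

end

theory Submission
  imports Defs
begin

text \<open>
  Both limits are compared with concrete ones: operator systems with eventually coherent sequences
  modulo null sequences, C*-algebras with asymptotically coherent sequences modulo null sequences.
  The comparison gives, for the given limits, density of the images, the norms as limits of the
  norms along the system, the matrix cones up to small multiples of the unit, and the universal
  property against objects of arbitrary type.

  The estimate \<open>\<parallel>a \<cdot> s\<parallel> \<le> \<parallel>a\<parallel> \<parallel>s\<parallel>\<close> in an operator C*-system passes to the limit,
  so the limit action is well defined on approximating sequences. Everything else, in particular the
  bimodule laws, the positivity of \<open>A\<^sup>* \<cdot> X \<cdot> A\<close> and the universal property, extends by continuity,
  since matrix cones are closed and unital completely positive maps and *-homomorphisms are contractive.
\<close>

section \<open>Star vector spaces, seminorms and limits\<close>

text \<open>A given limit is universal only against objects of two types, its own and a type of sets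
  of sequences, while the theorem needs maps into objects of arbitrary type. The concrete limit
  bridges this: universality at its type gives a map from the given limit into it, uniqueness at the
  given type shows that returning by the concrete mediating map is the identity, and the concrete
  limit maps into cocones of any type by construction. The two concrete limits differ because a
  limit of C*-algebras is complete, while a limit of operator systems is a union of images, with
  positivity up to small multiples of the unit.

  The analytic input is one square root of \<open>1 - a\<close>. It makes *-homomorphisms
  contractive, through unitaries, and actions contractive, through the 2 by 2 matrix with diagonal
  \<open>r e\<close> and off-diagonal entry \<open>s\<close>. The norm estimate at a level uses the
  norms of that level, which may exceed those in the limit; it survives because norms along the
  system decrease to the norm in the limit.\<close>

lemma complex_ring_simps [simp]:
  "carrier complex_ring = UNIV" "mult complex_ring = (*)" "one complex_ring = 1"
  "zero complex_ring = 0" "add complex_ring = (+)"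
  by (simp_all add: complex_ring_def)

lemma cring_complex_ring: "cring complex_ring"
  by (rule cringI) (auto intro!: abelian_groupI comm_monoidI simp: algebra_simps, metis add.right_inverse)

context star_vector_space
begin

lemma smult_cl [simp, intro]: "x \<in> carrier V \<Longrightarrow> c \<odot>\<^bsub>V\<^esub> x \<in> carrier V"
  using smult_closed by simp

text \<open>Inherited names are ambiguous in extensions, where they may denote facts about
  \<open>complex_ring\<close>.\<close>

lemmas v_ac = a_ac and v_minus_eq = minus_eq and v_r_neg = r_neg and v_l_neg = l_neg
  and v_r_neg1 = r_neg1 and v_r_neg2 = r_neg2 and v_add_cl = a_closed
  and v_minus_cl = minus_closed and v_zero_cl = zero_closed and v_minus_minus = minus_minus
  and v_finsum_closed = finsum_closed and v_finsum_insert = finsum_insert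
  and v_finsum_empty = finsum_empty and v_finsum_add = finsum_addf
  and v_finsum_singleton = finsum_singleton and v_finsum_cong' = finsum_cong'

lemma smult_plus: "x \<in> carrier V \<Longrightarrow> (a + b) \<odot>\<^bsub>V\<^esub> x = a \<odot>\<^bsub>V\<^esub> x \<oplus> b \<odot>\<^bsub>V\<^esub> x"
  using smult_l_distr[of a b x] by simp

lemma smult_dist: "\<lbrakk>x \<in> carrier V; y \<in> carrier V\<rbrakk> \<Longrightarrow> c \<odot>\<^bsub>V\<^esub> (x \<oplus> y) = c \<odot>\<^bsub>V\<^esub> x \<oplus> c \<odot>\<^bsub>V\<^esub> y"
  using smult_r_distr by simp

lemma smult_smult: "x \<in> carrier V \<Longrightarrow> a \<odot>\<^bsub>V\<^esub> (b \<odot>\<^bsub>V\<^esub> x) = (a * b) \<odot>\<^bsub>V\<^esub> x"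
  using smult_assoc1[of a b x] by simp

lemma smult_1 [simp]: "x \<in> carrier V \<Longrightarrow> 1 \<odot>\<^bsub>V\<^esub> x = x"
  using smult_one by simp

lemma smult_0 [simp]: "x \<in> carrier V \<Longrightarrow> 0 \<odot>\<^bsub>V\<^esub> x = \<zero>"
  using smult_l_null by simp

lemma smult_zero [simp]: "c \<odot>\<^bsub>V\<^esub> \<zero> = \<zero>"
  using smult_r_null by simp

lemma smult_neg1: "x \<in> carrier V \<Longrightarrow> (-1) \<odot>\<^bsub>V\<^esub> x = \<ominus> x"
proof -
  assume x: "x \<in> carrier V"
  have "(-1) \<odot>\<^bsub>V\<^esub> x \<oplus> x = (-1 + 1) \<odot>\<^bsub>V\<^esub> x"
    using x by (simp only: smult_plus smult_1)
  then have "(-1) \<odot>\<^bsub>V\<^esub> x \<oplus> x = \<zero>" using x by simp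
  from minus_equality[OF this] x show ?thesis by simp
qed

lemma smult_minus: "x \<in> carrier V \<Longrightarrow> c \<odot>\<^bsub>V\<^esub> (\<ominus> x) = \<ominus> (c \<odot>\<^bsub>V\<^esub> x)"
  using smult_r_minus[of c x] by simp

lemma smult_neg: "x \<in> carrier V \<Longrightarrow> (- c) \<odot>\<^bsub>V\<^esub> x = \<ominus> (c \<odot>\<^bsub>V\<^esub> x)"
  using smult_smult[of x "-1" c] smult_neg1[of "c \<odot>\<^bsub>V\<^esub> x"] by simp

lemma smult_diff: "\<lbrakk>x \<in> carrier V; y \<in> carrier V\<rbrakk> \<Longrightarrow> c \<odot>\<^bsub>V\<^esub> (x \<ominus> y) = c \<odot>\<^bsub>V\<^esub> x \<ominus> c \<odot>\<^bsub>V\<^esub> y"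
  by (simp add: minus_eq smult_dist smult_minus)

lemma smult_2: "x \<in> carrier V \<Longrightarrow> 2 \<odot>\<^bsub>V\<^esub> x = x \<oplus> x"
  using smult_plus[of x 1 1] by simp

lemma minus_zero_V [simp]: "\<ominus> \<zero> = \<zero>"
  using smult_neg1[of \<zero>] by simp

lemma invol_zero [simp]: "invol V \<zero> = \<zero>"
  using invol_smult[of \<zero> 0] invol_closed[of \<zero>] by simp

lemma invol_minus: "x \<in> carrier V \<Longrightarrow> invol V (\<ominus> x) = \<ominus> (invol V x)"
  using invol_smult[of x "-1"] invol_closed[of x] by (simp add: smult_neg1)

lemma invol_diff: "\<lbrakk>x \<in> carrier V; y \<in> carrier V\<rbrakk> \<Longrightarrow> invol V (x \<ominus> y) = invol V x \<ominus> invol V y"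
  by (simp add: minus_eq invol_add invol_minus)

text \<open>The structure is registered with all six ring operations, so that in a C*-algebra these
  vector space rules and the ring rules form one rewrite system for \<open>algebra\<close>.\<close>

lemmas [algebra add: ring "zero V" "add V" "a_inv V" "a_minus V" "one V" "mult V"] =
  a_closed zero_closed a_inv_closed minus_closed smult_cl invol_closed
  a_assoc l_zero l_neg a_comm minus_eq
  r_zero r_neg r_neg2 r_neg1 minus_add minus_minus minus_zero_V a_lcomm
  smult_dist smult_smult smult_minus smult_zero smult_1 smult_neg

lemma diff_trans: "\<lbrakk>x \<in> carrier V; y \<in> carrier V; z \<in> carrier V\<rbrakk> \<Longrightarrow> x \<ominus> z = (x \<ominus> y) \<oplus> (y \<ominus> z)"
  by algebra

lemma diff_add: "\<lbrakk>x \<in> carrier V; y \<in> carrier V; x' \<in> carrier V; y' \<in> carrier V\<rbrakk>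
    \<Longrightarrow> (x \<oplus> y) \<ominus> (x' \<oplus> y') = (x \<ominus> x') \<oplus> (y \<ominus> y')"
  by algebra

lemma minus_diff: "\<lbrakk>x \<in> carrier V; y \<in> carrier V\<rbrakk> \<Longrightarrow> \<ominus> (x \<ominus> y) = y \<ominus> x"
  by algebra

lemma diff_self [simp]: "x \<in> carrier V \<Longrightarrow> x \<ominus> x = \<zero>"
  by algebra

lemma diff_zero [simp]: "x \<in> carrier V \<Longrightarrow> x \<ominus> \<zero> = x"
  by algebra

lemma diff_eq_zero: "\<lbrakk>x \<in> carrier V; y \<in> carrier V\<rbrakk> \<Longrightarrow> x \<ominus> y = \<zero> \<longleftrightarrow> x = y"
  by (metis diff_self diff_trans diff_zero minus_diff r_zero minus_zero_V zero_closed minus_closed)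

lemma diff_add_cancel: "\<lbrakk>x \<in> carrier V; y \<in> carrier V\<rbrakk> \<Longrightarrow> (x \<ominus> y) \<oplus> y = x"
  by algebra

end

lemma star_vector_spaceI:
  fixes V (structure)
  assumes "abelian_group V"
    and "\<And>c x. x \<in> carrier V \<Longrightarrow> c \<odot>\<^bsub>V\<^esub> x \<in> carrier V"
    and "\<And>a b x. x \<in> carrier V \<Longrightarrow> (a + b) \<odot>\<^bsub>V\<^esub> x = a \<odot>\<^bsub>V\<^esub> x \<oplus> b \<odot>\<^bsub>V\<^esub> x"
    and "\<And>c x y. \<lbrakk>x \<in> carrier V; y \<in> carrier V\<rbrakk> \<Longrightarrow> c \<odot>\<^bsub>V\<^esub> (x \<oplus> y) = c \<odot>\<^bsub>V\<^esub> x \<oplus> c \<odot>\<^bsub>V\<^esub> y"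
    and "\<And>a b x. x \<in> carrier V \<Longrightarrow> (a * b) \<odot>\<^bsub>V\<^esub> x = a \<odot>\<^bsub>V\<^esub> (b \<odot>\<^bsub>V\<^esub> x)"
    and "\<And>x. x \<in> carrier V \<Longrightarrow> 1 \<odot>\<^bsub>V\<^esub> x = x"
    and "\<And>x. x \<in> carrier V \<Longrightarrow> invol V x \<in> carrier V"
    and "\<And>x. x \<in> carrier V \<Longrightarrow> invol V (invol V x) = x"
    and "\<And>x y. \<lbrakk>x \<in> carrier V; y \<in> carrier V\<rbrakk> \<Longrightarrow> invol V (x \<oplus> y) = invol V x \<oplus> invol V y"
    and "\<And>c x. x \<in> carrier V \<Longrightarrow> invol V (c \<odot>\<^bsub>V\<^esub> x) = cnj c \<odot>\<^bsub>V\<^esub> invol V x"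
  shows "star_vector_space V"
  by (intro star_vector_space.intro star_vector_space_axioms.intro moduleI cring_complex_ring assms)
    (simp_all add: assms)

lemma complex_linearD:
  assumes "complex_linear V W f"
  shows "x \<in> carrier V \<Longrightarrow> f x \<in> carrier W"
    and "\<lbrakk>x \<in> carrier V; y \<in> carrier V\<rbrakk> \<Longrightarrow> f (x \<oplus>\<^bsub>V\<^esub> y) = f x \<oplus>\<^bsub>W\<^esub> f y"
    and "x \<in> carrier V \<Longrightarrow> f (c \<odot>\<^bsub>V\<^esub> x) = c \<odot>\<^bsub>W\<^esub> f x"
  using assms by (auto simp: complex_linear_def)

locale linear_map = V: star_vector_space V + W: star_vector_space W
  for V :: "('a, 'm) star_space_scheme" and W :: "('b, 'n) star_space_scheme" +
  fixes f :: "'a \<Rightarrow> 'b"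
  assumes linear: "complex_linear V W f"
begin

lemmas closed [simp, intro] = complex_linearD(1)[OF linear]
lemmas add = complex_linearD(2)[OF linear]
lemmas smult = complex_linearD(3)[OF linear]

lemma zero [simp]: "f \<zero>\<^bsub>V\<^esub> = \<zero>\<^bsub>W\<^esub>"
  using smult[of "\<zero>\<^bsub>V\<^esub>" 0] by simp

lemma minus: "x \<in> carrier V \<Longrightarrow> f (\<ominus>\<^bsub>V\<^esub> x) = \<ominus>\<^bsub>W\<^esub> f x"
  using smult[of x "-1"] by (simp add: V.smult_neg1 W.smult_neg1)

lemma diff: "\<lbrakk>x \<in> carrier V; y \<in> carrier V\<rbrakk> \<Longrightarrow> f (x \<ominus>\<^bsub>V\<^esub> y) = f x \<ominus>\<^bsub>W\<^esub> f y"
  by (simp add: V.minus_eq W.minus_eq add minus)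

lemma finsum: "finite I \<Longrightarrow> g \<in> I \<rightarrow> carrier V \<Longrightarrow> f (finsum V g I) = finsum W (\<lambda>i. f (g i)) I"
proof (induction I rule: finite_induct)
  case (insert i I)
  then have "f (g i) \<in> carrier W" "(\<lambda>i. f (g i)) \<in> I \<rightarrow> carrier W" by auto
  moreover have "f (finsum V g (insert i I)) = f (g i) \<oplus>\<^bsub>W\<^esub> f (finsum V g I)"
    using insert by (simp add: add Pi_def)
  ultimately show ?case using insert by (simp add: Pi_def)
qed simp

end

section \<open>Transport of algebraic laws along surjective maps, later applied to coset
  maps\<close>

lemma abelian_group_image:
  assumes V: "abelian_group V" and car: "carrier W = q ` carrier V"
    and add: "\<And>x y. \<lbrakk>x \<in> carrier V; y \<in> carrier V\<rbrakk> \<Longrightarrow> q x \<oplus>\<^bsub>W\<^esub> q y = q (x \<oplus>\<^bsub>V\<^esub> y)"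
    and zero: "\<zero>\<^bsub>W\<^esub> = q \<zero>\<^bsub>V\<^esub>"
  shows "abelian_group W"
proof -
  interpret V: abelian_group V by fact
  have cl: "q x \<in> carrier W" if "x \<in> carrier V" for x using that car by auto
  show ?thesis
  proof (rule abelian_groupI)
    fix x assume "x \<in> carrier W"
    then obtain u where u: "x = q u" "u \<in> carrier V" using car by auto
    then have "q (\<ominus>\<^bsub>V\<^esub> u) \<oplus>\<^bsub>W\<^esub> x = \<zero>\<^bsub>W\<^esub>"
      by (simp add: add zero V.l_neg)
    then show "\<exists>y\<in>carrier W. y \<oplus>\<^bsub>W\<^esub> x = \<zero>\<^bsub>W\<^esub>" using cl u by blast
  qed (unfold car zero, auto simp: add V.a_ac)
qed

lemma star_vector_space_image:
  fixes V :: "('a, 'm) star_space_scheme" and W :: "('b, 'n) star_space_scheme"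
  assumes V: "star_vector_space V" and car: "carrier W = q ` carrier V"
    and add: "\<And>x y. \<lbrakk>x \<in> carrier V; y \<in> carrier V\<rbrakk> \<Longrightarrow> q x \<oplus>\<^bsub>W\<^esub> q y = q (x \<oplus>\<^bsub>V\<^esub> y)"
    and zero: "\<zero>\<^bsub>W\<^esub> = q \<zero>\<^bsub>V\<^esub>"
    and smult: "\<And>c x. x \<in> carrier V \<Longrightarrow> c \<odot>\<^bsub>W\<^esub> q x = q (c \<odot>\<^bsub>V\<^esub> x)"
    and invol: "\<And>x. x \<in> carrier V \<Longrightarrow> invol W (q x) = q (invol V x)"
  shows "star_vector_space W"
proof -
  interpret V: star_vector_space V by fact
  show ?thesis
  proof (rule star_vector_spaceI)
    show "abelian_group W"
      using V.M.abelian_group_axioms car add zero by (rule abelian_group_image)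
  qed (unfold car, auto simp: add smult invol V.smult_plus V.smult_dist V.smult_smult
      V.invol_closed V.invol_invol V.invol_add V.invol_smult)
qed

lemma ring_image:
  assumes V: "ring V" and car: "carrier W = q ` carrier V"
    and add: "\<And>x y. \<lbrakk>x \<in> carrier V; y \<in> carrier V\<rbrakk> \<Longrightarrow> q x \<oplus>\<^bsub>W\<^esub> q y = q (x \<oplus>\<^bsub>V\<^esub> y)"
    and mult: "\<And>x y. \<lbrakk>x \<in> carrier V; y \<in> carrier V\<rbrakk> \<Longrightarrow> q x \<otimes>\<^bsub>W\<^esub> q y = q (x \<otimes>\<^bsub>V\<^esub> y)"
    and zero: "\<zero>\<^bsub>W\<^esub> = q \<zero>\<^bsub>V\<^esub>" and one: "\<one>\<^bsub>W\<^esub> = q \<one>\<^bsub>V\<^esub>"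
  shows "ring W"
proof -
  interpret V: ring V by fact
  show ?thesis
  proof (rule ringI)
    show "abelian_group W"
      using V.abelian_group_axioms car add zero by (rule abelian_group_image)
    show "monoid W"
      by (rule monoidI, unfold car one) (auto simp: mult V.m_assoc)
  qed (unfold car, auto simp: add mult V.l_distr V.r_distr)
qed


text \<open>Common form of \<open>cstar_lim\<close> and \<open>os_lim\<close>, so that the rules for
  limits are proved once for both norms.\<close>

definition nlim :: "(complex, 'a, 'm) module_scheme \<Rightarrow> ('a \<Rightarrow> real) \<Rightarrow> (nat \<Rightarrow> 'a) \<Rightarrow> 'a \<Rightarrow> bool" where
  "nlim V N f x \<longleftrightarrow> (\<lambda>n. N (f n \<ominus>\<^bsub>V\<^esub> x)) \<longlonglongrightarrow> 0"

abbreviation "os_nlim S \<equiv> nlim S (os_norm S)"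
abbreviation "c_nlim A \<equiv> nlim A (nrm A)"

lemma cstar_lim_nlim: "cstar_lim A = nlim A (nrm A)"
  by (simp add: fun_eq_iff cstar_lim_def nlim_def)

lemma os_lim_nlim: "os_lim S = nlim S (os_norm S)"
  by (simp add: fun_eq_iff os_lim_def nlim_def)

text \<open>Definiteness is split off because limits of norms on spaces of sequences vanish on null
  sequences; they become norms only after passing to a quotient.\<close>

locale seminormed_star = star_vector_space V
  for V :: "('a, 'm) star_space_scheme" (structure) +
  fixes N :: "'a \<Rightarrow> real"
  assumes N_nonneg: "x \<in> carrier V \<Longrightarrow> 0 \<le> N x"
    and N_triangle: "\<lbrakk>x \<in> carrier V; y \<in> carrier V\<rbrakk> \<Longrightarrow> N (x \<oplus> y) \<le> N x + N y"
    and N_smult: "x \<in> carrier V \<Longrightarrow> N (c \<odot>\<^bsub>V\<^esub> x) = cmod c * N x"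
    and N_invol: "x \<in> carrier V \<Longrightarrow> N (invol V x) = N x"
begin

lemma N_zero [simp]: "N \<zero> = 0"
  using N_smult[of \<zero> 0] by simp

lemma N_minus: "x \<in> carrier V \<Longrightarrow> N (\<ominus> x) = N x"
  using N_smult[of x "-1"] by (simp add: smult_neg1)

lemma N_diff_commute: "\<lbrakk>x \<in> carrier V; y \<in> carrier V\<rbrakk> \<Longrightarrow> N (x \<ominus> y) = N (y \<ominus> x)"
  using N_minus[of "x \<ominus> y"] by (simp add: minus_diff)

lemma N_diff_triangle: "\<lbrakk>x \<in> carrier V; y \<in> carrier V; z \<in> carrier V\<rbrakk>
    \<Longrightarrow> N (x \<ominus> z) \<le> N (x \<ominus> y) + N (y \<ominus> z)"
  using N_triangle[of "x \<ominus> y" "y \<ominus> z"] diff_trans[of x y z] by simp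

lemma N_le_diff: "\<lbrakk>x \<in> carrier V; y \<in> carrier V\<rbrakk> \<Longrightarrow> N x \<le> N (x \<ominus> y) + N y"
  using N_diff_triangle[of x y \<zero>] by simp

lemma N_add_diff: "\<lbrakk>x \<in> carrier V; y \<in> carrier V; x' \<in> carrier V; y' \<in> carrier V\<rbrakk>
    \<Longrightarrow> N ((x \<oplus> y) \<ominus> (x' \<oplus> y')) \<le> N (x \<ominus> x') + N (y \<ominus> y')"
  using N_triangle[of "x \<ominus> x'" "y \<ominus> y'"] diff_add[of x y x' y'] by simp

lemma N_abs_diff: "\<lbrakk>x \<in> carrier V; y \<in> carrier V\<rbrakk> \<Longrightarrow> \<bar>N x - N y\<bar> \<le> N (x \<ominus> y)"
  using N_le_diff[of x y] N_le_diff[of y x] N_diff_commute[of x y] by simp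

lemma nlim_const: "x \<in> carrier V \<Longrightarrow> nlim V N (\<lambda>_. x) x"
  by (simp add: nlim_def)

lemma nlim_I: "(\<And>n. f n \<in> carrier V) \<Longrightarrow> x \<in> carrier V \<Longrightarrow> (\<And>n. N (f n \<ominus> x) \<le> g n) \<Longrightarrow> g \<longlonglongrightarrow> 0
    \<Longrightarrow> nlim V N f x"
  unfolding nlim_def
  by (rule tendsto_sandwich[of "\<lambda>_. 0" _ _ g]) (auto simp: N_nonneg)

lemma nlim_add:
  assumes "\<And>n. f n \<in> carrier V" "\<And>n. g n \<in> carrier V" "x \<in> carrier V" "y \<in> carrier V"
    and "nlim V N f x" "nlim V N g y"
  shows "nlim V N (\<lambda>n. f n \<oplus> g n) (x \<oplus> y)"
  using assms(1-4)
  by (intro nlim_I[where g = "\<lambda>n. N (f n \<ominus> x) + N (g n \<ominus> y)"] N_add_diff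
      tendsto_add_zero assms(5,6)[unfolded nlim_def]) auto

lemma nlim_smult:
  assumes "\<And>n. f n \<in> carrier V" "x \<in> carrier V" "nlim V N f x"
  shows "nlim V N (\<lambda>n. c \<odot>\<^bsub>V\<^esub> f n) (c \<odot>\<^bsub>V\<^esub> x)"
  using assms(1,2)
  by (intro nlim_I[where g = "\<lambda>n. cmod c * N (f n \<ominus> x)"]
      tendsto_mult_right_zero assms(3)[unfolded nlim_def]) (auto simp: N_smult simp flip: smult_diff)

lemma nlim_invol:
  assumes "\<And>n. f n \<in> carrier V" "x \<in> carrier V" "nlim V N f x"
  shows "nlim V N (\<lambda>n. invol V (f n)) (invol V x)"
  using assms by (auto simp: nlim_def N_invol simp flip: invol_diff)

lemma nlim_diff:
  assumes "\<And>n. f n \<in> carrier V" "\<And>n. g n \<in> carrier V" "x \<in> carrier V" "y \<in> carrier V"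
    and "nlim V N f x" "nlim V N g y"
  shows "nlim V N (\<lambda>n. f n \<ominus> g n) (x \<ominus> y)"
  using nlim_add[of f "\<lambda>n. (-1) \<odot>\<^bsub>V\<^esub> g n" x "(-1) \<odot>\<^bsub>V\<^esub> y"] nlim_smult[of g y "-1"] assms
  by (simp add: smult_neg1 minus_eq)

lemma nlim_finsum:
  assumes "finite I" "\<And>i n. i \<in> I \<Longrightarrow> f i n \<in> carrier V" "\<And>i. i \<in> I \<Longrightarrow> x i \<in> carrier V"
    and "\<And>i. i \<in> I \<Longrightarrow> nlim V N (f i) (x i)"
  shows "nlim V N (\<lambda>n. finsum V (\<lambda>i. f i n) I) (finsum V x I)"
  using assms
proof (induction I rule: finite_induct)
  case empty
  then show ?case by (simp add: nlim_const)
next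
  case (insert i I)
  then have "nlim V N (\<lambda>n. f i n \<oplus> finsum V (\<lambda>i. f i n) I) (x i \<oplus> finsum V x I)"
    by (intro nlim_add) auto
  moreover have "finsum V (\<lambda>i. f i n) (insert i I) = f i n \<oplus> finsum V (\<lambda>i. f i n) I" for n
    using insert by (auto intro!: finsum_insert)
  moreover have "finsum V x (insert i I) = x i \<oplus> finsum V x I"
    using insert by (auto intro!: finsum_insert)
  ultimately show ?case by simp
qed

lemma nlim_norm:
  assumes "\<And>n. f n \<in> carrier V" "x \<in> carrier V" "nlim V N f x"
  shows "(\<lambda>n. N (f n)) \<longlonglongrightarrow> N x"
proof -
  have "(\<lambda>n. N (f n) - N x) \<longlonglongrightarrow> 0"
    by (rule tendsto_0_le[OF assms(3)[unfolded nlim_def], of _ 1]) (simp add: N_abs_diff N_nonneg assms)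
  then show ?thesis by (simp add: LIM_zero_iff)
qed

lemma nlim_transfer:
  assumes "\<And>n. f n \<in> carrier V" "\<And>n. g n \<in> carrier V" "x \<in> carrier V"
    and "nlim V N f x" "(\<lambda>n. N (g n \<ominus> f n)) \<longlonglongrightarrow> 0"
  shows "nlim V N g x"
  using assms(1-3)
  by (intro nlim_I[where g = "\<lambda>n. N (g n \<ominus> f n) + N (f n \<ominus> x)"] N_diff_triangle
      tendsto_add_zero assms(5) assms(4)[unfolded nlim_def]) auto

lemma nlim_diff_null:
  assumes "\<And>n. f n \<in> carrier V" "\<And>n. g n \<in> carrier V" "x \<in> carrier V"
    and "nlim V N f x" "nlim V N g x"
  shows "(\<lambda>n. N (f n \<ominus> g n)) \<longlonglongrightarrow> 0"
  using nlim_diff[OF assms(1,2,3,3,4,5)] assms(1-3) by (simp add: nlim_def)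

lemma nlim_eventually_cong:
  "nlim V N f x \<Longrightarrow> (\<And>n. n \<ge> k \<Longrightarrow> g n = f n) \<Longrightarrow> nlim V N g x"
  unfolding nlim_def
  by (erule Lim_transform_eventually) (auto simp: eventually_at_top_linorder intro: exI[of _ k])

lemma nlim_Cauchy:
  assumes "\<And>n. f n \<in> carrier V" "x \<in> carrier V" "nlim V N f x" "0 < \<epsilon>"
  shows "\<exists>k. \<forall>m\<ge>k. \<forall>n\<ge>k. N (f m \<ominus> f n) < \<epsilon>"
proof -
  obtain k where k: "\<And>n. n \<ge> k \<Longrightarrow> N (f n \<ominus> x) < \<epsilon> / 2"
    using order_tendstoD(2)[OF assms(3)[unfolded nlim_def], of "\<epsilon> / 2"] assms(4)
    by (auto simp: eventually_at_top_linorder)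
  have "N (f m \<ominus> f n) < \<epsilon>" if "m \<ge> k" "n \<ge> k" for m n
    using N_diff_triangle[of "f m" x "f n"] N_diff_commute[of x "f n"] k[OF that(1)] k[OF that(2)] assms(1,2)
    by simp
  then show ?thesis by blast
qed

end

locale normed_star = seminormed_star V N
  for V :: "('a, 'm) star_space_scheme" (structure) and N :: "'a \<Rightarrow> real" +
  assumes N_eq_zero: "x \<in> carrier V \<Longrightarrow> N x = 0 \<Longrightarrow> x = \<zero>"
begin

lemma nlim_unique:
  assumes "\<And>n. f n \<in> carrier V" "x \<in> carrier V" "y \<in> carrier V" "nlim V N f x" "nlim V N f y"
  shows "x = y"
proof -
  have "nlim V N (\<lambda>n. f n \<ominus> f n) (x \<ominus> y)"
    using assms by (intro nlim_diff) auto
  then have "(\<lambda>n. N (\<zero> \<ominus> (x \<ominus> y))) \<longlonglongrightarrow> 0"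
    using assms(1) by (simp add: nlim_def)
  then have "N (\<zero> \<ominus> (x \<ominus> y)) = 0" by (simp add: LIMSEQ_const_iff)
  then have "N (x \<ominus> y) = 0" using N_diff_commute[of \<zero> "x \<ominus> y"] assms by simp
  then show ?thesis using N_eq_zero[of "x \<ominus> y"] assms by (simp add: diff_eq_zero)
qed

end

text \<open>Near-minimal choices turn approximability into one convergent sequence.\<close>

lemma approximating_choice:
  fixes d :: "nat \<Rightarrow> 'a \<Rightarrow> real"
  assumes ne: "\<And>n. G n \<noteq> {}" and nn: "\<And>n x. x \<in> G n \<Longrightarrow> 0 \<le> d n x"
    and approx: "\<And>\<epsilon>. 0 < \<epsilon> \<Longrightarrow> \<exists>k. \<forall>n\<ge>k. \<exists>x\<in>G n. d n x < \<epsilon>"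
  shows "\<exists>g. (\<forall>n. g n \<in> G n) \<and> (\<lambda>n. d n (g n)) \<longlonglongrightarrow> 0"
proof -
  \<comment> \<open>The infimum of \<open>d n\<close> over \<open>G n\<close> need not be attained;
    the slack \<open>1 / Suc n\<close> replaces attainment and vanishes in the limit.\<close>
  have "\<exists>x\<in>G n. \<forall>y\<in>G n. d n x \<le> d n y + 1 / Suc n" for n
  proof (rule ccontr)
    assume "\<not> ?thesis"
    then have *: "\<And>x. x \<in> G n \<Longrightarrow> \<exists>y\<in>G n. d n y < d n x - 1 / Suc n" by force
    have bb: "bdd_below (d n ` G n)" using nn by (auto simp: bdd_below_def)
    obtain x where x: "x \<in> G n" "d n x < Inf (d n ` G n) + 1 / Suc n"
      using cInf_lessD[of "d n ` G n" "Inf (d n ` G n) + 1 / Suc n"] ne by auto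
    obtain y where "y \<in> G n" "d n y < d n x - 1 / Suc n" using * x by blast
    moreover have "Inf (d n ` G n) \<le> d n y" using bb \<open>y \<in> G n\<close> by (intro cInf_lower) auto
    ultimately show False using x by simp
  qed
  then obtain g where g: "\<And>n. g n \<in> G n" "\<And>n y. y \<in> G n \<Longrightarrow> d n (g n) \<le> d n y + 1 / Suc n"
    by metis
  have "(\<lambda>n. d n (g n)) \<longlonglongrightarrow> 0"
  proof (rule LIMSEQ_I)
    fix r :: real assume r: "0 < r"
    obtain k where k: "\<And>n. n \<ge> k \<Longrightarrow> \<exists>x\<in>G n. d n x < r / 2" using approx[of "r / 2"] r by auto
    obtain l where l: "1 / Suc l < r / 2" using r nat_approx_posE[of "r / 2"] by auto
    have "norm (d n (g n) - 0) < r" if n: "n \<ge> max k l" for n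
    proof -
      obtain x where x: "x \<in> G n" "d n x < r / 2" using k[of n] n by auto
      have "1 / Suc n \<le> 1 / Suc l" using n by (simp add: frac_le)
      then have "d n (g n) < r" using g(2)[OF x(1)] x(2) l by linarith
      then show ?thesis using nn[OF g(1)] by simp
    qed
    then show "\<exists>no. \<forall>n\<ge>no. norm (d n (g n) - 0) < r" by blast
  qed
  then show ?thesis using g(1) by blast
qed

section \<open>C*-algebras\<close>

text \<open>A C*-algebra up to definiteness and completeness of the norm: the form in which algebras
  of sequences arise before the quotient by null elements.\<close>

locale pre_cstar = ring A + star_vector_space A for A :: "'a cstar" (structure) +
  assumes smult_mult_left: "\<lbrakk>x \<in> carrier A; y \<in> carrier A\<rbrakk> \<Longrightarrow> (c \<odot>\<^bsub>A\<^esub> x) \<otimes> y = c \<odot>\<^bsub>A\<^esub> (x \<otimes> y)"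
    and smult_mult_right: "\<lbrakk>x \<in> carrier A; y \<in> carrier A\<rbrakk> \<Longrightarrow> x \<otimes> (c \<odot>\<^bsub>A\<^esub> y) = c \<odot>\<^bsub>A\<^esub> (x \<otimes> y)"
    and invol_mult: "\<lbrakk>x \<in> carrier A; y \<in> carrier A\<rbrakk> \<Longrightarrow> invol A (x \<otimes> y) = invol A y \<otimes> invol A x"
    and nrm_nonneg: "x \<in> carrier A \<Longrightarrow> 0 \<le> nrm A x"
    and nrm_triangle: "\<lbrakk>x \<in> carrier A; y \<in> carrier A\<rbrakk> \<Longrightarrow> nrm A (x \<oplus> y) \<le> nrm A x + nrm A y"
    and nrm_smult: "x \<in> carrier A \<Longrightarrow> nrm A (c \<odot>\<^bsub>A\<^esub> x) = cmod c * nrm A x"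
    and nrm_mult: "\<lbrakk>x \<in> carrier A; y \<in> carrier A\<rbrakk> \<Longrightarrow> nrm A (x \<otimes> y) \<le> nrm A x * nrm A y"
    and cstar_identity: "x \<in> carrier A \<Longrightarrow> nrm A (invol A x \<otimes> x) = (nrm A x)\<^sup>2"
begin

lemma ring_A: "ring A"
  by (rule pre_cstar.axioms(1)[OF pre_cstar_axioms])

lemmas times_closed [simp, intro] = ring.ring_simprules(5)[OF ring_A]
  and times_assoc = ring.ring_simprules(11)[OF ring_A]
  and times_l_distr = ring.ring_simprules(13)[OF ring_A]
  and times_r_distr = ring.ring_simprules(23)[OF ring_A]
  and unit_closed [simp, intro] = ring.ring_simprules(6)[OF ring_A]
  and unit_l [simp] = ring.ring_simprules(12)[OF ring_A]
  and unit_r [simp] = monoid.r_one[OF ring.is_monoid[OF ring_A]]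

lemmas [algebra add: ring "zero A" "add A" "a_inv A" "a_minus A" "one A" "mult A"] =
  unit_r smult_mult_left smult_mult_right

text \<open>By the C*-identity, the square of the norm of \<open>x\<close> is at most the product of
  the norms of its adjoint and of \<open>x\<close>; cancel one factor. Applied to \<open>x\<close>
  and to its adjoint this makes the involution isometric.\<close>

lemma nrm_le_invol: "x \<in> carrier A \<Longrightarrow> nrm A x \<le> nrm A (invol A x)"
proof (cases "nrm A x = 0")
  case False
  assume x: "x \<in> carrier A"
  have "(nrm A x)\<^sup>2 \<le> nrm A (invol A x) * nrm A x"
    using nrm_mult[of "invol A x" x] cstar_identity[of x] x invol_closed by simp
  then show ?thesis using False nrm_nonneg[OF x] by (simp add: power2_eq_square)
qed (simp add: nrm_nonneg invol_closed)

sublocale seminormed_star A "nrm A"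
proof
  show "nrm A (invol A x) = nrm A x" if "x \<in> carrier A" for x
    using nrm_le_invol[OF that] nrm_le_invol[of "invol A x"] that
    by (simp add: invol_closed invol_invol)
qed (fact nrm_nonneg nrm_triangle nrm_smult)+

lemma nrm_mult_diff:
  assumes "x \<in> carrier A" "y \<in> carrier A" "x' \<in> carrier A" "y' \<in> carrier A"
  shows "nrm A ((x \<otimes> y) \<ominus> (x' \<otimes> y')) \<le> nrm A (x \<ominus> x') * nrm A y + nrm A x' * nrm A (y \<ominus> y')"
proof -
  have "(x \<otimes> y) \<ominus> (x' \<otimes> y') = (x \<ominus> x') \<otimes> y \<oplus> x' \<otimes> (y \<ominus> y')"
    using assms by algebra
  then have "nrm A ((x \<otimes> y) \<ominus> (x' \<otimes> y')) \<le> nrm A ((x \<ominus> x') \<otimes> y) + nrm A (x' \<otimes> (y \<ominus> y'))"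
    using assms by (simp add: nrm_triangle)
  also have "\<dots> \<le> nrm A (x \<ominus> x') * nrm A y + nrm A x' * nrm A (y \<ominus> y')"
    using assms by (intro add_mono nrm_mult) auto
  finally show ?thesis .
qed

lemma nlim_mult:
  assumes "\<And>n. f n \<in> carrier A" "\<And>n. g n \<in> carrier A" "x \<in> carrier A" "y \<in> carrier A"
    and "c_nlim A f x" "c_nlim A g y"
  shows "c_nlim A (\<lambda>n. f n \<otimes> g n) (x \<otimes> y)"
proof (rule nlim_I)
  show "nrm A ((f n \<otimes> g n) \<ominus> (x \<otimes> y)) \<le> nrm A (f n \<ominus> x) * nrm A (g n) + nrm A x * nrm A (g n \<ominus> y)" for n
    using assms by (intro nrm_mult_diff)
  have "(\<lambda>n. nrm A (f n \<ominus> x) * nrm A (g n) + nrm A x * nrm A (g n \<ominus> y)) \<longlonglongrightarrow> 0 * nrm A y + nrm A x * 0"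
    using assms(5,6)[unfolded nlim_def] nlim_norm[OF assms(2,4,6)]
    by (intro tendsto_add tendsto_mult tendsto_const)
  then show "(\<lambda>n. nrm A (f n \<ominus> x) * nrm A (g n) + nrm A x * nrm A (g n \<ominus> y)) \<longlonglongrightarrow> 0" by simp
qed (use assms in auto)

lemma invol_one: "invol A \<one> = \<one>"
  using invol_mult[of "invol A \<one>" \<one>] by (simp add: invol_invol invol_closed)

text \<open>The norm of the unit equals its own square, hence is 0 or 1; the value 0 belongs to the
  zero algebra.\<close>

lemma nrm_one_le: "nrm A \<one> \<le> 1"
  using cstar_identity[of \<one>] by (auto simp: invol_one power2_eq_square)

end

sublocale cstar_algebra \<subseteq> pre?: pre_cstar A
  by unfold_locales (fact smult_mult_left smult_mult_right invol_mult nrm_nonneg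
      nrm_triangle nrm_smult nrm_mult cstar_identity)+

sublocale cstar_algebra \<subseteq> normed_star A "nrm A"
  by unfold_locales (simp add: nrm_eq_zero)

context cstar_algebra
begin

lemma nlim_complete:
  assumes "\<And>n. f n \<in> carrier A"
    and "\<And>\<epsilon>. 0 < \<epsilon> \<Longrightarrow> \<exists>k. \<forall>m\<ge>k. \<forall>n\<ge>k. nrm A (f m \<ominus> f n) < \<epsilon>"
  shows "\<exists>x\<in>carrier A. c_nlim A f x"
  unfolding nlim_def using complete[of f] assms by blast

text \<open>\<open>1 - z\<close> is a square root of \<open>1 - a\<close> when \<open>z\<close> is the fixed point of the contraction
  \<open>y \<mapsto> (a + y\<^sup>2) / 2\<close>.\<close>

lemma sqrt_one_minus:
  assumes a: "a \<in> carrier A" "invol A a = a" "nrm A a < 1"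
  shows "\<exists>x\<in>carrier A. invol A x = x \<and> x \<otimes> x = \<one> \<ominus> a \<and>
    (\<forall>b\<in>carrier A. a \<otimes> b = b \<otimes> a \<longrightarrow> x \<otimes> b = b \<otimes> x)"
proof -
  define \<rho> where "\<rho> = nrm A a"
  have \<rho>: "0 \<le> \<rho>" "\<rho> < 1" using a nrm_nonneg by (auto simp: \<rho>_def)
  define F where "F y = (1/2) \<odot>\<^bsub>A\<^esub> (a \<oplus> y \<otimes> y)" for y
  have F_cl: "F y \<in> carrier A" if "y \<in> carrier A" for y using that a by (simp add: F_def)
  \<comment> \<open>The ball of radius \<rho> is invariant because (\<rho> + \<rho> * \<rho>) / 2
    \<le> \<rho> for \<rho> < 1.\<close>
  have F_le: "nrm A (F y) \<le> \<rho>" if y: "y \<in> carrier A" "nrm A y \<le> \<rho>" for y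
  proof -
    have "nrm A (y \<otimes> y) \<le> \<rho> * \<rho>"
      using nrm_mult[of y y] mult_mono[OF y(2) y(2) \<rho>(1) nrm_nonneg[OF y(1)]] y by simp
    also have "\<dots> \<le> \<rho>" using \<rho> mult_left_le[of \<rho> \<rho>] by simp
    finally have "nrm A (a \<oplus> y \<otimes> y) \<le> 2 * \<rho>"
      using nrm_triangle[of a "y \<otimes> y"] y a by (simp add: \<rho>_def)
    then show ?thesis using y a by (simp add: F_def nrm_smult norm_divide)
  qed
  \<comment> \<open>On that ball the squares differ by at most 2 * \<rho> times the distance, and
    the factor 1/2 in \<open>F\<close> leaves the Lipschitz constant \<rho>.\<close>
  have F_contr: "nrm A (F u \<ominus> F v) \<le> \<rho> * nrm A (u \<ominus> v)"
    if uv: "u \<in> carrier A" "v \<in> carrier A" "nrm A u \<le> \<rho>" "nrm A v \<le> \<rho>" for u v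
  proof -
    have "F u \<ominus> F v = (1/2) \<odot>\<^bsub>A\<^esub> ((a \<oplus> u \<otimes> u) \<ominus> (a \<oplus> v \<otimes> v))"
      using uv a by (simp add: F_def smult_diff)
    then have "nrm A (F u \<ominus> F v) = 1/2 * nrm A ((a \<oplus> u \<otimes> u) \<ominus> (a \<oplus> v \<otimes> v))"
      using uv a by (simp add: nrm_smult norm_divide)
    also have "nrm A ((a \<oplus> u \<otimes> u) \<ominus> (a \<oplus> v \<otimes> v)) \<le> nrm A (u \<otimes> u \<ominus> v \<otimes> v)"
      using N_add_diff[of a "u \<otimes> u" a "v \<otimes> v"] a uv by simp
    also have "\<dots> \<le> nrm A (u \<ominus> v) * nrm A u + nrm A v * nrm A (u \<ominus> v)"
      using uv by (intro pre.nrm_mult_diff)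
    also have "\<dots> \<le> nrm A (u \<ominus> v) * \<rho> + \<rho> * nrm A (u \<ominus> v)"
      using uv by (intro add_mono mult_mono order_refl nrm_nonneg minus_closed) (auto simp: \<rho>)
    finally show ?thesis by simp
  qed
  define y where "y n = (F ^^ n) \<zero>" for n
  have y_Suc: "y (Suc n) = F (y n)" for n by (simp add: y_def)
  have y: "y n \<in> carrier A \<and> nrm A (y n) \<le> \<rho> \<and> invol A (y n) = y n" for n
  proof (induction n)
    case 0 then show ?case using \<rho> by (simp add: y_def)
  next
    case (Suc n)
    then show ?case using F_cl F_le a
      by (simp add: y_Suc F_def invol_smult invol_add invol_mult)
  qed
  \<comment> \<open>Both iterates arise by applying \<open>F\<close> n times, to \<open>y j\<close>
    and to the zero element, whose distance is at most \<rho>. This gives the Cauchy property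
    without summing a geometric series.\<close>
  have y_dist: "nrm A (y (n + j) \<ominus> y n) \<le> \<rho> ^ n * \<rho>" for n j
  proof (induction n)
    case 0
    have "y 0 = \<zero>" by (simp add: y_def)
    then show ?case using y by simp
  next
    case (Suc n)
    have "nrm A (y (Suc n + j) \<ominus> y (Suc n)) \<le> \<rho> * nrm A (y (n + j) \<ominus> y n)"
      using F_contr[of "y (n + j)" "y n"] y by (simp add: y_Suc)
    also have "\<dots> \<le> \<rho> * (\<rho> ^ n * \<rho>)" using Suc \<rho> by (intro mult_left_mono) auto
    finally show ?case by (simp add: mult.assoc)
  qed
  have "\<exists>z\<in>carrier A. c_nlim A y z"
  proof (rule nlim_complete)
    fix \<epsilon> :: real assume \<epsilon>: "0 < \<epsilon>"
    have "(\<lambda>n. \<rho> ^ n * \<rho>) \<longlonglongrightarrow> 0"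
      using \<rho> by (intro tendsto_mult_left_zero LIMSEQ_realpow_zero)
    from order_tendstoD(2)[OF this \<epsilon>]
    obtain k where k: "\<And>n. n \<ge> k \<Longrightarrow> \<rho> ^ n * \<rho> < \<epsilon>" by (auto simp: eventually_at_top_linorder)
    have *: "nrm A (y m \<ominus> y n) < \<epsilon>" if "n \<ge> k" "m \<ge> n" for m n
      using y_dist[of n "m - n"] k[of n] that by simp
    have "nrm A (y m \<ominus> y n) < \<epsilon>" if "n \<ge> k" "m \<ge> k" for m n
      using *[of n m] *[of m n] that N_diff_commute[of "y m" "y n"] y by (cases "n \<le> m") auto
    then show "\<exists>k. \<forall>m\<ge>k. \<forall>n\<ge>k. nrm A (y m \<ominus> y n) < \<epsilon>" by blast
  qed (use y in simp)
  then obtain z where z: "z \<in> carrier A" "c_nlim A y z" by blast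
  have yc: "\<And>n. y n \<in> carrier A" using y by simp
  have "c_nlim A (\<lambda>n. F (y n)) (F z)"
    unfolding F_def using z yc a
    by (intro nlim_smult nlim_add pre.nlim_mult nlim_const) auto
  moreover have "c_nlim A (\<lambda>n. F (y n)) z"
    using LIMSEQ_Suc[OF z(2)[unfolded nlim_def]] by (simp add: nlim_def y_Suc)
  ultimately have Fz: "F z = z"
    using nlim_unique[of "\<lambda>n. F (y n)"] F_cl yc z by simp
  have "2 \<odot>\<^bsub>A\<^esub> F z = a \<oplus> z \<otimes> z" using z a by (simp add: F_def smult_smult)
  then have zz: "z \<oplus> z = a \<oplus> z \<otimes> z" using Fz z by (simp add: smult_2)
  have "c_nlim A (\<lambda>n. invol A (y n)) (invol A z)" using yc z by (intro nlim_invol)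
  then have inv: "invol A z = z" using y z nlim_unique[of y] by (simp add: invol_closed)
  \<comment> \<open>Commutation with \<open>a\<close> passes to all iterates and then to the limit.
    It is what later makes \<open>b + \<i> s\<close> unitary, with \<open>s\<close> the square root
    of \<open>1 - b b\<close>.\<close>
  have comm: "z \<otimes> b = b \<otimes> z" if b: "b \<in> carrier A" "a \<otimes> b = b \<otimes> a" for b
  proof -
    have yb: "y n \<otimes> b = b \<otimes> y n" for n
    proof (induction n)
      case 0 then show ?case using b by (simp add: y_def)
    next
      case (Suc n)
      have "y n \<otimes> y n \<otimes> b = b \<otimes> (y n \<otimes> y n)"
        using Suc b(1) yc[of n] times_assoc[of "y n" "y n" b] times_assoc[of "y n" b "y n"] times_assoc[of b "y n" "y n"] by simp
      then show ?case
        using b yc[of n] a(1) by (simp add: y_Suc F_def smult_mult_left smult_mult_right times_l_distr times_r_distr)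
    qed
    have "c_nlim A (\<lambda>n. y n \<otimes> b) (z \<otimes> b)" "c_nlim A (\<lambda>n. b \<otimes> y n) (b \<otimes> z)"
      using yc z b by (auto intro!: pre.nlim_mult nlim_const)
    then show ?thesis using nlim_unique[of "\<lambda>n. y n \<otimes> b"] yb b z yc by simp
  qed
  show ?thesis
  proof (intro bexI conjI ballI impI)
    show "invol A (\<one> \<ominus> z) = \<one> \<ominus> z" using z inv by (simp add: invol_diff pre.invol_one)
    \<comment> \<open>The fixed point equation \<open>z + z = a + z z\<close> is exactly what turns
      \<open>1 - 2 z + z z\<close> into \<open>1 - a\<close>.\<close>
    have "(\<one> \<ominus> z) \<otimes> (\<one> \<ominus> z) = \<one> \<ominus> (z \<oplus> z) \<oplus> z \<otimes> z" using z by algebra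
    also have "\<dots> = \<one> \<ominus> a" unfolding zz using z a by algebra
    finally show "(\<one> \<ominus> z) \<otimes> (\<one> \<ominus> z) = \<one> \<ominus> a" .
    show "(\<one> \<ominus> z) \<otimes> b = b \<otimes> (\<one> \<ominus> z)" if b: "b \<in> carrier A" "a \<otimes> b = b \<otimes> a" for b
    proof -
      have "(\<one> \<ominus> z) \<otimes> b = b \<ominus> z \<otimes> b" "b \<otimes> (\<one> \<ominus> z) = b \<ominus> b \<otimes> z" using b z by algebra+
      then show ?thesis using comm[OF b] by simp
    qed
  qed (use z in auto)
qed

end

section \<open>Contractivity of unital *-homomorphisms\<close>

locale cstar_morphism = A: cstar_algebra A + B: cstar_algebra B
  for A :: "'a cstar" and B :: "'b cstar" +
  fixes h :: "'a \<Rightarrow> 'b"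
  assumes hom: "cstar_hom A B h"
begin

sublocale linear_map A B h
  by unfold_locales (use hom in \<open>simp add: cstar_hom_def\<close>)

lemma mult: "\<lbrakk>x \<in> carrier A; y \<in> carrier A\<rbrakk> \<Longrightarrow> h (x \<otimes>\<^bsub>A\<^esub> y) = h x \<otimes>\<^bsub>B\<^esub> h y"
  using hom by (simp add: cstar_hom_def ring_hom_def)

lemma one: "h \<one>\<^bsub>A\<^esub> = \<one>\<^bsub>B\<^esub>"
  using hom by (simp add: cstar_hom_def ring_hom_def)

lemma invol: "x \<in> carrier A \<Longrightarrow> h (invol A x) = invol B (h x)"
  using hom by (simp add: cstar_hom_def)

text \<open>A self-adjoint \<open>b\<close> with \<open>\<parallel>b\<parallel> < 1\<close> is the real part of the unitary \<open>b + \<i> sqrt (1 - b\<^sup>2)\<close>, and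
  unital *-homomorphisms preserve unitaries.\<close>

lemma contractive_selfadjoint:
  assumes b: "b \<in> carrier A" "invol A b = b" "nrm A b < 1"
  shows "nrm B (h b) \<le> 1"
proof -
  have "nrm A (b \<otimes>\<^bsub>A\<^esub> b) = (nrm A b)\<^sup>2" using A.cstar_identity[OF b(1)] b by simp
  also have "\<dots> < 1" using b A.nrm_nonneg[OF b(1)] by (simp add: power_less_one_iff abs_square_less_1)
  finally obtain s where s: "s \<in> carrier A" "invol A s = s" "s \<otimes>\<^bsub>A\<^esub> s = \<one>\<^bsub>A\<^esub> \<ominus>\<^bsub>A\<^esub> b \<otimes>\<^bsub>A\<^esub> b"
    and comm: "s \<otimes>\<^bsub>A\<^esub> b = b \<otimes>\<^bsub>A\<^esub> s"
    using A.sqrt_one_minus[of "b \<otimes>\<^bsub>A\<^esub> b"] b(1) A.times_assoc[of b b b]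
    by (metis A.invol_mult A.times_closed b(2))
  define u where "u = b \<oplus>\<^bsub>A\<^esub> \<i> \<odot>\<^bsub>A\<^esub> s"
  define w where "w = b \<oplus>\<^bsub>A\<^esub> (- \<i>) \<odot>\<^bsub>A\<^esub> s"
  have cl: "u \<in> carrier A" "w \<in> carrier A" using b s by (auto simp: u_def w_def)
  have w: "invol A u = w" using b s by (simp add: u_def w_def A.invol_add A.invol_smult)
  have "w \<otimes>\<^bsub>A\<^esub> u = b \<otimes>\<^bsub>A\<^esub> b \<oplus>\<^bsub>A\<^esub> s \<otimes>\<^bsub>A\<^esub> s \<oplus>\<^bsub>A\<^esub> (\<i> \<odot>\<^bsub>A\<^esub> (b \<otimes>\<^bsub>A\<^esub> s) \<ominus>\<^bsub>A\<^esub> \<i> \<odot>\<^bsub>A\<^esub> (s \<otimes>\<^bsub>A\<^esub> b))"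
    using b s(1) unfolding u_def w_def
    by (simp add: A.times_l_distr A.times_r_distr A.smult_mult_left A.smult_mult_right A.smult_smult
        A.smult_dist, simp add: A.smult_neg A.v_minus_eq A.v_ac)
  also have "\<dots> = \<one>\<^bsub>A\<^esub>"
    unfolding comm s(3) using b s(1) by (simp add: A.v_minus_eq A.v_ac A.v_r_neg A.v_r_neg1 A.v_r_neg2)
  finally have "h w \<otimes>\<^bsub>B\<^esub> h u = \<one>\<^bsub>B\<^esub>" using cl mult one by metis
  then have "(nrm B (h u))\<^sup>2 \<le> 1"
    using B.cstar_identity[of "h u"] B.pre.nrm_one_le cl by (simp add: w flip: invol)
  then have hu: "nrm B (h u) \<le> 1"
    using abs_le_square_iff[of "nrm B (h u)" 1] by simp
  then have hw: "nrm B (h w) \<le> 1"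
    using B.N_invol[of "h u"] cl by (simp add: w flip: invol)
  \<comment> \<open>The element \<open>b\<close> is the mean of \<open>u\<close> and its adjoint
    \<open>w\<close>, and the images of both have norm at most 1.\<close>
  have "u \<oplus>\<^bsub>A\<^esub> w = b \<oplus>\<^bsub>A\<^esub> b" unfolding u_def w_def
    using b s by (simp add: A.smult_neg A.v_ac A.v_r_neg1 A.v_r_neg2 A.v_r_neg)
  then have "(1/2) \<odot>\<^bsub>A\<^esub> (u \<oplus>\<^bsub>A\<^esub> w) = b" using b by (simp add: A.smult_smult flip: A.smult_2)
  then have "h b = (1/2) \<odot>\<^bsub>B\<^esub> (h u \<oplus>\<^bsub>B\<^esub> h w)"
    using cl smult[of "u \<oplus>\<^bsub>A\<^esub> w" "1/2"] by (simp add: add)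
  then have "nrm B (h b) = 1/2 * nrm B (h u \<oplus>\<^bsub>B\<^esub> h w)"
    using cl by (simp add: B.nrm_smult norm_divide)
  also have "\<dots> \<le> 1" using B.nrm_triangle[of "h u" "h w"] hu hw cl by simp
  finally show ?thesis .
qed

text \<open>The C*-identity reduces the claim to the self-adjoint element \<open>b\<close>, the
  adjoint of \<open>x\<close> times \<open>x\<close>. Dividing \<open>b\<close> by any
  \<open>t\<close> above its norm produces the strict bound that the self-adjoint case
  requires.\<close>

lemma contractive:
  assumes x: "x \<in> carrier A"
  shows "nrm B (h x) \<le> nrm A x"
proof -
  define b where "b = invol A x \<otimes>\<^bsub>A\<^esub> x"
  have b: "b \<in> carrier A" "invol A b = b"
    using x by (simp_all add: b_def A.invol_closed A.invol_mult A.invol_invol)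
  have "nrm B (h b) \<le> t" if t: "nrm A b < t" for t
  proof -
    have t0: "0 < t" using t A.nrm_nonneg[OF b(1)] by linarith
    have "nrm A (complex_of_real (1/t) \<odot>\<^bsub>A\<^esub> b) < 1" using t t0 b by (simp add: A.nrm_smult norm_divide)
    then have "nrm B (h (complex_of_real (1/t) \<odot>\<^bsub>A\<^esub> b)) \<le> 1"
      using b by (intro contractive_selfadjoint) (auto simp: A.invol_smult)
    then show ?thesis using t0 b by (simp add: smult B.nrm_smult norm_divide)
  qed
  then have "nrm B (h b) \<le> nrm A b" by (rule dense_ge)
  then have "(nrm B (h x))\<^sup>2 \<le> (nrm A x)\<^sup>2"
    using x by (simp add: b_def mult invol A.invol_closed A.cstar_identity B.cstar_identity)
  then show ?thesis using abs_le_square_iff[of "nrm B (h x)" "nrm A x"] A.nrm_nonneg[OF x] B.nrm_nonneg[of "h x"] x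
    by simp
qed

lemma nlim_hom:
  assumes "\<And>n. f n \<in> carrier A" "x \<in> carrier A" "c_nlim A f x"
  shows "c_nlim B (\<lambda>n. h (f n)) (h x)"
  using assms(1,2)
  by (intro B.nlim_I[OF _ _ _ assms(3)[unfolded nlim_def]]) (auto simp: contractive simp flip: diff)

end

lemma cstar_morphismI: "cstar_algebra A \<Longrightarrow> cstar_algebra B \<Longrightarrow> cstar_hom A B h \<Longrightarrow> cstar_morphism A B h"
  by (simp add: cstar_morphism_def cstar_morphism_axioms_def)

section \<open>Quotients by star subspaces\<close>

text \<open>Cosets are sets of elements, so a quotient of a space of sequences has a type of sets of
  sequences, the type at which the given limits are assumed universal.\<close>

definition coset :: "('a, 'm) star_space_scheme \<Rightarrow> 'a set \<Rightarrow> 'a \<Rightarrow> 'a set" where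
  "coset V I x = {y \<in> carrier V. y \<ominus>\<^bsub>V\<^esub> x \<in> I}"

definition rep :: "('a, 'm) star_space_scheme \<Rightarrow> 'a set \<Rightarrow> 'a set \<Rightarrow> 'a" where
  "rep V I u = (SOME x. x \<in> carrier V \<and> coset V I x = u)"

text \<open>The operations go through chosen representatives. For a star subspace the linear
  operations and the involution do not depend on the choice; for the product this is shown only
  where the subspace consists of the null elements of a C*-seminorm.\<close>

definition quot_space :: "('a, 'm) star_space_scheme \<Rightarrow> 'a set \<Rightarrow> 'a set star_space" where
  "quot_space V I = \<lparr>carrier = coset V I ` carrier V,
     mult = \<lambda>u v. coset V I (rep V I u \<otimes>\<^bsub>V\<^esub> rep V I v), one = coset V I \<one>\<^bsub>V\<^esub>,
     zero = coset V I \<zero>\<^bsub>V\<^esub>, add = \<lambda>u v. coset V I (rep V I u \<oplus>\<^bsub>V\<^esub> rep V I v),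
     smult = \<lambda>c u. coset V I (c \<odot>\<^bsub>V\<^esub> rep V I u), invol = \<lambda>u. coset V I (invol V (rep V I u))\<rparr>"

locale star_subspace = star_vector_space V for V :: "('a, 'm) star_space_scheme" (structure) +
  fixes I :: "'a set"
  assumes I_sub: "I \<subseteq> carrier V" and I_zero: "\<zero> \<in> I"
    and I_add: "\<lbrakk>x \<in> I; y \<in> I\<rbrakk> \<Longrightarrow> x \<oplus> y \<in> I"
    and I_smult: "x \<in> I \<Longrightarrow> c \<odot>\<^bsub>V\<^esub> x \<in> I"
    and I_invol: "x \<in> I \<Longrightarrow> invol V x \<in> I"
begin

lemma I_cl: "x \<in> I \<Longrightarrow> x \<in> carrier V"
  using I_sub by blast

lemma I_minus: "x \<in> I \<Longrightarrow> \<ominus> x \<in> I"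
  using I_smult[of x "-1"] I_cl by (simp add: smult_neg1)

lemma coset_eq:
  assumes "x \<in> carrier V" "y \<in> carrier V"
  shows "coset V I x = coset V I y \<longleftrightarrow> x \<ominus> y \<in> I"
proof
  assume eq: "coset V I x = coset V I y"
  have "x \<in> coset V I x" using assms I_zero by (simp add: coset_def)
  then show "x \<ominus> y \<in> I" unfolding eq by (simp add: coset_def)
next
  assume xy: "x \<ominus> y \<in> I"
  then have yx: "y \<ominus> x \<in> I" using I_minus[of "x \<ominus> y"] assms by (simp add: minus_diff)
  have "z \<ominus> x \<in> I \<longleftrightarrow> z \<ominus> y \<in> I" if "z \<in> carrier V" for z
    using I_add[OF _ xy, of "z \<ominus> x"] I_add[OF _ yx, of "z \<ominus> y"]
      diff_trans[OF that assms] diff_trans[OF that assms(2,1)] by metis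
  then show "coset V I x = coset V I y" by (auto simp: coset_def)
qed

lemma rep_coset:
  assumes "x \<in> carrier V"
  shows "rep V I (coset V I x) \<in> carrier V" "coset V I (rep V I (coset V I x)) = coset V I x"
    "rep V I (coset V I x) \<ominus> x \<in> I"
proof -
  have *: "rep V I (coset V I x) \<in> carrier V \<and> coset V I (rep V I (coset V I x)) = coset V I x"
    unfolding rep_def by (rule someI[of _ x]) (simp add: assms)
  then show "rep V I (coset V I x) \<in> carrier V" "coset V I (rep V I (coset V I x)) = coset V I x" by auto
  with assms show "rep V I (coset V I x) \<ominus> x \<in> I" using coset_eq by blast
qed

lemma quot_add:
  assumes "x \<in> carrier V" "y \<in> carrier V"
  shows "coset V I x \<oplus>\<^bsub>quot_space V I\<^esub> coset V I y = coset V I (x \<oplus> y)"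
  using assms rep_coset[of x] rep_coset[of y]
  by (simp add: quot_space_def coset_eq diff_add I_add)

lemma quot_smult:
  assumes "x \<in> carrier V"
  shows "c \<odot>\<^bsub>quot_space V I\<^esub> coset V I x = coset V I (c \<odot>\<^bsub>V\<^esub> x)"
  using assms rep_coset[of x] I_smult[of "rep V I (coset V I x) \<ominus> x" c]
  by (simp add: quot_space_def coset_eq smult_diff)

lemma quot_invol:
  assumes "x \<in> carrier V"
  shows "invol (quot_space V I) (coset V I x) = coset V I (invol V x)"
  using assms rep_coset[of x] I_invol[of "rep V I (coset V I x) \<ominus> x"]
  by (simp add: quot_space_def coset_eq invol_diff invol_closed)

lemma quot_zero: "\<zero>\<^bsub>quot_space V I\<^esub> = coset V I \<zero>"
  and quot_carrier: "carrier (quot_space V I) = coset V I ` carrier V"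
  and quot_one: "\<one>\<^bsub>quot_space V I\<^esub> = coset V I \<one>"
  by (simp_all add: quot_space_def)

end

definition quot_cstar :: "'a cstar \<Rightarrow> 'a set cstar" where
  "quot_cstar A = (let I = {x \<in> carrier A. nrm A x = 0} in
     star_space.extend (quot_space A I) \<lparr>nrm = \<lambda>u. nrm A (rep A I u)\<rparr>)"

context pre_cstar
begin

abbreviation "Null \<equiv> {x \<in> carrier A. nrm A x = 0}"
abbreviation "cl \<equiv> coset A Null"

sublocale N: star_subspace A Null
proof
  fix x y assume "x \<in> Null" "y \<in> Null"
  then show "x \<oplus> y \<in> Null"
    using N_triangle[of x y] N_nonneg[of "x \<oplus> y"] by auto
qed (auto simp: N_smult N_invol invol_closed)

text \<open>The norm is independent of the representative because it is 1-Lipschitz, the product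
  because \<open>nrm_mult_diff\<close> bounds the change of a product by multiples of the changes of
  its factors.\<close>

lemma quot_cstar_simps:
  "carrier (quot_cstar A) = cl ` carrier A"
  "zero (quot_cstar A) = cl \<zero>" "one (quot_cstar A) = cl \<one>"
  "\<lbrakk>x \<in> carrier A; y \<in> carrier A\<rbrakk> \<Longrightarrow> cl x \<oplus>\<^bsub>quot_cstar A\<^esub> cl y = cl (x \<oplus> y)"
  "\<lbrakk>x \<in> carrier A; y \<in> carrier A\<rbrakk> \<Longrightarrow> cl x \<otimes>\<^bsub>quot_cstar A\<^esub> cl y = cl (x \<otimes> y)"
  "x \<in> carrier A \<Longrightarrow> c \<odot>\<^bsub>quot_cstar A\<^esub> cl x = cl (c \<odot>\<^bsub>A\<^esub> x)"
  "x \<in> carrier A \<Longrightarrow> invol (quot_cstar A) (cl x) = cl (invol A x)"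
  "x \<in> carrier A \<Longrightarrow> nrm (quot_cstar A) (cl x) = nrm A x"
proof -
  note [simp] = quot_cstar_def Let_def star_space.extend_def
  show "carrier (quot_cstar A) = cl ` carrier A" "zero (quot_cstar A) = cl \<zero>" "one (quot_cstar A) = cl \<one>"
    by (simp_all add: N.quot_carrier N.quot_zero N.quot_one)
  show "x \<in> carrier A \<Longrightarrow> c \<odot>\<^bsub>quot_cstar A\<^esub> cl x = cl (c \<odot>\<^bsub>A\<^esub> x)"
    "x \<in> carrier A \<Longrightarrow> invol (quot_cstar A) (cl x) = cl (invol A x)"
    using N.quot_smult[of x] N.quot_invol[of x] by simp_all
  have eq: "nrm A x = nrm A y" if "x \<ominus> y \<in> Null" "x \<in> carrier A" "y \<in> carrier A" for x y
    using that N_abs_diff[of x y] by simp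
  show "x \<in> carrier A \<Longrightarrow> nrm (quot_cstar A) (cl x) = nrm A x"
    using N.rep_coset[of x] eq[of "rep A Null (cl x)" x] by simp
  assume x: "x \<in> carrier A" and y: "y \<in> carrier A"
  then show "cl x \<oplus>\<^bsub>quot_cstar A\<^esub> cl y = cl (x \<oplus> y)" using N.quot_add[of x y] by simp
  let ?x = "rep A Null (cl x)" and ?y = "rep A Null (cl y)"
  have "nrm A ((?x \<otimes> ?y) \<ominus> (x \<otimes> y)) \<le> nrm A (?x \<ominus> x) * nrm A ?y + nrm A x * nrm A (?y \<ominus> y)"
    using N.rep_coset[OF x] N.rep_coset[OF y] x y by (intro nrm_mult_diff)
  also have "\<dots> = 0" using N.rep_coset[OF x] N.rep_coset[OF y] by simp
  finally have "cl (?x \<otimes> ?y) = cl (x \<otimes> y)"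
    using N.rep_coset[OF x] N.rep_coset[OF y] x y N_nonneg[of "(?x \<otimes> ?y) \<ominus> (x \<otimes> y)"]
    by (subst N.coset_eq) auto
  then show "cl x \<otimes>\<^bsub>quot_cstar A\<^esub> cl y = cl (x \<otimes> y)" by (simp add: quot_space_def)
qed

lemma star_vector_space_quot: "star_vector_space (quot_cstar A)"
  using star_vector_space_axioms
  by (rule star_vector_space_image[where q = cl]) (simp_all add: quot_cstar_simps)

lemma quot_diff:
  assumes x: "x \<in> carrier A" and y: "y \<in> carrier A"
  shows "cl x \<ominus>\<^bsub>quot_cstar A\<^esub> cl y = cl (x \<ominus> y)"
proof -
  interpret Q: star_vector_space "quot_cstar A" by (rule star_vector_space_quot)
  have y': "cl y \<in> carrier (quot_cstar A)" using y by (simp add: quot_cstar_simps)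
  have "cl x \<ominus>\<^bsub>quot_cstar A\<^esub> cl y = cl x \<oplus>\<^bsub>quot_cstar A\<^esub> (-1) \<odot>\<^bsub>quot_cstar A\<^esub> cl y"
    by (simp add: Q.v_minus_eq Q.smult_neg1 y')
  also have "\<dots> = cl (x \<oplus> (-1) \<odot>\<^bsub>A\<^esub> y)" using x y by (simp add: quot_cstar_simps)
  finally show ?thesis using x y by (simp add: v_minus_eq smult_neg1)
qed

text \<open>Completeness is required of the seminorm upstairs: a Cauchy sequence of cosets lifts
  term by term with the same distances.\<close>

theorem cstar_algebra_quot:
  assumes complete: "\<And>f. \<lbrakk>\<And>n. f n \<in> carrier A;
        \<And>\<epsilon>. 0 < \<epsilon> \<Longrightarrow> \<exists>k. \<forall>m\<ge>k. \<forall>n\<ge>k. nrm A (f m \<ominus> f n) < \<epsilon>\<rbrakk> \<Longrightarrow> \<exists>x\<in>carrier A. c_nlim A f x"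
  shows "cstar_algebra (quot_cstar A)"
proof -
  let ?Q = "quot_cstar A"
  note [simp] = quot_cstar_simps(2-)
  have car: "\<And>P. (\<forall>u\<in>carrier ?Q. P u) \<longleftrightarrow> (\<forall>x\<in>carrier A. P (cl x))"
    by (simp add: quot_cstar_simps(1))
  have "ring ?Q"
    using ring_A by (rule ring_image[where q = cl]) (simp_all add: quot_cstar_simps)
  moreover have "cstar_algebra_axioms ?Q"
  proof (rule cstar_algebra_axioms.intro, goal_cases)
    \<comment> \<open>Case 10 is completeness and case 5 below is definiteness of the norm; the
      other axioms hold on representatives.\<close>
    case (10 f)
    have "\<forall>n. \<exists>x. x \<in> carrier A \<and> f n = cl x" using 10(1) by (auto simp: quot_cstar_simps(1))
    then obtain g where g: "\<And>n. g n \<in> carrier A" "\<And>n. f n = cl (g n)" by metis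
    then have f: "f = (\<lambda>n. cl (g n))" by auto
    have d: "nrm ?Q (f m \<ominus>\<^bsub>?Q\<^esub> cl x) = nrm A (g m \<ominus> x)" if "x \<in> carrier A" for m x
      using g that by (simp add: quot_diff)
    have e: "nrm ?Q (f m \<ominus>\<^bsub>?Q\<^esub> f n) = nrm A (g m \<ominus> g n)" for m n
      using d[of "g n" m] g by simp
    have "\<exists>x\<in>carrier A. c_nlim A g x"
      using 10(2) g(1) by (intro complete) (auto simp: e)
    then obtain x where x: "x \<in> carrier A" "c_nlim A g x" by blast
    then show ?case
      by (intro bexI[of _ "cl x"]) (simp_all add: nlim_def d quot_cstar_simps(1))
  next
    case (5 u)
    then obtain x where "u = cl x" "x \<in> carrier A" by (auto simp: quot_cstar_simps(1))
    then show ?case using N.coset_eq[of x \<zero>] by simp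
  qed (unfold quot_cstar_simps(1), auto simp: smult_mult_left smult_mult_right invol_mult invol_closed
      nrm_nonneg nrm_triangle nrm_smult nrm_mult cstar_identity)
  ultimately show ?thesis
    using star_vector_space_quot by (simp add: cstar_algebra_def)
qed

end

section \<open>Inductive limits of C*-algebras\<close>

text \<open>The connecting maps are indexed by a starting level and a number of steps, so that no
  side condition comparing two levels arises.\<close>

primrec tr :: "(nat \<Rightarrow> 'a \<Rightarrow> 'a) \<Rightarrow> nat \<Rightarrow> nat \<Rightarrow> 'a \<Rightarrow> 'a" where
  "tr f k 0 x = x"
| "tr f k (Suc j) x = f (k + j) (tr f k j x)"

lemma tr_fun: "tr f k 0 = (\<lambda>x. x)" "tr f k (Suc j) = (\<lambda>x. f (k + j) (tr f k j x))"
  by auto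

lemma tr_tr: "tr f (k + i) j (tr f k i x) = tr f k (i + j) x"
  by (induction j) (simp_all add: add.assoc)

lemma tr_cocone:
  assumes "\<And>k x. x \<in> C k \<Longrightarrow> f k x \<in> C (Suc k)" "\<And>k x. x \<in> C k \<Longrightarrow> g (Suc k) (f k x) = g k x"
    and "x \<in> C k"
  shows "tr f k j x \<in> C (k + j)" "g (k + j) (tr f k j x) = g k x"
  using assms by (induction j) simp_all

lemma uniform_index:
  fixes n :: nat
  assumes "\<And>i j. \<lbrakk>i < n; j < n\<rbrakk> \<Longrightarrow> \<exists>k. \<forall>m\<ge>k. Q i j m"
  shows "\<exists>k::nat. \<forall>i j m. i < n \<longrightarrow> j < n \<longrightarrow> k \<le> m \<longrightarrow> Q i j m"
proof -
  have "\<forall>\<^sub>F m in sequentially. \<forall>i\<in>{..<n}. \<forall>j\<in>{..<n}. Q i j m"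
    using assms by (intro eventually_ball_finite ballI) (auto simp: eventually_at_top_linorder)
  then show ?thesis unfolding eventually_at_top_linorder by blast
qed

text \<open>The limit is the infimum of the eventual upper bounds: up to a small error, each late
  term is itself such a bound.\<close>

lemma convergent_almost_decseq:
  fixes a :: "nat \<Rightarrow> real"
  assumes nn: "\<And>n. 0 \<le> a n" and dec: "\<And>\<epsilon>. 0 < \<epsilon> \<Longrightarrow> \<exists>k. \<forall>n\<ge>k. \<forall>m\<ge>n. a m \<le> a n + \<epsilon>"
  shows "convergent a"
proof -
  define E where "E = {M. \<exists>k. \<forall>n\<ge>k. a n \<le> M}"
  obtain k1 where k1: "\<And>n m. k1 \<le> n \<Longrightarrow> n \<le> m \<Longrightarrow> a m \<le> a n + 1" using dec[of 1] by auto
  then have "a k1 + 1 \<in> E" unfolding E_def by blast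
  then have ne: "E \<noteq> {}" by blast
  have pos: "0 \<le> M" if "M \<in> E" for M using that nn order_trans unfolding E_def by blast
  then have bb: "bdd_below E" by (meson bdd_below.I)
  have "a \<longlonglongrightarrow> Inf E"
  proof (rule LIMSEQ_I)
    fix r :: real assume r: "0 < r"
    obtain M where M: "M \<in> E" "M < Inf E + r" using cInf_lessD[OF ne, of "Inf E + r"] r by auto
    obtain k where k: "\<And>n. n \<ge> k \<Longrightarrow> a n \<le> M" using M by (auto simp: E_def)
    obtain l where l: "\<And>n m. l \<le> n \<Longrightarrow> n \<le> m \<Longrightarrow> a m \<le> a n + r/2" using dec[of "r/2"] r by auto
    have "norm (a n - Inf E) < r" if n: "n \<ge> max k l" for n
    proof -
      have "a n + r/2 \<in> E" using l n unfolding E_def by auto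
      then have "Inf E \<le> a n + r/2" using bb by (rule cInf_lower)
      moreover have "a n < Inf E + r" using k[of n] n M by simp
      ultimately show ?thesis using r by simp
    qed
    then show "\<exists>no. \<forall>n\<ge>no. norm (a n - Inf E) < r" by blast
  qed
  then show ?thesis by (rule convergentI)
qed

lemma cstar_hom_id: "cstar_algebra A \<Longrightarrow> cstar_hom A A (\<lambda>x. x)"
  by (auto simp: cstar_hom_def complex_linear_def ring_hom_def)

lemma cstar_hom_comp:
  assumes f: "cstar_hom A B f" and g: "cstar_hom B C g"
  shows "cstar_hom A C (\<lambda>x. g (f x))"
proof -
  have "f \<in> carrier A \<rightarrow> carrier B" using f by (simp add: cstar_hom_def ring_hom_def)
  then show ?thesis using f g by (auto simp: cstar_hom_def complex_linear_def ring_hom_def Pi_iff)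
qed

section \<open>Asymptotically coherent sequences in a system of C*-algebras\<close>

locale cstar_system =
  fixes A :: "nat \<Rightarrow> 'a cstar" and \<pi> :: "nat \<Rightarrow> 'a \<Rightarrow> 'a"
  assumes algs: "cstar_algebra (A k)" and homs: "cstar_hom (A k) (A (Suc k)) (\<pi> k)"
begin

sublocale A: cstar_algebra "A k" for k by (rule algs)

lemma tr_hom: "cstar_hom (A k) (A (k + j)) (tr \<pi> k j)"
proof (induction j)
  case 0
  then show ?case using cstar_hom_id[OF algs] by (simp add: tr_fun del: tr.simps)
next
  case (Suc j)
  then show ?case using cstar_hom_comp[OF Suc homs] by (simp add: tr_fun del: tr.simps)
qed

sublocale T: cstar_morphism "A k" "A (k + j)" "tr \<pi> k j" for k j
  by (intro cstar_morphismI algs tr_hom)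

text \<open>The closure of the coherent sequences: for every precision, one element of one level
  shadows the tail. Exact coherence would give the algebraic limit only, which need not be
  complete.\<close>

definition asym :: "(nat \<Rightarrow> 'a) \<Rightarrow> bool" where
  "asym f \<longleftrightarrow> (\<forall>n. f n \<in> carrier (A n)) \<and>
    (\<forall>\<epsilon>>0. \<exists>k. \<exists>a\<in>carrier (A k). \<forall>j. nrm (A (k + j)) (f (k + j) \<ominus>\<^bsub>A (k + j)\<^esub> tr \<pi> k j a) < \<epsilon>)"

lemma asym_cl [simp]: "asym f \<Longrightarrow> f n \<in> carrier (A n)"
  by (simp add: asym_def)

lemma asymD:
  "\<lbrakk>asym f; 0 < \<epsilon>\<rbrakk> \<Longrightarrow> \<exists>k. \<exists>a\<in>carrier (A k). \<forall>j. nrm (A (k + j)) (f (k + j) \<ominus>\<^bsub>A (k + j)\<^esub> tr \<pi> k j a) < \<epsilon>"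
  unfolding asym_def by blast

text \<open>The shadowing element may be replaced by its image at any later level. Two sequences can
  thus be approximated from a common level, as sums and products require.\<close>

lemma asymE:
  assumes "asym f" "0 < \<epsilon>"
  shows "\<exists>k0. \<forall>k\<ge>k0. \<exists>a\<in>carrier (A k). \<forall>j. nrm (A (k + j)) (f (k + j) \<ominus>\<^bsub>A (k + j)\<^esub> tr \<pi> k j a) < \<epsilon>"
proof -
  obtain k0 a where a: "a \<in> carrier (A k0)"
    "\<And>j. nrm (A (k0 + j)) (f (k0 + j) \<ominus>\<^bsub>A (k0 + j)\<^esub> tr \<pi> k0 j a) < \<epsilon>"
    using asymD[OF assms] by blast
  have "\<exists>a\<in>carrier (A k). \<forall>j. nrm (A (k + j)) (f (k + j) \<ominus>\<^bsub>A (k + j)\<^esub> tr \<pi> k j a) < \<epsilon>" if kk: "k \<ge> k0" for k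
  proof -
    obtain i where i: "k = k0 + i" using le_Suc_ex[OF kk] by blast
    have "nrm (A (k + j)) (f (k + j) \<ominus>\<^bsub>A (k + j)\<^esub> tr \<pi> k j (tr \<pi> k0 i a)) < \<epsilon>" for j
      unfolding i tr_tr using a(2)[of "i + j"] by (simp only: add.assoc)
    moreover have "tr \<pi> k0 i a \<in> carrier (A k)" using a(1) unfolding i by (rule T.closed)
    ultimately show ?thesis by blast
  qed
  then show ?thesis by blast
qed

lemma asym_eventually:
  assumes cl: "\<And>n. f n \<in> carrier (A n)"
    and "\<And>\<epsilon>. 0 < \<epsilon> \<Longrightarrow> \<exists>g. asym g \<and> (\<forall>\<^sub>F n in sequentially. nrm (A n) (f n \<ominus>\<^bsub>A n\<^esub> g n) < \<epsilon>)"
  shows "asym f"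
  unfolding asym_def
proof (intro conjI allI impI)
  fix \<epsilon> :: real assume \<epsilon>: "0 < \<epsilon>"
  obtain g N where g: "asym g" "\<And>n. n \<ge> N \<Longrightarrow> nrm (A n) (f n \<ominus>\<^bsub>A n\<^esub> g n) < \<epsilon>/2"
    using assms(2)[of "\<epsilon>/2"] \<epsilon> by (auto simp: eventually_at_top_linorder)
  obtain k0 where k0: "\<And>k. k \<ge> k0 \<Longrightarrow> \<exists>a\<in>carrier (A k). \<forall>j. nrm (A (k + j)) (g (k + j) \<ominus>\<^bsub>A (k + j)\<^esub> tr \<pi> k j a) < \<epsilon>/2"
    using asymE[OF g(1) half_gt_zero[OF \<epsilon>]] by blast
  define k where "k = max k0 N"
  have k0k: "k0 \<le> k" and kN: "N \<le> k" by (auto simp: k_def)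
  obtain a where a: "a \<in> carrier (A k)" "\<And>j. nrm (A (k + j)) (g (k + j) \<ominus>\<^bsub>A (k + j)\<^esub> tr \<pi> k j a) < \<epsilon>/2"
    using k0[OF k0k] by blast
  have "nrm (A (k + j)) (f (k + j) \<ominus>\<^bsub>A (k + j)\<^esub> tr \<pi> k j a) < \<epsilon>" for j
    using A.N_diff_triangle[of "f (k + j)" "k + j" "g (k + j)" "tr \<pi> k j a"] cl g(1) a(1) a(2)[of j]
      g(2)[OF trans_le_add1[OF kN, of j]]
    by simp
  with a(1) show "\<exists>k. \<exists>a\<in>carrier (A k). \<forall>j. nrm (A (k + j)) (f (k + j) \<ominus>\<^bsub>A (k + j)\<^esub> tr \<pi> k j a) < \<epsilon>"
    by blast
qed (fact cl)

text \<open>The tail stays within 1 of the images of a single element, and the connecting maps are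
  contractive.\<close>

lemma asym_bounded:
  assumes "asym f"
  obtains k M where "0 < M" "\<And>n. n \<ge> k \<Longrightarrow> nrm (A n) (f n) \<le> M"
proof -
  have one: "(0::real) < 1" by simp
  obtain k a where a: "a \<in> carrier (A k)"
    "\<And>j. nrm (A (k + j)) (f (k + j) \<ominus>\<^bsub>A (k + j)\<^esub> tr \<pi> k j a) < 1"
    using asymD[OF assms one] by blast
  have "nrm (A n) (f n) \<le> 1 + nrm (A k) a" if nk: "n \<ge> k" for n
  proof -
    obtain i where i: "n = k + i" using le_Suc_ex[OF nk] by blast
    have "nrm (A n) (f n) \<le> nrm (A n) (f n \<ominus>\<^bsub>A n\<^esub> tr \<pi> k i a) + nrm (A n) (tr \<pi> k i a)"
      unfolding i using assms a(1) by (intro A.N_le_diff) auto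
    then show ?thesis using a(2)[of i] T.contractive[OF a(1), of i] by (simp add: i)
  qed
  moreover have "0 < 1 + nrm (A k) a" using A.nrm_nonneg[OF a(1)] by simp
  ultimately show ?thesis using that by blast
qed

lemma asym_add: "\<lbrakk>asym f; asym g\<rbrakk> \<Longrightarrow> asym (\<lambda>n. f n \<oplus>\<^bsub>A n\<^esub> g n)"
  unfolding asym_def[of "\<lambda>n. f n \<oplus>\<^bsub>A n\<^esub> g n"]
proof (intro conjI allI impI)
  assume f: "asym f" and g: "asym g"
  fix \<epsilon> :: real assume \<epsilon>: "0 < \<epsilon>"
  obtain k0 where k0: "\<And>k. k \<ge> k0 \<Longrightarrow> \<exists>a\<in>carrier (A k). \<forall>j. nrm (A (k + j)) (f (k + j) \<ominus>\<^bsub>A (k + j)\<^esub> tr \<pi> k j a) < \<epsilon>/2"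
    using asymE[OF f half_gt_zero[OF \<epsilon>]] by blast
  obtain k1 where k1: "\<And>k. k \<ge> k1 \<Longrightarrow> \<exists>a\<in>carrier (A k). \<forall>j. nrm (A (k + j)) (g (k + j) \<ominus>\<^bsub>A (k + j)\<^esub> tr \<pi> k j a) < \<epsilon>/2"
    using asymE[OF g half_gt_zero[OF \<epsilon>]] by blast
  let ?k = "max k0 k1"
  obtain a b where ab: "a \<in> carrier (A ?k)" "b \<in> carrier (A ?k)"
    "\<And>j. nrm (A (?k + j)) (f (?k + j) \<ominus>\<^bsub>A (?k + j)\<^esub> tr \<pi> ?k j a) < \<epsilon>/2"
    "\<And>j. nrm (A (?k + j)) (g (?k + j) \<ominus>\<^bsub>A (?k + j)\<^esub> tr \<pi> ?k j b) < \<epsilon>/2"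
    using k0[OF max.cobounded1] k1[OF max.cobounded2] by blast
  have "nrm (A (?k + j)) ((f (?k + j) \<oplus>\<^bsub>A (?k + j)\<^esub> g (?k + j)) \<ominus>\<^bsub>A (?k + j)\<^esub> tr \<pi> ?k j (a \<oplus>\<^bsub>A ?k\<^esub> b)) < \<epsilon>" for j
    using A.N_add_diff[of "f (?k + j)" "?k + j" "g (?k + j)" "tr \<pi> ?k j a" "tr \<pi> ?k j b"] ab(1,2) ab(3)[of j] ab(4)[of j] f g
    by (simp add: T.add)
  with ab(1,2) show "\<exists>k. \<exists>a\<in>carrier (A k). \<forall>j. nrm (A (k + j)) ((f (k + j) \<oplus>\<^bsub>A (k + j)\<^esub> g (k + j)) \<ominus>\<^bsub>A (k + j)\<^esub> tr \<pi> k j a) < \<epsilon>"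
    by blast
qed simp

lemma asym_mult: "\<lbrakk>asym f; asym g\<rbrakk> \<Longrightarrow> asym (\<lambda>n. f n \<otimes>\<^bsub>A n\<^esub> g n)"
  unfolding asym_def[of "\<lambda>n. f n \<otimes>\<^bsub>A n\<^esub> g n"]
proof (intro conjI allI impI)
  assume f: "asym f" and g: "asym g"
  fix \<epsilon> :: real assume \<epsilon>: "0 < \<epsilon>"
  obtain k2 M where M: "0 < M" "\<And>n. n \<ge> k2 \<Longrightarrow> nrm (A n) (f n) \<le> M" using asym_bounded[OF f] by blast
  obtain k3 M' where M': "0 < M'" "\<And>n. n \<ge> k3 \<Longrightarrow> nrm (A n) (g n) \<le> M'" using asym_bounded[OF g] by blast
  \<comment> \<open>The error of the product will be below
    \<open>\<delta> * M' + (M + 1) * \<delta>\<close>, whose factors add up to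
    \<open>M + M' + 1\<close>. The minimum with 1 keeps the norms of the approximants of
    \<open>f\<close> below \<open>M + 1\<close>.\<close>
  define \<delta> where "\<delta> = min 1 (\<epsilon> / (M + M' + 1))"
  have S: "0 < M + M' + 1" using M M' by simp
  have "\<delta> \<le> \<epsilon> / (M + M' + 1)" by (simp add: \<delta>_def)
  then have "\<delta> * (M + M' + 1) \<le> \<epsilon>" using S by (simp add: pos_le_divide_eq)
  then have \<delta>: "0 < \<delta>" "\<delta> \<le> 1" "\<delta> * (M + M' + 1) \<le> \<epsilon>"
    using S \<epsilon> by (simp_all add: \<delta>_def)
  obtain k0 where k0: "\<And>k. k \<ge> k0 \<Longrightarrow> \<exists>a\<in>carrier (A k). \<forall>j. nrm (A (k + j)) (f (k + j) \<ominus>\<^bsub>A (k + j)\<^esub> tr \<pi> k j a) < \<delta>"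
    using asymE[OF f \<delta>(1)] by blast
  obtain k1 where k1: "\<And>k. k \<ge> k1 \<Longrightarrow> \<exists>a\<in>carrier (A k). \<forall>j. nrm (A (k + j)) (g (k + j) \<ominus>\<^bsub>A (k + j)\<^esub> tr \<pi> k j a) < \<delta>"
    using asymE[OF g \<delta>(1)] by blast
  define k where "k = max (max k0 k1) (max k2 k3)"
  have kk: "k0 \<le> k" "k1 \<le> k" and k2: "k2 \<le> k + j" and k3: "k3 \<le> k + j" for j by (auto simp: k_def)
  obtain a b where ab: "a \<in> carrier (A k)" "b \<in> carrier (A k)"
    "\<And>j. nrm (A (k + j)) (f (k + j) \<ominus>\<^bsub>A (k + j)\<^esub> tr \<pi> k j a) < \<delta>"
    "\<And>j. nrm (A (k + j)) (g (k + j) \<ominus>\<^bsub>A (k + j)\<^esub> tr \<pi> k j b) < \<delta>"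
    using k0[OF kk(1)] k1[OF kk(2)] by blast
  have "nrm (A (k + j)) ((f (k + j) \<otimes>\<^bsub>A (k + j)\<^esub> g (k + j)) \<ominus>\<^bsub>A (k + j)\<^esub> tr \<pi> k j (a \<otimes>\<^bsub>A k\<^esub> b)) < \<epsilon>" for j
  proof -
    let ?n = "k + j" let ?a = "tr \<pi> k j a" and ?b = "tr \<pi> k j b"
    have cl: "f ?n \<in> carrier (A ?n)" "g ?n \<in> carrier (A ?n)" "?a \<in> carrier (A ?n)" "?b \<in> carrier (A ?n)"
      using f g ab by auto
    have fa: "nrm (A ?n) (f ?n \<ominus>\<^bsub>A ?n\<^esub> ?a) < \<delta>" and gb: "nrm (A ?n) (g ?n \<ominus>\<^bsub>A ?n\<^esub> ?b) < \<delta>"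
      using ab(3,4) by auto
    have a: "nrm (A ?n) ?a \<le> M + 1"
      using A.N_le_diff[OF cl(3,1)] A.N_diff_commute[OF cl(3,1)] fa M(2)[OF k2, of j] \<delta>(2) by simp
    have "nrm (A ?n) ((f ?n \<otimes>\<^bsub>A ?n\<^esub> g ?n) \<ominus>\<^bsub>A ?n\<^esub> (?a \<otimes>\<^bsub>A ?n\<^esub> ?b))
      \<le> nrm (A ?n) (f ?n \<ominus>\<^bsub>A ?n\<^esub> ?a) * nrm (A ?n) (g ?n) + nrm (A ?n) ?a * nrm (A ?n) (g ?n \<ominus>\<^bsub>A ?n\<^esub> ?b)"
      using cl by (intro A.nrm_mult_diff)
    also have "\<dots> \<le> \<delta> * M' + (M + 1) * nrm (A ?n) (g ?n \<ominus>\<^bsub>A ?n\<^esub> ?b)"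
      using fa a M(1) M'(2)[OF k3, of j] \<delta> cl by (intro add_mono mult_mono) (auto simp: A.nrm_nonneg)
    also have "\<dots> < \<delta> * M' + (M + 1) * \<delta>" using gb M by simp
    also have "\<dots> \<le> \<epsilon>" using \<delta>(3) by (simp add: algebra_simps)
    finally show ?thesis using ab(1,2) by (simp add: T.mult)
  qed
  with ab(1,2) show "\<exists>k. \<exists>a\<in>carrier (A k). \<forall>j. nrm (A (k + j)) ((f (k + j) \<otimes>\<^bsub>A (k + j)\<^esub> g (k + j)) \<ominus>\<^bsub>A (k + j)\<^esub> tr \<pi> k j a) < \<epsilon>"
    using A.times_closed by blast
qed simp

lemma asym_invol: "asym f \<Longrightarrow> asym (\<lambda>n. invol (A n) (f n))"
  unfolding asym_def[of "\<lambda>n. invol (A n) (f n)"]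
proof (intro conjI allI impI)
  assume f: "asym f"
  fix \<epsilon> :: real assume "0 < \<epsilon>"
  then obtain k a where a: "a \<in> carrier (A k)"
    "\<And>j. nrm (A (k + j)) (f (k + j) \<ominus>\<^bsub>A (k + j)\<^esub> tr \<pi> k j a) < \<epsilon>"
    using asymD[OF f] by blast
  have "nrm (A (k + j)) (invol (A (k + j)) (f (k + j)) \<ominus>\<^bsub>A (k + j)\<^esub> tr \<pi> k j (invol (A k) a)) < \<epsilon>" for j
    using a f A.N_invol[of "f (k + j) \<ominus>\<^bsub>A (k + j)\<^esub> tr \<pi> k j a" "k + j"]
    by (simp add: T.invol A.invol_diff)
  with a(1) show "\<exists>k. \<exists>a\<in>carrier (A k). \<forall>j. nrm (A (k + j)) (invol (A (k + j)) (f (k + j)) \<ominus>\<^bsub>A (k + j)\<^esub> tr \<pi> k j a) < \<epsilon>"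
    using A.invol_closed by blast
qed (simp add: A.invol_closed)

lemma asym_smult: "asym f \<Longrightarrow> asym (\<lambda>n. c \<odot>\<^bsub>A n\<^esub> f n)"
  unfolding asym_def[of "\<lambda>n. c \<odot>\<^bsub>A n\<^esub> f n"]
proof (intro conjI allI impI)
  assume f: "asym f"
  fix \<epsilon> :: real assume "0 < \<epsilon>"
  \<comment> \<open>Adding 1 to \<open>cmod c\<close> avoids a separate treatment of the scalar
    0.\<close>
  then have "0 < \<epsilon> / (cmod c + 1)" by (simp add: add_nonneg_pos)
  then obtain k a where a: "a \<in> carrier (A k)"
    "\<And>j. nrm (A (k + j)) (f (k + j) \<ominus>\<^bsub>A (k + j)\<^esub> tr \<pi> k j a) < \<epsilon> / (cmod c + 1)"
    using asymD[OF f] by blast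
  have "nrm (A (k + j)) ((c \<odot>\<^bsub>A (k + j)\<^esub> f (k + j)) \<ominus>\<^bsub>A (k + j)\<^esub> tr \<pi> k j (c \<odot>\<^bsub>A k\<^esub> a)) < \<epsilon>" for j
  proof -
    let ?d = "f (k + j) \<ominus>\<^bsub>A (k + j)\<^esub> tr \<pi> k j a"
    have d: "?d \<in> carrier (A (k + j))" using f a by simp
    have "(c \<odot>\<^bsub>A (k + j)\<^esub> f (k + j)) \<ominus>\<^bsub>A (k + j)\<^esub> tr \<pi> k j (c \<odot>\<^bsub>A k\<^esub> a) = c \<odot>\<^bsub>A (k + j)\<^esub> ?d"
      using f a by (simp add: T.smult A.smult_diff)
    then have "nrm (A (k + j)) ((c \<odot>\<^bsub>A (k + j)\<^esub> f (k + j)) \<ominus>\<^bsub>A (k + j)\<^esub> tr \<pi> k j (c \<odot>\<^bsub>A k\<^esub> a)) = cmod c * nrm (A (k + j)) ?d"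
      using d by (simp add: A.nrm_smult)
    also have "\<dots> \<le> (cmod c + 1) * nrm (A (k + j)) ?d"
      using A.nrm_nonneg[OF d] by (simp add: algebra_simps)
    also have "\<dots> < \<epsilon>" using a(2)[of j] by (simp add: pos_less_divide_eq add_nonneg_pos mult.commute)
    finally show ?thesis .
  qed
  with a(1) show "\<exists>k. \<exists>a\<in>carrier (A k). \<forall>j. nrm (A (k + j)) ((c \<odot>\<^bsub>A (k + j)\<^esub> f (k + j)) \<ominus>\<^bsub>A (k + j)\<^esub> tr \<pi> k j a) < \<epsilon>"
    using A.smult_cl by blast
qed simp

text \<open>The zeros below level \<open>k\<close> are filler: classes of sequences depend only on
  tails.\<close>

definition coh :: "nat \<Rightarrow> 'a \<Rightarrow> nat \<Rightarrow> 'a" where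
  "coh k a n = (if n < k then \<zero>\<^bsub>A n\<^esub> else tr \<pi> k (n - k) a)"

lemma coh_tr [simp]: "coh k a (k + j) = tr \<pi> k j a"
  by (simp add: coh_def)

lemma coh_cl: "a \<in> carrier (A k) \<Longrightarrow> coh k a n \<in> carrier (A n)"
  using T.closed[of a k "n - k"] by (cases "n < k") (simp_all add: coh_def)

lemma asym_coh: "a \<in> carrier (A k) \<Longrightarrow> asym (coh k a)"
  unfolding asym_def by (auto simp: coh_cl intro!: exI[of _ k] bexI[of _ a])

lemma asym_zero: "asym (\<lambda>n. \<zero>\<^bsub>A n\<^esub>)"
  unfolding asym_def by (auto intro!: exI[of _ 0] bexI[of _ "\<zero>\<^bsub>A 0\<^esub>"] simp: T.zero[of 0, simplified])

lemma asym_one: "asym (\<lambda>n. \<one>\<^bsub>A n\<^esub>)"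
  unfolding asym_def by (auto intro!: exI[of _ 0] bexI[of _ "\<one>\<^bsub>A 0\<^esub>"] simp: T.one[of 0, simplified])

text \<open>The norm is a genuine limit by \<open>nrm_lim\<close>. It is a seminorm which kills null
  sequences, so \<open>seqC\<close> is a \<open>pre_cstar\<close> and the limit algebra is its
  quotient.\<close>

definition seqC :: "(nat \<Rightarrow> 'a) cstar" where
  "seqC = \<lparr>carrier = {f. asym f}, mult = \<lambda>f g n. f n \<otimes>\<^bsub>A n\<^esub> g n, one = \<lambda>n. \<one>\<^bsub>A n\<^esub>,
     zero = \<lambda>n. \<zero>\<^bsub>A n\<^esub>, add = \<lambda>f g n. f n \<oplus>\<^bsub>A n\<^esub> g n, smult = \<lambda>c f n. c \<odot>\<^bsub>A n\<^esub> f n,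
     invol = \<lambda>f n. invol (A n) (f n), nrm = \<lambda>f. lim (\<lambda>n. nrm (A n) (f n))\<rparr>"

lemma seqC_simps [simp]:
  "carrier seqC = {f. asym f}" "f \<otimes>\<^bsub>seqC\<^esub> g = (\<lambda>n. f n \<otimes>\<^bsub>A n\<^esub> g n)" "\<one>\<^bsub>seqC\<^esub> = (\<lambda>n. \<one>\<^bsub>A n\<^esub>)"
  "\<zero>\<^bsub>seqC\<^esub> = (\<lambda>n. \<zero>\<^bsub>A n\<^esub>)" "f \<oplus>\<^bsub>seqC\<^esub> g = (\<lambda>n. f n \<oplus>\<^bsub>A n\<^esub> g n)"
  "c \<odot>\<^bsub>seqC\<^esub> f = (\<lambda>n. c \<odot>\<^bsub>A n\<^esub> f n)" "invol seqC f = (\<lambda>n. invol (A n) (f n))"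
  by (simp_all add: seqC_def)

text \<open>From some level on the sequence is shadowed by images of one element, and these have
  decreasing norms; hence the norms of the sequence are decreasing up to small errors.\<close>

lemma nrm_lim:
  assumes f: "asym f"
  shows "(\<lambda>n. nrm (A n) (f n)) \<longlonglongrightarrow> nrm seqC f"
proof -
  have "convergent (\<lambda>n. nrm (A n) (f n))"
  proof (rule convergent_almost_decseq)
    fix \<epsilon> :: real assume "0 < \<epsilon>"
    then obtain k0 where k0: "\<And>k. k \<ge> k0 \<Longrightarrow> \<exists>a\<in>carrier (A k). \<forall>j. nrm (A (k + j)) (f (k + j) \<ominus>\<^bsub>A (k + j)\<^esub> tr \<pi> k j a) < \<epsilon>/2"
      using asymE[OF f half_gt_zero] by blast
    have "nrm (A m) (f m) \<le> nrm (A n) (f n) + \<epsilon>" if nm: "k0 \<le> n" "n \<le> m" for n m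
    proof -
      obtain j where j: "m = n + j" using le_Suc_ex[OF nm(2)] by blast
      obtain a where a: "a \<in> carrier (A n)" "\<And>j. nrm (A (n + j)) (f (n + j) \<ominus>\<^bsub>A (n + j)\<^esub> tr \<pi> n j a) < \<epsilon>/2"
        using k0[OF nm(1)] by blast
      have "nrm (A m) (f m) \<le> nrm (A m) (f m \<ominus>\<^bsub>A m\<^esub> tr \<pi> n j a) + nrm (A m) (tr \<pi> n j a)"
        using f a j by (intro A.N_le_diff) auto
      also have "\<dots> \<le> \<epsilon>/2 + nrm (A n) a"
        using a(2)[of j] T.contractive[OF a(1), of j] j by simp
      also have "nrm (A n) a \<le> nrm (A n) (f n) + \<epsilon>/2"
        using A.N_le_diff[of a n "f n"] A.N_diff_commute[of a n "f n"] a(2)[of 0] a(1) f by simp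
      finally show ?thesis by simp
    qed
    then show "\<exists>k. \<forall>n\<ge>k. \<forall>m\<ge>n. nrm (A m) (f m) \<le> nrm (A n) (f n) + \<epsilon>" by blast
  qed (simp add: A.nrm_nonneg f)
  then show ?thesis by (simp add: convergent_LIMSEQ_iff seqC_def)
qed

lemma abelian_group_seqC: "abelian_group seqC"
proof (rule abelian_groupI)
  fix f assume "f \<in> carrier seqC"
  then show "\<exists>g\<in>carrier seqC. g \<oplus>\<^bsub>seqC\<^esub> f = \<zero>\<^bsub>seqC\<^esub>"
    using asym_smult[of f "-1"]
    by (intro bexI[of _ "\<lambda>n. (-1) \<odot>\<^bsub>A n\<^esub> f n"]) (simp_all add: A.smult_neg1 A.v_l_neg)
qed (auto simp: asym_add asym_zero A.v_ac)

lemma pre_cstar_seqC: "pre_cstar seqC"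
proof -
  have "ring seqC"
    by (intro ringI abelian_group_seqC monoidI)
      (auto simp: asym_mult asym_one A.times_assoc A.times_l_distr A.times_r_distr)
  moreover have "star_vector_space seqC"
    by (intro star_vector_spaceI abelian_group_seqC)
      (auto simp: asym_smult asym_invol A.smult_plus A.smult_dist A.smult_smult A.invol_closed A.invol_invol
        A.invol_add A.invol_smult)
  moreover have "pre_cstar_axioms seqC"
  proof (rule pre_cstar_axioms.intro, goal_cases)
    case (4 f)
    then show ?case
      by (intro LIMSEQ_le_const[OF nrm_lim]) (auto simp: A.nrm_nonneg)
  next
    case (5 f g)
    then show ?case
      by (intro LIMSEQ_le[OF nrm_lim tendsto_add[OF nrm_lim nrm_lim]]) (auto simp: asym_add A.nrm_triangle)
  next
    case (6 f c)
    then have "(\<lambda>n. nrm (A n) (c \<odot>\<^bsub>A n\<^esub> f n)) \<longlonglongrightarrow> cmod c * nrm seqC f"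
      using tendsto_mult_left[OF nrm_lim[of f], of "cmod c"] by (simp add: A.nrm_smult)
    then show ?case using 6 LIMSEQ_unique[OF nrm_lim[OF asym_smult[of f c]]] by simp
  next
    case (7 f g)
    then show ?case
      by (intro LIMSEQ_le[OF nrm_lim tendsto_mult[OF nrm_lim nrm_lim]]) (auto simp: asym_mult A.nrm_mult)
  next
    case (8 f)
    then have "(\<lambda>n. nrm (A n) (invol (A n) (f n) \<otimes>\<^bsub>A n\<^esub> f n)) \<longlonglongrightarrow> (nrm seqC f)\<^sup>2"
      using tendsto_power[OF nrm_lim[of f], of 2] by (simp add: A.cstar_identity)
    then show ?case
      using 8 LIMSEQ_unique[OF nrm_lim[OF asym_mult[OF asym_invol[of f], of f]]] by simp
  qed (auto simp: A.smult_mult_left A.smult_mult_right A.invol_mult)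
  ultimately show ?thesis by (simp add: pre_cstar_def)
qed

sublocale C: pre_cstar seqC by (rule pre_cstar_seqC)

lemma seqC_diff: "\<lbrakk>asym f; asym g\<rbrakk> \<Longrightarrow> f \<ominus>\<^bsub>seqC\<^esub> g = (\<lambda>n. f n \<ominus>\<^bsub>A n\<^esub> g n)"
  using C.smult_neg1[of g] by (simp add: C.v_minus_eq A.v_minus_eq A.smult_neg1 flip: C.smult_neg1)

lemma asym_diff: "\<lbrakk>asym f; asym g\<rbrakk> \<Longrightarrow> asym (\<lambda>n. f n \<ominus>\<^bsub>A n\<^esub> g n)"
  using C.v_minus_cl[of f g] by (simp add: seqC_diff)

end

context cstar_system
begin

text \<open>Limits of fast Cauchy sequences are diagonal: at place \<open>n\<close> use the last member that still
  agrees, at \<open>n\<close>, with its predecessors to the prescribed precision.\<close>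

lemma seqC_fast_complete:
  assumes g: "\<And>l. asym (g l)"
    and fast: "\<And>l m. l \<le> m \<Longrightarrow> nrm seqC (g l \<ominus>\<^bsub>seqC\<^esub> g m) < (1/2) ^ l"
  shows "\<exists>x. asym x \<and> (\<forall>l. nrm seqC (g l \<ominus>\<^bsub>seqC\<^esub> x) \<le> (1/2) ^ l)"
proof -
  define ok where "ok n i \<longleftrightarrow> i \<le> n \<and> (\<forall>m\<le>i. \<forall>l\<le>m. nrm (A n) (g l n \<ominus>\<^bsub>A n\<^esub> g m n) < (1/2) ^ l)" for n i
  define d where "d n = Max {i. ok n i}" for n
  have fin: "finite {i. ok n i}" for n
    by (rule finite_subset[of _ "{..n}"]) (auto simp: ok_def)
  have "ok n 0" for n using g by (simp add: ok_def)
  then have d_ok: "ok n (d n)" for n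
    using Max_in[OF fin[of n]] unfolding d_def by blast
  \<comment> \<open>For fixed \<open>i\<close> only finitely many strict inequalities between limits
    of norms are involved, so they all hold at late places. Hence \<open>d n\<close> eventually
    exceeds every bound.\<close>
  have ev_ok: "\<forall>\<^sub>F n in sequentially. ok n i" for i
  proof -
    have "\<forall>\<^sub>F n in sequentially. nrm (A n) (g l n \<ominus>\<^bsub>A n\<^esub> g m n) < (1/2) ^ l" if "l \<le> m" for l m
      using order_tendstoD(2)[OF nrm_lim[OF asym_diff[OF g g]], of l m "(1/2) ^ l"] fast[OF that] g
      by (simp add: seqC_diff)
    then have "\<forall>\<^sub>F n in sequentially. \<forall>m\<in>{..i}. \<forall>l\<in>{..m}. nrm (A n) (g l n \<ominus>\<^bsub>A n\<^esub> g m n) < (1/2) ^ l"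
      by (intro eventually_ball_finite ballI) auto
    then show ?thesis using eventually_ge_at_top[of i]
      by eventually_elim (auto simp: ok_def)
  qed
  define x where "x n = g (d n) n" for n
  have close: "\<forall>\<^sub>F n in sequentially. nrm (A n) (g l n \<ominus>\<^bsub>A n\<^esub> x n) < (1/2) ^ l" for l
    using ev_ok[of l]
  proof eventually_elim
    case (elim n)
    then have "l \<le> d n" unfolding d_def using fin by (intro Max_ge) auto
    then show ?case using d_ok[of n] unfolding ok_def x_def by blast
  qed
  have xcl: "x n \<in> carrier (A n)" for n using g by (simp add: x_def)
  have x: "asym x"
  proof (rule asym_eventually)
    fix \<epsilon> :: real assume \<epsilon>: "0 < \<epsilon>"
    obtain l where l: "(1/2::real) ^ l < \<epsilon>" using real_arch_pow_inv[OF \<epsilon>, of "1/2"] by auto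
    have "\<forall>\<^sub>F n in sequentially. nrm (A n) (x n \<ominus>\<^bsub>A n\<^esub> g l n) < \<epsilon>"
      using close[of l]
    proof eventually_elim
      case (elim n)
      then show ?case using A.N_diff_commute[of "x n" n "g l n"] xcl g l by simp
    qed
    then show "\<exists>g. asym g \<and> (\<forall>\<^sub>F n in sequentially. nrm (A n) (x n \<ominus>\<^bsub>A n\<^esub> g n) < \<epsilon>)" using g by blast
  qed (fact xcl)
  have "nrm seqC (g l \<ominus>\<^bsub>seqC\<^esub> x) \<le> (1/2) ^ l" for l
    unfolding seqC_diff[OF g x]
  proof (rule tendsto_upperbound[OF nrm_lim[OF asym_diff[OF g x]]])
    show "\<forall>\<^sub>F n in sequentially. nrm (A n) (g l n \<ominus>\<^bsub>A n\<^esub> x n) \<le> (1/2) ^ l"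
      using close[of l] by eventually_elim simp
  qed simp
  with x show ?thesis by blast
qed

lemma seqC_complete:
  assumes f: "\<And>n. f n \<in> carrier seqC"
    and cauchy: "\<And>\<epsilon>. 0 < \<epsilon> \<Longrightarrow> \<exists>k. \<forall>m\<ge>k. \<forall>n\<ge>k. nrm seqC (f m \<ominus>\<^bsub>seqC\<^esub> f n) < \<epsilon>"
  shows "\<exists>x\<in>carrier seqC. c_nlim seqC f x"
proof -
  have "\<forall>l. \<exists>k. \<forall>m\<ge>k. \<forall>n\<ge>k. nrm seqC (f m \<ominus>\<^bsub>seqC\<^esub> f n) < (1/2) ^ l"
    using cauchy by simp
  then obtain K where K: "\<And>l m n. m \<ge> K l \<Longrightarrow> n \<ge> K l \<Longrightarrow> nrm seqC (f m \<ominus>\<^bsub>seqC\<^esub> f n) < (1/2) ^ l"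
    by metis
  \<comment> \<open>Summing the thresholds makes \<open>k m\<close> at least \<open>K l\<close> for
    all \<open>l \<le> m\<close>, so the subsequence is fast at every index.\<close>
  define k where "k l = (\<Sum>i\<le>l. K i)" for l
  have k_ge: "K l \<le> k m" if "l \<le> m" for l m
    unfolding k_def using that by (intro member_le_sum) auto
  have fa: "asym (f n)" for n using f by simp
  have "\<exists>x. asym x \<and> (\<forall>l. nrm seqC (f (k l) \<ominus>\<^bsub>seqC\<^esub> x) \<le> (1/2) ^ l)"
    by (intro seqC_fast_complete K k_ge order_refl fa)
  then obtain x where x: "asym x" "\<And>l. nrm seqC (f (k l) \<ominus>\<^bsub>seqC\<^esub> x) \<le> (1/2) ^ l" by blast
  have "(\<lambda>n. nrm seqC (f n \<ominus>\<^bsub>seqC\<^esub> x)) \<longlonglongrightarrow> 0"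
  proof (rule LIMSEQ_I)
    fix r :: real assume r: "0 < r"
    then have r2: "0 < r/2" by simp
    obtain l where l: "(1/2::real) ^ l < r/2" using real_arch_pow_inv[OF r2, of "1/2"] by auto
    have "norm (nrm seqC (f n \<ominus>\<^bsub>seqC\<^esub> x) - 0) < r" if "n \<ge> K l" for n
      using C.N_diff_triangle[of "f n" "f (k l)" x] K[OF that k_ge[OF order_refl]] x(1) x(2)[of l] l fa[of n] fa[of "k l"]
        C.nrm_nonneg[of "f n \<ominus>\<^bsub>seqC\<^esub> x"] C.v_minus_cl[of "f n" x]
      by simp
    then show "\<exists>no. \<forall>n\<ge>no. norm (nrm seqC (f n \<ominus>\<^bsub>seqC\<^esub> x) - 0) < r" by blast
  qed
  then show ?thesis using x(1) by (auto simp: nlim_def)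
qed

section \<open>The concrete limit C*-algebra and its canonical maps\<close>

definition limC :: "(nat \<Rightarrow> 'a) set cstar" where
  "limC = quot_cstar seqC"

sublocale L: cstar_algebra limC
  unfolding limC_def by (intro C.cstar_algebra_quot seqC_complete)

definition cls :: "(nat \<Rightarrow> 'a) \<Rightarrow> (nat \<Rightarrow> 'a) set" where
  "cls = coset seqC {x \<in> carrier seqC. nrm seqC x = 0}"

lemmas limC_simps = C.quot_cstar_simps[folded cls_def limC_def, unfolded seqC_simps mem_Collect_eq]

definition can :: "nat \<Rightarrow> 'a \<Rightarrow> (nat \<Rightarrow> 'a) set" where
  "can k a = cls (coh k a)"

lemma cls_eqI:
  assumes "asym f" "asym g" "\<And>n. n \<ge> k \<Longrightarrow> f n = g n"
  shows "cls f = cls g"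
proof -
  have "(\<lambda>n. nrm (A n) (f n \<ominus>\<^bsub>A n\<^esub> g n)) \<longlonglongrightarrow> 0"
    using assms by (intro tendsto_eventually eventually_sequentiallyI[of k]) simp
  then have "nrm seqC (f \<ominus>\<^bsub>seqC\<^esub> g) = 0"
    using nrm_lim[OF asym_diff[OF assms(1,2)]] LIMSEQ_unique by (simp add: seqC_diff assms)
  then show ?thesis unfolding cls_def using assms by (subst C.N.coset_eq) (auto simp: seqC_diff asym_diff)
qed

lemma can_eqI:
  assumes "asym f" "a \<in> carrier (A k)" "\<And>j. f (k + j) = tr \<pi> k j a"
  shows "cls f = can k a"
  unfolding can_def
proof (rule cls_eqI[of _ _ k])
  show "f n = coh k a n" if "n \<ge> k" for n using assms(3)[of "n - k"] that by (simp add: coh_def)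
qed (use assms asym_coh in auto)

lemma can_hom: "cstar_hom (A k) limC (can k)"
proof -
  have mult: "can k (a \<otimes>\<^bsub>A k\<^esub> b) = can k a \<otimes>\<^bsub>limC\<^esub> can k b" if "a \<in> carrier (A k)" "b \<in> carrier (A k)" for a b
    using that can_eqI[OF asym_mult[OF asym_coh asym_coh, of a k b k], of "a \<otimes>\<^bsub>A k\<^esub> b" k]
    by (simp add: T.mult can_def limC_simps asym_coh)
  have add: "can k (a \<oplus>\<^bsub>A k\<^esub> b) = can k a \<oplus>\<^bsub>limC\<^esub> can k b" if "a \<in> carrier (A k)" "b \<in> carrier (A k)" for a b
    using that can_eqI[OF asym_add[OF asym_coh asym_coh, of a k b k], of "a \<oplus>\<^bsub>A k\<^esub> b" k]
    by (simp add: T.add can_def limC_simps asym_coh)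
  have smult: "can k (c \<odot>\<^bsub>A k\<^esub> a) = c \<odot>\<^bsub>limC\<^esub> can k a" if "a \<in> carrier (A k)" for a c
    using that can_eqI[OF asym_smult[OF asym_coh, of a k c], of "c \<odot>\<^bsub>A k\<^esub> a" k]
    by (simp add: T.smult can_def limC_simps asym_coh)
  have invol: "can k (invol (A k) a) = invol limC (can k a)" if "a \<in> carrier (A k)" for a
    using that can_eqI[OF asym_invol[OF asym_coh, of a k], of "invol (A k) a" k]
    by (simp add: T.invol can_def limC_simps asym_coh A.invol_closed)
  have one: "can k \<one>\<^bsub>A k\<^esub> = \<one>\<^bsub>limC\<^esub>"
    using can_eqI[OF asym_one, of "\<one>\<^bsub>A k\<^esub>" k] by (simp add: T.one limC_simps)
  show ?thesis
    unfolding cstar_hom_def ring_hom_def complex_linear_def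
    using mult add smult invol one by (auto simp: can_def limC_simps(1) asym_coh)
qed

lemma can_Suc:
  assumes "a \<in> carrier (A k)"
  shows "can (Suc k) (\<pi> k a) = can k a"
  unfolding can_def
proof (rule cls_eqI)
  have cl: "\<pi> k a \<in> carrier (A (Suc k))" using T.closed[OF assms, of 1] by simp
  then show "asym (coh (Suc k) (\<pi> k a))" by (rule asym_coh)
  fix n assume "n \<ge> Suc k"
  then obtain j where "n = Suc k + j" using le_Suc_ex by blast
  then show "coh (Suc k) (\<pi> k a) n = coh k a n"
    using coh_tr[of "Suc k" "\<pi> k a" j] coh_tr[of k a "Suc 0 + j"] tr_tr[of \<pi> k "Suc 0" j a] by simp
qed (fact asym_coh[OF assms])

text \<open>The norm of the class is by definition the limit of the norms of the images of
  \<open>a\<close>, so some image comes within any error of it.\<close>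

lemma nrm_can_le:
  assumes "a \<in> carrier (A k)" "0 < \<epsilon>"
  shows "\<exists>j. nrm (A (k + j)) (tr \<pi> k j a) \<le> nrm limC (can k a) + \<epsilon>"
proof -
  have "nrm limC (can k a) = nrm seqC (coh k a)"
    using assms asym_coh by (simp add: can_def limC_simps)
  then have "\<forall>\<^sub>F n in sequentially. nrm (A n) (coh k a n) < nrm limC (can k a) + \<epsilon>"
    using order_tendstoD(2)[OF nrm_lim[OF asym_coh[OF assms(1)]], of "nrm limC (can k a) + \<epsilon>"] assms(2) by simp
  then obtain n where "\<And>m. m \<ge> n \<Longrightarrow> nrm (A m) (coh k a m) < nrm limC (can k a) + \<epsilon>"
    by (auto simp: eventually_at_top_linorder)
  from this[of "k + n"] show ?thesis by (auto intro: exI[of _ n])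
qed

end

section \<open>Mediating maps from the concrete limit into cocones of arbitrary type\<close>

locale cstar_cocone = cstar_system A \<pi> + B: cstar_algebra B
  for A :: "nat \<Rightarrow> 'a cstar" and \<pi> :: "nat \<Rightarrow> 'a \<Rightarrow> 'a" and B :: "'b cstar" +
  fixes \<rho> :: "nat \<Rightarrow> 'a \<Rightarrow> 'b"
  assumes \<rho>_hom: "cstar_hom (A k) B (\<rho> k)"
    and \<rho>_compat: "a \<in> carrier (A k) \<Longrightarrow> \<rho> (Suc k) (\<pi> k a) = \<rho> k a"
begin

sublocale R: cstar_morphism "A k" B "\<rho> k" for k
  by (intro cstar_morphismI algs B.cstar_algebra_axioms \<rho>_hom)

lemma \<rho>_tr: "a \<in> carrier (A k) \<Longrightarrow> \<rho> (k + j) (tr \<pi> k j a) = \<rho> k a"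
  using tr_cocone(2)[of "\<lambda>k. carrier (A k)" \<pi> \<rho> a k j] T.closed[of _ _ 1] \<rho>_compat by simp

text \<open>Compatibility sends all images of a shadowing element to the same point of
  \<open>B\<close>, and contractivity keeps the images of the tail close to it; so they form a
  Cauchy sequence.\<close>

lemma asym_image_lim:
  assumes f: "asym f"
  shows "\<exists>b\<in>carrier B. c_nlim B (\<lambda>n. \<rho> n (f n)) b"
proof (rule B.nlim_complete)
  fix \<epsilon> :: real assume "0 < \<epsilon>"
  then obtain k a where a: "a \<in> carrier (A k)"
    "\<And>j. nrm (A (k + j)) (f (k + j) \<ominus>\<^bsub>A (k + j)\<^esub> tr \<pi> k j a) < \<epsilon>/2"
    using asymD[OF f half_gt_zero] by blast
  have close: "nrm B (\<rho> n (f n) \<ominus>\<^bsub>B\<^esub> \<rho> k a) < \<epsilon>/2" if nk: "n \<ge> k" for n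
  proof -
    obtain j where j: "n = k + j" using le_Suc_ex[OF nk] by blast
    have "\<rho> n (f n) \<ominus>\<^bsub>B\<^esub> \<rho> k a = \<rho> n (f n \<ominus>\<^bsub>A n\<^esub> tr \<pi> k j a)"
      unfolding j using f a by (simp add: R.diff \<rho>_tr)
    then show ?thesis
      using R.contractive[of "f n \<ominus>\<^bsub>A n\<^esub> tr \<pi> k j a" n] a(1) a(2)[of j] f by (simp add: j)
  qed
  have "nrm B (\<rho> m (f m) \<ominus>\<^bsub>B\<^esub> \<rho> n (f n)) < \<epsilon>" if "m \<ge> k" "n \<ge> k" for m n
    using B.N_diff_triangle[of "\<rho> m (f m)" "\<rho> k a" "\<rho> n (f n)"] B.N_diff_commute[of "\<rho> k a" "\<rho> n (f n)"]
      close[OF that(1)] close[OF that(2)] f a(1) by simp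
  then show "\<exists>k. \<forall>m\<ge>k. \<forall>n\<ge>k. nrm B (\<rho> m (f m) \<ominus>\<^bsub>B\<^esub> \<rho> n (f n)) < \<epsilon>" by blast
qed (use f in simp)

definition med :: "(nat \<Rightarrow> 'a) set \<Rightarrow> 'b" where
  "med u = (SOME b. b \<in> carrier B \<and>
     c_nlim B (\<lambda>n. \<rho> n (rep seqC {x \<in> carrier seqC. nrm seqC x = 0} u n)) b)"

text \<open>Two representatives differ by a null sequence, and contractive maps send null sequences
  to null sequences; hence the limit in \<open>B\<close> depends only on the class.\<close>

lemma med_cls:
  assumes f: "asym f"
  shows "med (cls f) \<in> carrier B" "c_nlim B (\<lambda>n. \<rho> n (f n)) (med (cls f))"
proof -
  define g where "g = rep seqC {x \<in> carrier seqC. nrm seqC x = 0} (cls f)"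
  have g: "asym g" "nrm seqC (g \<ominus>\<^bsub>seqC\<^esub> f) = 0" using C.N.rep_coset[of f] f by (auto simp: cls_def g_def)
  have m: "med (cls f) \<in> carrier B \<and> c_nlim B (\<lambda>n. \<rho> n (g n)) (med (cls f))"
    unfolding med_def g_def[symmetric] by (rule someI_ex) (use asym_image_lim[OF g(1)] in blast)
  then show "med (cls f) \<in> carrier B" by blast
  have le: "nrm B (\<rho> n (f n) \<ominus>\<^bsub>B\<^esub> \<rho> n (g n)) \<le> nrm (A n) (g n \<ominus>\<^bsub>A n\<^esub> f n)" for n
    using R.contractive[of "f n \<ominus>\<^bsub>A n\<^esub> g n" n] A.N_diff_commute[of "f n" n "g n"] f g by (simp add: R.diff)
  have "(\<lambda>n. nrm (A n) (g n \<ominus>\<^bsub>A n\<^esub> f n)) \<longlonglongrightarrow> 0"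
    using nrm_lim[OF asym_diff[OF g(1) f]] g f by (simp add: seqC_diff)
  then have "(\<lambda>n. nrm B (\<rho> n (f n) \<ominus>\<^bsub>B\<^esub> \<rho> n (g n))) \<longlonglongrightarrow> 0"
    by (rule tendsto_0_le[of _ _ _ 1]) (use le f g in \<open>simp add: B.nrm_nonneg A.nrm_nonneg\<close>)
  then show "c_nlim B (\<lambda>n. \<rho> n (f n)) (med (cls f))"
    using m f g(1) by (intro B.nlim_transfer[of "\<lambda>n. \<rho> n (g n)" "\<lambda>n. \<rho> n (f n)"] R.closed asym_cl) simp_all
qed

lemma med_eqI:
  assumes "asym f" "b \<in> carrier B" "c_nlim B (\<lambda>n. \<rho> n (f n)) b"
  shows "med (cls f) = b"
  using assms med_cls[OF assms(1)] B.nlim_unique[of "\<lambda>n. \<rho> n (f n)"] by simp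

lemma med_can:
  assumes "a \<in> carrier (A k)"
  shows "med (can k a) = \<rho> k a"
  unfolding can_def
proof (rule med_eqI[OF asym_coh[OF assms]])
  have "\<rho> n (coh k a n) = \<rho> k a" if "n \<ge> k" for n
    using \<rho>_tr[OF assms, of "n - k"] that by (simp add: coh_def)
  then show "c_nlim B (\<lambda>n. \<rho> n (coh k a n)) (\<rho> k a)"
    using assms by (intro B.nlim_eventually_cong[OF B.nlim_const]) auto
qed (use assms in simp)

lemma med_hom: "cstar_hom limC B med"
proof -
  have mult: "med (u \<otimes>\<^bsub>limC\<^esub> v) = med u \<otimes>\<^bsub>B\<^esub> med v" if "u \<in> carrier limC" "v \<in> carrier limC" for u v
    using that by (auto simp: limC_simps R.mult med_cls intro!: med_eqI asym_mult B.nlim_mult)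
  have add: "med (u \<oplus>\<^bsub>limC\<^esub> v) = med u \<oplus>\<^bsub>B\<^esub> med v" if "u \<in> carrier limC" "v \<in> carrier limC" for u v
    using that by (auto simp: limC_simps R.add med_cls intro!: med_eqI asym_add B.nlim_add)
  have smult: "med (c \<odot>\<^bsub>limC\<^esub> u) = c \<odot>\<^bsub>B\<^esub> med u" if "u \<in> carrier limC" for u c
    using that by (auto simp: limC_simps R.smult med_cls intro!: med_eqI asym_smult B.nlim_smult)
  have invol: "med (invol limC u) = invol B (med u)" if "u \<in> carrier limC" for u
    using that by (auto simp: limC_simps R.invol med_cls B.invol_closed intro!: med_eqI asym_invol B.nlim_invol)
  have one: "med \<one>\<^bsub>limC\<^esub> = \<one>\<^bsub>B\<^esub>"
    by (auto simp: limC_simps R.one intro!: med_eqI asym_one B.nlim_const)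
  show ?thesis
    unfolding cstar_hom_def ring_hom_def complex_linear_def
    using mult add smult invol one med_cls by (auto simp: limC_simps(1))
qed

end

text \<open>The given limit \<open>L\<close> is a retract of the concrete one: \<open>lim2\<close>
  provides \<mu> into \<open>limC\<close>, and \<open>lim1\<close> shows that mapping back after
  \<mu> is the identity. Density then comes from representing sequences, the norm bound from
  contractivity of \<mu>, and factorisation through \<open>B\<close> of any type by composing \<mu>
  with the concrete mediating map.\<close>

lemma cstar_inductive_limitD:
  fixes L :: "'w cstar" and A :: "nat \<Rightarrow> 'a cstar"
  assumes sys: "cstar_system A \<pi>"
    and lim1: "cstar_inductive_limit TYPE('w) A \<pi> L \<pi>i"
    and lim2: "cstar_inductive_limit TYPE((nat \<Rightarrow> 'a) set) A \<pi> L \<pi>i"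
  shows cstar_limit_dense: "x \<in> carrier L \<Longrightarrow>
      \<exists>f. (\<forall>n. f n \<in> carrier (A n)) \<and> c_nlim L (\<lambda>n. \<pi>i n (f n)) x"
    and cstar_limit_norm: "\<lbrakk>a \<in> carrier (A k); 0 < \<epsilon>\<rbrakk> \<Longrightarrow>
      \<exists>j. nrm (A (k + j)) (tr \<pi> k j a) \<le> nrm L (\<pi>i k a) + \<epsilon>"
    and cstar_limit_factor: "\<lbrakk>cstar_algebra B; \<And>k. cstar_hom (A k) B (\<rho> k);
        \<And>k a. a \<in> carrier (A k) \<Longrightarrow> \<rho> (Suc k) (\<pi> k a) = \<rho> k a\<rbrakk> \<Longrightarrow>
      \<exists>\<nu>. cstar_hom L B \<nu> \<and> (\<forall>k. \<forall>a\<in>carrier (A k). \<nu> (\<pi>i k a) = \<rho> k a)"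
proof -
  interpret cstar_system A \<pi> by (rule sys)
  note l1 = lim1[unfolded cstar_inductive_limit_def] and l2 = lim2[unfolded cstar_inductive_limit_def]
  have L: "cstar_algebra L" by (rule l1[THEN conjunct1])
  have hom: "cstar_hom (A k) L (\<pi>i k)" for k
    by (rule l1[THEN conjunct2, THEN conjunct1, THEN spec])
  have compat: "\<pi>i (Suc k) (\<pi> k a) = \<pi>i k a" if "a \<in> carrier (A k)" for k a
    using that by (rule l1[THEN conjunct2, THEN conjunct2, THEN conjunct1, THEN spec, THEN bspec])
  interpret i: cstar_cocone A \<pi> L \<pi>i
    by (intro cstar_cocone.intro cstar_cocone_axioms.intro sys L hom compat)
  have cone: "cstar_algebra limC \<and> (\<forall>k. cstar_hom (A k) limC (can k)) \<and>
      (\<forall>k. \<forall>a\<in>carrier (A k). can (Suc k) (\<pi> k a) = can k a)"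
    by (intro conjI allI ballI L.cstar_algebra_axioms can_hom can_Suc)
  obtain \<mu> where m: "cstar_hom L limC \<mu> \<and> (\<forall>k. \<forall>a\<in>carrier (A k). \<mu> (\<pi>i k a) = can k a) \<and>
      (\<forall>\<mu>'. cstar_hom L limC \<mu>' \<and> (\<forall>k. \<forall>a\<in>carrier (A k). \<mu>' (\<pi>i k a) = can k a) \<longrightarrow>
        (\<forall>x\<in>carrier L. \<mu>' x = \<mu> x))"
    by (rule exE[OF l2[THEN conjunct2, THEN conjunct2, THEN conjunct2, THEN spec, THEN spec, THEN mp, OF cone]])
  have \<mu>: "cstar_hom L limC \<mu>" by (rule m[THEN conjunct1])
  have \<mu>_can: "\<mu> (\<pi>i k a) = can k a" if "a \<in> carrier (A k)" for k a
    using that by (rule m[THEN conjunct2, THEN conjunct1, THEN spec, THEN bspec])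
  interpret \<mu>: cstar_morphism L limC \<mu>
    using L L.cstar_algebra_axioms \<mu> by (rule cstar_morphismI)
  \<comment> \<open>The composite and the identity both mediate the cocone of \<open>L\<close> over
    itself, so uniqueness makes them equal.\<close>
  have id: "i.med (\<mu> x) = x" if x: "x \<in> carrier L" for x
  proof -
    have *: "cstar_hom L L (\<lambda>x. x) \<and> (\<forall>k. \<forall>a\<in>carrier (A k). \<pi>i k a = \<pi>i k a)"
      "cstar_hom L L (\<lambda>x. i.med (\<mu> x)) \<and> (\<forall>k. \<forall>a\<in>carrier (A k). i.med (\<mu> (\<pi>i k a)) = \<pi>i k a)"
      using cstar_hom_id[OF L] cstar_hom_comp[OF \<mu> i.med_hom] by (auto simp: \<mu>_can i.med_can)
    have cone: "cstar_algebra L \<and> (\<forall>k. cstar_hom (A k) L (\<pi>i k)) \<and>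
        (\<forall>k. \<forall>a\<in>carrier (A k). \<pi>i (Suc k) (\<pi> k a) = \<pi>i k a)"
      by (intro conjI allI ballI L hom compat)
    obtain \<mu>0 where u: "cstar_hom L L \<mu>0 \<and> (\<forall>k. \<forall>a\<in>carrier (A k). \<mu>0 (\<pi>i k a) = \<pi>i k a) \<and>
        (\<forall>\<mu>'. cstar_hom L L \<mu>' \<and> (\<forall>k. \<forall>a\<in>carrier (A k). \<mu>' (\<pi>i k a) = \<pi>i k a) \<longrightarrow>
          (\<forall>x\<in>carrier L. \<mu>' x = \<mu>0 x))"
      by (rule exE[OF l1[THEN conjunct2, THEN conjunct2, THEN conjunct2, THEN spec, THEN spec, THEN mp, OF cone]])
    note u = u[THEN conjunct2, THEN conjunct2, THEN spec, THEN mp, THEN bspec]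
    show ?thesis using u[OF *(1) x] u[OF *(2) x] by simp
  qed
  show "\<exists>f. (\<forall>n. f n \<in> carrier (A n)) \<and> c_nlim L (\<lambda>n. \<pi>i n (f n)) x" if x: "x \<in> carrier L"
  proof -
    have "\<mu> x \<in> carrier limC" using x by simp
    then obtain f where f: "asym f" "\<mu> x = cls f" by (auto simp: limC_simps(1))
    then have "c_nlim L (\<lambda>n. \<pi>i n (f n)) x"
      using i.med_cls(2)[OF f(1)] id[OF x] by simp
    then show ?thesis using f(1) by (intro exI[of _ f]) simp
  qed
  show "\<exists>j. nrm (A (k + j)) (tr \<pi> k j a) \<le> nrm L (\<pi>i k a) + \<epsilon>" if a: "a \<in> carrier (A k)" "0 < \<epsilon>"
  proof -
    have "nrm limC (can k a) \<le> nrm L (\<pi>i k a)"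
      using \<mu>.contractive[of "\<pi>i k a"] i.R.closed[OF a(1)] \<mu>_can[OF a(1)] by simp
    moreover obtain j where "nrm (A (k + j)) (tr \<pi> k j a) \<le> nrm limC (can k a) + \<epsilon>"
      using nrm_can_le[OF a] by (rule exE)
    ultimately have "nrm (A (k + j)) (tr \<pi> k j a) \<le> nrm L (\<pi>i k a) + \<epsilon>" by linarith
    then show ?thesis by (rule exI)
  qed
  show "\<exists>\<nu>. cstar_hom L B \<nu> \<and> (\<forall>k. \<forall>a\<in>carrier (A k). \<nu> (\<pi>i k a) = \<rho> k a)"
    if B: "cstar_algebra B" "\<And>k. cstar_hom (A k) B (\<rho> k)"
      "\<And>k a. a \<in> carrier (A k) \<Longrightarrow> \<rho> (Suc k) (\<pi> k a) = \<rho> k a"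
  proof -
    interpret r: cstar_cocone A \<pi> B \<rho>
      by (intro cstar_cocone.intro cstar_cocone_axioms.intro sys B)
    show ?thesis using cstar_hom_comp[OF \<mu> r.med_hom] by (auto simp: \<mu>_can r.med_can)
  qed
qed

section \<open>Matrix cones\<close>

text \<open>Matrices are functions here; only their entries below the size matter.\<close>

definition hermF :: "('a, 'm) star_space_scheme \<Rightarrow> nat \<Rightarrow> (nat \<Rightarrow> nat \<Rightarrow> 'a) \<Rightarrow> bool" where
  "hermF V n F \<longleftrightarrow> (\<forall>i<n. \<forall>j<n. F i j \<in> carrier V \<and> invol V (F i j) = F j i)"

lemma hermFD:
  "hermF V n F \<Longrightarrow> i < n \<Longrightarrow> j < n \<Longrightarrow> F i j \<in> carrier V"
  "hermF V n F \<Longrightarrow> i < n \<Longrightarrow> j < n \<Longrightarrow> invol V (F i j) = F j i"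
  by (simp_all add: hermF_def)

definition scalF :: "(complex, 'a, 'm) module_scheme \<Rightarrow> 'a \<Rightarrow> real \<Rightarrow> nat \<Rightarrow> nat \<Rightarrow> 'a" where
  "scalF V e r i j = (if i = j then complex_of_real r \<odot>\<^bsub>V\<^esub> e else \<zero>\<^bsub>V\<^esub>)"

text \<open>The 2 by 2 matrix with \<open>r e\<close> on the diagonal and \<open>x\<close> and its
  adjoint off it; its positivity is the order-theoretic form of the bound \<open>r\<close> on the
  norm of \<open>x\<close>.\<close>

definition blockF :: "('a, 'm) star_space_scheme \<Rightarrow> 'a \<Rightarrow> real \<Rightarrow> 'a \<Rightarrow> nat \<Rightarrow> nat \<Rightarrow> 'a" where
  "blockF V e r x i j = (if i = j then complex_of_real r \<odot>\<^bsub>V\<^esub> e else if i = 0 then x else invol V x)"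

text \<open>Neither properness nor the Archimedean property is included here. Keeping the unit and
  the cones apart from any record lets the same lemmas serve operator systems, spaces of sequences
  and quotients.\<close>

locale matrix_cone = star_vector_space V for V :: "('a, 'm) star_space_scheme" (structure) +
  fixes e :: 'a and P :: "nat \<Rightarrow> (nat \<Rightarrow> nat \<Rightarrow> 'a) \<Rightarrow> bool"
  assumes P_cong: "\<lbrakk>P n F; \<And>i j. \<lbrakk>i < n; j < n\<rbrakk> \<Longrightarrow> G i j = F i j\<rbrakk> \<Longrightarrow> P n G"
    and P_hermF: "P n F \<Longrightarrow> hermF V n F"
    and P_add: "\<lbrakk>P n F; P n G\<rbrakk> \<Longrightarrow> P n (\<lambda>i j. F i j \<oplus> G i j)"
    and P_compress: "P n F \<Longrightarrow>
      P m (\<lambda>i j. \<Oplus>k\<in>{..<n}. \<Oplus>l\<in>{..<n}. (cnj (\<alpha> k i) * \<alpha> l j) \<odot>\<^bsub>V\<^esub> F k l)"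
    and e_cl: "e \<in> carrier V" and e_herm: "invol V e = e"
    and P_order: "hermF V n F \<Longrightarrow> \<exists>r>0. P n (\<lambda>i j. scalF V e r i j \<ominus> F i j)"
begin

abbreviation "E \<equiv> scalF V e"
abbreviation "bnd r x \<equiv> P 2 (blockF V e r x)"

lemmas P_cl = hermFD(1)[OF P_hermF] and P_herm = hermFD(2)[OF P_hermF]

lemma E_cl [simp]: "E r i j \<in> carrier V"
  using e_cl by (simp add: scalF_def)

lemma E_add: "E (r + s) i j = E r i j \<oplus> E s i j"
  using e_cl by (simp add: scalF_def smult_plus)

lemma E_scale: "complex_of_real r \<odot>\<^bsub>V\<^esub> E s i j = E (r * s) i j"
  using e_cl by (simp add: scalF_def smult_smult)

lemma hermF_E: "hermF V n (E r)"
  using e_cl e_herm by (simp add: hermF_def scalF_def invol_smult)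

text \<open>Compression by a matrix whose column \<open>i\<close> has the single entry
  \<open>c i\<close>, in row \<open>p i\<close>. It covers rescaling, sign changes, permutations,
  submatrices and repeated rows.\<close>

lemma P_select:
  assumes P: "P n F" and p: "\<And>i. i < m \<Longrightarrow> p i < n"
  shows "P m (\<lambda>i j. (cnj (c i) * c j) \<odot>\<^bsub>V\<^esub> F (p i) (p j))"
proof (rule P_cong[OF P_compress[OF P, where \<alpha> = "\<lambda>k i. if k = p i then c i else 0"]])
  fix i j assume ij: "i < m" "j < m"
  let ?\<alpha> = "\<lambda>k i. if k = p i then c i else (0::complex)"
  have inner: "(\<Oplus>l\<in>{..<n}. (cnj (?\<alpha> k i) * ?\<alpha> l j) \<odot>\<^bsub>V\<^esub> F k l) =
      (if p i = k then (cnj (c i) * c j) \<odot>\<^bsub>V\<^esub> F k (p j) else \<zero>)" (is "?L = ?R") if k: "k < n" for k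
  proof -
    have "?L = (\<Oplus>l\<in>{..<n}. if p j = l then (cnj (?\<alpha> k i) * c j) \<odot>\<^bsub>V\<^esub> F k l else \<zero>)"
      using P_cl[OF P] k by (intro v_finsum_cong') auto
    also have "\<dots> = (cnj (?\<alpha> k i) * c j) \<odot>\<^bsub>V\<^esub> F k (p j)"
      using P_cl[OF P] k p[OF ij(2)] by (intro v_finsum_singleton) auto
    also have "\<dots> = ?R" using P_cl[OF P k p[OF ij(2)]] by auto
    finally show ?thesis .
  qed
  have "(\<Oplus>k\<in>{..<n}. \<Oplus>l\<in>{..<n}. (cnj (?\<alpha> k i) * ?\<alpha> l j) \<odot>\<^bsub>V\<^esub> F k l) =
      (\<Oplus>k\<in>{..<n}. if p i = k then (cnj (c i) * c j) \<odot>\<^bsub>V\<^esub> F k (p j) else \<zero>)"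
    using P_cl[OF P] p[OF ij(2)] by (intro v_finsum_cong' inner) auto
  also have "\<dots> = (cnj (c i) * c j) \<odot>\<^bsub>V\<^esub> F (p i) (p j)"
    using P_cl[OF P] p ij by (intro v_finsum_singleton) auto
  finally show "(cnj (c i) * c j) \<odot>\<^bsub>V\<^esub> F (p i) (p j) =
      (\<Oplus>k\<in>{..<n}. \<Oplus>l\<in>{..<n}. (cnj (?\<alpha> k i) * ?\<alpha> l j) \<odot>\<^bsub>V\<^esub> F k l)" by simp
qed

lemma P_scale:
  assumes P: "P n F" and r: "0 \<le> r"
  shows "P n (\<lambda>i j. complex_of_real r \<odot>\<^bsub>V\<^esub> F i j)"
proof (rule P_cong[OF P_select[OF P, of n "\<lambda>i. i" "\<lambda>_. complex_of_real (sqrt r)"]])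
  show "complex_of_real r \<odot>\<^bsub>V\<^esub> F i j =
      (cnj (complex_of_real (sqrt r)) * complex_of_real (sqrt r)) \<odot>\<^bsub>V\<^esub> F i j" for i j
    using r by (simp flip: of_real_mult)
qed

text \<open>Positivity of the unit comes from the order unit property of the zero matrix, which
  makes some \<open>r\<close> times the unit matrix positive. Selection with the factors
  \<open>sqrt (d i / r)\<close> then adjusts the diagonal.\<close>

lemma P_diag:
  assumes d: "\<And>i. i < n \<Longrightarrow> 0 \<le> d i"
  shows "P n (\<lambda>i j. if i = j then complex_of_real (d i) \<odot>\<^bsub>V\<^esub> e else \<zero>)"
proof -
  obtain r where r: "r > 0" "P n (\<lambda>i j. E r i j \<ominus> \<zero>)"
    using P_order[of n "\<lambda>_ _. \<zero>"] by (auto simp: hermF_def)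
  show ?thesis
  proof (rule P_cong[OF P_select[OF r(2), of n "\<lambda>i. i" "\<lambda>i. complex_of_real (sqrt (d i / r))"]])
    fix i j assume "i < n" "j < n"
    let ?s = "complex_of_real (sqrt (d i / r))"
    have "sqrt (d i / r) * sqrt (d i / r) * r = d i" using d[OF \<open>i < n\<close>] r(1) by simp
    then have "cnj ?s * ?s * complex_of_real r = complex_of_real (d i)"
      by (simp only: complex_cnj_complex_of_real flip: of_real_mult)
    then show "(if i = j then complex_of_real (d i) \<odot>\<^bsub>V\<^esub> e else \<zero>) =
      (cnj ?s * complex_of_real (sqrt (d j / r))) \<odot>\<^bsub>V\<^esub> (E r i j \<ominus> \<zero>)"
      using e_cl by (cases "i = j") (simp_all only: scalF_def smult_smult diff_zero smult_cl if_True if_False smult_zero v_zero_cl simp_thms)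
  qed simp
qed

lemma P_E: "0 \<le> r \<Longrightarrow> P n (E r)"
  using P_diag[of n "\<lambda>_. r"] by (simp add: scalF_def[abs_def])

lemma P_zero: "P n (\<lambda>_ _. \<zero>)"
  by (rule P_cong[OF P_E[of 0]]) (use e_cl in \<open>simp_all add: scalF_def\<close>)

lemma blockF_simps [simp]:
  "blockF V e r x i i = complex_of_real r \<odot>\<^bsub>V\<^esub> e" "blockF V e r x 0 (Suc 0) = x" "blockF V e r x (Suc 0) 0 = invol V x"
  "blockF V e r x 0 1 = x" "blockF V e r x 1 0 = invol V x"
  by (simp_all add: blockF_def)

lemma less_2: "(i::nat) < 2 \<longleftrightarrow> i = 0 \<or> i = 1"
  by auto

lemma bnd_cl: "bnd r x \<Longrightarrow> x \<in> carrier V"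
  using P_cl[of 2 "blockF V e r x" 0 1] by simp

text \<open>The remaining entry is the adjoint of \<open>x\<close> because positive matrices are
  hermitian.\<close>

lemma bndI:
  assumes "P 2 F" "F 0 0 = complex_of_real r \<odot>\<^bsub>V\<^esub> e" "F 1 1 = complex_of_real r \<odot>\<^bsub>V\<^esub> e" "F 0 1 = x"
  shows "bnd r x"
  by (rule P_cong[OF assms(1)]) (use assms P_herm[OF assms(1), of 0 1] in \<open>auto simp: less_2\<close>)

lemma bnd_mono:
  assumes x: "bnd r x" and "r \<le> s" shows "bnd s x"
  by (rule bndI[OF P_add[OF x P_E[of "s - r"]]])
    (use assms bnd_cl[OF x] e_cl in \<open>simp_all add: scalF_def flip: smult_plus of_real_add\<close>)

lemma bnd_exists: assumes x: "x \<in> carrier V" shows "\<exists>r>0. bnd r x"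
proof -
  have "hermF V 2 (blockF V e 0 x)"
    using x e_cl by (auto simp: hermF_def less_2 invol_closed invol_invol)
  then obtain r where r: "r > 0" "P 2 (\<lambda>i j. E r i j \<ominus> blockF V e 0 x i j)" using P_order by blast
  \<comment> \<open>The order unit bounds the matrix with \<open>x\<close> off the diagonal, which
    yields \<open>-x\<close> in the block; flipping the sign of the second coordinate restores
    \<open>x\<close>.\<close>
  have "bnd r x"
    by (rule bndI[OF P_select[OF r(2), of 2 "\<lambda>i. i" "\<lambda>i. if i = 0 then 1 else -1"]])
      (use x e_cl in \<open>simp_all add: scalF_def smult_neg1 v_minus_eq v_minus_minus\<close>)
  with r(1) show ?thesis by blast
qed

lemma bnd_add:
  assumes "bnd r x" "bnd s y" shows "bnd (r + s) (x \<oplus> y)"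
  by (rule bndI[OF P_add[OF assms]]) (use e_cl in \<open>simp_all add: smult_plus\<close>)

lemma bnd_smult:
  assumes x: "bnd r x" shows "bnd (cmod c * r) (c \<odot>\<^bsub>V\<^esub> x)"
proof (cases "c = 0")
  case True
  then show ?thesis using bnd_cl[OF x] e_cl
    by (intro bndI[OF P_zero]) simp_all
next
  case False
  \<comment> \<open>Compressing by the diagonal matrix with entries \<open>s\<close> and
    \<open>c / s\<close>, where \<open>s\<close> is the square root of \<open>cmod c\<close>,
    multiplies both diagonal entries by \<open>cmod c\<close> and the upper right entry by
    \<open>c\<close>.\<close>
  define s where "s = complex_of_real (sqrt (cmod c))"
  have s: "cnj s * s = complex_of_real (cmod c)" "s \<noteq> 0" "cnj s = s" using False
    by (simp_all add: s_def flip: of_real_mult)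
  have cs: "cnj (c / s) * (c / s) = complex_of_real (cmod c)"
  proof -
    have "cnj (c / s) * (c / s) = (c * cnj c) / (cnj s * s)" by (simp add: mult.commute)
    also have "\<dots> = complex_of_real (cmod c)" unfolding s(1) complex_norm_square[symmetric]
      using False by (simp add: power2_eq_square)
    finally show ?thesis .
  qed
  show ?thesis
    by (rule bndI[OF P_select[OF x, of 2 "\<lambda>i. i" "\<lambda>i. if i = 0 then s else c / s"]])
      (use s cs bnd_cl[OF x] e_cl in \<open>simp_all add: smult_smult\<close>)
qed

text \<open>Exchanging the two coordinates, by \<open>1 - i\<close>, exchanges \<open>x\<close> and
  its adjoint.\<close>

lemma bnd_invol: assumes x: "bnd r x" shows "bnd r (invol V x)"
  by (rule bndI[OF P_select[OF x, of 2 "\<lambda>i. 1 - i" "\<lambda>_. 1"]])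
    (use bnd_cl[OF x] e_cl in \<open>simp_all add: invol_closed\<close>)

text \<open>Compressing the block by the column with entries 1, 1 gives twice
  \<open>r e + x\<close>.\<close>

lemma bnd_real:
  assumes x: "bnd r x" and h: "invol V x = x"
  shows "P 1 (\<lambda>i j. E r i j \<oplus> x)"
proof -
  have c: "x \<in> carrier V" by (rule bnd_cl[OF x])
  have two: "{..<2::nat} = {0, 1}" by auto
  have s: "(\<Oplus>k\<in>{..<2}. \<Oplus>l\<in>{..<2}. (cnj 1 * 1) \<odot>\<^bsub>V\<^esub> blockF V e r x k l)
     = (complex_of_real r \<odot>\<^bsub>V\<^esub> e \<oplus> x) \<oplus> (x \<oplus> complex_of_real r \<odot>\<^bsub>V\<^esub> e)"
    using c e_cl h by (simp add: two v_finsum_insert v_finsum_empty)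
  have "P 1 (\<lambda>i j. (complex_of_real r \<odot>\<^bsub>V\<^esub> e \<oplus> x) \<oplus> (x \<oplus> complex_of_real r \<odot>\<^bsub>V\<^esub> e))"
    using P_compress[OF x, of 1 "\<lambda>_ _. 1"] unfolding s .
  from P_scale[OF this, of "1/2"]
  show ?thesis
  proof (rule P_cong)
    fix i j :: nat assume "i < 1" "j < 1"
    have "(complex_of_real r \<odot>\<^bsub>V\<^esub> e \<oplus> x) \<oplus> (x \<oplus> complex_of_real r \<odot>\<^bsub>V\<^esub> e) = 2 \<odot>\<^bsub>V\<^esub> (complex_of_real r \<odot>\<^bsub>V\<^esub> e \<oplus> x)"
      using c e_cl by (simp add: smult_2 v_ac)
    then show "E r i j \<oplus> x = complex_of_real (1/2) \<odot>\<^bsub>V\<^esub> ((complex_of_real r \<odot>\<^bsub>V\<^esub> e \<oplus> x) \<oplus> (x \<oplus> complex_of_real r \<odot>\<^bsub>V\<^esub> e))"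
      using c e_cl \<open>i < 1\<close> \<open>j < 1\<close> by (simp add: smult_smult scalF_def)
  qed simp
qed

end

context matrix_cone
begin

text \<open>The contribution of a pair of mirrored entries becomes positive after adding
  \<open>r\<close> on the diagonal. On the diagonal this is \<open>bnd_real\<close>; off it, the 2
  by 2 block is spread to rows \<open>i\<close> and \<open>j\<close>, and the other diagonal places
  are filled by \<open>P_diag\<close>.\<close>

lemma P_pair:
  assumes h: "hermF V n Z" and r: "0 \<le> r" and ij: "i \<le> j" "j < n" and b: "bnd r (Z i j)"
  shows "P n (\<lambda>a b. (if (a, b) = (i, j) \<or> (b, a) = (i, j) then Z a b else \<zero>) \<oplus> E r a b)"
proof (cases "i = j")
  case True
  have Z: "Z i i \<in> carrier V" "invol V (Z i i) = Z i i" using h ij hermFD[OF h, of i i] by auto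
  have "P 1 (\<lambda>a b. E r a b \<oplus> Z i i)" using b Z True by (intro bnd_real) auto
  from P_add[OF P_select[OF this, of n "\<lambda>_. 0" "\<lambda>a. if a = i then 1 else 0"]
      P_diag[of n "\<lambda>a. if a = i then 0 else r"]] r
  have "P n (\<lambda>a b. (cnj (if a = i then 1 else 0) * (if b = i then 1 else 0)) \<odot>\<^bsub>V\<^esub> (E r 0 0 \<oplus> Z i i)
      \<oplus> (if a = b then complex_of_real (if a = i then 0 else r) \<odot>\<^bsub>V\<^esub> e else \<zero>))" by simp
  then show ?thesis
    by (rule P_cong) (use True Z e_cl in \<open>auto simp: scalF_def v_ac\<close>)
next
  case False
  have Z: "Z i j \<in> carrier V" "invol V (Z i j) = Z j i" using hermFD[OF h, of i j] ij by auto
  from P_add[OF P_select[OF b, of n "\<lambda>a. if a = j then 1 else 0" "\<lambda>a. if a = i \<or> a = j then 1 else 0"]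
      P_diag[of n "\<lambda>a. if a = i \<or> a = j then 0 else r"]] r
  have "P n (\<lambda>a b. (cnj (if a = i \<or> a = j then 1 else 0) * (if b = i \<or> b = j then 1 else 0)) \<odot>\<^bsub>V\<^esub>
        blockF V e r (Z i j) (if a = j then 1 else 0) (if b = j then 1 else 0)
      \<oplus> (if a = b then complex_of_real (if a = i \<or> a = j then 0 else r) \<odot>\<^bsub>V\<^esub> e else \<zero>))" by simp
  then show ?thesis
    by (rule P_cong) (use False Z hermFD(1)[OF h ij(2), of i] ij e_cl in \<open>auto simp: scalF_def\<close>)
qed

lemma if_disj_add:
  assumes "\<not> (p \<and> q)" "z \<in> carrier V" "x \<in> carrier V" "y \<in> carrier V"
  shows "(if p \<or> q then z else \<zero>) \<oplus> (x \<oplus> y) = ((if p then z else \<zero>) \<oplus> x) \<oplus> ((if q then z else \<zero>) \<oplus> y)"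
  using assms by (cases p; cases q) (auto simp: v_ac)

text \<open>The matrix is the sum of its contributions for the pairs \<open>i \<le> j\<close>. Each
  costs \<open>r\<close> times the unit and there are at most \<open>n * n\<close> pairs.\<close>

lemma P_small_entries:
  assumes h: "hermF V n Z" and r: "0 \<le> r" and b: "\<And>i j. \<lbrakk>i < n; j < n\<rbrakk> \<Longrightarrow> bnd r (Z i j)"
  shows "P n (\<lambda>i j. Z i j \<oplus> E (real (n * n) * r) i j)"
proof -
  have ind: "P n (\<lambda>a b. (if (a, b) \<in> I \<or> (b, a) \<in> I then Z a b else \<zero>) \<oplus> E (real (card I) * r) a b)"
    if "finite I" "I \<subseteq> {(i, j). i \<le> j \<and> j < n}" for I
    using that
  proof (induction I rule: finite_induct)
    case empty
    then show ?case by (intro P_cong[OF P_zero]) (use e_cl in \<open>auto simp: scalF_def\<close>)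
  next
    case (insert x I)
    obtain i j where x: "x = (i, j)" by (cases x)
    then have ij: "i \<le> j" "j < n" using insert by auto
    have "P n (\<lambda>a b. (if (a, b) = (i, j) \<or> (b, a) = (i, j) then Z a b else \<zero>) \<oplus> E r a b)"
      using ij by (intro P_pair[OF h r ij] b) auto
    from P_add[OF insert.IH this]
    show ?case
    proof (rule P_cong)
      fix a b assume ab: "a < n" "b < n"
      have Z: "Z a b \<in> carrier V" using h ab by (rule hermFD)
      let ?p = "(a, b) \<in> I \<or> (b, a) \<in> I" and ?q = "(a, b) = (i, j) \<or> (b, a) = (i, j)"
      have A: "\<not> (?p \<and> ?q)"
        using insert.hyps(2) insert.prems ij unfolding x by auto
      have B: "E (real (card (insert x I)) * r) a b = E (real (card I) * r) a b \<oplus> E r a b"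
        using insert.hyps by (simp add: algebra_simps flip: E_add)
      have C: "(a, b) \<in> insert x I \<or> (b, a) \<in> insert x I \<longleftrightarrow> ?p \<or> ?q"
        unfolding x by auto
      show "(if (a, b) \<in> insert x I \<or> (b, a) \<in> insert x I then Z a b else \<zero>) \<oplus> E (real (card (insert x I)) * r) a b =
        ((if ?p then Z a b else \<zero>) \<oplus> E (real (card I) * r) a b) \<oplus> ((if ?q then Z a b else \<zero>) \<oplus> E r a b)"
        unfolding B C by (rule if_disj_add[OF A Z E_cl E_cl])
    qed (use insert in auto)
  qed
  let ?I = "{(i, j). i \<le> j \<and> j < n}"
  have sub: "?I \<subseteq> {..<n} \<times> {..<n}" by auto
  have fin: "finite ?I" by (rule finite_subset[OF sub]) simp
  have card: "card ?I \<le> n * n" using card_mono[OF _ sub] by simp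
  have "0 \<le> real (n * n - card ?I) * r" using r by simp
  from P_add[OF ind[OF fin order_refl] P_E[OF this]]
  show ?thesis
  proof (rule P_cong)
    fix a b assume ab: "a < n" "b < n"
    have "real (n * n) * r = real (card ?I) * r + real (n * n - card ?I) * r"
      using card by (simp add: of_nat_diff algebra_simps)
    then have "E (real (n * n) * r) a b = E (real (card ?I) * r) a b \<oplus> E (real (n * n - card ?I) * r) a b"
      by (metis E_add)
    moreover have "(a, b) \<in> ?I \<or> (b, a) \<in> ?I" using ab by auto
    ultimately show "Z a b \<oplus> E (real (n * n) * r) a b =
      (if (a, b) \<in> ?I \<or> (b, a) \<in> ?I then Z a b else \<zero>) \<oplus> E (real (card ?I) * r) a b \<oplus> E (real (n * n - card ?I) * r) a b"
      using hermFD(1)[OF h ab] by (simp add: v_ac)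
  qed
qed

end

section \<open>Archimedean cones: the order norm and closedness of the cones\<close>

locale arch_cone = matrix_cone V e P
  for V :: "('a, 'm) star_space_scheme" (structure) and e :: 'a and P :: "nat \<Rightarrow> (nat \<Rightarrow> nat \<Rightarrow> 'a) \<Rightarrow> bool" +
  assumes P_arch: "\<lbrakk>hermF V n F; \<And>r. 0 < r \<Longrightarrow> P n (\<lambda>i j. F i j \<oplus> scalF V e r i j)\<rbrakk> \<Longrightarrow> P n F"
begin

definition nr :: "'a \<Rightarrow> real" where
  "nr x = Inf {r. 0 \<le> r \<and> bnd r x}"

text \<open>The Archimedean property makes the infimum attained, so norm bounds and positivity of
  blocks are interchangeable.\<close>

lemma nr_le_iff:
  assumes x: "x \<in> carrier V" and r: "0 \<le> r"
  shows "nr x \<le> r \<longleftrightarrow> bnd r x"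
proof
  assume "bnd r x"
  then show "nr x \<le> r" unfolding nr_def using r by (intro cInf_lower) (auto simp: bdd_below_def)
next
  assume le: "nr x \<le> r"
  have ne: "{r. 0 \<le> r \<and> bnd r x} \<noteq> {}" using bnd_exists[OF x] less_imp_le by blast
  have *: "bnd s x" if s: "r < s" for s
  proof -
    have "Inf {r. 0 \<le> r \<and> bnd r x} < s" using le s by (simp add: nr_def)
    from cInf_lessD[OF ne this] show ?thesis using bnd_mono[of _ x s] by auto
  qed
  show "bnd r x"
  proof (rule P_arch)
    show "hermF V 2 (blockF V e r x)" using P_hermF[OF *[of "r + 1"]] e_cl e_herm
      by (auto simp: hermF_def less_2 invol_smult)
    show "P 2 (\<lambda>i j. blockF V e r x i j \<oplus> E s i j)" if "0 < s" for s
      by (rule P_cong[OF *[of "r + s"]])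
        (use that x e_cl in \<open>auto simp: less_2 scalF_def smult_plus invol_closed\<close>)
  qed
qed

lemma nr_nonneg: assumes x: "x \<in> carrier V" shows "0 \<le> nr x"
proof -
  have ne: "{r. 0 \<le> r \<and> bnd r x} \<noteq> {}" using bnd_exists[OF x] less_imp_le by blast
  then show ?thesis unfolding nr_def by (intro cInf_greatest) auto
qed

lemma bnd_nr: "x \<in> carrier V \<Longrightarrow> bnd (nr x) x"
  using nr_le_iff[of x "nr x"] nr_nonneg[of x] by simp

lemma nr_smult_le: assumes x: "x \<in> carrier V" shows "nr (c \<odot>\<^bsub>V\<^esub> x) \<le> cmod c * nr x"
  using bnd_smult[OF bnd_nr[OF x], of c] x nr_nonneg[OF x] by (subst nr_le_iff) auto

sublocale seminormed_star V nr
proof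
  fix x y c assume x: "x \<in> carrier V"
  show "0 \<le> nr x" by (rule nr_nonneg[OF x])
  show "nr (x \<oplus> y) \<le> nr x + nr y" if y: "y \<in> carrier V"
    using bnd_add[OF bnd_nr[OF x] bnd_nr[OF y]] x y nr_nonneg by (subst nr_le_iff) auto
  show "nr (c \<odot>\<^bsub>V\<^esub> x) = cmod c * nr x"
  proof (cases "c = 0")
    case True
    then show ?thesis using nr_smult_le[OF x, of 0] nr_nonneg[of \<zero>] x by simp
  next
    case False
    have "nr x \<le> cmod (1 / c) * nr (c \<odot>\<^bsub>V\<^esub> x)"
      using nr_smult_le[of "c \<odot>\<^bsub>V\<^esub> x" "1 / c"] x False by (simp add: smult_smult)
    then have "cmod c * nr x \<le> nr (c \<odot>\<^bsub>V\<^esub> x)"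
      using False by (simp add: norm_divide field_simps)
    with nr_smult_le[OF x] show ?thesis by (rule order_antisym)
  qed
  have le: "nr (invol V z) \<le> nr z" if "z \<in> carrier V" for z
    using bnd_invol[OF bnd_nr[OF that]] that nr_nonneg[OF that] by (subst nr_le_iff) (auto simp: invol_closed)
  show "nr (invol V x) = nr x"
    using le[OF x] le[of "invol V x"] x by (simp add: invol_closed invol_invol)
qed

lemma hermF_diff: "\<lbrakk>hermF V n F; hermF V n G\<rbrakk> \<Longrightarrow> hermF V n (\<lambda>i j. F i j \<ominus> G i j)"
  by (simp add: hermF_def invol_diff)

text \<open>Write \<open>G\<close> as \<open>F\<close> plus a hermitian matrix with small entries,
  and absorb the latter by \<open>P_small_entries\<close>.\<close>

lemma P_near:
  assumes F: "P n F" and G: "hermF V n G" and r: "0 \<le> r"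
    and near: "\<And>i j. \<lbrakk>i < n; j < n\<rbrakk> \<Longrightarrow> nr (G i j \<ominus> F i j) \<le> r"
  shows "P n (\<lambda>i j. G i j \<oplus> E (real (n * n) * r) i j)"
proof -
  have h: "hermF V n (\<lambda>i j. G i j \<ominus> F i j)" using G P_hermF[OF F] by (rule hermF_diff)
  have "P n (\<lambda>i j. (G i j \<ominus> F i j) \<oplus> E (real (n * n) * r) i j)"
    using near hermFD(1)[OF h] by (intro P_small_entries h r) (simp flip: nr_le_iff[OF _ r])
  from P_add[OF F this] show ?thesis
  proof (rule P_cong)
    fix i j assume "i < n" "j < n"
    then have "F i j \<in> carrier V" "G i j \<in> carrier V" using P_cl[OF F] hermFD(1)[OF G] by auto
    then show "G i j \<oplus> E (real (n * n) * r) i j = F i j \<oplus> ((G i j \<ominus> F i j) \<oplus> E (real (n * n) * r) i j)"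
      using diff_add_cancel[of "G i j" "F i j"] v_ac(2)[of "F i j" "G i j \<ominus> F i j"]
      by (simp flip: v_ac(1))
  qed
qed

text \<open>Up to any multiple \<open>r\<close> of the unit, \<open>G\<close> is positive because it
  lies close to some \<open>F k\<close>; the Archimedean property then removes
  \<open>r\<close>.\<close>

lemma P_limit:
  assumes F: "\<And>k. P n (F k)" and G: "hermF V n G"
    and lim: "\<And>i j. \<lbrakk>i < n; j < n\<rbrakk> \<Longrightarrow> nlim V nr (\<lambda>k. F k i j) (G i j)"
  shows "P n G"
proof (rule P_arch[OF G])
  fix r :: real assume r: "0 < r"
  \<comment> \<open>The summand 1 keeps the divisor positive for matrices of size 0.\<close>
  define c where "c = real (n * n + 1)"
  have c: "0 < c" unfolding c_def of_nat_0_less_iff by simp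
  define \<epsilon> where "\<epsilon> = r / c"
  have \<epsilon>: "0 < \<epsilon>" using r c by (simp add: \<epsilon>_def)
  have "\<forall>\<^sub>F k in sequentially. \<forall>i\<in>{..<n}. \<forall>j\<in>{..<n}. nr (F k i j \<ominus> G i j) < \<epsilon>"
    using order_tendstoD(2)[OF lim[unfolded nlim_def] \<epsilon>] by (intro eventually_ball_finite ballI) auto
  then obtain k where k: "\<And>i j. \<lbrakk>i < n; j < n\<rbrakk> \<Longrightarrow> nr (F k i j \<ominus> G i j) < \<epsilon>"
    by (auto simp: eventually_at_top_linorder)
  have "nr (G i j \<ominus> F k i j) \<le> \<epsilon>" if "i < n" "j < n" for i j
    using k[OF that] N_diff_commute[OF hermFD(1)[OF G that] P_cl[OF F that]] by simp
  then have "P n (\<lambda>i j. G i j \<oplus> E (real (n * n) * \<epsilon>) i j)"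
    using \<epsilon> by (intro P_near[OF F G]) auto
  moreover have "0 \<le> r - real (n * n) * \<epsilon>"
  proof -
    have "real (n * n) * \<epsilon> \<le> c * \<epsilon>" using \<epsilon> by (intro mult_right_mono) (auto simp: c_def)
    also have "\<dots> = r" using c by (simp add: \<epsilon>_def)
    finally show ?thesis by simp
  qed
  ultimately have "P n (\<lambda>i j. (G i j \<oplus> E (real (n * n) * \<epsilon>) i j) \<oplus> E (r - real (n * n) * \<epsilon>) i j)"
    by (rule P_add[OF _ P_E])
  then show "P n (\<lambda>i j. G i j \<oplus> E r i j)"
  proof (rule P_cong)
    fix i j assume "i < n" "j < n"
    then have "G i j \<in> carrier V" using hermFD(1)[OF G] by blast
    moreover have "E r i j = E (real (n * n) * \<epsilon>) i j \<oplus> E (r - real (n * n) * \<epsilon>) i j"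
      by (simp flip: E_add)
    ultimately show "G i j \<oplus> E r i j = (G i j \<oplus> E (real (n * n) * \<epsilon>) i j) \<oplus> E (r - real (n * n) * \<epsilon>) i j"
      by (simp add: v_ac)
  qed
qed

text \<open>Restrict \<open>F\<close> to the rows \<open>i\<close>, \<open>j\<close>, and
  \<open>-F\<close> likewise with the sign of the second row flipped. In the sum the diagonals
  cancel and the off-diagonal entry doubles, so twice \<open>F i j\<close> has the bound 0.\<close>

lemma P_pm_null:
  assumes F: "P n F" and mF: "P n (\<lambda>i j. \<ominus> F i j)" and ij: "i < n" "j < n"
  shows "nr (F i j) = 0"
proof -
  have p: "\<And>a. a < 2 \<Longrightarrow> (if a = 0 then i else j) < n" using ij by auto
  note cl = P_cl[OF F]
  let ?p = "\<lambda>a::nat. if a = 0 then i else j" and ?s = "\<lambda>a::nat. if a = 0 then 1 else (- 1 :: complex)"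
  have "P 2 (\<lambda>a b. (cnj 1 * 1) \<odot>\<^bsub>V\<^esub> F (?p a) (?p b))" by (rule P_select[OF F, of 2 ?p "\<lambda>_. 1"]) (rule p)
  moreover have "P 2 (\<lambda>a b. (cnj (?s a) * ?s b) \<odot>\<^bsub>V\<^esub> \<ominus> F (?p a) (?p b))" by (rule P_select[OF mF, of 2 ?p ?s]) (rule p)
  ultimately have "P 2 (\<lambda>a b. (cnj 1 * 1) \<odot>\<^bsub>V\<^esub> F (?p a) (?p b) \<oplus> (cnj (?s a) * ?s b) \<odot>\<^bsub>V\<^esub> \<ominus> F (?p a) (?p b))"
    by (rule P_add)
  then have "bnd 0 (F i j \<oplus> F i j)"
    by (rule bndI) (use cl ij e_cl in \<open>simp_all add: smult_neg1 v_minus_minus v_r_neg\<close>)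
  then have "nr (F i j \<oplus> F i j) \<le> 0" using cl ij by (subst nr_le_iff) auto
  moreover have "nr (F i j \<oplus> F i j) = 2 * nr (F i j)"
    using cl ij by (simp add: N_smult flip: smult_2)
  ultimately show ?thesis using nr_nonneg[OF cl[OF ij]] by simp
qed

end

section \<open>Operator systems as matrix cones\<close>

definition cone :: "'s opsys \<Rightarrow> nat \<Rightarrow> (nat \<Rightarrow> nat \<Rightarrow> 's) \<Rightarrow> bool" where
  "cone S n F \<longleftrightarrow> mat n n (\<lambda>(i, j). F i j) \<in> pos S n"

lemma mats_mat: "mat n n (\<lambda>(i, j). F i j) \<in> mats S n \<longleftrightarrow> (\<forall>i<n. \<forall>j<n. F i j \<in> carrier S)"
proof -
  have "elements_mat (mat n n (\<lambda>(i, j). F i j)) = {F i j | i j. i < n \<and> j < n}"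
    by (force simp: elements_mat_def)
  then show ?thesis by (auto simp: mats_def)
qed

lemma herm_mat: "mat n n (\<lambda>(i, j). F i j) \<in> herm S n \<longleftrightarrow> hermF S n F"
  unfolding herm_def hermF_def mem_Collect_eq mats_mat
  by (auto simp: mat_invol_def mat_eq_iff)

lemma mat_index: "X \<in> carrier_mat n n \<Longrightarrow> mat n n (\<lambda>(i, j). X $$ (i, j)) = X"
  by (intro eq_matI) auto

lemma mat_fun_eq: "mat n n (\<lambda>(i, j). F i j) = mat n n (\<lambda>(i, j). G i j) \<longleftrightarrow> (\<forall>i<n. \<forall>j<n. F i j = G i j)"
  by (auto simp: mat_eq_iff)

lemma madd_mat: "madd S (mat n n (\<lambda>(i, j). F i j)) (mat n n (\<lambda>(i, j). G i j)) = mat n n (\<lambda>(i, j). F i j \<oplus>\<^bsub>S\<^esub> G i j)"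
  by (intro eq_matI) (auto simp: madd_def)

lemma msub_mat: "msub S (mat n n (\<lambda>(i, j). F i j)) (mat n n (\<lambda>(i, j). G i j)) = mat n n (\<lambda>(i, j). F i j \<ominus>\<^bsub>S\<^esub> G i j)"
  by (intro eq_matI) (auto simp: msub_def)

lemma mscale_mat: "mscale S r (mat n n (\<lambda>(i, j). F i j)) = mat n n (\<lambda>(i, j). complex_of_real r \<odot>\<^bsub>S\<^esub> F i j)"
  by (intro eq_matI) (auto simp: mscale_def)

lemma mzero_mat: "mzero S n = mat n n (\<lambda>(i, j). \<zero>\<^bsub>S\<^esub>)"
  by (intro eq_matI) (auto simp: mzero_def)

lemma compress_mat: "\<alpha> \<in> carrier_mat n m \<Longrightarrow> compress S \<alpha> (mat n n (\<lambda>(i, j). F i j)) = mat m m (\<lambda>(i, j).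
    \<Oplus>\<^bsub>S\<^esub>k\<in>{..<n}. \<Oplus>\<^bsub>S\<^esub>l\<in>{..<n}. (cnj (\<alpha> $$ (k, i)) * \<alpha> $$ (l, j)) \<odot>\<^bsub>S\<^esub> mat n n (\<lambda>(i, j). F i j) $$ (k, l))"
  by (intro eq_matI) (auto simp: compress_def)

lemma map_mat_mat: "map_mat f (mat n n (\<lambda>(i, j). F i j)) = mat n n (\<lambda>(i, j). f (F i j))"
  by (intro eq_matI) auto

lemma mscale_munit:
  assumes "star_vector_space S" "ounit S \<in> carrier S"
  shows "mscale S r (munit S n) = mat n n (\<lambda>(i, j). scalF S (ounit S) r i j)"
  using star_vector_space.smult_zero[OF assms(1)]
  by (intro eq_matI) (auto simp: mscale_def munit_def scalF_def)

text \<open>Properness enters as a separate hypothesis: in an \<open>arch_cone\<close>, a matrix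
  that is positive together with its negative is only known to have entries of seminorm 0.\<close>

lemma operator_systemI:
  fixes S :: "'s opsys"
  assumes arch: "arch_cone S (ounit S) P"
    and proper: "\<And>n F i j. \<lbrakk>P n F; P n (\<lambda>i j. \<ominus>\<^bsub>S\<^esub> F i j); i < n; j < n\<rbrakk> \<Longrightarrow> F i j = \<zero>\<^bsub>S\<^esub>"
    and pos: "\<And>n. pos S n = {X \<in> carrier_mat n n. P n (\<lambda>i j. X $$ (i, j))}"
  shows "operator_system S"
proof -
  interpret arch_cone S "ounit S" P by (rule arch)
  have pos_iff: "mat n n (\<lambda>(i, j). F i j) \<in> pos S n \<longleftrightarrow> P n F" for n F
    using P_cong[of n F "\<lambda>i j. mat n n (\<lambda>(i, j). F i j) $$ (i, j)"]
      P_cong[of n "\<lambda>i j. mat n n (\<lambda>(i, j). F i j) $$ (i, j)" F] by (auto simp: pos)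
  have form: "\<exists>F. X = mat n n (\<lambda>(i, j). F i j)" if "X \<in> carrier_mat n n" for X :: "'s mat" and n
    using mat_index[OF that] by metis
  have form_pos: "\<exists>F. X = mat n n (\<lambda>(i, j). F i j)" if "X \<in> pos S n" for X and n
    using that form by (simp add: pos)
  have form_herm: "\<exists>F. X = mat n n (\<lambda>(i, j). F i j)" if "X \<in> herm S n" for X and n
    using that form by (simp add: herm_def mats_def)
  note unitE = mscale_munit[OF star_vector_space_axioms e_cl]
  show ?thesis
  proof (intro operator_system.intro operator_system_axioms.intro star_vector_space_axioms)
    fix n show "pos S n \<subseteq> herm S n"
    proof
      fix X assume X: "X \<in> pos S n"
      then obtain F where F: "X = mat n n (\<lambda>(i, j). F i j)" using form_pos by blast
      show "X \<in> herm S n" using X P_hermF unfolding F herm_mat pos_iff by blast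
    qed
    show "mzero S n \<in> pos S n" unfolding mzero_mat pos_iff by (rule P_zero)
  next
    fix X Y n assume X: "X \<in> pos S n" and Y: "Y \<in> pos S n"
    then obtain F G where F: "X = mat n n (\<lambda>(i, j). F i j)" "Y = mat n n (\<lambda>(i, j). G i j)"
      using form_pos by blast
    show "madd S X Y \<in> pos S n" using X Y P_add unfolding F madd_mat pos_iff by blast
  next
    fix X n and r :: real assume X: "X \<in> pos S n" and r: "0 \<le> r"
    then obtain F where F: "X = mat n n (\<lambda>(i, j). F i j)" using form_pos by blast
    show "mscale S r X \<in> pos S n" using X P_scale[OF _ r] unfolding F mscale_mat pos_iff by blast
  next
    fix X n assume X: "X \<in> pos S n" and mX: "msub S (mzero S n) X \<in> pos S n"
    then obtain F where F: "X = mat n n (\<lambda>(i, j). F i j)" using form_pos by blast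
    have P: "P n F" using X unfolding F pos_iff .
    have "P n (\<lambda>i j. \<zero>\<^bsub>S\<^esub> \<ominus>\<^bsub>S\<^esub> F i j)" using mX unfolding F mzero_mat msub_mat pos_iff .
    then have "P n (\<lambda>i j. \<ominus>\<^bsub>S\<^esub> F i j)"
      by (rule P_cong) (simp add: P_cl[OF P] v_minus_eq)
    with P have "\<forall>i<n. \<forall>j<n. F i j = \<zero>\<^bsub>S\<^esub>" using proper by blast
    then show "X = mzero S n" unfolding F mzero_mat mat_fun_eq .
  next
    fix X and \<alpha> :: "complex mat" and n m assume X: "X \<in> pos S n" and \<alpha>: "\<alpha> \<in> carrier_mat n m"
    then obtain F where F: "X = mat n n (\<lambda>(i, j). F i j)" using form_pos by blast
    have "P n (\<lambda>i j. mat n n (\<lambda>(i, j). F i j) $$ (i, j))" using X by (simp add: pos F)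
    from P_compress[OF this, of m "\<lambda>k i. \<alpha> $$ (k, i)"]
    show "compress S \<alpha> X \<in> pos S m" unfolding F compress_mat[OF \<alpha>] pos_iff .
  next
    fix X n assume X: "X \<in> herm S n"
    then obtain F where F: "X = mat n n (\<lambda>(i, j). F i j)" using form_herm by blast
    show "\<exists>r>0. msub S (mscale S r (munit S n)) X \<in> pos S n"
      using X P_order unfolding F unitE msub_mat pos_iff herm_mat by blast
  next
    fix X n assume X: "X \<in> herm S n" and *: "\<And>r. 0 < r \<Longrightarrow> madd S (mscale S r (munit S n)) X \<in> pos S n"
    then obtain F where F: "X = mat n n (\<lambda>(i, j). F i j)" using form_herm by blast
    have h: "hermF S n F" using X unfolding F herm_mat .
    have "P n (\<lambda>i j. F i j \<oplus>\<^bsub>S\<^esub> E r i j)" if "0 < r" for r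
      using *[OF that] unfolding F unitE madd_mat pos_iff
      by (rule P_cong) (simp add: hermFD(1)[OF h] v_ac)
    then show "X \<in> pos S n" unfolding F pos_iff by (rule P_arch[OF h])
  qed (fact e_cl e_herm)+
qed

context operator_system
begin

sublocale K: arch_cone S "ounit S" "cone S"
proof
  note unitE = mscale_munit[OF star_vector_space_axioms ounit_closed]
  show "cone S n G" if "cone S n F" "\<And>i j. \<lbrakk>i < n; j < n\<rbrakk> \<Longrightarrow> G i j = F i j" for n F G
    using that mat_fun_eq[of n F G] by (auto simp: cone_def)
  show "hermF S n F" if "cone S n F" for n F
    using subsetD[OF pos_herm that[unfolded cone_def]] unfolding herm_mat .
  show "cone S n (\<lambda>i j. F i j \<oplus> G i j)" if "cone S n F" "cone S n G" for n F G
    using pos_add[OF that[unfolded cone_def]] by (simp add: cone_def madd_mat)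
  show "cone S m (\<lambda>i j. \<Oplus>k\<in>{..<n}. \<Oplus>l\<in>{..<n}. (cnj (\<alpha> k i) * \<alpha> l j) \<odot>\<^bsub>S\<^esub> F k l)"
    if F: "cone S n F" for n F m \<alpha>
  proof -
    have cl: "F k l \<in> carrier S" if "k < n" "l < n" for k l
      using subsetD[OF pos_herm F[unfolded cone_def]] that unfolding herm_mat by (rule hermFD)
    let ?\<alpha> = "mat n m (\<lambda>(i, j). \<alpha> i j)"
    have "mat m m (\<lambda>(i, j). \<Oplus>k\<in>{..<n}. \<Oplus>l\<in>{..<n}. (cnj (\<alpha> k i) * \<alpha> l j) \<odot>\<^bsub>S\<^esub> F k l) =
      mat m m (\<lambda>(i, j). \<Oplus>k\<in>{..<n}. \<Oplus>l\<in>{..<n}. (cnj (?\<alpha> $$ (k, i)) * ?\<alpha> $$ (l, j)) \<odot>\<^bsub>S\<^esub> mat n n (\<lambda>(i, j). F i j) $$ (k, l))"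
      unfolding mat_fun_eq using cl by (intro allI impI v_finsum_cong') (auto intro!: v_finsum_cong' v_finsum_closed)
    then show ?thesis
      using pos_compress[OF F[unfolded cone_def], of ?\<alpha> m] compress_mat[of ?\<alpha> n m S F]
      by (simp add: cone_def)
  qed
  show "\<exists>r>0. cone S n (\<lambda>i j. scalF S (ounit S) r i j \<ominus> F i j)" if "hermF S n F" for n F
    using order_unit[of "mat n n (\<lambda>(i, j). F i j)" n] that
    unfolding unitE msub_mat herm_mat cone_def by blast
  show "cone S n F" if h: "hermF S n F" and *: "\<And>r. 0 < r \<Longrightarrow> cone S n (\<lambda>i j. F i j \<oplus> scalF S (ounit S) r i j)" for n F
    unfolding cone_def
  proof (rule archimedean)
    show "mat n n (\<lambda>(i, j). F i j) \<in> herm S n" using h by (simp add: herm_mat)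
    fix r :: real assume "0 < r"
    have "mat n n (\<lambda>(i, j). F i j \<oplus> scalF S (ounit S) r i j) = mat n n (\<lambda>(i, j). scalF S (ounit S) r i j \<oplus> F i j)"
      unfolding mat_fun_eq using hermFD(1)[OF h] ounit_closed by (auto simp: scalF_def v_ac)
    then show "madd S (mscale S r (munit S n)) (mat n n (\<lambda>(i, j). F i j)) \<in> pos S n"
      using *[OF \<open>0 < r\<close>] unfolding unitE madd_mat cone_def by simp
  qed
qed (fact ounit_closed ounit_herm)+

lemma cone_proper:
  assumes "cone S n F" "cone S n (\<lambda>i j. \<ominus> F i j)" "i < n" "j < n"
  shows "F i j = \<zero>"
proof -
  have "mat n n (\<lambda>(i, j). \<zero> \<ominus> F i j) = mat n n (\<lambda>(i, j). \<ominus> F i j)"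
    unfolding mat_fun_eq using K.P_cl[OF assms(1)] by (auto simp: v_minus_eq)
  then have "mat n n (\<lambda>(i, j). F i j) = mzero S n"
    using assms(1,2) by (intro pos_proper) (simp_all add: cone_def mzero_mat msub_mat)
  then show ?thesis using assms(3,4) unfolding mzero_mat mat_fun_eq by blast
qed

lemma block_eq:
  "four_block_mat (mscale S r (munit S 1)) (mat 1 1 (\<lambda>_. x)) (mat_invol S (mat 1 1 (\<lambda>_. x))) (mscale S r (munit S 1))
     = mat 2 2 (\<lambda>(i, j). blockF S (ounit S) r x i j)"
  by (intro eq_matI) (auto simp: mscale_def munit_def mat_invol_def blockF_def)

lemma os_norm_nr: "os_norm S x = K.nr x"
proof -
  have "dim_row (mat 1 1 (\<lambda>_. x)) = 1" by simp
  then show ?thesis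
    unfolding os_norm_def mnorm_def K.nr_def Let_def cone_def by (simp only: block_eq mult_1_right)
qed

lemma os_norm_le_iff: "\<lbrakk>x \<in> carrier S; 0 \<le> r\<rbrakk> \<Longrightarrow> os_norm S x \<le> r \<longleftrightarrow> cone S 2 (blockF S (ounit S) r x)"
  by (simp add: os_norm_nr K.nr_le_iff)

sublocale normed_star S "os_norm S"
proof -
  have eq: "os_norm S = K.nr" by (simp add: fun_eq_iff os_norm_nr)
  interpret s: seminormed_star S K.nr by (rule K.seminormed_star_axioms)
  show "normed_star S (os_norm S)"
    unfolding eq
  proof
    fix x assume x: "x \<in> carrier S" and 0: "K.nr x = 0"
    then have b: "cone S 2 (blockF S (ounit S) 0 x)" using K.bnd_nr[OF x] by simp
    \<comment> \<open>Flipping one sign turns a block with zero diagonal into its negative, so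
      properness forces \<open>x\<close> to vanish.\<close>
    have "cone S 2 (\<lambda>i j. \<ominus> blockF S (ounit S) 0 x i j)"
    proof (rule K.P_cong[OF K.P_select[OF b, of 2 "\<lambda>i. i" "\<lambda>i. if i = 0 then 1 else -1"]])
      show "\<ominus> blockF S (ounit S) 0 x i j = (cnj (if i = 0 then 1 else -1) * (if j = 0 then 1 else -1)) \<odot>\<^bsub>S\<^esub> blockF S (ounit S) 0 x i j"
        if "i < 2" "j < 2" for i j
        using x ounit_closed that by (auto simp: K.less_2 smult_neg1 invol_closed)
    qed
    from cone_proper[OF b this, of 0 1] show "x = \<zero>" by simp
  qed
qed

lemma pos_cone: "X \<in> carrier_mat n n \<Longrightarrow> X \<in> pos S n \<longleftrightarrow> cone S n (\<lambda>i j. X $$ (i, j))"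
  by (simp only: cone_def mat_index)

lemma pos_carrier_mat: "X \<in> pos S n \<Longrightarrow> X \<in> carrier_mat n n"
  using pos_herm by (auto simp: herm_def mats_def)

lemma cone_limit:
  assumes "\<And>k. cone S n (F k)" "hermF S n G"
    and "\<And>i j. \<lbrakk>i < n; j < n\<rbrakk> \<Longrightarrow> os_nlim S (\<lambda>k. F k i j) (G i j)"
  shows "cone S n G"
  using K.P_limit[of n F G] assms by (simp add: os_norm_nr[abs_def])

end

section \<open>The quotient of an Archimedean cone by its null elements is an operator
  system\<close>

definition quot_opsys :: "('a, 'm) star_space_scheme \<Rightarrow> 'a set \<Rightarrow> 'a \<Rightarrow> (nat \<Rightarrow> (nat \<Rightarrow> nat \<Rightarrow> 'a) \<Rightarrow> bool) \<Rightarrow> 'a set opsys" where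
  "quot_opsys V I e P = star_space.extend (quot_space V I) \<lparr>ounit = coset V I e,
     pos = \<lambda>n. {X \<in> carrier_mat n n. \<exists>F. P n F \<and> (\<forall>i<n. \<forall>j<n. X $$ (i, j) = coset V I (F i j))}\<rparr>"

context arch_cone
begin

abbreviation "Null \<equiv> {x \<in> carrier V. nr x = 0}"
abbreviation "cl \<equiv> coset V Null"
abbreviation "Q \<equiv> quot_opsys V Null e P"

sublocale N: star_subspace V Null
proof
  fix x y assume "x \<in> Null" "y \<in> Null"
  then show "x \<oplus> y \<in> Null"
    using N_triangle[of x y] N_nonneg[of "x \<oplus> y"] by auto
qed (auto simp: N_smult N_invol invol_closed)

lemma Q_simps:
  "carrier Q = cl ` carrier V" "zero Q = cl \<zero>" "ounit Q = cl e"
  "\<lbrakk>x \<in> carrier V; y \<in> carrier V\<rbrakk> \<Longrightarrow> cl x \<oplus>\<^bsub>Q\<^esub> cl y = cl (x \<oplus> y)"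
  "x \<in> carrier V \<Longrightarrow> c \<odot>\<^bsub>Q\<^esub> cl x = cl (c \<odot>\<^bsub>V\<^esub> x)"
  "x \<in> carrier V \<Longrightarrow> invol Q (cl x) = cl (invol V x)"
  "pos Q n = {X \<in> carrier_mat n n. \<exists>F. P n F \<and> (\<forall>i<n. \<forall>j<n. X $$ (i, j) = cl (F i j))}"
proof -
  note [simp] = quot_opsys_def star_space.extend_def
  show "carrier Q = cl ` carrier V" "zero Q = cl \<zero>" "ounit Q = cl e"
    "pos Q n = {X \<in> carrier_mat n n. \<exists>F. P n F \<and> (\<forall>i<n. \<forall>j<n. X $$ (i, j) = cl (F i j))}"
    by (simp_all add: N.quot_carrier N.quot_zero)
  show "x \<in> carrier V \<Longrightarrow> c \<odot>\<^bsub>Q\<^esub> cl x = cl (c \<odot>\<^bsub>V\<^esub> x)"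
    "x \<in> carrier V \<Longrightarrow> invol Q (cl x) = cl (invol V x)"
    using N.quot_smult[of x] N.quot_invol[of x] by simp_all
  show "\<lbrakk>x \<in> carrier V; y \<in> carrier V\<rbrakk> \<Longrightarrow> cl x \<oplus>\<^bsub>Q\<^esub> cl y = cl (x \<oplus> y)"
    using N.quot_add[of x y] by simp
qed

lemma star_vector_space_Q: "star_vector_space Q"
  using star_vector_space_axioms
  by (rule star_vector_space_image[where q = cl]) (simp_all add: Q_simps)

lemma cl_in: "x \<in> carrier V \<Longrightarrow> cl x \<in> carrier Q"
  by (simp add: Q_simps(1))

lemma linear_cl: "linear_map V Q cl"
proof -
  interpret Q: star_vector_space Q by (rule star_vector_space_Q)
  show ?thesis
    by unfold_locales (auto simp: complex_linear_def Q_simps)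
qed

text \<open>If the entries of \<open>G\<close> and \<open>F\<close> differ by null elements, the
  constant sequence \<open>F\<close> converges to \<open>G\<close> in the seminorm, and the cones
  are closed.\<close>

lemma P_representatives:
  assumes F: "P n F" and G: "hermF V n G" and eq: "\<And>i j. \<lbrakk>i < n; j < n\<rbrakk> \<Longrightarrow> cl (G i j) = cl (F i j)"
  shows "P n G"
proof (rule P_limit[of n "\<lambda>_. F", OF F G])
  fix i j assume ij: "i < n" "j < n"
  have "F i j \<ominus> G i j \<in> Null"
    using N.coset_eq[of "F i j" "G i j"] P_cl[OF F ij] hermFD(1)[OF G ij] eq[OF ij] by simp
  then show "nlim V nr (\<lambda>k. F i j) (G i j)" by (simp add: nlim_def)
qed

definition PQ :: "nat \<Rightarrow> (nat \<Rightarrow> nat \<Rightarrow> 'a set) \<Rightarrow> bool" where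
  "PQ n G \<longleftrightarrow> (\<exists>F. P n F \<and> (\<forall>i<n. \<forall>j<n. G i j = cl (F i j)))"

lemma PQ_cl: "hermF V n F \<Longrightarrow> PQ n (\<lambda>i j. cl (F i j)) \<longleftrightarrow> P n F"
proof
  assume h: "hermF V n F" and "PQ n (\<lambda>i j. cl (F i j))"
  then obtain G where G: "P n G" "\<forall>i<n. \<forall>j<n. cl (F i j) = cl (G i j)" unfolding PQ_def by blast
  show "P n F" by (rule P_representatives[OF G(1) h]) (use G(2) in blast)
qed (auto simp: PQ_def)

text \<open>Entrywise representatives need not form a hermitian matrix; averaging with the adjoint
  repairs this and keeps the cosets.\<close>

lemma hermF_lift:
  assumes "hermF Q n G"
  obtains F where "hermF V n F" "\<And>i j. \<lbrakk>i < n; j < n\<rbrakk> \<Longrightarrow> G i j = cl (F i j)"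
proof -
  interpret l: linear_map V Q cl by (rule linear_cl)
  have "\<forall>i j. \<exists>x. i < n \<longrightarrow> j < n \<longrightarrow> x \<in> carrier V \<and> G i j = cl x"
    using hermFD(1)[OF assms, unfolded Q_simps(1)] by blast
  then obtain H where H: "\<And>i j. i < n \<Longrightarrow> j < n \<Longrightarrow> H i j \<in> carrier V \<and> G i j = cl (H i j)"
    by metis
  define F where "F i j = (1/2) \<odot>\<^bsub>V\<^esub> (H i j \<oplus> invol V (H j i))" for i j
  have "hermF V n F"
    using H by (auto simp: hermF_def F_def invol_smult invol_add invol_closed invol_invol v_ac)
  moreover have "G i j = cl (F i j)" if ij: "i < n" "j < n" for i j
  proof -
    have "cl (invol V (H j i)) = cl (H i j)"
      using hermFD(2)[OF assms ij(2,1)] H[OF ij] H[OF ij(2,1)] by (simp add: Q_simps)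
    then have "cl (F i j) = (1/2) \<odot>\<^bsub>Q\<^esub> (cl (H i j) \<oplus>\<^bsub>Q\<^esub> cl (H i j))"
      using H[OF ij] H[OF ij(2,1)] by (simp add: F_def l.smult l.add invol_closed)
    also have "\<dots> = cl (H i j)"
      using H[OF ij] cl_in[of "H i j"] by (simp add: l.W.smult_smult flip: l.W.smult_2)
    finally show ?thesis using H[OF ij] by simp
  qed
  ultimately show ?thesis using that by blast
qed

lemma scalF_cl: "scalF Q (cl e) r i j = cl (E r i j)"
  using e_cl by (simp add: scalF_def Q_simps)

text \<open>Order unit and Archimedean property are checked on hermitian lifts, with
  \<open>P_representatives\<close> exchanging one positive lift for another. Properness holds
  because \<open>P_pm_null\<close> makes the entries null, hence zero as cosets.\<close>

lemma operator_system_Q: "operator_system Q"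
proof (rule operator_systemI)
  interpret l: linear_map V Q cl by (rule linear_cl)
  show "arch_cone Q (ounit Q) PQ"
    unfolding Q_simps(3)
  proof
    show "PQ n G'" if "PQ n G" "\<And>i j. \<lbrakk>i < n; j < n\<rbrakk> \<Longrightarrow> G' i j = G i j" for n G G'
      using that unfolding PQ_def by auto
    show "hermF Q n G" if "PQ n G" for n G
      using that P_hermF by (auto simp: PQ_def hermF_def cl_in Q_simps(6))
    show "PQ n (\<lambda>i j. G i j \<oplus>\<^bsub>Q\<^esub> G' i j)" if G: "PQ n G" and G': "PQ n G'" for n G G'
    proof -
      obtain F F' where F: "P n F" "\<forall>i<n. \<forall>j<n. G i j = cl (F i j)" "P n F'" "\<forall>i<n. \<forall>j<n. G' i j = cl (F' i j)"
        using G G' unfolding PQ_def by blast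
      then show ?thesis unfolding PQ_def
        using P_cl[OF F(1)] P_cl[OF F(3)] by (intro exI[of _ "\<lambda>i j. F i j \<oplus> F' i j"]) (simp add: P_add l.add)
    qed
    show "PQ m (\<lambda>i j. finsum Q (\<lambda>k. finsum Q (\<lambda>l. (cnj (\<alpha> k i) * \<alpha> l j) \<odot>\<^bsub>Q\<^esub> G k l) {..<n}) {..<n})"
      if G: "PQ n G" for n G m \<alpha>
    proof -
      obtain F where F: "P n F" "\<And>i j. i < n \<Longrightarrow> j < n \<Longrightarrow> G i j = cl (F i j)"
        using G unfolding PQ_def by blast
      note c = P_cl[OF F(1)]
      have "finsum Q (\<lambda>k. finsum Q (\<lambda>l. (cnj (\<alpha> k i) * \<alpha> l j) \<odot>\<^bsub>Q\<^esub> G k l) {..<n}) {..<n} =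
        cl (\<Oplus>k\<in>{..<n}. \<Oplus>l\<in>{..<n}. (cnj (\<alpha> k i) * \<alpha> l j) \<odot>\<^bsub>V\<^esub> F k l)" (is "?L = _") for i j
      proof -
        have "?L = finsum Q (\<lambda>k. cl (\<Oplus>l\<in>{..<n}. (cnj (\<alpha> k i) * \<alpha> l j) \<odot>\<^bsub>V\<^esub> F k l)) {..<n}"
        proof (intro l.W.v_finsum_cong' refl)
          show "(\<lambda>k. cl (\<Oplus>l\<in>{..<n}. (cnj (\<alpha> k i) * \<alpha> l j) \<odot>\<^bsub>V\<^esub> F k l)) \<in> {..<n} \<rightarrow> carrier Q"
            using c by (auto intro!: cl_in v_finsum_closed)
          fix k assume k: "k \<in> {..<n}"
          have "finsum Q (\<lambda>l. (cnj (\<alpha> k i) * \<alpha> l j) \<odot>\<^bsub>Q\<^esub> G k l) {..<n} =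
              finsum Q (\<lambda>l. cl ((cnj (\<alpha> k i) * \<alpha> l j) \<odot>\<^bsub>V\<^esub> F k l)) {..<n}"
            using c k F(2) by (intro l.W.v_finsum_cong') (auto intro!: cl_in simp: l.smult)
          also have "\<dots> = cl (\<Oplus>l\<in>{..<n}. (cnj (\<alpha> k i) * \<alpha> l j) \<odot>\<^bsub>V\<^esub> F k l)"
            using c k by (intro l.finsum[symmetric]) auto
          finally show "finsum Q (\<lambda>l. (cnj (\<alpha> k i) * \<alpha> l j) \<odot>\<^bsub>Q\<^esub> G k l) {..<n} =
            cl (\<Oplus>l\<in>{..<n}. (cnj (\<alpha> k i) * \<alpha> l j) \<odot>\<^bsub>V\<^esub> F k l)" .
        qed
        also have "\<dots> = cl (\<Oplus>k\<in>{..<n}. \<Oplus>l\<in>{..<n}. (cnj (\<alpha> k i) * \<alpha> l j) \<odot>\<^bsub>V\<^esub> F k l)"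
          using c by (intro l.finsum[symmetric]) (auto intro!: v_finsum_closed)
        finally show ?thesis .
      qed
      then show ?thesis unfolding PQ_def using P_compress[OF F(1)] by blast
    qed
    show "cl e \<in> carrier Q" "invol Q (cl e) = cl e" using e_cl e_herm by (simp_all add: cl_in Q_simps(6))
    show "\<exists>r>0. PQ n (\<lambda>i j. scalF Q (cl e) r i j \<ominus>\<^bsub>Q\<^esub> G i j)" if G: "hermF Q n G" for n G
    proof -
      obtain F where F: "hermF V n F" "\<And>i j. \<lbrakk>i < n; j < n\<rbrakk> \<Longrightarrow> G i j = cl (F i j)" using hermF_lift[OF G] by blast
      obtain r where r: "r > 0" "P n (\<lambda>i j. E r i j \<ominus> F i j)" using P_order[OF F(1)] by blast
      have "scalF Q (cl e) r i j \<ominus>\<^bsub>Q\<^esub> G i j = cl (E r i j \<ominus> F i j)" if "i < n" "j < n" for i j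
        using hermFD(1)[OF F(1) that] F(2)[OF that] by (simp add: scalF_cl l.diff)
      then show ?thesis unfolding PQ_def using r by blast
    qed
    show "PQ n G" if G: "hermF Q n G" and *: "\<And>r. 0 < r \<Longrightarrow> PQ n (\<lambda>i j. G i j \<oplus>\<^bsub>Q\<^esub> scalF Q (cl e) r i j)" for n G
    proof -
      obtain F where F: "hermF V n F" "\<And>i j. \<lbrakk>i < n; j < n\<rbrakk> \<Longrightarrow> G i j = cl (F i j)" using hermF_lift[OF G] by blast
      have "P n (\<lambda>i j. F i j \<oplus> E r i j)" if r: "0 < r" for r
      proof -
        obtain H where H: "P n H" "\<forall>i<n. \<forall>j<n. G i j \<oplus>\<^bsub>Q\<^esub> scalF Q (cl e) r i j = cl (H i j)"
          using *[OF r] unfolding PQ_def by blast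
        have h: "hermF V n (\<lambda>i j. F i j \<oplus> E r i j)"
          using F(1) hermF_E[of n r] by (simp add: hermF_def invol_add)
        show ?thesis
        proof (rule P_representatives[OF H(1) h])
          show "cl (F i j \<oplus> E r i j) = cl (H i j)" if "i < n" "j < n" for i j
            using H(2)[rule_format, OF that] F(2)[OF that] hermFD(1)[OF F(1) that]
            by (simp add: scalF_cl Q_simps(4))
        qed
      qed
      then have "P n F" by (rule P_arch[OF F(1)])
      then show ?thesis unfolding PQ_def using F(2) by blast
    qed
  qed
  show "pos Q n = {X \<in> carrier_mat n n. PQ n (\<lambda>i j. X $$ (i, j))}" for n
    by (simp add: Q_simps(7) PQ_def)
  show "G i j = \<zero>\<^bsub>Q\<^esub>" if G: "PQ n G" "PQ n (\<lambda>i j. \<ominus>\<^bsub>Q\<^esub> G i j)" and ij: "i < n" "j < n" for n G i j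
  proof -
    obtain F where F: "P n F" "\<forall>i<n. \<forall>j<n. G i j = cl (F i j)" using G unfolding PQ_def by blast
    obtain H where H: "P n H" "\<forall>i<n. \<forall>j<n. \<ominus>\<^bsub>Q\<^esub> G i j = cl (H i j)" using G unfolding PQ_def by blast
    have h: "hermF V n (\<lambda>i j. \<ominus> F i j)" using P_hermF[OF F(1)] by (simp add: hermF_def invol_minus)
    have "P n (\<lambda>i j. \<ominus> F i j)"
    proof (rule P_representatives[OF H(1) h])
      show "cl (\<ominus> F i j) = cl (H i j)" if "i < n" "j < n" for i j
        using F(2)[rule_format, OF that] H(2)[rule_format, OF that] P_cl[OF F(1) that] l.minus[of "F i j"] by simp
    qed
    then have "nr (F i j) = 0" using F(1) ij P_pm_null by blast
    then have "cl (F i j) = cl \<zero>" using P_cl[OF F(1) ij] by (subst N.coset_eq) auto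
    then show ?thesis unfolding Q_simps(2) using F(2)[rule_format, OF ij] by (rule trans[rotated])
  qed
qed

lemma cone_Q: "hermF V n F \<Longrightarrow> cone Q n (\<lambda>i j. cl (F i j)) \<longleftrightarrow> P n F"
proof -
  assume h: "hermF V n F"
  have "cone Q n (\<lambda>i j. cl (F i j)) \<longleftrightarrow> PQ n (\<lambda>i j. cl (F i j))"
    by (simp add: cone_def Q_simps(7) PQ_def)
  then show ?thesis using PQ_cl[OF h] by simp
qed

lemma cone_Q_lift:
  assumes "cone Q n G"
  obtains F where "P n F" "\<And>i j. \<lbrakk>i < n; j < n\<rbrakk> \<Longrightarrow> G i j = cl (F i j)"
proof -
  have "PQ n G" using assms by (simp add: cone_def Q_simps(7) PQ_def)
  then obtain F where "P n F" "\<forall>i<n. \<forall>j<n. G i j = cl (F i j)" unfolding PQ_def by blast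
  then show ?thesis using that[of F] by blast
qed

end

section \<open>Unital completely positive maps\<close>

definition compF :: "(complex, 'a, 'm) module_scheme \<Rightarrow> nat \<Rightarrow> (nat \<Rightarrow> nat \<Rightarrow> complex) \<Rightarrow> (nat \<Rightarrow> nat \<Rightarrow> 'a) \<Rightarrow> nat \<Rightarrow> nat \<Rightarrow> 'a" where
  "compF V n \<alpha> F i j = (\<Oplus>\<^bsub>V\<^esub>k\<in>{..<n}. \<Oplus>\<^bsub>V\<^esub>l\<in>{..<n}. (cnj (\<alpha> k i) * \<alpha> l j) \<odot>\<^bsub>V\<^esub> F k l)"

context star_vector_space
begin

lemma compF_cl:
  assumes "\<And>i j. \<lbrakk>i < n; j < n\<rbrakk> \<Longrightarrow> F i j \<in> carrier V"
  shows "compF V n \<alpha> F i j \<in> carrier V"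
  unfolding compF_def using assms by (intro v_finsum_closed Pi_I smult_cl) auto

lemma compF_add:
  assumes F: "\<And>i j. \<lbrakk>i < n; j < n\<rbrakk> \<Longrightarrow> F i j \<in> carrier V" and G: "\<And>i j. \<lbrakk>i < n; j < n\<rbrakk> \<Longrightarrow> G i j \<in> carrier V"
  shows "compF V n \<alpha> (\<lambda>i j. F i j \<oplus> G i j) i j = compF V n \<alpha> F i j \<oplus> compF V n \<alpha> G i j"
proof -
  let ?c = "\<lambda>k l. cnj (\<alpha> k i) * \<alpha> l j"
  have "(\<Oplus>l\<in>{..<n}. ?c k l \<odot>\<^bsub>V\<^esub> (F k l \<oplus> G k l)) =
      (\<Oplus>l\<in>{..<n}. ?c k l \<odot>\<^bsub>V\<^esub> F k l) \<oplus> (\<Oplus>l\<in>{..<n}. ?c k l \<odot>\<^bsub>V\<^esub> G k l)" if k: "k < n" for k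
  proof -
    have "(\<Oplus>l\<in>{..<n}. ?c k l \<odot>\<^bsub>V\<^esub> (F k l \<oplus> G k l)) = (\<Oplus>l\<in>{..<n}. ?c k l \<odot>\<^bsub>V\<^esub> F k l \<oplus> ?c k l \<odot>\<^bsub>V\<^esub> G k l)"
      using F G k by (intro v_finsum_cong' refl) (auto simp: smult_dist)
    also have "\<dots> = (\<Oplus>l\<in>{..<n}. ?c k l \<odot>\<^bsub>V\<^esub> F k l) \<oplus> (\<Oplus>l\<in>{..<n}. ?c k l \<odot>\<^bsub>V\<^esub> G k l)"
      using F G k by (intro v_finsum_add) auto
    finally show ?thesis .
  qed
  then have "compF V n \<alpha> (\<lambda>i j. F i j \<oplus> G i j) i j =
      (\<Oplus>k\<in>{..<n}. (\<Oplus>l\<in>{..<n}. ?c k l \<odot>\<^bsub>V\<^esub> F k l) \<oplus> (\<Oplus>l\<in>{..<n}. ?c k l \<odot>\<^bsub>V\<^esub> G k l))"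
    unfolding compF_def using F G by (intro v_finsum_cong') (auto intro!: v_finsum_closed v_add_cl)
  also have "\<dots> = compF V n \<alpha> F i j \<oplus> compF V n \<alpha> G i j"
    unfolding compF_def using F G by (intro v_finsum_add) (auto intro!: v_finsum_closed)
  finally show ?thesis .
qed

lemma linear_smult: "linear_map V V (\<lambda>x. c \<odot>\<^bsub>V\<^esub> x)"
  by unfold_locales (auto simp: complex_linear_def smult_dist smult_smult mult.commute)

lemma compF_smult:
  assumes F: "\<And>i j. \<lbrakk>i < n; j < n\<rbrakk> \<Longrightarrow> F i j \<in> carrier V"
  shows "compF V n \<alpha> (\<lambda>i j. c \<odot>\<^bsub>V\<^esub> F i j) i j = c \<odot>\<^bsub>V\<^esub> compF V n \<alpha> F i j"
proof -
  interpret c: linear_map V V "\<lambda>x. c \<odot>\<^bsub>V\<^esub> x" by (rule linear_smult)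
  let ?c = "\<lambda>k l. cnj (\<alpha> k i) * \<alpha> l j"
  have "c \<odot>\<^bsub>V\<^esub> compF V n \<alpha> F i j = (\<Oplus>k\<in>{..<n}. c \<odot>\<^bsub>V\<^esub> (\<Oplus>l\<in>{..<n}. ?c k l \<odot>\<^bsub>V\<^esub> F k l))"
    unfolding compF_def using F by (intro c.finsum) (auto intro!: v_finsum_closed)
  also have "\<dots> = (\<Oplus>k\<in>{..<n}. \<Oplus>l\<in>{..<n}. c \<odot>\<^bsub>V\<^esub> (?c k l \<odot>\<^bsub>V\<^esub> F k l))"
    using F by (intro v_finsum_cong' c.finsum refl) (auto intro!: v_finsum_closed)
  also have "\<dots> = compF V n \<alpha> (\<lambda>i j. c \<odot>\<^bsub>V\<^esub> F i j) i j"
    unfolding compF_def using F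
    by (intro v_finsum_cong' refl) (auto intro!: v_finsum_closed v_finsum_cong' simp: smult_smult mult.commute)
  finally show ?thesis by simp
qed

end

lemma (in linear_map) compF:
  assumes F: "\<And>i j. \<lbrakk>i < n; j < n\<rbrakk> \<Longrightarrow> F i j \<in> carrier V"
  shows "f (compF V n \<alpha> F i j) = compF W n \<alpha> (\<lambda>i j. f (F i j)) i j"
proof -
  let ?c = "\<lambda>k l. cnj (\<alpha> k i) * \<alpha> l j"
  have "f (compF V n \<alpha> F i j) = (\<Oplus>\<^bsub>W\<^esub>k\<in>{..<n}. f (\<Oplus>\<^bsub>V\<^esub>l\<in>{..<n}. ?c k l \<odot>\<^bsub>V\<^esub> F k l))"
    unfolding compF_def using F by (intro finsum) (auto intro!: V.v_finsum_closed)
  also have "\<dots> = (\<Oplus>\<^bsub>W\<^esub>k\<in>{..<n}. \<Oplus>\<^bsub>W\<^esub>l\<in>{..<n}. f (?c k l \<odot>\<^bsub>V\<^esub> F k l))"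
    using F by (intro W.v_finsum_cong' finsum refl) (auto intro!: W.v_finsum_closed)
  also have "\<dots> = compF W n \<alpha> (\<lambda>i j. f (F i j)) i j"
    unfolding compF_def using F
    by (intro W.v_finsum_cong' refl) (auto intro!: W.v_finsum_closed W.v_finsum_cong' simp: smult)
  finally show ?thesis .
qed

context matrix_cone
begin

lemma P_compF: "P n F \<Longrightarrow> P m (compF V n \<alpha> F)"
  using P_compress[of n F m \<alpha>] by (simp add: compF_def[abs_def])

lemma hermF_add: "\<lbrakk>hermF V n F; hermF V n G\<rbrakk> \<Longrightarrow> hermF V n (\<lambda>i j. F i j \<oplus> G i j)"
  by (simp add: hermF_def invol_add)

lemma hermF_smult: "hermF V n F \<Longrightarrow> hermF V n (\<lambda>i j. complex_of_real r \<odot>\<^bsub>V\<^esub> F i j)"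
  by (simp add: hermF_def invol_smult)

text \<open>A hermitian matrix is a difference of two positive ones, and compression is additive and
  preserves positivity; no involution of a double sum has to be computed.\<close>

lemma hermF_compF:
  assumes F: "hermF V n F" shows "hermF V m (compF V n \<alpha> F)"
proof -
  obtain r where r: "r > 0" "P n (\<lambda>i j. E r i j \<ominus> F i j)" using P_order[OF F] by blast
  note cF = hermFD(1)[OF F]
  let ?D = "\<lambda>i j. E r i j \<ominus> F i j"
  have cD: "?D i j \<in> carrier V" if "i < n" "j < n" for i j using cF[OF that] by simp
  have "compF V n \<alpha> (E r) i j = compF V n \<alpha> (\<lambda>i j. ?D i j \<oplus> F i j) i j" for i j
    unfolding compF_def using cF
    by (intro v_finsum_cong' refl) (auto intro!: v_finsum_closed v_finsum_cong' simp: diff_add_cancel)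
  then have eq: "compF V n \<alpha> (E r) i j = compF V n \<alpha> ?D i j \<oplus> compF V n \<alpha> F i j" for i j
    using compF_add[of n ?D F \<alpha> i j] cD cF by simp
  have cl: "compF V n \<alpha> ?D i j \<in> carrier V" "compF V n \<alpha> F i j \<in> carrier V" for i j
    using cD cF by (auto intro: compF_cl)
  have F_eq: "compF V n \<alpha> F i j = compF V n \<alpha> (E r) i j \<oplus> (-1) \<odot>\<^bsub>V\<^esub> compF V n \<alpha> ?D i j" for i j
    unfolding eq using cl by (simp add: smult_neg1 v_ac v_r_neg v_r_neg1 v_r_neg2)
  have "hermF V m (compF V n \<alpha> (E r))" "hermF V m (compF V n \<alpha> ?D)"
    using r P_E[of r n] by (auto intro: P_hermF P_compF)
  then show ?thesis
    using hermF_add[OF _ hermF_smult[of m _ "-1"], of "compF V n \<alpha> (E r)" "compF V n \<alpha> ?D"] F_eq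
    by (simp add: hermF_def)
qed

end

locale ucp_map = S: operator_system S + T: operator_system T
  for S :: "'s opsys" and T :: "'t opsys" +
  fixes \<phi> :: "'s \<Rightarrow> 't"
  assumes ucp: "ucp S T \<phi>"
begin

sublocale linear_map S T \<phi>
  by unfold_locales (use ucp in \<open>simp add: ucp_def\<close>)

lemma unit: "\<phi> (ounit S) = ounit T"
  using ucp by (simp add: ucp_def)

lemma cone: "cone S n F \<Longrightarrow> cone T n (\<lambda>i j. \<phi> (F i j))"
  using ucp by (auto simp: ucp_def cone_def simp flip: map_mat_mat)

text \<open>Compatibility with the involution is not among the conditions of \<open>ucp\<close>. It
  is read off from a positive block containing \<open>x\<close>, whose image is again
  hermitian.\<close>

lemma invol: assumes x: "x \<in> carrier S" shows "\<phi> (invol S x) = invol T (\<phi> x)"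
proof -
  obtain r where "cone S 2 (blockF S (ounit S) r x)" using S.K.bnd_exists[OF x] by blast
  from T.K.P_herm[OF cone[OF this], of 0 1] show ?thesis by simp
qed

lemma scalF: "\<phi> (scalF S (ounit S) r i j) = scalF T (ounit T) r i j"
  using S.ounit_closed by (simp add: scalF_def smult unit)

lemma blockF: "x \<in> carrier S \<Longrightarrow> \<phi> (blockF S (ounit S) r x i j) = blockF T (ounit T) r (\<phi> x) i j"
  using S.ounit_closed by (simp add: blockF_def smult unit invol)

lemma hermF: "hermF S n F \<Longrightarrow> hermF T n (\<lambda>i j. \<phi> (F i j))"
  by (auto simp: hermF_def simp flip: invol)

text \<open>Complete positivity and unitality send the block that witnesses the norm of
  \<open>x\<close> to the same block for its image.\<close>

lemma contractive: assumes x: "x \<in> carrier S" shows "os_norm T (\<phi> x) \<le> os_norm S x"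
proof -
  have "cone S 2 (blockF S (ounit S) (os_norm S x) x)"
    using S.os_norm_le_iff[OF x, of "os_norm S x"] S.N_nonneg[OF x] by simp
  from cone[OF this] have "cone T 2 (blockF T (ounit T) (os_norm S x) (\<phi> x))"
    by (simp add: blockF[OF x])
  then show ?thesis using x S.N_nonneg[OF x] by (subst T.os_norm_le_iff) auto
qed

lemma nlim_ucp:
  assumes "\<And>n. f n \<in> carrier S" "x \<in> carrier S" "os_nlim S f x"
  shows "os_nlim T (\<lambda>n. \<phi> (f n)) (\<phi> x)"
  using assms(1,2)
  by (intro T.nlim_I[OF _ _ _ assms(3)[unfolded nlim_def]]) (auto simp: contractive simp flip: diff)

end

lemma ucp_mapI: "operator_system S \<Longrightarrow> operator_system T \<Longrightarrow> ucp S T \<phi> \<Longrightarrow> ucp_map S T \<phi>"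
  by (simp add: ucp_map_def ucp_map_axioms_def)

lemma ucpI:
  assumes S: "operator_system S" and "complex_linear S T \<phi>" "\<phi> (ounit S) = ounit T"
    and cone: "\<And>n F. cone S n F \<Longrightarrow> cone T n (\<lambda>i j. \<phi> (F i j))"
  shows "ucp S T \<phi>"
  unfolding ucp_def
proof (intro conjI allI ballI assms(2,3))
  interpret S: operator_system S by (rule S)
  fix n X assume X: "X \<in> pos S n"
  then have c: "X \<in> carrier_mat n n" by (rule S.pos_carrier_mat)
  have "cone T n (\<lambda>i j. \<phi> (X $$ (i, j)))" using X S.pos_cone[OF c] by (intro cone) simp
  moreover have "map_mat \<phi> X = mat n n (\<lambda>(i, j). \<phi> (X $$ (i, j)))" using c by (intro eq_matI) auto
  ultimately show "map_mat \<phi> X \<in> pos T n" by (simp add: cone_def)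
qed

lemma ucp_id: "operator_system S \<Longrightarrow> ucp S S (\<lambda>x. x)"
  by (rule ucpI) (auto simp: complex_linear_def)

lemma ucp_comp:
  assumes f: "ucp S T f" and g: "ucp T U g"
  shows "ucp S U (\<lambda>x. g (f x))"
proof -
  have "map_mat (\<lambda>x. g (f x)) X = map_mat g (map_mat f X)" for X by (intro eq_matI) auto
  moreover have "f \<in> carrier S \<rightarrow> carrier T" using f by (simp add: ucp_def complex_linear_def)
  ultimately show ?thesis using f g by (auto simp: ucp_def complex_linear_def Pi_iff)
qed

section \<open>Inductive limits of operator systems\<close>

locale os_seq =
  fixes S :: "nat \<Rightarrow> 's opsys" and \<phi> :: "nat \<Rightarrow> 's \<Rightarrow> 's"
  assumes systems: "operator_system (S k)" and ucps: "ucp (S k) (S (Suc k)) (\<phi> k)"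
begin

sublocale S: operator_system "S k" for k by (rule systems)

lemma tr_ucp: "ucp (S k) (S (k + j)) (tr \<phi> k j)"
proof (induction j)
  case 0
  then show ?case using ucp_id[OF systems] by (simp add: tr_fun del: tr.simps)
next
  case (Suc j)
  then show ?case using ucp_comp[OF Suc ucps] by (simp add: tr_fun del: tr.simps)
qed

sublocale T: ucp_map "S k" "S (k + j)" "tr \<phi> k j" for k j
  by (intro ucp_mapI systems tr_ucp)

text \<open>Coherence is exact, unlike for C*-algebras, because the limit in operator systems is a
  union of images. Demanding it only from some index on lets an element of any level define a
  sequence.\<close>

definition coherent :: "(nat \<Rightarrow> 's) \<Rightarrow> bool" where
  "coherent f \<longleftrightarrow> (\<forall>n. f n \<in> carrier (S n)) \<and> (\<exists>k. \<forall>n\<ge>k. f (Suc n) = \<phi> n (f n))"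

lemma coherent_cl [simp]: "coherent f \<Longrightarrow> f n \<in> carrier (S n)"
  by (simp add: coherent_def)

lemma coherent_tr:
  assumes "coherent f"
  shows "\<exists>k. \<forall>n\<ge>k. \<forall>j. f (n + j) = tr \<phi> n j (f n)"
proof -
  obtain k where k: "\<And>n. n \<ge> k \<Longrightarrow> f (Suc n) = \<phi> n (f n)" using assms by (auto simp: coherent_def)
  have "f (n + j) = tr \<phi> n j (f n)" if "n \<ge> k" for n j
    using that by (induction j) (simp_all add: k)
  then show ?thesis by blast
qed

lemma coherentI:
  assumes f: "coherent f" and g: "coherent g" and h: "\<And>n. h n \<in> carrier (S n)"
    and step: "\<And>n. \<lbrakk>f (Suc n) = \<phi> n (f n); g (Suc n) = \<phi> n (g n)\<rbrakk> \<Longrightarrow> h (Suc n) = \<phi> n (h n)"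
  shows "coherent h"
proof -
  obtain k where k: "\<And>n. n \<ge> k \<Longrightarrow> f (Suc n) = \<phi> n (f n)" using f by (auto simp: coherent_def)
  obtain l where l: "\<And>n. n \<ge> l \<Longrightarrow> g (Suc n) = \<phi> n (g n)" using g by (auto simp: coherent_def)
  have "\<forall>n\<ge>max k l. h (Suc n) = \<phi> n (h n)" using k l step by simp
  with h show ?thesis unfolding coherent_def by blast
qed

text \<open>The fields \<open>mult\<close> and \<open>one\<close> are fillers without
  meaning.\<close>

definition seqV :: "(nat \<Rightarrow> 's) star_space" where
  "seqV = \<lparr>carrier = {f. coherent f}, mult = \<lambda>f g. f, one = \<lambda>n. \<zero>\<^bsub>S n\<^esub>,
     zero = \<lambda>n. \<zero>\<^bsub>S n\<^esub>, add = \<lambda>f g n. f n \<oplus>\<^bsub>S n\<^esub> g n, smult = \<lambda>c f n. c \<odot>\<^bsub>S n\<^esub> f n,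
     invol = \<lambda>f n. invol (S n) (f n)\<rparr>"

lemma seqV_simps [simp]:
  "carrier seqV = {f. coherent f}" "\<zero>\<^bsub>seqV\<^esub> = (\<lambda>n. \<zero>\<^bsub>S n\<^esub>)" "f \<oplus>\<^bsub>seqV\<^esub> g = (\<lambda>n. f n \<oplus>\<^bsub>S n\<^esub> g n)"
  "c \<odot>\<^bsub>seqV\<^esub> f = (\<lambda>n. c \<odot>\<^bsub>S n\<^esub> f n)" "invol seqV f = (\<lambda>n. invol (S n) (f n))"
  by (simp_all add: seqV_def)

lemma coherent_zero: "coherent (\<lambda>n. \<zero>\<^bsub>S n\<^esub>)"
proof -
  have "\<phi> n \<zero>\<^bsub>S n\<^esub> = \<zero>\<^bsub>S (Suc n)\<^esub>" for n
    using T.zero[of n 1] by simp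
  then show ?thesis unfolding coherent_def by simp
qed

lemma coherent_unit: "coherent (\<lambda>n. ounit (S n))"
  unfolding coherent_def using ucps by (simp add: S.ounit_closed ucp_def)

lemma coherent_add: "\<lbrakk>coherent f; coherent g\<rbrakk> \<Longrightarrow> coherent (\<lambda>n. f n \<oplus>\<^bsub>S n\<^esub> g n)"
proof (rule coherentI[of f g])
  fix n assume fg: "coherent f" "coherent g" "f (Suc n) = \<phi> n (f n)" "g (Suc n) = \<phi> n (g n)"
  then show "f (Suc n) \<oplus>\<^bsub>S (Suc n)\<^esub> g (Suc n) = \<phi> n (f n \<oplus>\<^bsub>S n\<^esub> g n)"
    using T.add[of "f n" n "g n" 1] by simp
qed auto

lemma coherent_smult: "coherent f \<Longrightarrow> coherent (\<lambda>n. c \<odot>\<^bsub>S n\<^esub> f n)"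
proof (rule coherentI[of f f])
  fix n assume fg: "coherent f" "f (Suc n) = \<phi> n (f n)"
  then show "c \<odot>\<^bsub>S (Suc n)\<^esub> f (Suc n) = \<phi> n (c \<odot>\<^bsub>S n\<^esub> f n)"
    using T.smult[of "f n" n 1 c] by simp
qed auto

lemma coherent_invol: "coherent f \<Longrightarrow> coherent (\<lambda>n. invol (S n) (f n))"
proof (rule coherentI[of f f])
  fix n assume fg: "coherent f" "f (Suc n) = \<phi> n (f n)"
  then show "invol (S (Suc n)) (f (Suc n)) = \<phi> n (invol (S n) (f n))"
    using T.invol[of "f n" n 1] by simp
qed (auto simp: S.invol_closed)

lemma star_vector_space_seqV: "star_vector_space seqV"
proof (rule star_vector_spaceI)
  show "abelian_group seqV"
  proof (rule abelian_groupI)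
    fix f assume "f \<in> carrier seqV"
    then show "\<exists>g\<in>carrier seqV. g \<oplus>\<^bsub>seqV\<^esub> f = \<zero>\<^bsub>seqV\<^esub>"
      using coherent_smult[of f "-1"]
      by (intro bexI[of _ "\<lambda>n. (-1) \<odot>\<^bsub>S n\<^esub> f n"]) (simp_all add: S.smult_neg1 S.v_l_neg)
  qed (auto simp: coherent_add coherent_zero S.v_ac)
qed (auto simp: coherent_smult coherent_invol S.smult_plus S.smult_dist S.smult_smult S.invol_closed S.invol_invol
        S.invol_add S.invol_smult)

sublocale V: star_vector_space seqV by (rule star_vector_space_seqV)

lemma seqV_minus: "coherent f \<Longrightarrow> \<ominus>\<^bsub>seqV\<^esub> f = (\<lambda>n. \<ominus>\<^bsub>S n\<^esub> f n)"
  using V.smult_neg1[of f] by (simp add: S.smult_neg1 fun_eq_iff)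

lemma seqV_diff: "\<lbrakk>coherent f; coherent g\<rbrakk> \<Longrightarrow> f \<ominus>\<^bsub>seqV\<^esub> g = (\<lambda>n. f n \<ominus>\<^bsub>S n\<^esub> g n)"
  by (simp add: V.v_minus_eq S.v_minus_eq seqV_minus)

abbreviation "eV \<equiv> \<lambda>n. ounit (S n)"
abbreviation "EE m \<equiv> scalF (S m) (ounit (S m))"

lemma scalF_seqV: "scalF seqV eV r i j m = EE m r i j"
  by (simp add: scalF_def)

lemma blockF_seqV: "blockF seqV eV r x i j m = blockF (S m) (ounit (S m)) r (x m) i j"
  by (simp add: blockF_def)

lemma linear_eval: "linear_map seqV (S m) (\<lambda>f. f m)"
  by unfold_locales (auto simp: complex_linear_def)

lemma compF_seqV:
  assumes "\<And>i j. \<lbrakk>i < n; j < n\<rbrakk> \<Longrightarrow> coherent (F i j)"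
  shows "compF seqV n \<alpha> F i j m = compF (S m) n \<alpha> (\<lambda>i j. F i j m) i j"
proof -
  interpret ev: linear_map seqV "S m" "\<lambda>f. f m" by (rule linear_eval)
  show ?thesis using assms by (intro ev.compF) simp
qed

lemma hermF_seqV: "hermF seqV n F \<longleftrightarrow> (\<forall>i<n. \<forall>j<n. coherent (F i j)) \<and> (\<forall>m. hermF (S m) n (\<lambda>i j. F i j m))"
  by (auto simp: hermF_def fun_eq_iff)

text \<open>The Archimedean closure of eventual positivity: the index from which the shifted
  matrices are positive may depend on \<open>r\<close>.\<close>

definition PV :: "nat \<Rightarrow> (nat \<Rightarrow> nat \<Rightarrow> nat \<Rightarrow> 's) \<Rightarrow> bool" where
  "PV n F \<longleftrightarrow> hermF seqV n F \<and>
     (\<forall>r>0. \<exists>k. \<forall>m\<ge>k. cone (S m) n (\<lambda>i j. F i j m \<oplus>\<^bsub>S m\<^esub> EE m r i j))"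

lemma PVD: "PV n F \<Longrightarrow> 0 < r \<Longrightarrow> \<exists>k. \<forall>m\<ge>k. cone (S m) n (\<lambda>i j. F i j m \<oplus>\<^bsub>S m\<^esub> EE m r i j)"
  by (simp add: PV_def)

lemma PV_exact:
  assumes F: "hermF seqV n F" and pos: "\<And>m. m \<ge> k \<Longrightarrow> cone (S m) n (\<lambda>i j. F i j m)"
  shows "PV n F"
  unfolding PV_def using F S.K.P_add[OF pos S.K.P_E] less_imp_le by blast

text \<open>From a common index on all entries are images of their values there. The order bound at
  that level is carried to later levels by the connecting maps, with the same
  \<open>r\<close>.\<close>

lemma PV_order_exact:
  assumes F: "hermF seqV n F"
  shows "\<exists>r>0. \<exists>k. \<forall>m\<ge>k. cone (S m) n (\<lambda>i j. EE m r i j \<ominus>\<^bsub>S m\<^esub> F i j m)"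
proof -
  have coh: "coherent (F i j)" if "i < n" "j < n" for i j using F that by (simp add: hermF_seqV)
  obtain k where "\<And>i j m. \<lbrakk>i < n; j < n; k \<le> m\<rbrakk> \<Longrightarrow> \<forall>l. F i j (m + l) = tr \<phi> m l (F i j m)"
    using uniform_index[of n "\<lambda>i j m. \<forall>l. F i j (m + l) = tr \<phi> m l (F i j m)", OF coherent_tr[OF coh]] by blast
  then have tr: "F i j (k + l) = tr \<phi> k l (F i j k)" if "i < n" "j < n" for i j l
    using that by blast
  have "hermF (S k) n (\<lambda>i j. F i j k)" using F by (simp add: hermF_seqV)
  then obtain r where r: "r > 0" "cone (S k) n (\<lambda>i j. EE k r i j \<ominus>\<^bsub>S k\<^esub> F i j k)" using S.K.P_order by blast
  have "cone (S m) n (\<lambda>i j. EE m r i j \<ominus>\<^bsub>S m\<^esub> F i j m)" if mk: "m \<ge> k" for m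
  proof -
    obtain l where l: "m = k + l" using le_Suc_ex[OF mk] by blast
    show ?thesis unfolding l
    proof (rule S.K.P_cong[OF T.cone[OF r(2)]])
      fix i j assume ij: "i < n" "j < n"
      show "EE (k + l) r i j \<ominus>\<^bsub>S (k + l)\<^esub> F i j (k + l) = tr \<phi> k l (EE k r i j \<ominus>\<^bsub>S k\<^esub> F i j k)"
        using tr[OF ij] coh[OF ij] by (simp add: T.diff T.scalF)
    qed
  qed
  with r(1) show ?thesis by blast
qed

lemma hermF_scal: "hermF seqV n (scalF seqV eV r)"
proof -
  have "coherent (scalF seqV eV r i j)" for i j
    unfolding scalF_def using coherent_smult[OF coherent_unit] coherent_zero by simp
  then show ?thesis using S.K.hermF_E by (simp add: hermF_seqV scalF_seqV)
qed

text \<open>Compression turns an added multiple of the unit into a multiple of the compressed unit,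
  which is eventually dominated by \<open>R\<close> times the unit. Starting from the error
  \<open>r / R\<close> therefore leaves at most \<open>r\<close>.\<close>

lemma PV_compF:
  assumes F: "PV n F"
  shows "PV m (compF seqV n \<alpha> F)"
  unfolding PV_def
proof (intro conjI allI impI)
  have h: "hermF seqV n F" using F by (simp add: PV_def)
  have comp_coh: "hermF seqV m (compF seqV n \<alpha> G)" if G: "hermF seqV n G" for G
  proof -
    have c: "\<And>i j. i < n \<Longrightarrow> j < n \<Longrightarrow> coherent (G i j)" using G by (simp add: hermF_seqV)
    then have "coherent (compF seqV n \<alpha> G i j)" for i j using V.compF_cl[of n G \<alpha> i j] by simp
    moreover have "hermF (S p) m (compF (S p) n \<alpha> (\<lambda>i j. G i j p))" for p
      using G by (intro S.K.hermF_compF) (simp add: hermF_seqV)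
    moreover have "compF seqV n \<alpha> G i j p = compF (S p) n \<alpha> (\<lambda>i j. G i j p) i j" for i j p
      by (rule compF_seqV[OF c])
    ultimately show ?thesis unfolding hermF_seqV by simp
  qed
  show "hermF seqV m (compF seqV n \<alpha> F)" by (rule comp_coh[OF h])
  fix r :: real assume r: "0 < r"
  have cE: "coherent (scalF seqV eV s i j)" for s i j
    unfolding scalF_def using coherent_smult[OF coherent_unit] coherent_zero by simp
  obtain R k where R: "R > 0" "\<And>p. p \<ge> k \<Longrightarrow> cone (S p) m (\<lambda>i j. EE p R i j \<ominus>\<^bsub>S p\<^esub> compF seqV n \<alpha> (scalF seqV eV 1) i j p)"
    using PV_order_exact[OF comp_coh[OF hermF_scal]] by blast
  have rR: "0 < r / R" using r R by simp
  obtain l where l: "\<And>p. p \<ge> l \<Longrightarrow> cone (S p) n (\<lambda>i j. F i j p \<oplus>\<^bsub>S p\<^esub> EE p (r / R) i j)"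
    using PVD[OF F rR] by blast
  have "cone (S p) m (\<lambda>i j. compF seqV n \<alpha> F i j p \<oplus>\<^bsub>S p\<^esub> EE p r i j)" if p: "p \<ge> max k l" for p
  proof -
    have cF: "F i j p \<in> carrier (S p)" if "i < n" "j < n" for i j using h that by (simp add: hermF_seqV)
    have pk: "p \<ge> k" and pl: "p \<ge> l" using p by auto
    have 1: "cone (S p) m (compF (S p) n \<alpha> (\<lambda>i j. F i j p \<oplus>\<^bsub>S p\<^esub> EE p (r / R) i j))"
      by (rule S.K.P_compF[OF l[OF pl]])
    have 2: "cone (S p) m (\<lambda>i j. complex_of_real (r / R) \<odot>\<^bsub>S p\<^esub> (EE p R i j \<ominus>\<^bsub>S p\<^esub> compF seqV n \<alpha> (scalF seqV eV 1) i j p))"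
      using rR by (intro S.K.P_scale R(2) pk) simp
    show ?thesis
    proof (rule S.K.P_cong[OF S.K.P_add[OF 1 2]])
      fix i j
      let ?C = "compF (S p) n \<alpha> (\<lambda>i j. F i j p) i j" and ?D = "compF (S p) n \<alpha> (EE p 1) i j"
      have cl: "?C \<in> carrier (S p)" "?D \<in> carrier (S p)" using cF by (auto intro: S.compF_cl)
      have a: "compF (S p) n \<alpha> (\<lambda>i j. F i j p \<oplus>\<^bsub>S p\<^esub> EE p (r / R) i j) i j =
          ?C \<oplus>\<^bsub>S p\<^esub> complex_of_real (r / R) \<odot>\<^bsub>S p\<^esub> ?D"
      proof -
        have e: "EE p (r / R) = (\<lambda>i j. complex_of_real (r / R) \<odot>\<^bsub>S p\<^esub> EE p 1 i j)"
          by (simp add: fun_eq_iff S.K.E_scale del: of_real_divide)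
        have "compF (S p) n \<alpha> (\<lambda>i j. F i j p \<oplus>\<^bsub>S p\<^esub> EE p (r / R) i j) i j = ?C \<oplus>\<^bsub>S p\<^esub> compF (S p) n \<alpha> (EE p (r / R)) i j"
          using cF by (intro S.compF_add) auto
        also have "compF (S p) n \<alpha> (EE p (r / R)) i j = complex_of_real (r / R) \<odot>\<^bsub>S p\<^esub> ?D"
          unfolding e by (rule S.compF_smult) simp
        finally show ?thesis .
      qed
      have b: "compF seqV n \<alpha> (scalF seqV eV 1) i j p = ?D"
        by (subst compF_seqV) (simp_all add: cE scalF_seqV)
      have c: "compF seqV n \<alpha> F i j p = ?C"
        using h by (intro compF_seqV) (simp add: hermF_seqV)
      have d: "complex_of_real (r / R) \<odot>\<^bsub>S p\<^esub> EE p R i j = EE p r i j"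
        using R(1) by (simp add: S.K.E_scale del: of_real_divide)
      show "compF seqV n \<alpha> F i j p \<oplus>\<^bsub>S p\<^esub> EE p r i j = compF (S p) n \<alpha> (\<lambda>i j. F i j p \<oplus>\<^bsub>S p\<^esub> EE p (r / R) i j) i j \<oplus>\<^bsub>S p\<^esub>
          complex_of_real (r / R) \<odot>\<^bsub>S p\<^esub> (EE p R i j \<ominus>\<^bsub>S p\<^esub> compF seqV n \<alpha> (scalF seqV eV 1) i j p)"
        unfolding a b c S.smult_diff[OF S.K.E_cl cl(2)] d using cl
        by (simp add: S.v_minus_eq S.v_ac S.v_r_neg1 S.v_r_neg2 S.v_r_neg del: of_real_divide)
    qed
  qed
  then show "\<exists>k. \<forall>p\<ge>k. cone (S p) m (\<lambda>i j. compF seqV n \<alpha> F i j p \<oplus>\<^bsub>S p\<^esub> EE p r i j)" by blast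
qed

lemma E_half: "EE m r i j = EE m (r/2) i j \<oplus>\<^bsub>S m\<^esub> EE m (r/2) i j"
  by (simp flip: S.K.E_add)

sublocale V: arch_cone seqV eV PV
proof
  show "PV n G" if F: "PV n F" and eq: "\<And>i j. \<lbrakk>i < n; j < n\<rbrakk> \<Longrightarrow> G i j = F i j" for n F G
    unfolding PV_def
  proof (intro conjI allI impI)
    show "hermF seqV n G" using F eq by (simp add: PV_def hermF_def)
    fix r :: real assume "0 < r"
    then obtain k where k: "\<And>m. m \<ge> k \<Longrightarrow> cone (S m) n (\<lambda>i j. F i j m \<oplus>\<^bsub>S m\<^esub> EE m r i j)" using PVD[OF F] by blast
    have "cone (S m) n (\<lambda>i j. G i j m \<oplus>\<^bsub>S m\<^esub> EE m r i j)" if "m \<ge> k" for m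
      by (rule S.K.P_cong[OF k[OF that]]) (simp add: eq)
    then show "\<exists>k. \<forall>m\<ge>k. cone (S m) n (\<lambda>i j. G i j m \<oplus>\<^bsub>S m\<^esub> EE m r i j)" by blast
  qed
  show "hermF seqV n F" if "PV n F" for n F using that by (simp add: PV_def)
  show "PV n (\<lambda>i j. F i j \<oplus>\<^bsub>seqV\<^esub> G i j)" if F: "PV n F" and G: "PV n G" for n F G
    unfolding PV_def
  proof (intro conjI allI impI)
    have h: "hermF seqV n F" "hermF seqV n G" using F G by (auto simp: PV_def)
    then show "hermF seqV n (\<lambda>i j. F i j \<oplus>\<^bsub>seqV\<^esub> G i j)"
      by (simp add: hermF_def coherent_add S.invol_add fun_eq_iff)
    fix r :: real assume "0 < r"
    then have r2: "0 < r/2" by simp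
    obtain k where k: "\<And>m. m \<ge> k \<Longrightarrow> cone (S m) n (\<lambda>i j. F i j m \<oplus>\<^bsub>S m\<^esub> EE m (r/2) i j)" using PVD[OF F r2] by blast
    obtain l where l: "\<And>m. m \<ge> l \<Longrightarrow> cone (S m) n (\<lambda>i j. G i j m \<oplus>\<^bsub>S m\<^esub> EE m (r/2) i j)" using PVD[OF G r2] by blast
    have "cone (S m) n (\<lambda>i j. (F i j \<oplus>\<^bsub>seqV\<^esub> G i j) m \<oplus>\<^bsub>S m\<^esub> EE m r i j)" if m: "m \<ge> max k l" for m
    proof (rule S.K.P_cong[OF S.K.P_add[OF k l]])
      fix i j assume ij: "i < n" "j < n"
      have "coherent (F i j)" "coherent (G i j)" using h ij by (simp_all add: hermF_seqV)
      then show "(F i j \<oplus>\<^bsub>seqV\<^esub> G i j) m \<oplus>\<^bsub>S m\<^esub> EE m r i j =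
        F i j m \<oplus>\<^bsub>S m\<^esub> EE m (r / 2) i j \<oplus>\<^bsub>S m\<^esub> (G i j m \<oplus>\<^bsub>S m\<^esub> EE m (r / 2) i j)"
        unfolding E_half[of m r] by (simp add: S.v_ac)
    qed (use m in auto)
    then show "\<exists>k. \<forall>m\<ge>k. cone (S m) n (\<lambda>i j. (F i j \<oplus>\<^bsub>seqV\<^esub> G i j) m \<oplus>\<^bsub>S m\<^esub> EE m r i j)" by blast
  qed
  show "PV m (\<lambda>i j. \<Oplus>\<^bsub>seqV\<^esub>k\<in>{..<n}. \<Oplus>\<^bsub>seqV\<^esub>l\<in>{..<n}. (cnj (\<alpha> k i) * \<alpha> l j) \<odot>\<^bsub>seqV\<^esub> F k l)"
    if "PV n F" for n F m \<alpha>
    using PV_compF[OF that, of m \<alpha>] by (simp add: compF_def[abs_def])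
  show "eV \<in> carrier seqV" "invol seqV eV = eV" by (simp_all add: coherent_unit S.ounit_herm)
  show "\<exists>r>0. PV n (\<lambda>i j. scalF seqV eV r i j \<ominus>\<^bsub>seqV\<^esub> F i j)" if F: "hermF seqV n F" for n F
  proof -
    obtain r k where r: "r > 0" "\<And>m. m \<ge> k \<Longrightarrow> cone (S m) n (\<lambda>i j. EE m r i j \<ominus>\<^bsub>S m\<^esub> F i j m)"
      using PV_order_exact[OF F] by blast
    have eq: "(scalF seqV eV r i j \<ominus>\<^bsub>seqV\<^esub> F i j) m = EE m r i j \<ominus>\<^bsub>S m\<^esub> F i j m" if "i < n" "j < n" for i j m
      using F hermF_scal[of n r] that by (subst seqV_diff) (auto simp: hermF_seqV scalF_seqV)
    have "PV n (\<lambda>i j. scalF seqV eV r i j \<ominus>\<^bsub>seqV\<^esub> F i j)"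
    proof (rule PV_exact)
      show "hermF seqV n (\<lambda>i j. scalF seqV eV r i j \<ominus>\<^bsub>seqV\<^esub> F i j)"
        using F hermF_scal[of n r] V.v_minus_cl by (simp add: hermF_def V.invol_diff del: seqV_simps)
      show "cone (S m) n (\<lambda>i j. (scalF seqV eV r i j \<ominus>\<^bsub>seqV\<^esub> F i j) m)" if "m \<ge> k" for m
        by (rule S.K.P_cong[OF r(2)[OF that]]) (rule eq)
    qed
    with r(1) show ?thesis by blast
  qed
  show "PV n F" if h: "hermF seqV n F" and *: "\<And>r. 0 < r \<Longrightarrow> PV n (\<lambda>i j. F i j \<oplus>\<^bsub>seqV\<^esub> scalF seqV eV r i j)" for n F
    unfolding PV_def
  proof (intro conjI allI impI h)
    fix r :: real assume "0 < r"
    then have r2: "0 < r/2" by simp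
    \<comment> \<open>One half of \<open>r\<close> is spent on the Archimedean hypothesis, the other
      on the slack in \<open>PV\<close>.\<close>
    obtain k where k: "\<And>m. m \<ge> k \<Longrightarrow> cone (S m) n (\<lambda>i j. (F i j \<oplus>\<^bsub>seqV\<^esub> scalF seqV eV (r/2) i j) m \<oplus>\<^bsub>S m\<^esub> EE m (r/2) i j)"
      using PVD[OF *[OF r2] r2] by blast
    have "cone (S m) n (\<lambda>i j. F i j m \<oplus>\<^bsub>S m\<^esub> EE m r i j)" if m: "m \<ge> k" for m
    proof (rule S.K.P_cong[OF k[OF m]])
      fix i j assume ij: "i < n" "j < n"
      have "coherent (F i j)" using h ij by (simp add: hermF_seqV)
      then show "F i j m \<oplus>\<^bsub>S m\<^esub> EE m r i j = (F i j \<oplus>\<^bsub>seqV\<^esub> scalF seqV eV (r / 2) i j) m \<oplus>\<^bsub>S m\<^esub> EE m (r / 2) i j"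
        unfolding E_half[of m r] by (simp add: S.v_ac scalF_seqV)
    qed
    then show "\<exists>k. \<forall>m\<ge>k. cone (S m) n (\<lambda>i j. F i j m \<oplus>\<^bsub>S m\<^esub> EE m r i j)" by blast
  qed
qed

end

context os_seq
begin

section \<open>The concrete limit operator system and its canonical maps\<close>

definition limV :: "(nat \<Rightarrow> 's) set opsys" where
  "limV = quot_opsys seqV {x \<in> carrier seqV. V.nr x = 0} eV PV"

definition clv :: "(nat \<Rightarrow> 's) \<Rightarrow> (nat \<Rightarrow> 's) set" where
  "clv = coset seqV {x \<in> carrier seqV. V.nr x = 0}"

lemmas limV_simps = V.Q_simps[folded limV_def clv_def, unfolded seqV_simps mem_Collect_eq]
lemmas cone_limV = V.cone_Q[folded limV_def clv_def]
lemmas cone_limV_lift = V.cone_Q_lift[folded limV_def clv_def]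

lemma operator_system_limV: "operator_system limV"
  unfolding limV_def by (rule V.operator_system_Q)

sublocale L: operator_system limV by (rule operator_system_limV)

lemma linear_clv: "linear_map seqV limV clv"
  unfolding limV_def clv_def by (rule V.linear_cl)

lemma hermF_blockF: "coherent x \<Longrightarrow> hermF seqV 2 (blockF seqV eV r x)"
  using coherent_smult[OF coherent_unit, of r] coherent_invol[of x]
  by (auto simp: hermF_def V.less_2 S.invol_invol S.invol_smult S.ounit_herm S.ounit_closed)

text \<open>Adding \<epsilon> times the unit to a block only replaces \<open>r\<close> by
  \<open>r + \<epsilon>\<close>. Thus the order norm of a sequence is governed by the norms at late
  levels.\<close>

lemma PV_block_iff:
  assumes x: "coherent x"
  shows "PV 2 (blockF seqV eV r x) \<longleftrightarrow> (\<forall>\<epsilon>>0. \<exists>k. \<forall>m\<ge>k. cone (S m) 2 (blockF (S m) (ounit (S m)) (r + \<epsilon>) (x m)))"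
proof -
  have "cone (S m) 2 (\<lambda>i j. blockF seqV eV r x i j m \<oplus>\<^bsub>S m\<^esub> EE m \<epsilon> i j) \<longleftrightarrow>
      cone (S m) 2 (blockF (S m) (ounit (S m)) (r + \<epsilon>) (x m))" for m \<epsilon>
  proof -
    have "blockF seqV eV r x i j m \<oplus>\<^bsub>S m\<^esub> EE m \<epsilon> i j = blockF (S m) (ounit (S m)) (r + \<epsilon>) (x m) i j" if "i < 2" "j < 2" for i j
      using x S.ounit_closed that by (auto simp: V.less_2 blockF_seqV scalF_def S.smult_plus S.invol_closed)
    then have "mat 2 2 (\<lambda>(i, j). blockF seqV eV r x i j m \<oplus>\<^bsub>S m\<^esub> EE m \<epsilon> i j) = mat 2 2 (\<lambda>(i, j). blockF (S m) (ounit (S m)) (r + \<epsilon>) (x m) i j)"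
      unfolding mat_fun_eq by blast
    then show ?thesis by (simp add: cone_def)
  qed
  then show ?thesis using hermF_blockF[OF x] by (simp add: PV_def)
qed

lemma nr_zero_iff:
  assumes x: "coherent x"
  shows "V.nr x = 0 \<longleftrightarrow> (\<forall>\<epsilon>>0. \<exists>k. \<forall>m\<ge>k. os_norm (S m) (x m) \<le> \<epsilon>)"
proof -
  have "V.nr x = 0 \<longleftrightarrow> V.nr x \<le> 0" using V.nr_nonneg[of x] x by auto
  also have "\<dots> \<longleftrightarrow> PV 2 (blockF seqV eV 0 x)" using x by (intro V.nr_le_iff) auto
  also have "\<dots> \<longleftrightarrow> (\<forall>\<epsilon>>0. \<exists>k. \<forall>m\<ge>k. os_norm (S m) (x m) \<le> \<epsilon>)"
    using x by (simp add: PV_block_iff S.os_norm_le_iff)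
  finally show ?thesis .
qed

lemma clv_eqI:
  assumes "coherent f" "coherent g" "\<And>n. n \<ge> k \<Longrightarrow> f n = g n"
  shows "clv f = clv g"
proof -
  have d: "coherent (\<lambda>n. f n \<ominus>\<^bsub>S n\<^esub> g n)" using V.v_minus_cl[of f g] assms(1,2) by (simp add: seqV_diff)
  have "V.nr (\<lambda>n. f n \<ominus>\<^bsub>S n\<^esub> g n) = 0"
    unfolding nr_zero_iff[OF d] using assms by (auto intro!: exI[of _ k])
  then show ?thesis unfolding clv_def using assms(1,2) d by (subst V.N.coset_eq) (auto simp: seqV_diff)
qed

definition cohv :: "nat \<Rightarrow> 's \<Rightarrow> nat \<Rightarrow> 's" where
  "cohv k a n = (if n < k then \<zero>\<^bsub>S n\<^esub> else tr \<phi> k (n - k) a)"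

lemma cohv_tr [simp]: "cohv k a (k + j) = tr \<phi> k j a"
  by (simp add: cohv_def)

lemma nat_add_cases:
  fixes n k :: nat
  obtains "n < k" | j where "n = k + j"
  using that by (cases "n < k") (auto dest: le_Suc_ex simp: not_less)

lemma coherent_cohv: assumes a: "a \<in> carrier (S k)" shows "coherent (cohv k a)"
proof -
  have "cohv k a n \<in> carrier (S n)" for n
    using T.closed[OF a, of "n - k"] by (cases "n < k") (simp_all add: cohv_def)
  moreover have "cohv k a (Suc n) = \<phi> n (cohv k a n)" if "n \<ge> k" for n
    using that by (simp add: cohv_def Suc_diff_le)
  ultimately show ?thesis unfolding coherent_def by blast
qed

definition canv :: "nat \<Rightarrow> 's \<Rightarrow> (nat \<Rightarrow> 's) set" where
  "canv k a = clv (cohv k a)"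

lemma canv_eqI:
  assumes "coherent f" "a \<in> carrier (S k)" "\<And>j. f (k + j) = tr \<phi> k j a"
  shows "clv f = canv k a"
  unfolding canv_def
proof (rule clv_eqI[of _ _ k])
  show "f n = cohv k a n" if "n \<ge> k" for n using assms(3)[of "n - k"] that by (simp add: cohv_def)
qed (use assms coherent_cohv in auto)

lemma canv_ucp: "ucp (S k) limV (canv k)"
proof (rule ucpI[OF systems])
  have add: "canv k (a \<oplus>\<^bsub>S k\<^esub> b) = canv k a \<oplus>\<^bsub>limV\<^esub> canv k b" if "a \<in> carrier (S k)" "b \<in> carrier (S k)" for a b
    using that canv_eqI[OF coherent_add[OF coherent_cohv coherent_cohv, of a k b k], of "a \<oplus>\<^bsub>S k\<^esub> b" k]
    by (simp add: T.add canv_def limV_simps coherent_cohv)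
  have smult: "canv k (c \<odot>\<^bsub>S k\<^esub> a) = c \<odot>\<^bsub>limV\<^esub> canv k a" if "a \<in> carrier (S k)" for a c
    using that canv_eqI[OF coherent_smult[OF coherent_cohv, of a k c], of "c \<odot>\<^bsub>S k\<^esub> a" k]
    by (simp add: T.smult canv_def limV_simps coherent_cohv)
  show "complex_linear (S k) limV (canv k)"
    unfolding complex_linear_def using add smult by (auto simp: canv_def limV_simps(1) coherent_cohv)
  show "canv k (ounit (S k)) = ounit limV"
    using canv_eqI[OF coherent_unit S.ounit_closed, of k] by (simp add: T.unit limV_simps)
  fix n F assume F: "cone (S k) n F"
  have h: "hermF (S k) n F" by (rule S.K.P_hermF[OF F])
  have m: "cone (S m) n (\<lambda>i j. cohv k (F i j) m)" for m
  proof (rule nat_add_cases[of m k])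
    assume "m < k"
    then show ?thesis using S.K.P_zero by (simp add: cohv_def)
  next
    fix j assume "m = k + j"
    then show ?thesis using T.cone[OF F, of j] by simp
  qed
  have "hermF seqV n (\<lambda>i j. cohv k (F i j))"
    unfolding hermF_seqV using S.K.P_hermF[OF m] hermFD(1)[OF h] coherent_cohv by blast
  moreover from this have "PV n (\<lambda>i j. cohv k (F i j))" using m by (intro PV_exact)
  ultimately show "cone limV n (\<lambda>i j. canv k (F i j))" unfolding canv_def using cone_limV by blast
qed

lemma canv_Suc:
  assumes "a \<in> carrier (S k)"
  shows "canv (Suc k) (\<phi> k a) = canv k a"
  unfolding canv_def
proof (rule clv_eqI)
  have cl: "\<phi> k a \<in> carrier (S (Suc k))" using T.closed[OF assms, of 1] by simp
  then show "coherent (cohv (Suc k) (\<phi> k a))" by (rule coherent_cohv)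
  fix n assume "n \<ge> Suc k"
  then obtain j where "n = Suc k + j" using le_Suc_ex by blast
  then show "cohv (Suc k) (\<phi> k a) n = cohv k a n"
    using cohv_tr[of "Suc k" "\<phi> k a" j] cohv_tr[of k a "Suc 0 + j"] tr_tr[of \<phi> k "Suc 0" j a] by simp
qed (fact coherent_cohv[OF assms])

text \<open>The block that witnesses the norm of the class lifts to \<open>PV\<close>, hence is
  positive at late levels once \<epsilon> is added to its diagonal.\<close>

lemma norm_canv_le:
  assumes a: "a \<in> carrier (S k)" and \<epsilon>: "0 < \<epsilon>"
  shows "\<exists>j. os_norm (S (k + j)) (tr \<phi> k j a) \<le> os_norm limV (canv k a) + \<epsilon>"
proof -
  interpret l: linear_map seqV limV clv by (rule linear_clv)
  let ?r = "os_norm limV (canv k a)"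
  have c: "coherent (cohv k a)" by (rule coherent_cohv[OF a])
  have cl: "canv k a \<in> carrier limV" using c by (simp add: canv_def limV_simps(1))
  have r: "0 \<le> ?r" by (rule L.N_nonneg[OF cl])
  have "cone limV 2 (blockF limV (ounit limV) ?r (canv k a))"
    using L.os_norm_le_iff[OF cl r] by simp
  moreover have "blockF limV (ounit limV) ?r (canv k a) = (\<lambda>i j. clv (blockF seqV eV ?r (cohv k a) i j))"
    using c coherent_unit by (simp add: blockF_def fun_eq_iff canv_def limV_simps)
  ultimately have "PV 2 (blockF seqV eV ?r (cohv k a))"
    using cone_limV[OF hermF_blockF[OF c]] by simp
  then obtain l where "\<And>m. m \<ge> l \<Longrightarrow> cone (S m) 2 (blockF (S m) (ounit (S m)) (?r + \<epsilon>) (cohv k a m))"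
    using PV_block_iff[OF c] \<epsilon> by blast
  from this[of "k + l"] have "cone (S (k + l)) 2 (blockF (S (k + l)) (ounit (S (k + l))) (?r + \<epsilon>) (tr \<phi> k l a))"
    by simp
  then show ?thesis using T.closed[OF a] r \<epsilon> by (intro exI[of _ l]) (simp add: S.os_norm_le_iff)
qed

end

section \<open>Mediating maps from the concrete limit operator system into cocones of arbitrary
  type\<close>

locale os_cocone = os_seq S \<phi> + R: operator_system R
  for S :: "nat \<Rightarrow> 's opsys" and \<phi> :: "nat \<Rightarrow> 's \<Rightarrow> 's" and R :: "'t opsys" +
  fixes \<beta> :: "nat \<Rightarrow> 's \<Rightarrow> 't"
  assumes \<beta>_ucp: "ucp (S k) R (\<beta> k)"
    and \<beta>_compat: "s \<in> carrier (S k) \<Longrightarrow> \<beta> (Suc k) (\<phi> k s) = \<beta> k s"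
begin

sublocale B: ucp_map "S k" R "\<beta> k" for k
  by (intro ucp_mapI systems R.operator_system_axioms \<beta>_ucp)

lemma \<beta>_tr: "s \<in> carrier (S k) \<Longrightarrow> \<beta> (k + j) (tr \<phi> k j s) = \<beta> k s"
  using tr_cocone(2)[of "\<lambda>k. carrier (S k)" \<phi> \<beta> s k j] T.closed[of _ _ 1] \<beta>_compat by simp

lemma \<beta>_eventually_const:
  assumes f: "coherent f"
  shows "\<exists>k. \<forall>n\<ge>k. \<beta> n (f n) = \<beta> k (f k)"
proof -
  obtain k where k: "\<forall>n\<ge>k. \<forall>j. f (n + j) = tr \<phi> n j (f n)" using coherent_tr[OF f] by blast
  have "\<beta> n (f n) = \<beta> k (f k)" if nk: "n \<ge> k" for n
  proof -
    obtain j where "n = k + j" using le_Suc_ex[OF nk] by blast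
    then show ?thesis using k f \<beta>_tr[of "f k" k j] by simp
  qed
  then show ?thesis by blast
qed

text \<open>Along a coherent sequence the values in the cocone become constant, so no limit is taken
  and \<open>R\<close> need not be complete.\<close>

definition medv :: "(nat \<Rightarrow> 's) set \<Rightarrow> 't" where
  "medv u = (SOME t. \<exists>f k. coherent f \<and> clv f = u \<and> (\<forall>n\<ge>k. \<beta> n (f n) = t))"

text \<open>The eventual value is bounded by the norms at arbitrarily late levels, which tend to 0.
  Applied to differences, this makes the eventual value depend only on the class.\<close>

lemma null_image:
  assumes f: "coherent f" and 0: "V.nr f = 0" and const: "\<And>n. n \<ge> k \<Longrightarrow> \<beta> n (f n) = t"
  shows "t = \<zero>\<^bsub>R\<^esub>"
proof -
  have t: "t \<in> carrier R" using const[of k] B.closed[of "f k" k] f by simp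
  have "os_norm R t \<le> \<epsilon>" if \<epsilon>: "0 < \<epsilon>" for \<epsilon>
  proof -
    obtain l where l: "\<And>m. m \<ge> l \<Longrightarrow> os_norm (S m) (f m) \<le> \<epsilon>" using 0 \<epsilon> unfolding nr_zero_iff[OF f] by blast
    show ?thesis using B.contractive[of "f (max k l)" "max k l"] l[of "max k l"] const[of "max k l"] f by simp
  qed
  then have "os_norm R t \<le> 0" by (meson dense_ge)
  then show ?thesis using R.N_eq_zero[OF t] R.N_nonneg[OF t] by simp
qed

lemma clv_eq_image:
  assumes f: "coherent f" and g: "coherent g" and eq: "clv f = clv g"
    and cf: "\<And>n. n \<ge> k \<Longrightarrow> \<beta> n (f n) = t" and cg: "\<And>n. n \<ge> l \<Longrightarrow> \<beta> n (g n) = s"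
  shows "t = s"
proof -
  have d: "coherent (\<lambda>n. f n \<ominus>\<^bsub>S n\<^esub> g n)" using V.v_minus_cl[of f g] f g by (simp add: seqV_diff)
  have "V.nr (\<lambda>n. f n \<ominus>\<^bsub>S n\<^esub> g n) = 0"
    using eq V.N.coset_eq[of f g] f g unfolding clv_def by (simp add: seqV_diff)
  then have "t \<ominus>\<^bsub>R\<^esub> s = \<zero>\<^bsub>R\<^esub>"
    using d
  proof (intro null_image)
    show "\<beta> n (f n \<ominus>\<^bsub>S n\<^esub> g n) = t \<ominus>\<^bsub>R\<^esub> s" if "n \<ge> max k l" for n
      using cf[of n] cg[of n] that f g by (simp add: B.diff)
  qed
  moreover have "t \<in> carrier R" "s \<in> carrier R"
    using cf[of k] cg[of l] B.closed[of "f k" k] B.closed[of "g l" l] f g by auto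
  ultimately show ?thesis by (simp add: R.diff_eq_zero)
qed

lemma medv_clv:
  assumes f: "coherent f"
  shows "\<exists>k. \<forall>n\<ge>k. \<beta> n (f n) = medv (clv f)"
proof -
  obtain k where k: "\<forall>n\<ge>k. \<beta> n (f n) = \<beta> k (f k)" using \<beta>_eventually_const[OF f] by blast
  then have "\<exists>t g l. coherent g \<and> clv g = clv f \<and> (\<forall>n\<ge>l. \<beta> n (g n) = t)" using f by blast
  then have "\<exists>g l. coherent g \<and> clv g = clv f \<and> (\<forall>n\<ge>l. \<beta> n (g n) = medv (clv f))"
    unfolding medv_def by (rule someI_ex)
  then obtain g l where g: "coherent g" "clv g = clv f" "\<forall>n\<ge>l. \<beta> n (g n) = medv (clv f)" by blast
  have eq: "medv (clv f) = \<beta> k (f k)"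
    using clv_eq_image[OF g(1) f g(2)] g(3) k by blast
  show ?thesis unfolding eq using k by blast
qed

lemma medv_eqI:
  assumes "coherent f" "\<And>n. n \<ge> k \<Longrightarrow> \<beta> n (f n) = t"
  shows "medv (clv f) = t"
proof -
  obtain l where l: "\<forall>n\<ge>l. \<beta> n (f n) = medv (clv f)" using medv_clv[OF assms(1)] by blast
  show ?thesis using l[rule_format, of "max k l"] assms(2)[of "max k l"] by simp
qed

lemma medv_canv:
  assumes "a \<in> carrier (S k)"
  shows "medv (canv k a) = \<beta> k a"
  unfolding canv_def
proof (rule medv_eqI[OF coherent_cohv[OF assms], of k])
  show "\<beta> n (cohv k a n) = \<beta> k a" if "n \<ge> k" for n
    using \<beta>_tr[OF assms, of "n - k"] that by (simp add: cohv_def)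
qed

lemma medv_cl: assumes "coherent f" shows "medv (clv f) \<in> carrier R"
proof -
  obtain k where "\<forall>n\<ge>k. \<beta> n (f n) = medv (clv f)" using medv_clv[OF assms] by blast
  then show ?thesis using B.closed[of "f k" k] assms by auto
qed

lemma medv_ucp: "ucp limV R medv"
proof (rule ucpI[OF operator_system_limV])
  have add: "medv (u \<oplus>\<^bsub>limV\<^esub> v) = medv u \<oplus>\<^bsub>R\<^esub> medv v" if uv: "u \<in> carrier limV" "v \<in> carrier limV" for u v
  proof -
    obtain f g where fg: "coherent f" "coherent g" "u = clv f" "v = clv g" using uv by (auto simp: limV_simps(1))
    obtain k where k: "\<forall>n\<ge>k. \<beta> n (f n) = medv (clv f)" using medv_clv[OF fg(1)] by blast
    obtain l where l: "\<forall>n\<ge>l. \<beta> n (g n) = medv (clv g)" using medv_clv[OF fg(2)] by blast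
    have "medv (clv (\<lambda>n. f n \<oplus>\<^bsub>S n\<^esub> g n)) = medv (clv f) \<oplus>\<^bsub>R\<^esub> medv (clv g)"
      using fg k l by (intro medv_eqI[of _ "max k l"] coherent_add) (simp_all add: B.add)
    then show ?thesis using fg by (simp add: limV_simps)
  qed
  have smult: "medv (c \<odot>\<^bsub>limV\<^esub> u) = c \<odot>\<^bsub>R\<^esub> medv u" if u: "u \<in> carrier limV" for u c
  proof -
    obtain f where f: "coherent f" "u = clv f" using u by (auto simp: limV_simps(1))
    obtain k where k: "\<forall>n\<ge>k. \<beta> n (f n) = medv (clv f)" using medv_clv[OF f(1)] by blast
    have "medv (clv (\<lambda>n. c \<odot>\<^bsub>S n\<^esub> f n)) = c \<odot>\<^bsub>R\<^esub> medv (clv f)"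
      using f k by (intro medv_eqI[of _ k] coherent_smult) (simp_all add: B.smult)
    then show ?thesis using f by (simp add: limV_simps)
  qed
  show "complex_linear limV R medv"
    unfolding complex_linear_def using add smult medv_cl by (auto simp: limV_simps(1))
  show "medv (ounit limV) = ounit R"
    unfolding limV_simps(3) by (rule medv_eqI[OF coherent_unit]) (rule B.unit)
  fix n G assume "cone limV n G"
  then obtain F where F: "PV n F" "\<And>i j. \<lbrakk>i < n; j < n\<rbrakk> \<Longrightarrow> G i j = clv (F i j)"
    by (rule cone_limV_lift) blast
  have h: "hermF seqV n F" by (rule V.P_hermF[OF F(1)])
  then have coh: "coherent (F i j)" if "i < n" "j < n" for i j using that by (simp add: hermF_seqV)
  have "\<exists>k. \<forall>m\<ge>k. medv (G i j) = \<beta> m (F i j m)" if "i < n" "j < n" for i j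
    using medv_clv[OF coh[OF that]] unfolding F(2)[OF that] by metis
  then obtain k where med: "\<And>i j m. \<lbrakk>i < n; j < n; k \<le> m\<rbrakk> \<Longrightarrow> medv (G i j) = \<beta> m (F i j m)"
    using uniform_index[of n "\<lambda>i j m. medv (G i j) = \<beta> m (F i j m)"] by blast
  have hk: "hermF R n (\<lambda>i j. \<beta> k (F i j k))"
    using h by (intro B.hermF) (simp add: hermF_seqV)
  have hG: "hermF R n (\<lambda>i j. medv (G i j))" using hk by (simp add: hermF_def med[of _ _ k])
  \<comment> \<open>Lifts are positive at their levels only after adding a multiple of the unit, so
    the Archimedean property of \<open>R\<close> has to conclude.\<close>
  show "cone R n (\<lambda>i j. medv (G i j))"
  proof (rule R.K.P_arch[OF hG])
    fix r :: real assume "0 < r"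
    then obtain l where l: "\<And>m. m \<ge> l \<Longrightarrow> cone (S m) n (\<lambda>i j. F i j m \<oplus>\<^bsub>S m\<^esub> EE m r i j)" using PVD[OF F(1)] by blast
    let ?m = "max k l"
    show "cone R n (\<lambda>i j. medv (G i j) \<oplus>\<^bsub>R\<^esub> scalF R (ounit R) r i j)"
    proof (rule R.K.P_cong[OF B.cone[OF l]])
      fix i j assume ij: "i < n" "j < n"
      show "medv (G i j) \<oplus>\<^bsub>R\<^esub> scalF R (ounit R) r i j = \<beta> ?m (F i j ?m \<oplus>\<^bsub>S ?m\<^esub> EE ?m r i j)"
        using med[OF ij, of ?m] coh[OF ij] by (simp add: B.add B.scalF)
    qed simp
  qed
qed

end

text \<open>As for C*-algebras, the given limit is a retract of the concrete one. That elements of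
  \<open>L\<close> come from all late levels reflects eventual coherence, and the summand
  \<open>r\<close> in the statement about cones is the slack in \<open>PV\<close>.\<close>

lemma os_inductive_limitD:
  fixes L :: "'u opsys" and S :: "nat \<Rightarrow> 's opsys"
  assumes sys: "os_seq S \<phi>"
    and lim1: "os_inductive_limit TYPE('u) S \<phi> L \<phi>i"
    and lim2: "os_inductive_limit TYPE((nat \<Rightarrow> 's) set) S \<phi> L \<phi>i"
  shows os_limit_union: "x \<in> carrier L \<Longrightarrow> \<exists>k. \<forall>n\<ge>k. \<exists>s\<in>carrier (S n). x = \<phi>i n s"
    and os_limit_cone: "\<lbrakk>cone L n G; 0 < r\<rbrakk> \<Longrightarrow> \<exists>k. \<forall>m\<ge>k. \<exists>F. cone (S m) n F \<and>
      (\<forall>i<n. \<forall>j<n. \<phi>i m (F i j) = G i j \<oplus>\<^bsub>L\<^esub> scalF L (ounit L) r i j)"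
    and os_limit_norm: "\<lbrakk>a \<in> carrier (S k); 0 < \<epsilon>\<rbrakk> \<Longrightarrow>
      \<exists>j. os_norm (S (k + j)) (tr \<phi> k j a) \<le> os_norm L (\<phi>i k a) + \<epsilon>"
    and os_limit_factor: "\<lbrakk>operator_system R; \<And>k. ucp (S k) R (\<beta> k);
        \<And>k s. s \<in> carrier (S k) \<Longrightarrow> \<beta> (Suc k) (\<phi> k s) = \<beta> k s\<rbrakk> \<Longrightarrow>
      \<exists>\<nu>. ucp L R \<nu> \<and> (\<forall>k. \<forall>s\<in>carrier (S k). \<nu> (\<phi>i k s) = \<beta> k s)"
proof -
  interpret os_seq S \<phi> by (rule sys)
  note l1 = lim1[unfolded os_inductive_limit_def] and l2 = lim2[unfolded os_inductive_limit_def]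
  have L: "operator_system L" by (rule l1[THEN conjunct1])
  have hom: "ucp (S k) L (\<phi>i k)" for k
    by (rule l1[THEN conjunct2, THEN conjunct1, THEN spec])
  have compat: "\<phi>i (Suc k) (\<phi> k a) = \<phi>i k a" if "a \<in> carrier (S k)" for k a
    using that by (rule l1[THEN conjunct2, THEN conjunct2, THEN conjunct1, THEN spec, THEN bspec])
  interpret i: os_cocone S \<phi> L \<phi>i
    by (intro os_cocone.intro os_cocone_axioms.intro sys L hom compat)
  have cone: "operator_system limV \<and> (\<forall>k. ucp (S k) limV (canv k)) \<and>
      (\<forall>k. \<forall>a\<in>carrier (S k). canv (Suc k) (\<phi> k a) = canv k a)"
    by (intro conjI allI ballI operator_system_limV canv_ucp canv_Suc)
  obtain \<mu> where m: "ucp L limV \<mu> \<and> (\<forall>k. \<forall>a\<in>carrier (S k). \<mu> (\<phi>i k a) = canv k a) \<and>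
      (\<forall>\<mu>'. ucp L limV \<mu>' \<and> (\<forall>k. \<forall>a\<in>carrier (S k). \<mu>' (\<phi>i k a) = canv k a) \<longrightarrow>
        (\<forall>x\<in>carrier L. \<mu>' x = \<mu> x))"
    by (rule exE[OF l2[THEN conjunct2, THEN conjunct2, THEN conjunct2, THEN spec, THEN spec, THEN mp, OF cone]])
  have \<mu>: "ucp L limV \<mu>" by (rule m[THEN conjunct1])
  have \<mu>_can: "\<mu> (\<phi>i k a) = canv k a" if "a \<in> carrier (S k)" for k a
    using that by (rule m[THEN conjunct2, THEN conjunct1, THEN spec, THEN bspec])
  interpret \<mu>: ucp_map L limV \<mu>
    using L operator_system_limV \<mu> by (rule ucp_mapI)
  have id: "i.medv (\<mu> x) = x" if x: "x \<in> carrier L" for x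
  proof -
    have *: "ucp L L (\<lambda>x. x) \<and> (\<forall>k. \<forall>a\<in>carrier (S k). \<phi>i k a = \<phi>i k a)"
      "ucp L L (\<lambda>x. i.medv (\<mu> x)) \<and> (\<forall>k. \<forall>a\<in>carrier (S k). i.medv (\<mu> (\<phi>i k a)) = \<phi>i k a)"
      using ucp_id[OF L] ucp_comp[OF \<mu> i.medv_ucp] by (auto simp: \<mu>_can i.medv_canv)
    have cone: "operator_system L \<and> (\<forall>k. ucp (S k) L (\<phi>i k)) \<and>
        (\<forall>k. \<forall>a\<in>carrier (S k). \<phi>i (Suc k) (\<phi> k a) = \<phi>i k a)"
      by (intro conjI allI ballI L hom compat)
    obtain \<mu>0 where u: "ucp L L \<mu>0 \<and> (\<forall>k. \<forall>a\<in>carrier (S k). \<mu>0 (\<phi>i k a) = \<phi>i k a) \<and>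
        (\<forall>\<mu>'. ucp L L \<mu>' \<and> (\<forall>k. \<forall>a\<in>carrier (S k). \<mu>' (\<phi>i k a) = \<phi>i k a) \<longrightarrow>
          (\<forall>x\<in>carrier L. \<mu>' x = \<mu>0 x))"
      by (rule exE[OF l1[THEN conjunct2, THEN conjunct2, THEN conjunct2, THEN spec, THEN spec, THEN mp, OF cone]])
    note u = u[THEN conjunct2, THEN conjunct2, THEN spec, THEN mp, THEN bspec]
    show ?thesis using u[OF *(1) x] u[OF *(2) x] by simp
  qed
  show "\<exists>k. \<forall>n\<ge>k. \<exists>s\<in>carrier (S n). x = \<phi>i n s" if x: "x \<in> carrier L"
  proof -
    have "\<mu> x \<in> carrier limV" using x by simp
    then obtain f where f: "coherent f" "\<mu> x = clv f" by (auto simp: limV_simps(1))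
    obtain k where k: "\<forall>n\<ge>k. \<phi>i n (f n) = i.medv (clv f)" using i.medv_clv[OF f(1)] by blast
    have "x = \<phi>i n (f n)" if "n \<ge> k" for n using k[rule_format, OF that] id[OF x] f(2) by simp
    then show ?thesis using coherent_cl[OF f(1)] by blast
  qed
  show "\<exists>k. \<forall>m\<ge>k. \<exists>F. cone (S m) n F \<and> (\<forall>i<n. \<forall>j<n. \<phi>i m (F i j) = G i j \<oplus>\<^bsub>L\<^esub> scalF L (ounit L) r i j)"
    if G: "cone L n G" and r: "0 < r"
  proof -
    \<comment> \<open>Positivity is carried to the concrete limit by \<mu>, where it has lifts;
      mapping these lifts into \<open>L\<close> recovers \<open>G\<close> by the retraction
      identity.\<close>
    obtain F where F: "PV n F" "\<And>i j. \<lbrakk>i < n; j < n\<rbrakk> \<Longrightarrow> \<mu> (G i j) = clv (F i j)"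
      using \<mu>.cone[OF G] by (rule cone_limV_lift) blast
    have coh: "coherent (F i j)" if "i < n" "j < n" for i j
      using V.P_hermF[OF F(1)] that by (simp add: hermF_seqV)
    have G_eq: "G i j = i.medv (clv (F i j))" if "i < n" "j < n" for i j
      using id[OF i.R.K.P_cl[OF G that]] F(2)[OF that] by simp
    have "\<exists>k. \<forall>m\<ge>k. \<phi>i m (F i j m) = G i j" if "i < n" "j < n" for i j
      using i.medv_clv[OF coh[OF that]] unfolding G_eq[OF that] .
    then obtain k where K: "\<And>i j m. \<lbrakk>i < n; j < n; k \<le> m\<rbrakk> \<Longrightarrow> \<phi>i m (F i j m) = G i j"
      using uniform_index[of n "\<lambda>i j m. \<phi>i m (F i j m) = G i j"] by blast
    obtain l where l: "\<And>m. m \<ge> l \<Longrightarrow> cone (S m) n (\<lambda>i j. F i j m \<oplus>\<^bsub>S m\<^esub> EE m r i j)" using PVD[OF F(1) r] by blast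
    have "cone (S m) n (\<lambda>i j. F i j m \<oplus>\<^bsub>S m\<^esub> EE m r i j) \<and>
      (\<forall>i<n. \<forall>j<n. \<phi>i m (F i j m \<oplus>\<^bsub>S m\<^esub> EE m r i j) = G i j \<oplus>\<^bsub>L\<^esub> scalF L (ounit L) r i j)" if m: "m \<ge> max k l" for m
    proof (intro conjI allI impI)
      show "cone (S m) n (\<lambda>i j. F i j m \<oplus>\<^bsub>S m\<^esub> EE m r i j)" using l m by simp
      fix i j assume ij: "i < n" "j < n"
      have "k \<le> m" using m by simp
      then show "\<phi>i m (F i j m \<oplus>\<^bsub>S m\<^esub> EE m r i j) = G i j \<oplus>\<^bsub>L\<^esub> scalF L (ounit L) r i j"
        using K[OF ij] coh[OF ij] by (simp add: i.B.add i.B.scalF)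
    qed
    then show ?thesis by blast
  qed
  show "\<exists>j. os_norm (S (k + j)) (tr \<phi> k j a) \<le> os_norm L (\<phi>i k a) + \<epsilon>" if a: "a \<in> carrier (S k)" "0 < \<epsilon>"
  proof -
    have "os_norm limV (canv k a) \<le> os_norm L (\<phi>i k a)"
      using \<mu>.contractive[of "\<phi>i k a"] i.B.closed[OF a(1)] \<mu>_can[OF a(1)] by simp
    moreover obtain j where "os_norm (S (k + j)) (tr \<phi> k j a) \<le> os_norm limV (canv k a) + \<epsilon>"
      using norm_canv_le[OF a] by (rule exE)
    ultimately have "os_norm (S (k + j)) (tr \<phi> k j a) \<le> os_norm L (\<phi>i k a) + \<epsilon>" by linarith
    then show ?thesis by (rule exI)
  qed
  show "\<exists>\<nu>. ucp L R \<nu> \<and> (\<forall>k. \<forall>a\<in>carrier (S k). \<nu> (\<phi>i k a) = \<beta> k a)"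
    if R: "operator_system R" "\<And>k. ucp (S k) R (\<beta> k)"
      "\<And>k a. a \<in> carrier (S k) \<Longrightarrow> \<beta> (Suc k) (\<phi> k a) = \<beta> k a"
  proof -
    interpret r: os_cocone S \<phi> R \<beta>
      by (intro os_cocone.intro os_cocone_axioms.intro sys R)
    show ?thesis using ucp_comp[OF \<mu> r.medv_ucp] by (auto simp: \<mu>_can r.medv_canv)
  qed
qed

section \<open>Operator C*-systems\<close>

text \<open>The matrix \<open>M^* . F . M\<close>, with the sums nested as in
  \<open>mat_ract\<close> applied after \<open>mat_lact\<close>.\<close>

definition actF :: "('s, 'a) ocsys \<Rightarrow> nat \<Rightarrow> (nat \<Rightarrow> nat \<Rightarrow> 'a) \<Rightarrow> (nat \<Rightarrow> nat \<Rightarrow> 's) \<Rightarrow> nat \<Rightarrow> nat \<Rightarrow> 's" where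
  "actF X n M F i j = (\<Oplus>\<^bsub>osys X\<^esub>k\<in>{..<n}. ract X (\<Oplus>\<^bsub>osys X\<^esub>l\<in>{..<n}. lact X (invol (calg X) (M l i)) (F l k)) (M k j))"

locale ocs_bimodule = bimodule "calg X" "osys X" "lact X" "ract X" for X :: "('s, 'a) ocsys"
begin

lemma actF_cl:
  assumes "\<And>i j. \<lbrakk>i < n; j < n\<rbrakk> \<Longrightarrow> M i j \<in> carrier (calg X)" "\<And>i j. \<lbrakk>i < n; j < n\<rbrakk> \<Longrightarrow> F i j \<in> carrier (osys X)"
    and "i < n" "j < n"
  shows "actF X n M F i j \<in> carrier (osys X)"
  unfolding actF_def using assms
  by (intro S.v_finsum_closed Pi_I r_closed l_closed A.invol_closed) auto

lemma mat_act:
  assumes M: "\<And>i j. \<lbrakk>i < n; j < n\<rbrakk> \<Longrightarrow> M i j \<in> carrier (calg X)"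
    and F: "\<And>i j. \<lbrakk>i < n; j < n\<rbrakk> \<Longrightarrow> F i j \<in> carrier (osys X)"
  shows "mat_ract X (mat_lact X (mat_invol (calg X) (mat n n (\<lambda>(i, j). M i j))) (mat n n (\<lambda>(i, j). F i j))) (mat n n (\<lambda>(i, j). M i j))
    = mat n n (\<lambda>(i, j). actF X n M F i j)"
proof -
  have inv: "mat_invol (calg X) (mat n n (\<lambda>(i, j). M i j)) = mat n n (\<lambda>(i, j). invol (calg X) (M j i))"
    by (intro eq_matI) (auto simp: mat_invol_def)
  have l: "mat_lact X (mat n n (\<lambda>(i, j). invol (calg X) (M j i))) (mat n n (\<lambda>(i, j). F i j)) =
      mat n n (\<lambda>(i, j). \<Oplus>\<^bsub>osys X\<^esub>l\<in>{..<n}. lact X (invol (calg X) (M l i)) (F l j))"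
  proof (rule eq_matI)
    fix i j assume "i < dim_row (mat n n (\<lambda>(i, j). \<Oplus>\<^bsub>osys X\<^esub>l\<in>{..<n}. lact X (invol (calg X) (M l i)) (F l j)))"
      "j < dim_col (mat n n (\<lambda>(i, j). \<Oplus>\<^bsub>osys X\<^esub>l\<in>{..<n}. lact X (invol (calg X) (M l i)) (F l j)))"
    then have ij: "i < n" "j < n" by auto
    have "(\<Oplus>\<^bsub>osys X\<^esub>k\<in>{..<n}. lact X (mat n n (\<lambda>(i, j). invol (calg X) (M j i)) $$ (i, k)) (mat n n (\<lambda>(i, j). F i j) $$ (k, j)))
      = (\<Oplus>\<^bsub>osys X\<^esub>l\<in>{..<n}. lact X (invol (calg X) (M l i)) (F l j))"
      using M F ij by (intro S.v_finsum_cong') (auto intro!: l_closed A.invol_closed)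
    then show "mat_lact X (mat n n (\<lambda>(i, j). invol (calg X) (M j i))) (mat n n (\<lambda>(i, j). F i j)) $$ (i, j) =
      mat n n (\<lambda>(i, j). \<Oplus>\<^bsub>osys X\<^esub>l\<in>{..<n}. lact X (invol (calg X) (M l i)) (F l j)) $$ (i, j)"
      using ij by (simp add: mat_lact_def)
  qed (simp_all add: mat_lact_def)
  let ?G = "\<lambda>i j. \<Oplus>\<^bsub>osys X\<^esub>l\<in>{..<n}. lact X (invol (calg X) (M l i)) (F l j)"
  have G: "?G i j \<in> carrier (osys X)" if "i < n" "j < n" for i j
    using M F that by (intro S.v_finsum_closed Pi_I l_closed A.invol_closed) auto
  show ?thesis unfolding inv l
  proof (rule eq_matI)
    fix i j assume "i < dim_row (mat n n (\<lambda>(i, j). actF X n M F i j))" "j < dim_col (mat n n (\<lambda>(i, j). actF X n M F i j))"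
    then have ij: "i < n" "j < n" by auto
    have "(\<Oplus>\<^bsub>osys X\<^esub>k\<in>{..<n}. ract X (mat n n (\<lambda>(i, j). ?G i j) $$ (i, k)) (mat n n (\<lambda>(i, j). M i j) $$ (k, j)))
      = actF X n M F i j"
      unfolding actF_def using M G ij by (intro S.v_finsum_cong') (auto intro!: r_closed)
    then show "mat_ract X (mat n n (\<lambda>(i, j). ?G i j)) (mat n n (\<lambda>(i, j). M i j)) $$ (i, j) = mat n n (\<lambda>(i, j). actF X n M F i j) $$ (i, j)"
      using ij by (simp add: mat_ract_def)
  qed (simp_all add: mat_ract_def)
qed

lemma l_zero_left [simp]: assumes s: "s \<in> carrier (osys X)" shows "lact X \<zero>\<^bsub>calg X\<^esub> s = \<zero>\<^bsub>osys X\<^esub>"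
  using l_smult_left[of "\<zero>\<^bsub>calg X\<^esub>" s 0] s l_closed[of "\<zero>\<^bsub>calg X\<^esub>" s] by simp

lemma l_zero_right [simp]: assumes a: "a \<in> carrier (calg X)" shows "lact X a \<zero>\<^bsub>osys X\<^esub> = \<zero>\<^bsub>osys X\<^esub>"
  using l_smult_right[of a "\<zero>\<^bsub>osys X\<^esub>" 0] a l_closed[of a "\<zero>\<^bsub>osys X\<^esub>"] by simp

lemma r_zero_left [simp]: assumes a: "a \<in> carrier (calg X)" shows "ract X \<zero>\<^bsub>osys X\<^esub> a = \<zero>\<^bsub>osys X\<^esub>"
  using r_smult_left[of a "\<zero>\<^bsub>osys X\<^esub>" 0] a r_closed[of a "\<zero>\<^bsub>osys X\<^esub>"] by simp

lemma r_zero_right [simp]: assumes s: "s \<in> carrier (osys X)" shows "ract X s \<zero>\<^bsub>calg X\<^esub> = \<zero>\<^bsub>osys X\<^esub>"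
  using r_smult_right[of "\<zero>\<^bsub>calg X\<^esub>" s 0] s r_closed[of "\<zero>\<^bsub>calg X\<^esub>" s] by simp

lemma l_minus: "a \<in> carrier (calg X) \<Longrightarrow> b \<in> carrier (calg X) \<Longrightarrow> s \<in> carrier (osys X)
    \<Longrightarrow> lact X (a \<ominus>\<^bsub>calg X\<^esub> b) s = lact X a s \<ominus>\<^bsub>osys X\<^esub> lact X b s"
  using l_add_left[of a "(-1) \<odot>\<^bsub>calg X\<^esub> b" s] l_smult_left[of b s "-1"] l_closed[of b s]
  by (simp add: A.v_minus_eq S.v_minus_eq A.smult_neg1 S.smult_neg1)

end

lemma ocsI:
  assumes "operator_system (osys X)" "os_complete (osys X)" "cstar_algebra (calg X)"
    and bim: "bimodule (calg X) (osys X) (lact X) (ract X)"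
    and "\<And>a. a \<in> carrier (calg X) \<Longrightarrow> lact X a (ounit (osys X)) = ract X (ounit (osys X)) a"
    and act: "\<And>n F M. \<lbrakk>cone (osys X) n F; \<And>i j. \<lbrakk>i < n; j < n\<rbrakk> \<Longrightarrow> M i j \<in> carrier (calg X)\<rbrakk> \<Longrightarrow> cone (osys X) n (actF X n M F)"
  shows "ocs X"
  unfolding ocs_def
proof (intro conjI allI ballI assms(1-4))
  interpret S: operator_system "osys X" by fact
  interpret ocs_bimodule X using bim by (simp add: ocs_bimodule_def)
  fix n Y M assume Y: "Y \<in> pos (osys X) n" and M: "M \<in> mats (calg X) n"
  have Yc: "Y \<in> carrier_mat n n" using S.pos_carrier_mat[OF Y] .
  have Mc: "M \<in> carrier_mat n n" using M by (simp add: mats_def)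
  have cY: "cone (osys X) n (\<lambda>i j. Y $$ (i, j))" using Y S.pos_cone[OF Yc] by simp
  have cM: "M $$ (i, j) \<in> carrier (calg X)" if "i < n" "j < n" for i j
    using M Mc that by (auto simp: mats_def)
  have "mat_ract X (mat_lact X (mat_invol (calg X) M) Y) M = mat n n (\<lambda>(i, j). actF X n (\<lambda>i j. M $$ (i, j)) (\<lambda>i j. Y $$ (i, j)) i j)"
    using mat_act[of n "\<lambda>i j. M $$ (i, j)" "\<lambda>i j. Y $$ (i, j)", OF cM S.K.P_cl[OF cY]]
    by (simp only: mat_index[OF Mc] mat_index[OF Yc])
  then show "mat_ract X (mat_lact X (mat_invol (calg X) M) Y) M \<in> pos (osys X) n"
    using act[OF cY cM] by (simp add: cone_def)
qed (fact assms(5))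

locale ocs_obj =
  fixes X :: "('s, 'a) ocsys"
  assumes ocs: "ocs X"
begin

sublocale S: operator_system "osys X"
  using ocs by (simp add: ocs_def)

sublocale A: cstar_algebra "calg X"
  using ocs by (simp add: ocs_def)

sublocale ocs_bimodule X
  using ocs by (simp add: ocs_def ocs_bimodule_def)

lemma complete: "os_complete (osys X)"
  using ocs by (simp add: ocs_def)

lemma unit_comm: "a \<in> carrier (calg X) \<Longrightarrow> lact X a (ounit (osys X)) = ract X (ounit (osys X)) a"
  using ocs by (simp add: ocs_def)

lemma cone_actF:
  assumes F: "cone (osys X) n F" and M: "\<And>i j. \<lbrakk>i < n; j < n\<rbrakk> \<Longrightarrow> M i j \<in> carrier (calg X)"
  shows "cone (osys X) n (actF X n M F)"
proof -
  have "mat n n (\<lambda>(i, j). M i j) \<in> mats (calg X) n" using M by (simp add: mats_mat)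
  then have "mat_ract X (mat_lact X (mat_invol (calg X) (mat n n (\<lambda>(i, j). M i j))) (mat n n (\<lambda>(i, j). F i j))) (mat n n (\<lambda>(i, j). M i j)) \<in> pos (osys X) n"
    using ocs F unfolding ocs_def cone_def by blast
  then show ?thesis using mat_act[OF M S.K.P_cl[OF F]] by (simp add: cone_def)
qed

text \<open>The module positivity axiom for the diagonal matrix with entries \<open>d\<close>; only
  one summand survives in each of the two sums.\<close>

lemma cone_diag:
  assumes F: "cone (osys X) n F" and d: "\<And>i. i < n \<Longrightarrow> d i \<in> carrier (calg X)"
  shows "cone (osys X) n (\<lambda>i j. ract X (lact X (invol (calg X) (d i)) (F i j)) (d j))"
proof (rule S.K.P_cong[OF cone_actF[OF F, of "\<lambda>i j. if i = j then d i else \<zero>\<^bsub>calg X\<^esub>"]])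
  let ?M = "\<lambda>i j. if i = j then d i else \<zero>\<^bsub>calg X\<^esub>"
  fix i j assume ij: "i < n" "j < n"
  note cF = S.K.P_cl[OF F]
  have inner: "(\<Oplus>\<^bsub>osys X\<^esub>l\<in>{..<n}. lact X (invol (calg X) (?M l i)) (F l k)) = lact X (invol (calg X) (d i)) (F i k)" if k: "k < n" for k
  proof -
    have "(\<Oplus>\<^bsub>osys X\<^esub>l\<in>{..<n}. lact X (invol (calg X) (?M l i)) (F l k)) =
        (\<Oplus>\<^bsub>osys X\<^esub>l\<in>{..<n}. if i = l then lact X (invol (calg X) (d l)) (F l k) else \<zero>\<^bsub>osys X\<^esub>)"
      using cF d k by (intro S.v_finsum_cong') (auto intro!: l_closed A.invol_closed)
    also have "\<dots> = lact X (invol (calg X) (d i)) (F i k)"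
      using cF d k ij by (intro S.v_finsum_singleton) (auto intro!: l_closed A.invol_closed)
    finally show ?thesis .
  qed
  have cl: "lact X (invol (calg X) (d i)) (F i k) \<in> carrier (osys X)" if "k < n" for k
    using cF d that ij by (intro l_closed A.invol_closed) auto
  have "actF X n ?M F i j = (\<Oplus>\<^bsub>osys X\<^esub>k\<in>{..<n}. if j = k then ract X (lact X (invol (calg X) (d i)) (F i k)) (d k) else \<zero>\<^bsub>osys X\<^esub>)"
    unfolding actF_def
  proof (rule S.v_finsum_cong'[OF refl])
    show "(\<lambda>k. if j = k then ract X (lact X (invol (calg X) (d i)) (F i k)) (d k) else \<zero>\<^bsub>osys X\<^esub>) \<in> {..<n} \<rightarrow> carrier (osys X)"
      using cl d by (auto intro!: r_closed)
    fix k assume "k \<in> {..<n}"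
    then have k: "k < n" by simp
    show "ract X (\<Oplus>\<^bsub>osys X\<^esub>l\<in>{..<n}. lact X (invol (calg X) (?M l i)) (F l k)) (?M k j) =
      (if j = k then ract X (lact X (invol (calg X) (d i)) (F i k)) (d k) else \<zero>\<^bsub>osys X\<^esub>)"
      unfolding inner[OF k] using cl[OF k] by simp
  qed
  also have "\<dots> = ract X (lact X (invol (calg X) (d i)) (F i j)) (d j)"
    using cl d ij by (intro S.v_finsum_singleton) (auto intro!: r_closed)
  finally show "ract X (lact X (invol (calg X) (d i)) (F i j)) (d j) = actF X n ?M F i j" by simp
qed (use d in auto)

text \<open>The bimodule laws do not relate the actions to the involution. The relation is the
  hermitian symmetry of a positive block containing \<open>s\<close>, compressed by the diagonal
  matrix with entries the adjoint of \<open>a\<close> and 1.\<close>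

lemma invol_lact:
  assumes a: "a \<in> carrier (calg X)" and s: "s \<in> carrier (osys X)"
  shows "invol (osys X) (lact X a s) = ract X (invol (osys X) s) (invol (calg X) a)"
proof -
  obtain r where "cone (osys X) 2 (blockF (osys X) (ounit (osys X)) r s)" using S.K.bnd_exists[OF s] by blast
  from cone_diag[OF this, of "\<lambda>i. if i = 0 then invol (calg X) a else \<one>\<^bsub>calg X\<^esub>"] a
  have c: "cone (osys X) 2 (\<lambda>i j. ract X (lact X (invol (calg X) (if i = 0 then invol (calg X) a else \<one>\<^bsub>calg X\<^esub>))
      (blockF (osys X) (ounit (osys X)) r s i j)) (if j = 0 then invol (calg X) a else \<one>\<^bsub>calg X\<^esub>))"
    by (simp add: A.invol_closed)
  from S.K.P_herm[OF c, of 0 1] show ?thesis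
    using a s by (simp add: A.invol_invol A.invol_one l_one r_one l_closed S.invol_closed)
qed

lemma invol_ract:
  assumes a: "a \<in> carrier (calg X)" and s: "s \<in> carrier (osys X)"
  shows "invol (osys X) (ract X s a) = lact X (invol (calg X) a) (invol (osys X) s)"
proof -
  have "ract X s a = invol (osys X) (lact X (invol (calg X) a) (invol (osys X) s))"
    using invol_lact[of "invol (calg X) a" "invol (osys X) s"] a s
    by (simp add: A.invol_closed A.invol_invol S.invol_closed S.invol_invol)
  then show ?thesis using a s by (simp add: S.invol_invol l_closed A.invol_closed S.invol_closed)
qed

text \<open>If \<open>\<parallel>a\<parallel> < 1\<close> then \<open>1 - a a\<^sup>* = x\<^sup>2\<close> with \<open>x\<close> self-adjoint, so \<open>e - a e a\<^sup>* = x e x\<close> is positive.\<close>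

lemma lact_contractive:
  assumes a: "a \<in> carrier (calg X)" and 1: "nrm (calg X) a < 1" and s: "s \<in> carrier (osys X)"
  shows "os_norm (osys X) (lact X a s) \<le> os_norm (osys X) s"
proof -
  let ?A = "calg X" and ?S = "osys X" and ?e = "ounit (osys X)"
  let ?r = "os_norm ?S s"
  define c where "c = a \<otimes>\<^bsub>?A\<^esub> invol ?A a"
  have c: "c \<in> carrier ?A" "invol ?A c = c"
    using a by (simp_all add: c_def A.invol_closed A.invol_mult A.invol_invol)
  have "nrm ?A c \<le> nrm ?A a * nrm ?A a"
    using A.nrm_mult[of a "invol ?A a"] A.N_invol[OF a] a by (simp add: c_def A.invol_closed)
  also have "\<dots> < 1" using 1 A.nrm_nonneg[OF a] mult_strict_mono[of "nrm ?A a" 1 "nrm ?A a" 1] by simp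
  finally obtain x where x: "x \<in> carrier ?A" "invol ?A x = x" "x \<otimes>\<^bsub>?A\<^esub> x = \<one>\<^bsub>?A\<^esub> \<ominus>\<^bsub>?A\<^esub> c"
    using A.sqrt_one_minus[OF c] by blast
  have e: "?e \<in> carrier ?S" by (rule S.ounit_closed)
  have r: "0 \<le> ?r" by (rule S.N_nonneg[OF s])
  \<comment> \<open>Since the unit commutes with the algebra, all two-sided products around it can
    be collected on the left.\<close>
  have sandwich: "ract X (lact X b ?e) d = lact X (b \<otimes>\<^bsub>?A\<^esub> d) ?e" if "b \<in> carrier ?A" "d \<in> carrier ?A" for b d
    using that e by (simp add: l_r l_mult flip: unit_comm)
  have re: "ract X (lact X b (complex_of_real ?r \<odot>\<^bsub>?S\<^esub> ?e)) d = complex_of_real ?r \<odot>\<^bsub>?S\<^esub> lact X (b \<otimes>\<^bsub>?A\<^esub> d) ?e"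
    if "b \<in> carrier ?A" "d \<in> carrier ?A" for b d
    using that e by (simp add: l_smult_right r_smult_left l_closed sandwich)
  have "cone ?S 2 (blockF ?S ?e ?r s)" using S.os_norm_le_iff[OF s r] by simp
  \<comment> \<open>This puts \<open>lact X a s\<close> off the diagonal but leaves
    \<open>?r\<close> times \<open>a e a^*\<close> in the upper left corner.\<close>
  from cone_diag[OF this, of "\<lambda>i. if i = 0 then invol ?A a else \<one>\<^bsub>?A\<^esub>"] a
  have 1: "cone ?S 2 (\<lambda>i j. ract X (lact X (invol ?A (if i = 0 then invol ?A a else \<one>\<^bsub>?A\<^esub>))
      (blockF ?S ?e ?r s i j)) (if j = 0 then invol ?A a else \<one>\<^bsub>?A\<^esub>))"
    by (simp add: A.invol_closed)
  have "cone ?S 2 (scalF ?S ?e ?r)" by (rule S.K.P_E[OF r])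
  \<comment> \<open>The missing part of the corner is \<open>?r\<close> times \<open>x e x\<close>;
    the zero entry of the diagonal matrix leaves the other places unchanged.\<close>
  from cone_diag[OF this, of "\<lambda>i. if i = 0 then x else \<zero>\<^bsub>?A\<^esub>"] x
  have 2: "cone ?S 2 (\<lambda>i j. ract X (lact X (invol ?A (if i = 0 then x else \<zero>\<^bsub>?A\<^esub>))
      (scalF ?S ?e ?r i j)) (if j = 0 then x else \<zero>\<^bsub>?A\<^esub>))" by simp
  have "cone ?S 2 (blockF ?S ?e ?r (lact X a s))"
  proof (rule S.K.bndI[OF S.K.P_add[OF 1 2]])
    have "lact X (x \<otimes>\<^bsub>?A\<^esub> x) ?e = ?e \<ominus>\<^bsub>?S\<^esub> lact X c ?e"
      unfolding x(3) using c e by (simp add: l_minus l_one)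
    then have "complex_of_real ?r \<odot>\<^bsub>?S\<^esub> lact X c ?e \<oplus>\<^bsub>?S\<^esub> complex_of_real ?r \<odot>\<^bsub>?S\<^esub> lact X (x \<otimes>\<^bsub>?A\<^esub> x) ?e = complex_of_real ?r \<odot>\<^bsub>?S\<^esub> ?e"
      using c e l_closed[OF c(1) e] S.diff_add_cancel[of ?e "lact X c ?e"]
      by (simp add: S.v_ac flip: S.smult_dist)
    then show "ract X (lact X (invol ?A (if 0 = 0 then invol ?A a else \<one>\<^bsub>?A\<^esub>)) (blockF ?S ?e ?r s 0 0)) (if 0 = 0 then invol ?A a else \<one>\<^bsub>?A\<^esub>) \<oplus>\<^bsub>?S\<^esub>
        ract X (lact X (invol ?A (if 0 = 0 then x else \<zero>\<^bsub>?A\<^esub>)) (scalF ?S ?e ?r 0 0)) (if 0 = 0 then x else \<zero>\<^bsub>?A\<^esub>) = complex_of_real ?r \<odot>\<^bsub>?S\<^esub> ?e"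
      using a x e by (simp add: scalF_def re A.invol_closed A.invol_invol c_def)
  qed (use a x e s in \<open>simp_all add: scalF_def A.invol_invol A.invol_one A.invol_closed l_one r_one l_closed\<close>)
  then show ?thesis using S.os_norm_le_iff[OF l_closed[OF a s] r] by simp
qed

text \<open>Dividing \<open>a\<close> by any \<open>t\<close> above its norm reduces to
  \<open>lact_contractive\<close>; then \<open>t\<close> decreases to the norm.\<close>

lemma norm_lact:
  assumes a: "a \<in> carrier (calg X)" and s: "s \<in> carrier (osys X)"
  shows "os_norm (osys X) (lact X a s) \<le> nrm (calg X) a * os_norm (osys X) s"
proof -
  have "os_norm (osys X) (lact X a s) \<le> t * os_norm (osys X) s" if t: "nrm (calg X) a < t" for t
  proof -
    have t0: "0 < t" using t A.nrm_nonneg[OF a] by linarith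
    let ?b = "complex_of_real (1/t) \<odot>\<^bsub>calg X\<^esub> a"
    have "nrm (calg X) ?b < 1" using t t0 a by (simp add: A.nrm_smult norm_divide)
    then have "os_norm (osys X) (lact X ?b s) \<le> os_norm (osys X) s"
      using a s by (intro lact_contractive) auto
    then have "1/t * os_norm (osys X) (lact X a s) \<le> os_norm (osys X) s"
      using t0 a s by (simp add: l_smult_left S.N_smult l_closed norm_divide)
    then show ?thesis using t0 by (simp add: field_simps)
  qed
  note le = this
  show ?thesis
  \<comment> \<open>The passage to the infimum of \<open>t\<close> divides by the norm of
    \<open>s\<close>, so the value 0 is treated apart.\<close>
  proof (cases "os_norm (osys X) s = 0")
    case True
    then show ?thesis using le[of "nrm (calg X) a + 1"] by simp
  next
    case False
    then have p: "0 < os_norm (osys X) s" using S.N_nonneg[OF s] by simp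
    have "os_norm (osys X) (lact X a s) / os_norm (osys X) s \<le> nrm (calg X) a"
      by (rule dense_ge) (use le p in \<open>simp add: field_simps\<close>)
    then show ?thesis using p by (simp add: field_simps)
  qed
qed

text \<open>The involution exchanges the two actions and preserves both norms.\<close>

lemma norm_ract:
  assumes a: "a \<in> carrier (calg X)" and s: "s \<in> carrier (osys X)"
  shows "os_norm (osys X) (ract X s a) \<le> nrm (calg X) a * os_norm (osys X) s"
proof -
  have "os_norm (osys X) (ract X s a) = os_norm (osys X) (lact X (invol (calg X) a) (invol (osys X) s))"
    using S.N_invol[OF r_closed[OF a s]] by (simp add: invol_ract[OF a s])
  also have "\<dots> \<le> nrm (calg X) a * os_norm (osys X) s"
    using norm_lact[of "invol (calg X) a" "invol (osys X) s"] a s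
    by (simp add: A.invol_closed S.invol_closed A.N_invol S.N_invol)
  finally show ?thesis .
qed

end

section \<open>Completions\<close>

text \<open>The block matrix of size \<open>2 * n\<close> from \<open>mnorm\<close>, with
  \<open>r\<close> times the unit matrix on the diagonal and \<open>F\<close> and its adjoint off
  it.\<close>

definition bigF :: "'s opsys \<Rightarrow> nat \<Rightarrow> real \<Rightarrow> (nat \<Rightarrow> nat \<Rightarrow> 's) \<Rightarrow> nat \<Rightarrow> nat \<Rightarrow> 's" where
  "bigF S n r F i j = (if i < n then if j < n then scalF S (ounit S) r i j else F i (j - n)
     else if j < n then invol S (F j (i - n)) else scalF S (ounit S) r (i - n) (j - n))"

context operator_system
begin

lemma mnorm_eq: "mnorm S (mat n n (\<lambda>(i, j). F i j)) = Inf {r. 0 \<le> r \<and> cone S (2 * n) (bigF S n r F)}"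
proof -
  have "four_block_mat (mscale S r (munit S n)) (mat n n (\<lambda>(i, j). F i j)) (mat_invol S (mat n n (\<lambda>(i, j). F i j)))
      (mscale S r (munit S n)) = mat (2 * n) (2 * n) (\<lambda>(i, j). bigF S n r F i j)" for r
    unfolding mscale_munit[OF star_vector_space_axioms ounit_closed]
    by (intro eq_matI) (auto simp: bigF_def mat_invol_def)
  then show ?thesis by (simp add: mnorm_def cone_def)
qed

text \<open>Select the coordinates \<open>i\<close> and \<open>n + j\<close> of the large block
  matrix.\<close>

lemma cone_big_entry:
  assumes c: "cone S (2 * n) (bigF S n r F)" and ij: "i < n" "j < n"
  shows "cone S 2 (blockF S (ounit S) r (F i j))"
  by (rule K.bndI[OF K.P_select[OF c, of 2 "\<lambda>a. if a = 0 then i else n + j" "\<lambda>_. 1"]])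
    (use ij ounit_closed K.P_cl[OF c, of i "n + j"] in \<open>auto simp: bigF_def scalF_def\<close>)

lemma cone_big_exists:
  assumes F: "\<And>i j. \<lbrakk>i < n; j < n\<rbrakk> \<Longrightarrow> F i j \<in> carrier S"
  shows "\<exists>r\<ge>0. cone S (2 * n) (bigF S n r F)"
proof -
  have "hermF S (2 * n) (bigF S n 0 F)"
    using F ounit_closed by (auto simp: hermF_def bigF_def scalF_def invol_closed invol_invol)
  then obtain r where r: "r > 0" "cone S (2 * n) (\<lambda>i j. scalF S (ounit S) r i j \<ominus> bigF S n 0 F i j)"
    using K.P_order by blast
  have "cone S (2 * n) (bigF S n r F)"
  proof (rule K.P_cong[OF K.P_select[OF r(2), of "2 * n" "\<lambda>i. i" "\<lambda>i. if i < n then 1 else -1"]])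
    fix i j assume "i < 2 * n" "j < 2 * n"
    then show "bigF S n r F i j = (cnj (if i < n then 1 else -1) * (if j < n then 1 else -1)) \<odot>\<^bsub>S\<^esub>
        (scalF S (ounit S) r i j \<ominus> bigF S n 0 F i j)"
      using F[of i "j - n"] F[of j "i - n"] ounit_closed
      by (auto simp: bigF_def scalF_def smult_neg1 v_minus_eq v_minus_minus invol_closed)
  qed simp
  with r(1) show ?thesis using less_imp_le by blast
qed

lemma entry_le_mnorm:
  assumes F: "\<And>i j. \<lbrakk>i < n; j < n\<rbrakk> \<Longrightarrow> F i j \<in> carrier S" and ij: "i < n" "j < n"
  shows "os_norm S (F i j) \<le> mnorm S (mat n n (\<lambda>(i, j). F i j))"
  unfolding mnorm_eq
proof (rule cInf_greatest)
  show "{r. 0 \<le> r \<and> cone S (2 * n) (bigF S n r F)} \<noteq> {}" using cone_big_exists[OF F] by auto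
  show "os_norm S (F i j) \<le> r" if "r \<in> {r. 0 \<le> r \<and> cone S (2 * n) (bigF S n r F)}" for r
    using that cone_big_entry[OF _ ij, of r F] F[OF ij] by (simp add: os_norm_le_iff)
qed

lemma mnorm_zero: "mnorm S (mat n n (\<lambda>(i, j). \<zero>)) = 0"
proof -
  have "bigF S n 0 (\<lambda>i j. \<zero>) = (\<lambda>i j. \<zero>)"
    using ounit_closed by (simp add: bigF_def scalF_def fun_eq_iff)
  then have "cone S (2 * n) (bigF S n 0 (\<lambda>i j. \<zero>))" using K.P_zero by simp
  then show ?thesis unfolding mnorm_eq
    by (intro cInf_eq_minimum) auto
qed

lemma nlim_os_complete:
  assumes "os_complete S" "\<And>n. f n \<in> carrier S"
    and "\<And>\<epsilon>. 0 < \<epsilon> \<Longrightarrow> \<exists>k. \<forall>m\<ge>k. \<forall>n\<ge>k. os_norm S (f m \<ominus> f n) < \<epsilon>"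
  shows "\<exists>x\<in>carrier S. os_nlim S f x"
proof -
  have "(\<forall>n. f n \<in> carrier S) \<longrightarrow> (\<forall>\<epsilon>>0. \<exists>k. \<forall>m\<ge>k. \<forall>n\<ge>k. os_norm S (f m \<ominus> f n) < \<epsilon>) \<longrightarrow>
     (\<exists>x\<in>carrier S. os_lim S f x)" using assms(1) unfolding os_complete_def by (rule spec)
  then show ?thesis using assms(2,3) by (simp add: os_lim_nlim)
qed

end

lemma os_completionD:
  assumes S: "operator_system S" and compl: "os_completion S \<iota> T"
  shows completion_opsys: "operator_system T" and completion_complete: "os_complete T"
    and completion_ucp: "ucp S T \<iota>"
    and completion_norm: "x \<in> carrier S \<Longrightarrow> os_norm T (\<iota> x) = os_norm S x"
    and completion_dense: "t \<in> carrier T \<Longrightarrow> \<exists>f. (\<forall>n. f n \<in> carrier S) \<and> os_nlim T (\<lambda>n. \<iota> (f n)) t"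
    and completion_cone: "cone T n G \<Longrightarrow> \<exists>Y. (\<forall>k. cone S n (Y k)) \<and>
      (\<forall>i<n. \<forall>j<n. os_nlim T (\<lambda>k. \<iota> (Y k i j)) (G i j))"
proof -
  note c = compl[unfolded os_completion_def]
  show T: "operator_system T" and "os_complete T"
    using c by blast+
  have lin: "complex_linear S T \<iota>" and unit: "\<iota> (ounit S) = ounit T" using c by blast+
  show "os_norm T (\<iota> x) = os_norm S x" if "x \<in> carrier S" using c that by blast
  show "\<exists>f. (\<forall>n. f n \<in> carrier S) \<and> os_nlim T (\<lambda>n. \<iota> (f n)) t" if "t \<in> carrier T"
    using c that unfolding os_lim_nlim by blast
  have pos: "pos T n = {X \<in> mats T n. \<exists>Y. (\<forall>k. Y k \<in> pos S n) \<and>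
        (\<lambda>k. mnorm T (msub T (map_mat \<iota> (Y k)) X)) \<longlonglongrightarrow> 0}" for n
    using c by blast
  interpret S: operator_system S by (rule S)
  interpret T: operator_system T by (rule T)
  interpret \<iota>: linear_map S T \<iota> by unfold_locales (rule lin)
  show "ucp S T \<iota>"
  proof (rule ucpI[OF S lin unit])
    fix n F assume F: "cone S n F"
    let ?Y = "mat n n (\<lambda>(i, j). F i j)" and ?X = "mat n n (\<lambda>(i, j). \<iota> (F i j))"
    \<comment> \<open>A positive matrix over \<open>S\<close> maps into the closed cone of
      \<open>T\<close> through the constant approximating sequence, whose distance is the norm of
      the zero matrix.\<close>
    have "msub T (map_mat \<iota> ?Y) ?X = mat n n (\<lambda>(i, j). \<zero>\<^bsub>T\<^esub>)"
      unfolding map_mat_mat msub_mat mat_fun_eq using S.K.P_cl[OF F] by simp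
    then have "mnorm T (msub T (map_mat \<iota> ?Y) ?X) = 0" by (simp only: T.mnorm_zero)
    moreover have "?X \<in> mats T n" using S.K.P_cl[OF F] by (simp add: mats_mat)
    ultimately have "?X \<in> pos T n"
      unfolding pos using F[unfolded cone_def] by (auto intro!: exI[of _ "\<lambda>_. ?Y"])
    then show "cone T n (\<lambda>i j. \<iota> (F i j))" by (simp add: cone_def)
  qed
  show "\<exists>Y. (\<forall>k. cone S n (Y k)) \<and> (\<forall>i<n. \<forall>j<n. os_nlim T (\<lambda>k. \<iota> (Y k i j)) (G i j))"
    if G: "cone T n G"
  proof -
    obtain Y where Y: "\<And>k. Y k \<in> pos S n"
      and lim: "(\<lambda>k. mnorm T (msub T (map_mat \<iota> (Y k)) (mat n n (\<lambda>(i, j). G i j)))) \<longlonglongrightarrow> 0"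
      using G unfolding cone_def pos by blast
    define F where "F k i j = Y k $$ (i, j)" for k i j
    have YF: "Y k = mat n n (\<lambda>(i, j). F k i j)" for k
      using mat_index[OF S.pos_carrier_mat[OF Y]] by (simp add: F_def)
    have F: "cone S n (F k)" for k using Y[of k] by (simp add: YF cone_def)
    have "os_nlim T (\<lambda>k. \<iota> (F k i j)) (G i j)" if ij: "i < n" "j < n" for i j
    proof (rule T.nlim_I[OF _ _ _ lim])
      show "\<iota> (F k i j) \<in> carrier T" for k using S.K.P_cl[OF F ij] by simp
      show "G i j \<in> carrier T" using T.K.P_cl[OF G ij] .
      show "os_norm T (\<iota> (F k i j) \<ominus>\<^bsub>T\<^esub> G i j) \<le> mnorm T (msub T (map_mat \<iota> (Y k)) (mat n n (\<lambda>(i, j). G i j)))" for k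
        unfolding YF map_mat_mat msub_mat
        using S.K.P_cl[OF F] T.K.P_cl[OF G] by (intro T.entry_le_mnorm ij) auto
    qed
    with F show ?thesis by blast
  qed
qed

section \<open>Bounded actions\<close>

text \<open>Left and right actions are treated together, the right one as
  \<open>\<lambda>a s. ract X s a\<close>. Multiplicativity is left out because the two sides
  compose in opposite order.\<close>

locale bounded_action = A: cstar_algebra A + S: operator_system S
  for A :: "'a cstar" and S :: "'s opsys" +
  fixes act :: "'a \<Rightarrow> 's \<Rightarrow> 's"
  assumes act_cl: "\<lbrakk>a \<in> carrier A; s \<in> carrier S\<rbrakk> \<Longrightarrow> act a s \<in> carrier S"
    and act_add_right: "\<lbrakk>a \<in> carrier A; s \<in> carrier S; t \<in> carrier S\<rbrakk> \<Longrightarrow> act a (s \<oplus>\<^bsub>S\<^esub> t) = act a s \<oplus>\<^bsub>S\<^esub> act a t"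
    and act_add_left: "\<lbrakk>a \<in> carrier A; b \<in> carrier A; s \<in> carrier S\<rbrakk> \<Longrightarrow> act (a \<oplus>\<^bsub>A\<^esub> b) s = act a s \<oplus>\<^bsub>S\<^esub> act b s"
    and act_smult_left: "\<lbrakk>a \<in> carrier A; s \<in> carrier S\<rbrakk> \<Longrightarrow> act (c \<odot>\<^bsub>A\<^esub> a) s = c \<odot>\<^bsub>S\<^esub> act a s"
    and act_smult_right: "\<lbrakk>a \<in> carrier A; s \<in> carrier S\<rbrakk> \<Longrightarrow> act a (c \<odot>\<^bsub>S\<^esub> s) = c \<odot>\<^bsub>S\<^esub> act a s"
    and norm_act: "\<lbrakk>a \<in> carrier A; s \<in> carrier S\<rbrakk> \<Longrightarrow> os_norm S (act a s) \<le> nrm A a * os_norm S s"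
begin

lemma act_diff:
  assumes "a \<in> carrier A" "b \<in> carrier A" "s \<in> carrier S" "t \<in> carrier S"
  shows "act a s \<ominus>\<^bsub>S\<^esub> act b t = act (a \<ominus>\<^bsub>A\<^esub> b) s \<oplus>\<^bsub>S\<^esub> act b (s \<ominus>\<^bsub>S\<^esub> t)"
proof -
  have 1: "act (a \<ominus>\<^bsub>A\<^esub> b) s = act a s \<ominus>\<^bsub>S\<^esub> act b s"
    using assms act_add_left[of a "(-1) \<odot>\<^bsub>A\<^esub> b" s] act_smult_left[of b s "-1"] act_cl[of b s]
    by (simp add: A.v_minus_eq S.v_minus_eq A.smult_neg1 S.smult_neg1)
  have 2: "act b (s \<ominus>\<^bsub>S\<^esub> t) = act b s \<ominus>\<^bsub>S\<^esub> act b t"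
    using assms act_add_right[of b s "(-1) \<odot>\<^bsub>S\<^esub> t"] act_smult_right[of b t "-1"] act_cl[of b t]
    by (simp add: S.v_minus_eq S.smult_neg1)
  show ?thesis unfolding 1 2 using assms by (intro S.diff_trans act_cl)
qed

lemma norm_act_diff:
  assumes "a \<in> carrier A" "b \<in> carrier A" "s \<in> carrier S" "t \<in> carrier S"
  shows "os_norm S (act a s \<ominus>\<^bsub>S\<^esub> act b t) \<le> nrm A (a \<ominus>\<^bsub>A\<^esub> b) * os_norm S s + nrm A b * os_norm S (s \<ominus>\<^bsub>S\<^esub> t)"
proof -
  have "os_norm S (act a s \<ominus>\<^bsub>S\<^esub> act b t) \<le> os_norm S (act (a \<ominus>\<^bsub>A\<^esub> b) s) + os_norm S (act b (s \<ominus>\<^bsub>S\<^esub> t))"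
    unfolding act_diff[OF assms] using assms by (intro S.N_triangle act_cl) auto
  also have "\<dots> \<le> nrm A (a \<ominus>\<^bsub>A\<^esub> b) * os_norm S s + nrm A b * os_norm S (s \<ominus>\<^bsub>S\<^esub> t)"
    using assms by (intro add_mono norm_act) auto
  finally show ?thesis .
qed

lemma nlim_act:
  assumes "\<And>n. f n \<in> carrier A" "\<And>n. g n \<in> carrier S" "a \<in> carrier A" "s \<in> carrier S"
    and "c_nlim A f a" "os_nlim S g s"
  shows "os_nlim S (\<lambda>n. act (f n) (g n)) (act a s)"
proof (rule S.nlim_I)
  show "os_norm S (act (f n) (g n) \<ominus>\<^bsub>S\<^esub> act a s) \<le>
      nrm A (f n \<ominus>\<^bsub>A\<^esub> a) * os_norm S (g n) + nrm A a * os_norm S (g n \<ominus>\<^bsub>S\<^esub> s)" for n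
    using assms by (intro norm_act_diff)
  have "(\<lambda>n. nrm A (f n \<ominus>\<^bsub>A\<^esub> a) * os_norm S (g n) + nrm A a * os_norm S (g n \<ominus>\<^bsub>S\<^esub> s)) \<longlonglongrightarrow>
      0 * os_norm S s + nrm A a * 0"
    using assms(5,6)[unfolded nlim_def] S.nlim_norm[OF assms(2,4,6)]
    by (intro tendsto_add tendsto_mult tendsto_const)
  then show "(\<lambda>n. nrm A (f n \<ominus>\<^bsub>A\<^esub> a) * os_norm S (g n) + nrm A a * os_norm S (g n \<ominus>\<^bsub>S\<^esub> s)) \<longlonglongrightarrow> 0" by simp
qed (use assms in \<open>auto intro: act_cl\<close>)

end

context ocs_obj
begin

sublocale l: bounded_action "calg X" "osys X" "lact X"
  by unfold_locales (fact l_closed l_add_right l_add_left l_smult_left l_smult_right norm_lact)+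

sublocale r: bounded_action "calg X" "osys X" "\<lambda>a s. ract X s a"
  by unfold_locales (fact r_closed r_add_left r_add_right r_smult_right r_smult_left norm_ract)+

end

locale ocs_morphism = X: ocs_obj X + Y: ocs_obj Y
  for X :: "('s, 'a) ocsys" and Y :: "('t, 'b) ocsys" +
  fixes \<phi> :: "'s \<Rightarrow> 't" and \<pi> :: "'a \<Rightarrow> 'b"
  assumes hom: "ocs_hom X Y \<phi> \<pi>"
begin

sublocale p: ucp_map "osys X" "osys Y" \<phi>
  by unfold_locales (use hom in \<open>simp add: ocs_hom_def\<close>)

sublocale h: cstar_morphism "calg X" "calg Y" \<pi>
  by unfold_locales (use hom in \<open>simp add: ocs_hom_def\<close>)

lemma both: "\<lbrakk>a \<in> carrier (calg X); b \<in> carrier (calg X); s \<in> carrier (osys X)\<rbrakk> \<Longrightarrow>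
    \<phi> (ract X (lact X a s) b) = ract Y (lact Y (\<pi> a) (\<phi> s)) (\<pi> b)"
  using hom by (simp add: ocs_hom_def)

lemma lact: "\<lbrakk>a \<in> carrier (calg X); s \<in> carrier (osys X)\<rbrakk> \<Longrightarrow> \<phi> (lact X a s) = lact Y (\<pi> a) (\<phi> s)"
  using both[of a "\<one>\<^bsub>calg X\<^esub>" s] by (simp add: h.one X.r_one Y.r_one X.l_closed Y.l_closed)

lemma ract: "\<lbrakk>a \<in> carrier (calg X); s \<in> carrier (osys X)\<rbrakk> \<Longrightarrow> \<phi> (ract X s a) = ract Y (\<phi> s) (\<pi> a)"
  using both[of "\<one>\<^bsub>calg X\<^esub>" a s] by (simp add: h.one X.l_one Y.l_one)

end

lemma ocs_morphismI: "ocs X \<Longrightarrow> ocs Y \<Longrightarrow> ocs_hom X Y \<phi> \<pi> \<Longrightarrow> ocs_morphism X Y \<phi> \<pi>"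
  by (simp add: ocs_morphism_def ocs_morphism_axioms_def ocs_obj_def)

lemma ocs_homI:
  assumes "ucp (osys X) (osys Y) \<phi>" "cstar_hom (calg X) (calg Y) \<pi>" and X: "ocs X"
    and l: "\<And>a s. \<lbrakk>a \<in> carrier (calg X); s \<in> carrier (osys X)\<rbrakk> \<Longrightarrow> \<phi> (lact X a s) = lact Y (\<pi> a) (\<phi> s)"
    and r: "\<And>a s. \<lbrakk>a \<in> carrier (calg X); s \<in> carrier (osys X)\<rbrakk> \<Longrightarrow> \<phi> (ract X s a) = ract Y (\<phi> s) (\<pi> a)"
  shows "ocs_hom X Y \<phi> \<pi>"
proof -
  interpret ocs_obj X by unfold_locales (rule X)
  show ?thesis unfolding ocs_hom_def using assms(1,2) by (simp add: l r l_closed)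
qed

section \<open>Inductive limits of operator C*-systems\<close>

locale ocs_system =
  fixes X :: "nat \<Rightarrow> ('s, 'a) ocsys" and \<phi> :: "nat \<Rightarrow> 's \<Rightarrow> 's" and \<pi> :: "nat \<Rightarrow> 'a \<Rightarrow> 'a"
  assumes sys: "ocs_inductive_system X \<phi> \<pi>"
begin

abbreviation "S k \<equiv> osys (X k)"
abbreviation "A k \<equiv> calg (X k)"

lemma objs: "ocs (X k)" and homs: "ocs_hom (X k) (X (Suc k)) (\<phi> k) (\<pi> k)"
  using sys by (auto simp: ocs_inductive_system_def)

sublocale X: ocs_obj "X k" for k
  by unfold_locales (rule objs)

lemma os_seq_S: "os_seq S \<phi>"
  using homs by unfold_locales (auto simp: ocs_hom_def X.S.operator_system_axioms)

lemma cstar_system_A: "cstar_system A \<pi>"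
  using homs by unfold_locales (auto simp: ocs_hom_def X.A.cstar_algebra_axioms)

lemma tr_hom: "ocs_hom (X k) (X (k + j)) (tr \<phi> k j) (tr \<pi> k j)"
proof (induction j)
  case 0
  show ?case using ucp_id[OF X.S.operator_system_axioms[of k]] cstar_hom_id[OF X.A.cstar_algebra_axioms[of k]]
    by (simp add: ocs_hom_def tr_fun del: tr.simps)
next
  case (Suc j)
  interpret f: ocs_morphism "X k" "X (k + j)" "tr \<phi> k j" "tr \<pi> k j"
    by (rule ocs_morphismI[OF objs objs Suc])
  interpret g: ocs_morphism "X (k + j)" "X (Suc (k + j))" "\<phi> (k + j)" "\<pi> (k + j)"
    by (rule ocs_morphismI[OF objs objs homs])
  have "ocs_hom (X k) (X (Suc (k + j))) (\<lambda>s. \<phi> (k + j) (tr \<phi> k j s)) (\<lambda>a. \<pi> (k + j) (tr \<pi> k j a))"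
    using ucp_comp[OF f.p.ucp g.p.ucp] cstar_hom_comp[OF f.h.hom g.h.hom]
    by (intro ocs_homI objs) (simp_all add: f.lact g.lact f.ract g.ract)
  then show ?case by (simp add: tr_fun del: tr.simps)
qed

sublocale T: ocs_morphism "X k" "X (k + j)" "tr \<phi> k j" "tr \<pi> k j" for k j
  by (intro ocs_morphismI objs tr_hom)

end

locale ocs_limit_data = ocs_system X \<phi> \<pi>
  for X :: "nat \<Rightarrow> ('s, 'a) ocsys" and \<phi> :: "nat \<Rightarrow> 's \<Rightarrow> 's" and \<pi> :: "nat \<Rightarrow> 'a \<Rightarrow> 'a" +
  fixes Sinf :: "'u opsys" and \<phi>inf :: "nat \<Rightarrow> 's \<Rightarrow> 'u"
    and Shat :: "'v opsys" and \<iota> :: "'u \<Rightarrow> 'v"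
    and Ahat :: "'w cstar" and \<pi>i :: "nat \<Rightarrow> 'a \<Rightarrow> 'w"
  assumes lim1: "os_inductive_limit TYPE('u) (\<lambda>k. osys (X k)) \<phi> Sinf \<phi>inf"
    and lim2: "os_inductive_limit TYPE((nat \<Rightarrow> 's) set) (\<lambda>k. osys (X k)) \<phi> Sinf \<phi>inf"
    and compl: "os_completion Sinf \<iota> Shat"
    and lim3: "cstar_inductive_limit TYPE('w) (\<lambda>k. calg (X k)) \<pi> Ahat \<pi>i"
    and lim4: "cstar_inductive_limit TYPE((nat \<Rightarrow> 'a) set) (\<lambda>k. calg (X k)) \<pi> Ahat \<pi>i"
begin

abbreviation "\<phi>i k \<equiv> \<iota> \<circ> \<phi>inf k"

lemmas os_union = os_limit_union[OF os_seq_S lim1 lim2]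
  and os_cone = os_limit_cone[OF os_seq_S lim1 lim2]
  and os_nrm = os_limit_norm[OF os_seq_S lim1 lim2]
  and os_factor = os_limit_factor[OF os_seq_S lim1 lim2]
  and c_dense = cstar_limit_dense[OF cstar_system_A lim3 lim4]
  and c_nrm = cstar_limit_norm[OF cstar_system_A lim3 lim4]
  and c_factor = cstar_limit_factor[OF cstar_system_A lim3 lim4]

lemma Sinf_opsys: "operator_system Sinf"
  using lim1[unfolded os_inductive_limit_def] by (rule conjunct1)

sublocale I: operator_system Sinf by (rule Sinf_opsys)

sublocale H: operator_system Shat by (rule completion_opsys[OF Sinf_opsys compl])

sublocale \<iota>: ucp_map Sinf Shat \<iota>
  by (intro ucp_mapI Sinf_opsys completion_opsys[OF Sinf_opsys compl] completion_ucp[OF Sinf_opsys compl])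

lemma Ahat_cstar: "cstar_algebra Ahat"
  using lim3[unfolded cstar_inductive_limit_def] by (rule conjunct1)

sublocale C: cstar_algebra Ahat by (rule Ahat_cstar)

lemma \<phi>inf_ucp: "ucp (S k) Sinf (\<phi>inf k)"
  by (rule lim1[unfolded os_inductive_limit_def, THEN conjunct2, THEN conjunct1, THEN spec])

lemma \<phi>inf_compat: "s \<in> carrier (S k) \<Longrightarrow> \<phi>inf (Suc k) (\<phi> k s) = \<phi>inf k s"
  by (rule lim1[unfolded os_inductive_limit_def, THEN conjunct2, THEN conjunct2, THEN conjunct1, THEN spec, THEN bspec])

lemma \<pi>i_hom: "cstar_hom (A k) Ahat (\<pi>i k)"
  by (rule lim3[unfolded cstar_inductive_limit_def, THEN conjunct2, THEN conjunct1, THEN spec])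

lemma \<pi>i_compat: "a \<in> carrier (A k) \<Longrightarrow> \<pi>i (Suc k) (\<pi> k a) = \<pi>i k a"
  by (rule lim3[unfolded cstar_inductive_limit_def, THEN conjunct2, THEN conjunct2, THEN conjunct1, THEN spec, THEN bspec])

sublocale inf: ucp_map "S k" Sinf "\<phi>inf k" for k
  by (intro ucp_mapI X.S.operator_system_axioms Sinf_opsys \<phi>inf_ucp)

lemma \<phi>i_ucp: "ucp (S k) Shat (\<phi>i k)"
  using ucp_comp[OF \<phi>inf_ucp \<iota>.ucp] by (simp add: comp_def)

sublocale \<phi>i: ucp_map "S k" Shat "\<phi>i k" for k
  by (intro ucp_mapI X.S.operator_system_axioms H.operator_system_axioms \<phi>i_ucp)

sublocale \<pi>i: cstar_morphism "A k" Ahat "\<pi>i k" for k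
  by (intro cstar_morphismI X.A.cstar_algebra_axioms Ahat_cstar \<pi>i_hom)

lemma \<phi>i_compat: "s \<in> carrier (S k) \<Longrightarrow> \<phi>i (Suc k) (\<phi> k s) = \<phi>i k s"
  by (simp add: \<phi>inf_compat)

lemma \<phi>i_tr: "s \<in> carrier (S k) \<Longrightarrow> \<phi>i (k + j) (tr \<phi> k j s) = \<phi>i k s"
  using tr_cocone(2)[of "\<lambda>k. carrier (S k)" \<phi> \<phi>i s k j] T.p.closed[of _ _ 1] \<phi>i_compat by simp

lemma \<pi>i_tr: "a \<in> carrier (A k) \<Longrightarrow> \<pi>i (k + j) (tr \<pi> k j a) = \<pi>i k a"
  using tr_cocone(2)[of "\<lambda>k. carrier (A k)" \<pi> \<pi>i a k j] T.h.closed[of _ _ 1] \<pi>i_compat by simp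

lemma norm_\<phi>i: "s \<in> carrier (S k) \<Longrightarrow> os_norm Shat (\<phi>i k s) = os_norm Sinf (\<phi>inf k s)"
  using completion_norm[OF Sinf_opsys compl, of "\<phi>inf k s"] by simp

lemma s_nrm:
  assumes s: "s \<in> carrier (S k)" and \<epsilon>: "0 < \<epsilon>"
  shows "\<exists>j. os_norm (S (k + j)) (tr \<phi> k j s) \<le> os_norm Shat (\<phi>i k s) + \<epsilon>"
  using os_nrm[OF s \<epsilon>] unfolding norm_\<phi>i[OF s] .

text \<open>Near an approximant from \<open>Sinf\<close> there are images from all late levels, so a
  single sequence with its \<open>n\<close>-th term at level \<open>n\<close> can be chosen.
  Approximations of several elements thereby share their levels.\<close>

lemma s_dense:
  assumes t: "t \<in> carrier Shat"
  shows "\<exists>g. (\<forall>n. g n \<in> carrier (S n)) \<and> os_nlim Shat (\<lambda>n. \<phi>i n (g n)) t"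
  unfolding nlim_def
proof (rule approximating_choice)
  show "carrier (S n) \<noteq> {}" for n using X.S.ounit_closed by blast
  show "0 \<le> os_norm Shat (\<phi>i n x \<ominus>\<^bsub>Shat\<^esub> t)" if "x \<in> carrier (S n)" for n x
    using that t \<phi>i.closed by (intro H.N_nonneg H.v_minus_cl)
  fix \<epsilon> :: real assume \<epsilon>: "0 < \<epsilon>"
  obtain f where f: "\<And>n. f n \<in> carrier Sinf" "os_nlim Shat (\<lambda>n. \<iota> (f n)) t"
    using completion_dense[OF Sinf_opsys compl t] by blast
  obtain n where n: "os_norm Shat (\<iota> (f n) \<ominus>\<^bsub>Shat\<^esub> t) < \<epsilon>"
    using order_tendstoD(2)[OF f(2)[unfolded nlim_def] \<epsilon>] by (auto simp: eventually_at_top_linorder)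
  obtain k where "\<forall>m\<ge>k. \<exists>s\<in>carrier (S m). f n = \<phi>inf m s" using os_union[OF f(1)] by blast
  then have "\<exists>x\<in>carrier (S m). os_norm Shat (\<phi>i m x \<ominus>\<^bsub>Shat\<^esub> t) < \<epsilon>" if "m \<ge> k" for m
    using that n by (metis comp_apply)
  then show "\<exists>k. \<forall>n\<ge>k. \<exists>x\<in>carrier (S n). os_norm Shat (\<phi>i n x \<ominus>\<^bsub>Shat\<^esub> t) < \<epsilon>" by blast
qed

text \<open>Two approximations are combined: the cones of the completion are closures of those of
  \<open>Sinf\<close>, and a positive matrix over \<open>Sinf\<close> comes from positive matrices
  at late levels after adding a small multiple of the unit. The sum \<open>d\<close> of the entry
  distances lets one choice serve all entries.\<close>

lemma cone_dense:
  assumes G: "cone Shat n G"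
  shows "\<exists>Z. (\<forall>m. cone (S m) n (Z m)) \<and>
    (\<forall>i<n. \<forall>j<n. os_nlim Shat (\<lambda>m. \<phi>i m (Z m i j)) (G i j))"
proof -
  define d where "d m F = (\<Sum>i<n. \<Sum>j<n. os_norm Shat (\<phi>i m (F i j) \<ominus>\<^bsub>Shat\<^esub> G i j))" for m F
  have cG: "G i j \<in> carrier Shat" if "i < n" "j < n" for i j using H.K.P_cl[OF G that] .
  have "\<exists>Z. (\<forall>m. Z m \<in> {F. cone (S m) n F}) \<and> (\<lambda>m. d m (Z m)) \<longlonglongrightarrow> 0"
  proof (rule approximating_choice)
    show "{F. cone (S m) n F} \<noteq> {}" for m using X.S.K.P_zero by blast
    show "0 \<le> d m F" if "F \<in> {F. cone (S m) n F}" for m F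
      unfolding d_def using that X.S.K.P_cl[of m n F] cG \<phi>i.closed
      by (intro sum_nonneg H.N_nonneg H.v_minus_cl) auto
    fix \<epsilon> :: real assume \<epsilon>: "0 < \<epsilon>"
    \<comment> \<open>Each entry will contribute at most \<open>2 * \<delta>\<close>, so the total
      is at most \<open>n * n * 2 * \<delta> < \<epsilon>\<close>. The summands 1 in
      \<open>c\<close> and in \<open>e + 1\<close> make the inequality strict and keep the divisors
      positive.\<close>
    define c where "c = real (n * n + 1)"
    have c: "0 < c" unfolding c_def of_nat_0_less_iff by simp
    define e where "e = os_norm Shat (ounit Shat)"
    have e: "0 \<le> e" unfolding e_def by (rule H.N_nonneg[OF H.ounit_closed])
    define \<delta> where "\<delta> = \<epsilon> / (2 * c)"
    define r where "r = \<delta> / (e + 1)"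
    have \<delta>: "0 < \<delta>" and r: "0 < r" using \<epsilon> c e by (simp_all add: \<delta>_def r_def)
    obtain Y where Y: "\<And>k. cone Sinf n (Y k)"
      and Ylim: "\<And>i j. i < n \<Longrightarrow> j < n \<Longrightarrow> os_nlim Shat (\<lambda>k. \<iota> (Y k i j)) (G i j)"
      using completion_cone[OF Sinf_opsys compl G] by blast
    have "\<forall>\<^sub>F k in sequentially. \<forall>i\<in>{..<n}. \<forall>j\<in>{..<n}. os_norm Shat (\<iota> (Y k i j) \<ominus>\<^bsub>Shat\<^esub> G i j) < \<delta>"
      using order_tendstoD(2)[OF Ylim[unfolded nlim_def] \<delta>] by (intro eventually_ball_finite ballI) auto
    then obtain k where k: "\<And>i j. \<lbrakk>i < n; j < n\<rbrakk> \<Longrightarrow> os_norm Shat (\<iota> (Y k i j) \<ominus>\<^bsub>Shat\<^esub> G i j) < \<delta>"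
      by (auto simp: eventually_at_top_linorder)
    obtain l where l: "\<And>m. m \<ge> l \<Longrightarrow> \<exists>F. cone (S m) n F \<and>
        (\<forall>i<n. \<forall>j<n. \<phi>inf m (F i j) = Y k i j \<oplus>\<^bsub>Sinf\<^esub> scalF Sinf (ounit Sinf) r i j)"
      using os_cone[OF Y r] by blast
    have "\<exists>F\<in>{F. cone (S m) n F}. d m F < \<epsilon>" if m: "m \<ge> l" for m
    proof -
      obtain F where F: "cone (S m) n F"
        "\<And>i j. i < n \<Longrightarrow> j < n \<Longrightarrow> \<phi>inf m (F i j) = Y k i j \<oplus>\<^bsub>Sinf\<^esub> scalF Sinf (ounit Sinf) r i j"
        using l[OF m] by blast
      have small: "os_norm Shat (\<phi>i m (F i j) \<ominus>\<^bsub>Shat\<^esub> G i j) \<le> 2 * \<delta>" if ij: "i < n" "j < n" for i j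
      proof -
        have cY: "Y k i j \<in> carrier Sinf" using I.K.P_cl[OF Y ij] .
        let ?E = "scalF Shat (ounit Shat) r i j"
        \<comment> \<open>The error splits into the distance in the completion and the added
          multiple of the unit; a zero is inserted so that \<open>H.N_add_diff\<close>
          applies.\<close>
        have "\<phi>i m (F i j) \<ominus>\<^bsub>Shat\<^esub> G i j = (\<iota> (Y k i j) \<oplus>\<^bsub>Shat\<^esub> ?E) \<ominus>\<^bsub>Shat\<^esub> (G i j \<oplus>\<^bsub>Shat\<^esub> \<zero>\<^bsub>Shat\<^esub>)"
          using F(2)[OF ij] cY cG[OF ij] by (simp add: \<iota>.add \<iota>.scalF)
        then have "os_norm Shat (\<phi>i m (F i j) \<ominus>\<^bsub>Shat\<^esub> G i j) \<le>
            os_norm Shat (\<iota> (Y k i j) \<ominus>\<^bsub>Shat\<^esub> G i j) + os_norm Shat (?E \<ominus>\<^bsub>Shat\<^esub> \<zero>\<^bsub>Shat\<^esub>)"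
          using H.N_add_diff[of "\<iota> (Y k i j)" ?E "G i j" "\<zero>\<^bsub>Shat\<^esub>"] cY cG[OF ij] by simp
        also have "os_norm Shat (?E \<ominus>\<^bsub>Shat\<^esub> \<zero>\<^bsub>Shat\<^esub>) \<le> r * e"
          using H.ounit_closed r e by (simp add: scalF_def H.N_smult e_def)
        also have "r * e \<le> \<delta>"
          using e \<delta> by (simp add: r_def field_simps)
        finally show ?thesis using k[OF ij] by simp
      qed
      have "d m F \<le> (\<Sum>i<n. \<Sum>j<n. 2 * \<delta>)"
        unfolding d_def by (intro sum_mono small) auto
      also have "\<dots> = real (n * n) * (2 * \<delta>)" by simp
      also have "\<dots> < c * (2 * \<delta>)" using \<delta> by (intro mult_strict_right_mono) (auto simp: c_def)
      also have "\<dots> = \<epsilon>" using c by (simp add: \<delta>_def)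
      finally show ?thesis using F(1) by blast
    qed
    then show "\<exists>k. \<forall>m\<ge>k. \<exists>F\<in>{F. cone (S m) n F}. d m F < \<epsilon>" by blast
  qed
  then obtain Z where Z: "\<And>m. cone (S m) n (Z m)" "(\<lambda>m. d m (Z m)) \<longlonglongrightarrow> 0" by blast
  have "os_nlim Shat (\<lambda>m. \<phi>i m (Z m i j)) (G i j)" if ij: "i < n" "j < n" for i j
  proof (rule H.nlim_I[OF _ _ _ Z(2)])
    note cZ = X.S.K.P_cl[OF Z(1)]
    show "\<phi>i m (Z m i j) \<in> carrier Shat" for m using cZ[OF ij] by (rule \<phi>i.closed)
    show "G i j \<in> carrier Shat" using cG[OF ij] .
    fix m
    have nn: "0 \<le> os_norm Shat (\<phi>i m (Z m i j) \<ominus>\<^bsub>Shat\<^esub> G i j)" if "i < n" "j < n" for i j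
      using cZ[OF that] cG[OF that] by (intro H.N_nonneg H.v_minus_cl \<phi>i.closed)
    have "os_norm Shat (\<phi>i m (Z m i j) \<ominus>\<^bsub>Shat\<^esub> G i j) \<le> (\<Sum>j<n. os_norm Shat (\<phi>i m (Z m i j) \<ominus>\<^bsub>Shat\<^esub> G i j))"
      using ij nn by (intro member_le_sum[of j "{..<n}" "\<lambda>j. os_norm Shat (\<phi>i m (Z m i j) \<ominus>\<^bsub>Shat\<^esub> G i j)"]) auto
    also have "\<dots> \<le> d m (Z m)"
      unfolding d_def using ij nn
      by (intro member_le_sum[of i "{..<n}" "\<lambda>i. \<Sum>j<n. os_norm Shat (\<phi>i m (Z m i j) \<ominus>\<^bsub>Shat\<^esub> G i j)"] sum_nonneg) auto
    finally show "os_norm Shat (\<phi>i m (Z m i j) \<ominus>\<^bsub>Shat\<^esub> G i j) \<le> d m (Z m)" .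
  qed
  with Z(1) show ?thesis by blast
qed

end

context ocs_limit_data
begin

section \<open>Compatibility of limits along the levels with the operations\<close>

lemma s_add_lim:
  assumes "\<And>n. g n \<in> carrier (S n)" "\<And>n. h n \<in> carrier (S n)" "s \<in> carrier Shat" "t \<in> carrier Shat"
    and "os_nlim Shat (\<lambda>n. \<phi>i n (g n)) s" "os_nlim Shat (\<lambda>n. \<phi>i n (h n)) t"
  shows "os_nlim Shat (\<lambda>n. \<phi>i n (g n \<oplus>\<^bsub>S n\<^esub> h n)) (s \<oplus>\<^bsub>Shat\<^esub> t)"
  unfolding \<phi>i.add[OF assms(1,2)]
  by (rule H.nlim_add[OF \<phi>i.closed[OF assms(1)] \<phi>i.closed[OF assms(2)] assms(3-6)])

lemma s_smult_lim:
  assumes "\<And>n. g n \<in> carrier (S n)" "s \<in> carrier Shat" "os_nlim Shat (\<lambda>n. \<phi>i n (g n)) s"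
  shows "os_nlim Shat (\<lambda>n. \<phi>i n (c \<odot>\<^bsub>S n\<^esub> g n)) (c \<odot>\<^bsub>Shat\<^esub> s)"
  unfolding \<phi>i.smult[OF assms(1)]
  by (rule H.nlim_smult[OF \<phi>i.closed[OF assms(1)] assms(2-3)])

lemma a_add_lim:
  assumes "\<And>n. f n \<in> carrier (A n)" "\<And>n. h n \<in> carrier (A n)" "a \<in> carrier Ahat" "b \<in> carrier Ahat"
    and "c_nlim Ahat (\<lambda>n. \<pi>i n (f n)) a" "c_nlim Ahat (\<lambda>n. \<pi>i n (h n)) b"
  shows "c_nlim Ahat (\<lambda>n. \<pi>i n (f n \<oplus>\<^bsub>A n\<^esub> h n)) (a \<oplus>\<^bsub>Ahat\<^esub> b)"
  unfolding \<pi>i.add[OF assms(1,2)]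
  by (rule C.nlim_add[OF \<pi>i.closed[OF assms(1)] \<pi>i.closed[OF assms(2)] assms(3-6)])

lemma a_smult_lim:
  assumes "\<And>n. f n \<in> carrier (A n)" "a \<in> carrier Ahat" "c_nlim Ahat (\<lambda>n. \<pi>i n (f n)) a"
  shows "c_nlim Ahat (\<lambda>n. \<pi>i n (c \<odot>\<^bsub>A n\<^esub> f n)) (c \<odot>\<^bsub>Ahat\<^esub> a)"
  unfolding \<pi>i.smult[OF assms(1)]
  by (rule C.nlim_smult[OF \<pi>i.closed[OF assms(1)] assms(2-3)])

lemma a_mult_lim:
  assumes "\<And>n. f n \<in> carrier (A n)" "\<And>n. h n \<in> carrier (A n)" "a \<in> carrier Ahat" "b \<in> carrier Ahat"
    and "c_nlim Ahat (\<lambda>n. \<pi>i n (f n)) a" "c_nlim Ahat (\<lambda>n. \<pi>i n (h n)) b"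
  shows "c_nlim Ahat (\<lambda>n. \<pi>i n (f n \<otimes>\<^bsub>A n\<^esub> h n)) (a \<otimes>\<^bsub>Ahat\<^esub> b)"
  unfolding \<pi>i.mult[OF assms(1,2)]
  by (rule C.nlim_mult[OF \<pi>i.closed[OF assms(1)] \<pi>i.closed[OF assms(2)] assms(3-6)])

lemma a_invol_lim:
  assumes "\<And>n. f n \<in> carrier (A n)" "a \<in> carrier Ahat" "c_nlim Ahat (\<lambda>n. \<pi>i n (f n)) a"
  shows "c_nlim Ahat (\<lambda>n. \<pi>i n (invol (A n) (f n))) (invol Ahat a)"
  unfolding \<pi>i.invol[OF assms(1)]
  by (rule C.nlim_invol[OF \<pi>i.closed[OF assms(1)] assms(2-3)])

end

text \<open>One construction for both sides: \<open>lim_act\<close> becomes \<open>lim_lact\<close>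
  or \<open>lim_ract\<close> according to the choice of \<open>act\<close>.\<close>

locale lim_action = ocs_limit_data X \<phi> \<pi> Sinf \<phi>inf Shat \<iota> Ahat \<pi>i
  for X :: "nat \<Rightarrow> ('s, 'a) ocsys" and \<phi> :: "nat \<Rightarrow> 's \<Rightarrow> 's" and \<pi> :: "nat \<Rightarrow> 'a \<Rightarrow> 'a"
    and Sinf :: "'u opsys" and \<phi>inf :: "nat \<Rightarrow> 's \<Rightarrow> 'u"
    and Shat :: "'v opsys" and \<iota> :: "'u \<Rightarrow> 'v"
    and Ahat :: "'w cstar" and \<pi>i :: "nat \<Rightarrow> 'a \<Rightarrow> 'w" +
  fixes act :: "nat \<Rightarrow> 'a \<Rightarrow> 's \<Rightarrow> 's"
  assumes action: "bounded_action (calg (X k)) (osys (X k)) (act k)"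
    and tr_act: "\<lbrakk>a \<in> carrier (calg (X k)); s \<in> carrier (osys (X k))\<rbrakk> \<Longrightarrow>
      tr \<phi> k j (act k a s) = act (k + j) (tr \<pi> k j a) (tr \<phi> k j s)"
begin

sublocale a: bounded_action "A k" "S k" "act k" for k by (rule action)

definition lim_act :: "'w \<Rightarrow> 'v \<Rightarrow> 'v" where
  "lim_act a s = (THE t. t \<in> carrier Shat \<and>
     (\<exists>m f g. approximates X Shat \<phi>i Ahat \<pi>i m f g a s \<and>
        os_lim Shat (\<lambda>n. \<phi>i (m n) (act (m n) (f n) (g n))) t))"

text \<open>At level \<open>k\<close> the action is bounded by the norms of that level. Moving to a
  later level changes neither image in the limit, and brings both level norms within \<epsilon> of
  the limit norms; then \<epsilon> tends to 0.\<close>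

lemma norm_act_limit:
  assumes a: "a \<in> carrier (A k)" and s: "s \<in> carrier (S k)"
  shows "os_norm Shat (\<phi>i k (act k a s)) \<le> nrm Ahat (\<pi>i k a) * os_norm Shat (\<phi>i k s)"
proof -
  let ?p = "nrm Ahat (\<pi>i k a)" and ?q = "os_norm Shat (\<phi>i k s)"
  have p: "0 \<le> ?p" and q: "0 \<le> ?q"
    by (rule C.nrm_nonneg[OF \<pi>i.closed[OF a]], rule H.N_nonneg[OF \<phi>i.closed[OF s]])
  have le: "os_norm Shat (\<phi>i k (act k a s)) \<le> (?p + \<epsilon>) * (?q + \<epsilon>)" if \<epsilon>: "0 < \<epsilon>" for \<epsilon>
  proof -
    obtain i where i: "nrm (A (k + i)) (tr \<pi> k i a) \<le> ?p + \<epsilon>" using c_nrm[OF a \<epsilon>] by blast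
    obtain j where j: "os_norm (S (k + j)) (tr \<phi> k j s) \<le> ?q + \<epsilon>" using s_nrm[OF s \<epsilon>] by blast
    \<comment> \<open>The element of the algebra needs \<open>i\<close> steps and the element of the
      system \<open>j\<close>; further steps preserve both bounds because connecting maps are
      contractive.\<close>
    let ?m = "i + j"
    let ?a = "tr \<pi> k ?m a" and ?s = "tr \<phi> k ?m s"
    have ca: "?a \<in> carrier (A (k + ?m))" and cs: "?s \<in> carrier (S (k + ?m))"
      using T.h.closed[OF a] T.p.closed[OF s] by auto
    have "nrm (A (k + i + j)) (tr \<pi> (k + i) j (tr \<pi> k i a)) \<le> nrm (A (k + i)) (tr \<pi> k i a)"
      by (rule T.h.contractive[OF T.h.closed[OF a]])
    then have na: "nrm (A (k + ?m)) ?a \<le> ?p + \<epsilon>"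
      using i unfolding tr_tr by (simp add: add.assoc)
    have "os_norm (S (k + j + i)) (tr \<phi> (k + j) i (tr \<phi> k j s)) \<le> os_norm (S (k + j)) (tr \<phi> k j s)"
      by (rule T.p.contractive[OF T.p.closed[OF s]])
    then have ns: "os_norm (S (k + ?m)) ?s \<le> ?q + \<epsilon>"
      using j unfolding tr_tr by (simp add: add.assoc add.commute[of j i])
    have "\<phi>i k (act k a s) = \<phi>i (k + ?m) (act (k + ?m) ?a ?s)"
      using \<phi>i_tr[OF a.act_cl[OF a s], of ?m] by (simp only: tr_act[OF a s])
    then have "os_norm Shat (\<phi>i k (act k a s)) \<le> os_norm (S (k + ?m)) (act (k + ?m) ?a ?s)"
      using \<phi>i.contractive[OF a.act_cl[OF ca cs]] by (simp only:)
    also have "\<dots> \<le> nrm (A (k + ?m)) ?a * os_norm (S (k + ?m)) ?s" by (rule a.norm_act[OF ca cs])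
    also have "\<dots> \<le> (?p + \<epsilon>) * (?q + \<epsilon>)"
      using na ns p \<epsilon> X.S.N_nonneg[OF cs] by (intro mult_mono) auto
    finally show ?thesis .
  qed
  have "((\<lambda>\<epsilon>. (?p + \<epsilon>) * (?q + \<epsilon>)) \<longlongrightarrow> (?p + 0) * (?q + 0)) (at_right 0)"
    by (intro tendsto_intros)
  then have "os_norm Shat (\<phi>i k (act k a s)) \<le> (?p + 0) * (?q + 0)"
    by (rule tendsto_lowerbound) (auto simp: eventually_at_right_less intro!: eventually_mono[OF eventually_at_right_less[of 0]] le[unfolded comp_apply])
  then show ?thesis by simp
qed

lemma push:
  assumes f: "f \<in> carrier (A k)" and g: "g \<in> carrier (S k)" and kl: "k \<le> l"
  obtains f' g' where "f' \<in> carrier (A l)" "g' \<in> carrier (S l)" "\<pi>i l f' = \<pi>i k f" "\<phi>i l g' = \<phi>i k g"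
    "\<phi>i l (act l f' g') = \<phi>i k (act k f g)"
proof -
  obtain j where l: "l = k + j" using le_Suc_ex[OF kl] by blast
  show ?thesis
  proof (rule that[of "tr \<pi> k j f" "tr \<phi> k j g"])
    show "\<phi>i l (act l (tr \<pi> k j f) (tr \<phi> k j g)) = \<phi>i k (act k f g)"
      unfolding l tr_act[OF f g, symmetric] by (rule \<phi>i_tr[OF a.act_cl[OF f g]])
  qed (unfold l, (rule T.h.closed[OF f] T.p.closed[OF g] \<pi>i_tr[OF f] \<phi>i_tr[OF g])+)
qed

text \<open>Both products are moved to the common level \<open>max k l\<close>, where their
  difference splits by bilinearity.\<close>

lemma act_limit_diff:
  assumes f: "f \<in> carrier (A k)" "f' \<in> carrier (A l)" and g: "g \<in> carrier (S k)" "g' \<in> carrier (S l)"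
  shows "os_norm Shat (\<phi>i k (act k f g) \<ominus>\<^bsub>Shat\<^esub> \<phi>i l (act l f' g')) \<le>
    nrm Ahat (\<pi>i k f \<ominus>\<^bsub>Ahat\<^esub> \<pi>i l f') * os_norm Shat (\<phi>i k g) + nrm Ahat (\<pi>i l f') * os_norm Shat (\<phi>i k g \<ominus>\<^bsub>Shat\<^esub> \<phi>i l g')"
proof -
  let ?m = "max k l"
  obtain a s where as: "a \<in> carrier (A ?m)" "s \<in> carrier (S ?m)" "\<pi>i ?m a = \<pi>i k f" "\<phi>i ?m s = \<phi>i k g"
    "\<phi>i ?m (act ?m a s) = \<phi>i k (act k f g)"
    using push[OF f(1) g(1), of ?m] by (metis max.cobounded1)
  obtain b t where bt: "b \<in> carrier (A ?m)" "t \<in> carrier (S ?m)" "\<pi>i ?m b = \<pi>i l f'" "\<phi>i ?m t = \<phi>i l g'"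
    "\<phi>i ?m (act ?m b t) = \<phi>i l (act l f' g')"
    using push[OF f(2) g(2), of ?m] by (metis max.cobounded2)
  have cl: "act ?m (a \<ominus>\<^bsub>A ?m\<^esub> b) s \<in> carrier (S ?m)" "act ?m b (s \<ominus>\<^bsub>S ?m\<^esub> t) \<in> carrier (S ?m)"
    "a \<ominus>\<^bsub>A ?m\<^esub> b \<in> carrier (A ?m)" "s \<ominus>\<^bsub>S ?m\<^esub> t \<in> carrier (S ?m)"
    using as bt by (auto intro!: a.act_cl)
  have "\<phi>i ?m (act ?m a s) \<ominus>\<^bsub>Shat\<^esub> \<phi>i ?m (act ?m b t) =
      \<phi>i ?m (act ?m (a \<ominus>\<^bsub>A ?m\<^esub> b) s) \<oplus>\<^bsub>Shat\<^esub> \<phi>i ?m (act ?m b (s \<ominus>\<^bsub>S ?m\<^esub> t))"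
    unfolding \<phi>i.diff[OF a.act_cl[OF as(1,2)] a.act_cl[OF bt(1,2)], symmetric] a.act_diff[OF as(1) bt(1) as(2) bt(2)]
    by (rule \<phi>i.add[OF cl(1,2)])
  then have "os_norm Shat (\<phi>i ?m (act ?m a s) \<ominus>\<^bsub>Shat\<^esub> \<phi>i ?m (act ?m b t)) \<le>
      os_norm Shat (\<phi>i ?m (act ?m (a \<ominus>\<^bsub>A ?m\<^esub> b) s)) + os_norm Shat (\<phi>i ?m (act ?m b (s \<ominus>\<^bsub>S ?m\<^esub> t)))"
    using H.N_triangle[OF \<phi>i.closed[OF cl(1)] \<phi>i.closed[OF cl(2)]] by (simp only:)
  also have "\<dots> \<le> nrm Ahat (\<pi>i ?m (a \<ominus>\<^bsub>A ?m\<^esub> b)) * os_norm Shat (\<phi>i ?m s) + nrm Ahat (\<pi>i ?m b) * os_norm Shat (\<phi>i ?m (s \<ominus>\<^bsub>S ?m\<^esub> t))"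
    using as bt cl by (intro add_mono norm_act_limit)
  finally show ?thesis
    unfolding \<pi>i.diff[OF as(1) bt(1)] \<phi>i.diff[OF as(2) bt(2)] as(3-5) bt(3-5) .
qed

lemma approximatesD:
  assumes "approximates X Shat \<phi>i Ahat \<pi>i m f g a s"
  shows "f n \<in> carrier (A (m n))" "g n \<in> carrier (S (m n))"
    "c_nlim Ahat (\<lambda>n. \<pi>i (m n) (f n)) a" "os_nlim Shat (\<lambda>n. \<phi>i (m n) (g n)) s"
  using assms unfolding approximates_def cstar_lim_nlim os_lim_nlim by blast+

text \<open>The indices \<open>n\<close> and \<open>p\<close> vary independently. Equal
  approximations then give the Cauchy property, and \<open>n = p\<close> gives independence of the
  choice of approximations.\<close>

lemma act_close:
  assumes a: "a \<in> carrier Ahat" and s: "s \<in> carrier Shat"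
    and ap: "approximates X Shat \<phi>i Ahat \<pi>i m f g a s" and ap': "approximates X Shat \<phi>i Ahat \<pi>i m' f' g' a s"
    and \<epsilon>: "0 < \<epsilon>"
  shows "\<exists>K. \<forall>n\<ge>K. \<forall>p\<ge>K. os_norm Shat (\<phi>i (m n) (act (m n) (f n) (g n)) \<ominus>\<^bsub>Shat\<^esub> \<phi>i (m' p) (act (m' p) (f' p) (g' p))) < \<epsilon>"
proof -
  note A = approximatesD[OF ap] and A' = approximatesD[OF ap']
  define c where "c = nrm Ahat a + os_norm Shat s + 1"
  have nn: "0 \<le> nrm Ahat a" "0 \<le> os_norm Shat s" using C.nrm_nonneg[OF a] H.N_nonneg[OF s] .
  then have c: "0 < c" by (simp add: c_def)
  \<comment> \<open>The final bound is \<open>4 * c * \<delta>\<close>, and the factor 5 makes it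
    strictly smaller than \<epsilon>. Since \<open>\<delta> \<le> 1\<close>, the constant
    \<open>c\<close> bounds the norms of the approximants themselves.\<close>
  define \<delta> where "\<delta> = min 1 (\<epsilon> / (5 * c))"
  have "\<delta> \<le> \<epsilon> / (5 * c)" by (simp add: \<delta>_def)
  then have "5 * c * \<delta> \<le> \<epsilon>" using c by (simp add: pos_le_divide_eq mult.commute)
  then have \<delta>: "0 < \<delta>" "\<delta> \<le> 1" "5 * c * \<delta> \<le> \<epsilon>" using \<epsilon> c by (simp_all add: \<delta>_def)
  have "\<forall>\<^sub>F n in sequentially. nrm Ahat (\<pi>i (m n) (f n) \<ominus>\<^bsub>Ahat\<^esub> a) < \<delta> \<and> nrm Ahat (\<pi>i (m' n) (f' n) \<ominus>\<^bsub>Ahat\<^esub> a) < \<delta>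
      \<and> os_norm Shat (\<phi>i (m n) (g n) \<ominus>\<^bsub>Shat\<^esub> s) < \<delta> \<and> os_norm Shat (\<phi>i (m' n) (g' n) \<ominus>\<^bsub>Shat\<^esub> s) < \<delta>"
    using order_tendstoD(2)[OF A(3)[unfolded nlim_def] \<delta>(1)] order_tendstoD(2)[OF A'(3)[unfolded nlim_def] \<delta>(1)]
      order_tendstoD(2)[OF A(4)[unfolded nlim_def] \<delta>(1)] order_tendstoD(2)[OF A'(4)[unfolded nlim_def] \<delta>(1)]
    by (intro eventually_conj)
  then obtain K where K: "\<And>n. n \<ge> K \<Longrightarrow> nrm Ahat (\<pi>i (m n) (f n) \<ominus>\<^bsub>Ahat\<^esub> a) < \<delta> \<and> nrm Ahat (\<pi>i (m' n) (f' n) \<ominus>\<^bsub>Ahat\<^esub> a) < \<delta>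
      \<and> os_norm Shat (\<phi>i (m n) (g n) \<ominus>\<^bsub>Shat\<^esub> s) < \<delta> \<and> os_norm Shat (\<phi>i (m' n) (g' n) \<ominus>\<^bsub>Shat\<^esub> s) < \<delta>"
    unfolding eventually_at_top_linorder by blast
  have "os_norm Shat (\<phi>i (m n) (act (m n) (f n) (g n)) \<ominus>\<^bsub>Shat\<^esub> \<phi>i (m' p) (act (m' p) (f' p) (g' p))) < \<epsilon>"
    if "n \<ge> K" "p \<ge> K" for n p
  proof -
    define u where "u = \<pi>i (m n) (f n)"
    define u' where "u' = \<pi>i (m' p) (f' p)"
    define v where "v = \<phi>i (m n) (g n)"
    define v' where "v' = \<phi>i (m' p) (g' p)"
    have cl: "u \<in> carrier Ahat" "u' \<in> carrier Ahat" "v \<in> carrier Shat" "v' \<in> carrier Shat"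
      unfolding u_def u'_def v_def v'_def
      by (rule \<pi>i.closed[OF A(1)] \<pi>i.closed[OF A'(1)] \<phi>i.closed[OF A(2)] \<phi>i.closed[OF A'(2)])+
    have k: "nrm Ahat (u \<ominus>\<^bsub>Ahat\<^esub> a) < \<delta>" "nrm Ahat (u' \<ominus>\<^bsub>Ahat\<^esub> a) < \<delta>"
      "os_norm Shat (v \<ominus>\<^bsub>Shat\<^esub> s) < \<delta>" "os_norm Shat (v' \<ominus>\<^bsub>Shat\<^esub> s) < \<delta>"
      using K[OF that(1)] K[OF that(2)] by (simp_all only: u_def u'_def v_def v'_def)
    have uu: "nrm Ahat (u \<ominus>\<^bsub>Ahat\<^esub> u') \<le> 2 * \<delta>"
      using C.N_diff_triangle[OF cl(1) a cl(2)] C.N_diff_commute[OF a cl(2)] k by simp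
    have vv: "os_norm Shat (v \<ominus>\<^bsub>Shat\<^esub> v') \<le> 2 * \<delta>"
      using H.N_diff_triangle[OF cl(3) s cl(4)] H.N_diff_commute[OF s cl(4)] k by simp
    have v: "os_norm Shat v \<le> c" using H.N_le_diff[OF cl(3) s] k \<delta>(2) nn by (simp add: c_def)
    have u: "nrm Ahat u' \<le> c" using C.N_le_diff[OF cl(2) a] k \<delta>(2) nn by (simp add: c_def)
    have "os_norm Shat (\<phi>i (m n) (act (m n) (f n) (g n)) \<ominus>\<^bsub>Shat\<^esub> \<phi>i (m' p) (act (m' p) (f' p) (g' p))) \<le>
        nrm Ahat (u \<ominus>\<^bsub>Ahat\<^esub> u') * os_norm Shat v + nrm Ahat u' * os_norm Shat (v \<ominus>\<^bsub>Shat\<^esub> v')"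
      unfolding u_def u'_def v_def v'_def by (rule act_limit_diff[OF A(1) A'(1) A(2) A'(2)])
    also have "\<dots> \<le> (2 * \<delta>) * c + c * (2 * \<delta>)"
      using uu vv u v \<delta> c cl by (intro add_mono mult_mono) (auto intro: H.N_nonneg)
    also have "\<dots> < 5 * c * \<delta>" using c \<delta>(1) by simp
    finally show ?thesis using \<delta>(3) by linarith
  qed
  then show ?thesis by blast
qed

text \<open>Completeness provides a limit, and \<open>act_close\<close> shows that all
  approximations share it; hence the definite description in \<open>lim_act\<close> denotes.\<close>

lemma act_approx:
  assumes a: "a \<in> carrier Ahat" and s: "s \<in> carrier Shat"
    and ap: "approximates X Shat \<phi>i Ahat \<pi>i m f g a s"
  shows "lim_act a s \<in> carrier Shat"
    and "os_nlim Shat (\<lambda>n. \<phi>i (m n) (act (m n) (f n) (g n))) (lim_act a s)"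
proof -
  let ?w = "\<lambda>m f g n. \<phi>i (m n) (act (m n) (f n) (g n))"
  have cl: "?w m f g n \<in> carrier Shat" if "approximates X Shat \<phi>i Ahat \<pi>i m f g a s" for m f g n
    using approximatesD(1,2)[OF that] by (intro \<phi>i.closed a.act_cl)
  obtain t where t: "t \<in> carrier Shat" "os_nlim Shat (?w m f g) t"
    using H.nlim_os_complete[OF completion_complete[OF Sinf_opsys compl] cl[OF ap] act_close[OF a s ap ap]] by blast
  have uniq: "os_nlim Shat (?w m f g) t'"
    if t': "t' \<in> carrier Shat" and ap': "approximates X Shat \<phi>i Ahat \<pi>i m' f' g' a s" and l: "os_nlim Shat (?w m' f' g') t'" for t' m' f' g'
  proof (rule H.nlim_transfer[OF cl[OF ap'] cl[OF ap] t' l])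
    show "(\<lambda>n. os_norm Shat (?w m f g n \<ominus>\<^bsub>Shat\<^esub> ?w m' f' g' n)) \<longlonglongrightarrow> 0"
    proof (rule LIMSEQ_I)
      fix r :: real assume "0 < r"
      then obtain K where K: "\<forall>n\<ge>K. \<forall>p\<ge>K. os_norm Shat (?w m f g n \<ominus>\<^bsub>Shat\<^esub> ?w m' f' g' p) < r"
        using act_close[OF a s ap ap'] by blast
      have "norm (os_norm Shat (?w m f g n \<ominus>\<^bsub>Shat\<^esub> ?w m' f' g' n) - 0) < r" if "n \<ge> K" for n
        unfolding diff_zero real_norm_def abs_of_nonneg[OF H.N_nonneg[OF H.v_minus_cl[OF cl[OF ap] cl[OF ap']]]]
        using K that by blast
      then show "\<exists>no. \<forall>n\<ge>no. norm (os_norm Shat (?w m f g n \<ominus>\<^bsub>Shat\<^esub> ?w m' f' g' n) - 0) < r" by blast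
    qed
  qed
  have "lim_act a s = t"
    unfolding lim_act_def
  proof (rule the_equality)
    show "t \<in> carrier Shat \<and> (\<exists>m f g. approximates X Shat \<phi>i Ahat \<pi>i m f g a s \<and> os_lim Shat (?w m f g) t)"
      unfolding os_lim_nlim using t ap by blast
    fix t' assume "t' \<in> carrier Shat \<and> (\<exists>m f g. approximates X Shat \<phi>i Ahat \<pi>i m f g a s \<and> os_lim Shat (?w m f g) t')"
    then obtain m' f' g' where t': "t' \<in> carrier Shat" "approximates X Shat \<phi>i Ahat \<pi>i m' f' g' a s" "os_nlim Shat (?w m' f' g') t'"
      unfolding os_lim_nlim by blast
    show "t' = t" using H.nlim_unique[OF cl[OF ap] t'(1) t(1) uniq[OF t'] t(2)] .
  qed
  with t show "lim_act a s \<in> carrier Shat" "os_nlim Shat (?w m f g) (lim_act a s)" by simp_all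
qed

lemma act_lim:
  assumes "\<And>n. f n \<in> carrier (A n)" "\<And>n. g n \<in> carrier (S n)" "a \<in> carrier Ahat" "s \<in> carrier Shat"
    and "c_nlim Ahat (\<lambda>n. \<pi>i n (f n)) a" "os_nlim Shat (\<lambda>n. \<phi>i n (g n)) s"
  shows "os_nlim Shat (\<lambda>n. \<phi>i n (act n (f n) (g n))) (lim_act a s)"
proof (rule act_approx(2)[OF assms(3,4), of "\<lambda>n. n" f g])
  show "approximates X Shat \<phi>i Ahat \<pi>i (\<lambda>n. n) f g a s"
    unfolding approximates_def cstar_lim_nlim os_lim_nlim using assms by blast
qed

lemma lim_act_cl:
  assumes a: "a \<in> carrier Ahat" and s: "s \<in> carrier Shat"
  shows "lim_act a s \<in> carrier Shat"
proof -
  obtain f where f: "\<forall>n. f n \<in> carrier (A n)" "c_nlim Ahat (\<lambda>n. \<pi>i n (f n)) a" using c_dense[OF a] by blast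
  obtain g where g: "\<forall>n. g n \<in> carrier (S n)" "os_nlim Shat (\<lambda>n. \<phi>i n (g n)) s" using s_dense[OF s] by blast
  have "approximates X Shat \<phi>i Ahat \<pi>i (\<lambda>n. n) f g a s"
    unfolding approximates_def cstar_lim_nlim os_lim_nlim using f g by blast
  then show ?thesis by (rule act_approx(1)[OF a s])
qed

text \<open>Both sides are limits of the same sequence, by the law at each level. The other laws of
  the limit action follow this pattern.\<close>

lemma lim_act_add_right:
  assumes a: "a \<in> carrier Ahat" and s: "s \<in> carrier Shat" and t: "t \<in> carrier Shat"
  shows "lim_act a (s \<oplus>\<^bsub>Shat\<^esub> t) = lim_act a s \<oplus>\<^bsub>Shat\<^esub> lim_act a t"
proof -
  obtain f where f: "\<And>n. f n \<in> carrier (A n)" "c_nlim Ahat (\<lambda>n. \<pi>i n (f n)) a" using c_dense[OF a] by blast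
  obtain g where g: "\<And>n. g n \<in> carrier (S n)" "os_nlim Shat (\<lambda>n. \<phi>i n (g n)) s" using s_dense[OF s] by blast
  obtain h where h: "\<And>n. h n \<in> carrier (S n)" "os_nlim Shat (\<lambda>n. \<phi>i n (h n)) t" using s_dense[OF t] by blast
  have cl: "act n (f n) (g n) \<in> carrier (S n)" "act n (f n) (h n) \<in> carrier (S n)" for n
    using f g h by (auto intro: a.act_cl)
  have "os_nlim Shat (\<lambda>n. \<phi>i n (act n (f n) (g n \<oplus>\<^bsub>S n\<^esub> h n))) (lim_act a (s \<oplus>\<^bsub>Shat\<^esub> t))"
    by (rule act_lim[OF f(1) X.S.v_add_cl[OF g(1) h(1)] a H.v_add_cl[OF s t] f(2) s_add_lim[OF g(1) h(1) s t g(2) h(2)]])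
  moreover have "os_nlim Shat (\<lambda>n. \<phi>i n (act n (f n) (g n \<oplus>\<^bsub>S n\<^esub> h n))) (lim_act a s \<oplus>\<^bsub>Shat\<^esub> lim_act a t)"
    unfolding a.act_add_right[OF f(1) g(1) h(1)]
    by (rule s_add_lim[OF cl lim_act_cl[OF a s] lim_act_cl[OF a t] act_lim[OF f(1) g(1) a s f(2) g(2)] act_lim[OF f(1) h(1) a t f(2) h(2)]])
  ultimately show ?thesis
    by (rule H.nlim_unique[OF \<phi>i.closed[OF a.act_cl[OF f(1) X.S.v_add_cl[OF g(1) h(1)]]] lim_act_cl[OF a H.v_add_cl[OF s t]]
        H.v_add_cl[OF lim_act_cl[OF a s] lim_act_cl[OF a t]]])
qed

lemma lim_act_add_left:
  assumes a: "a \<in> carrier Ahat" and b: "b \<in> carrier Ahat" and s: "s \<in> carrier Shat"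
  shows "lim_act (a \<oplus>\<^bsub>Ahat\<^esub> b) s = lim_act a s \<oplus>\<^bsub>Shat\<^esub> lim_act b s"
proof -
  obtain f where f: "\<And>n. f n \<in> carrier (A n)" "c_nlim Ahat (\<lambda>n. \<pi>i n (f n)) a" using c_dense[OF a] by blast
  obtain h where h: "\<And>n. h n \<in> carrier (A n)" "c_nlim Ahat (\<lambda>n. \<pi>i n (h n)) b" using c_dense[OF b] by blast
  obtain g where g: "\<And>n. g n \<in> carrier (S n)" "os_nlim Shat (\<lambda>n. \<phi>i n (g n)) s" using s_dense[OF s] by blast
  have cl: "act n (f n) (g n) \<in> carrier (S n)" "act n (h n) (g n) \<in> carrier (S n)" for n
    using f g h by (auto intro: a.act_cl)
  have "os_nlim Shat (\<lambda>n. \<phi>i n (act n (f n \<oplus>\<^bsub>A n\<^esub> h n) (g n))) (lim_act (a \<oplus>\<^bsub>Ahat\<^esub> b) s)"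
    by (rule act_lim[OF X.A.v_add_cl[OF f(1) h(1)] g(1) C.v_add_cl[OF a b] s a_add_lim[OF f(1) h(1) a b f(2) h(2)] g(2)])
  moreover have "os_nlim Shat (\<lambda>n. \<phi>i n (act n (f n \<oplus>\<^bsub>A n\<^esub> h n) (g n))) (lim_act a s \<oplus>\<^bsub>Shat\<^esub> lim_act b s)"
    unfolding a.act_add_left[OF f(1) h(1) g(1)]
    by (rule s_add_lim[OF cl lim_act_cl[OF a s] lim_act_cl[OF b s] act_lim[OF f(1) g(1) a s f(2) g(2)] act_lim[OF h(1) g(1) b s h(2) g(2)]])
  ultimately show ?thesis
    by (rule H.nlim_unique[OF \<phi>i.closed[OF a.act_cl[OF X.A.v_add_cl[OF f(1) h(1)] g(1)]] lim_act_cl[OF C.v_add_cl[OF a b] s]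
        H.v_add_cl[OF lim_act_cl[OF a s] lim_act_cl[OF b s]]])
qed

lemma lim_act_smult:
  assumes a: "a \<in> carrier Ahat" and s: "s \<in> carrier Shat"
  shows "lim_act (c \<odot>\<^bsub>Ahat\<^esub> a) s = c \<odot>\<^bsub>Shat\<^esub> lim_act a s" "lim_act a (c \<odot>\<^bsub>Shat\<^esub> s) = c \<odot>\<^bsub>Shat\<^esub> lim_act a s"
proof -
  obtain f where f: "\<And>n. f n \<in> carrier (A n)" "c_nlim Ahat (\<lambda>n. \<pi>i n (f n)) a" using c_dense[OF a] by blast
  obtain g where g: "\<And>n. g n \<in> carrier (S n)" "os_nlim Shat (\<lambda>n. \<phi>i n (g n)) s" using s_dense[OF s] by blast
  note cl = a.act_cl[OF f(1) g(1)]
  have lim: "os_nlim Shat (\<lambda>n. \<phi>i n (c \<odot>\<^bsub>S n\<^esub> act n (f n) (g n))) (c \<odot>\<^bsub>Shat\<^esub> lim_act a s)"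
    by (rule s_smult_lim[OF cl lim_act_cl[OF a s] act_lim[OF f(1) g(1) a s f(2) g(2)]])
  have "os_nlim Shat (\<lambda>n. \<phi>i n (act n (c \<odot>\<^bsub>A n\<^esub> f n) (g n))) (lim_act (c \<odot>\<^bsub>Ahat\<^esub> a) s)"
    by (rule act_lim[OF X.A.smult_cl[OF f(1)] g(1) C.smult_cl[OF a] s a_smult_lim[OF f(1) a f(2)] g(2)])
  from this[unfolded a.act_smult_left[OF f(1) g(1)]] lim
  show "lim_act (c \<odot>\<^bsub>Ahat\<^esub> a) s = c \<odot>\<^bsub>Shat\<^esub> lim_act a s"
    by (rule H.nlim_unique[OF \<phi>i.closed[OF X.S.smult_cl[OF cl]] lim_act_cl[OF C.smult_cl[OF a] s] H.smult_cl[OF lim_act_cl[OF a s]]])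
  have "os_nlim Shat (\<lambda>n. \<phi>i n (act n (f n) (c \<odot>\<^bsub>S n\<^esub> g n))) (lim_act a (c \<odot>\<^bsub>Shat\<^esub> s))"
    by (rule act_lim[OF f(1) X.S.smult_cl[OF g(1)] a H.smult_cl[OF s] f(2) s_smult_lim[OF g(1) s g(2)]])
  from this[unfolded a.act_smult_right[OF f(1) g(1)]] lim
  show "lim_act a (c \<odot>\<^bsub>Shat\<^esub> s) = c \<odot>\<^bsub>Shat\<^esub> lim_act a s"
    by (rule H.nlim_unique[OF \<phi>i.closed[OF X.S.smult_cl[OF cl]] lim_act_cl[OF a H.smult_cl[OF s]] H.smult_cl[OF lim_act_cl[OF a s]]])
qed

end

text \<open>Closedness of the cones is stated for hermitian limits; symmetry of the limit follows
  from continuity of the involution and uniqueness of limits.\<close>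

lemma (in normed_star) hermF_limit:
  assumes F: "\<And>m. hermF V n (F m)" and G: "\<And>i j. \<lbrakk>i < n; j < n\<rbrakk> \<Longrightarrow> G i j \<in> carrier V"
    and lim: "\<And>i j. \<lbrakk>i < n; j < n\<rbrakk> \<Longrightarrow> nlim V N (\<lambda>m. F m i j) (G i j)"
  shows "hermF V n G"
  unfolding hermF_def
proof (intro allI impI conjI)
  fix i j assume ij: "i < n" "j < n"
  show "G i j \<in> carrier V" by (rule G[OF ij])
  have "nlim V N (\<lambda>m. invol V (F m i j)) (invol V (G i j))"
    by (rule nlim_invol[OF hermFD(1)[OF F ij] G[OF ij] lim[OF ij]])
  then have "nlim V N (\<lambda>m. F m j i) (invol V (G i j))" unfolding hermFD(2)[OF F ij] .
  from nlim_unique[OF hermFD(1)[OF F ij(2,1)] invol_closed[OF G[OF ij]] G[OF ij(2,1)] this lim[OF ij(2,1)]]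
  show "invol V (G i j) = G j i" .
qed

context ocs_limit_data
begin

sublocale l: lim_action X \<phi> \<pi> Sinf \<phi>inf Shat \<iota> Ahat \<pi>i "\<lambda>k. lact (X k)"
  by unfold_locales (rule X.l.act_cl X.l.act_add_right X.l.act_add_left X.l.act_smult_left X.l.act_smult_right
      X.l.norm_act T.lact; assumption)+

sublocale r: lim_action X \<phi> \<pi> Sinf \<phi>inf Shat \<iota> Ahat \<pi>i "\<lambda>k a s. ract (X k) s a"
  by unfold_locales (rule X.r.act_cl X.r.act_add_right X.r.act_add_left X.r.act_smult_left X.r.act_smult_right
      X.r.norm_act T.ract; assumption)+

section \<open>The limit object is an operator C*-system\<close>

abbreviation "L \<equiv> ocs_limit_object X Shat \<phi>i Ahat \<pi>i"

lemma L_simps: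
  "osys L = Shat" "calg L = Ahat" "lact L = l.lim_act" "ract L = (\<lambda>s a. r.lim_act a s)"
  by (simp_all add: ocs_limit_object_def fun_eq_iff lim_lact_def lim_ract_def l.lim_act_def r.lim_act_def)

text \<open>An approximation of an inner product by its own level sequence may be fed into
  \<open>act_lim\<close> again. Folding with the law at each level then identifies the sequences for
  the two sides.\<close>

lemma l_r_commute:
  assumes a: "a \<in> carrier Ahat" and b: "b \<in> carrier Ahat" and s: "s \<in> carrier Shat"
  shows "r.lim_act b (l.lim_act a s) = l.lim_act a (r.lim_act b s)"
    and "l.lim_act (a \<otimes>\<^bsub>Ahat\<^esub> b) s = l.lim_act a (l.lim_act b s)"
    and "r.lim_act (a \<otimes>\<^bsub>Ahat\<^esub> b) s = r.lim_act b (r.lim_act a s)"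
proof -
  obtain f where f: "\<And>n. f n \<in> carrier (A n)" "c_nlim Ahat (\<lambda>n. \<pi>i n (f n)) a" using c_dense[OF a] by blast
  obtain h where h: "\<And>n. h n \<in> carrier (A n)" "c_nlim Ahat (\<lambda>n. \<pi>i n (h n)) b" using c_dense[OF b] by blast
  obtain g where g: "\<And>n. g n \<in> carrier (S n)" "os_nlim Shat (\<lambda>n. \<phi>i n (g n)) s" using s_dense[OF s] by blast
  note lfg = l.act_lim[OF f(1) g(1) a s f(2) g(2)] and lhg = l.act_lim[OF h(1) g(1) b s h(2) g(2)]
    and rfg = r.act_lim[OF f(1) g(1) a s f(2) g(2)] and rhg = r.act_lim[OF h(1) g(1) b s h(2) g(2)]
    and fh = a_mult_lim[OF f(1) h(1) a b f(2) h(2)]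
  note c1 = X.l_closed[OF f(1) g(1)] and c2 = X.l_closed[OF h(1) g(1)] and c3 = X.r_closed[OF f(1) g(1)]
    and c4 = X.r_closed[OF h(1) g(1)] and c5 = X.A.times_closed[OF f(1) h(1)]
  note d1 = l.lim_act_cl[OF a s] and d2 = l.lim_act_cl[OF b s] and d3 = r.lim_act_cl[OF a s] and d4 = r.lim_act_cl[OF b s]
    and d5 = C.times_closed[OF a b]
  show "r.lim_act b (l.lim_act a s) = l.lim_act a (r.lim_act b s)"
    by (rule H.nlim_unique[OF \<phi>i.closed[OF X.r_closed[OF h(1) c1]] r.lim_act_cl[OF b d1] l.lim_act_cl[OF a d4]
        r.act_lim[OF h(1) c1 b d1 h(2) lfg] l.act_lim[OF f(1) c4 a d4 f(2) rhg, folded X.l_r[OF f(1) h(1) g(1)]]])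
  show "l.lim_act (a \<otimes>\<^bsub>Ahat\<^esub> b) s = l.lim_act a (l.lim_act b s)"
    by (rule H.nlim_unique[OF \<phi>i.closed[OF X.l_closed[OF c5 g(1)]] l.lim_act_cl[OF d5 s] l.lim_act_cl[OF a d2]
        l.act_lim[OF c5 g(1) d5 s fh g(2)] l.act_lim[OF f(1) c2 a d2 f(2) lhg, folded X.l_mult[OF f(1) h(1) g(1)]]])
  show "r.lim_act (a \<otimes>\<^bsub>Ahat\<^esub> b) s = r.lim_act b (r.lim_act a s)"
    by (rule H.nlim_unique[OF \<phi>i.closed[OF X.r_closed[OF c5 g(1)]] r.lim_act_cl[OF d5 s] r.lim_act_cl[OF b d3]
        r.act_lim[OF c5 g(1) d5 s fh g(2)] r.act_lim[OF h(1) c3 b d3 h(2) rfg, folded X.r_mult[OF f(1) h(1) g(1)]]])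
qed

lemma one_lim: "c_nlim Ahat (\<lambda>n. \<pi>i n \<one>\<^bsub>A n\<^esub>) \<one>\<^bsub>Ahat\<^esub>"
  unfolding \<pi>i.one by (rule C.nlim_const[OF C.unit_closed])

lemma unit_lim: "os_nlim Shat (\<lambda>n. \<phi>i n (ounit (S n))) (ounit Shat)"
  unfolding \<phi>i.unit by (rule H.nlim_const[OF H.ounit_closed])

lemma act_one:
  assumes s: "s \<in> carrier Shat"
  shows "l.lim_act \<one>\<^bsub>Ahat\<^esub> s = s" "r.lim_act \<one>\<^bsub>Ahat\<^esub> s = s"
proof -
  obtain g where g: "\<And>n. g n \<in> carrier (S n)" "os_nlim Shat (\<lambda>n. \<phi>i n (g n)) s" using s_dense[OF s] by blast
  note l1 = l.act_lim[OF X.A.unit_closed g(1) C.unit_closed s one_lim g(2), unfolded X.l_one[OF g(1)]]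
    and r1 = r.act_lim[OF X.A.unit_closed g(1) C.unit_closed s one_lim g(2), unfolded X.r_one[OF g(1)]]
  show "l.lim_act \<one>\<^bsub>Ahat\<^esub> s = s"
    by (rule H.nlim_unique[OF \<phi>i.closed[OF g(1)] l.lim_act_cl[OF C.unit_closed s] s l1 g(2)])
  show "r.lim_act \<one>\<^bsub>Ahat\<^esub> s = s"
    by (rule H.nlim_unique[OF \<phi>i.closed[OF g(1)] r.lim_act_cl[OF C.unit_closed s] s r1 g(2)])
qed

lemma act_unit:
  assumes a: "a \<in> carrier Ahat"
  shows "l.lim_act a (ounit Shat) = r.lim_act a (ounit Shat)"
proof -
  obtain f where f: "\<And>n. f n \<in> carrier (A n)" "c_nlim Ahat (\<lambda>n. \<pi>i n (f n)) a" using c_dense[OF a] by blast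
  note l1 = l.act_lim[OF f(1) X.S.ounit_closed a H.ounit_closed f(2) unit_lim]
    and r1 = r.act_lim[OF f(1) X.S.ounit_closed a H.ounit_closed f(2) unit_lim, folded X.unit_comm[OF f(1)]]
  show ?thesis
    by (rule H.nlim_unique[OF \<phi>i.closed[OF X.l_closed[OF f(1) X.S.ounit_closed]] l.lim_act_cl[OF a H.ounit_closed]
        r.lim_act_cl[OF a H.ounit_closed] l1 r1])
qed

lemma bimodule_L: "bimodule Ahat Shat l.lim_act (\<lambda>s a. r.lim_act a s)"
  by (intro bimodule.intro bimodule_axioms.intro Ahat_cstar H.star_vector_space_axioms)
    (rule l.lim_act_cl r.lim_act_cl l.lim_act_add_right l.lim_act_add_left r.lim_act_add_right r.lim_act_add_left
      l.lim_act_smult r.lim_act_smult l_r_commute act_one; assumption)+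

text \<open>The positive matrix is approximated by positive matrices at the levels and the entries
  of \<open>M\<close> by algebra elements at the same levels. Positivity holds level by level, and
  the finite double sums converge entrywise into a closed cone.\<close>

lemma cone_actF_L:
  assumes G: "cone Shat n G" and M: "\<And>i j. \<lbrakk>i < n; j < n\<rbrakk> \<Longrightarrow> M i j \<in> carrier Ahat"
  shows "cone Shat n (actF L n M G)"
proof -
  interpret L: ocs_bimodule L
    unfolding ocs_bimodule_def L_simps by (rule bimodule_L)
  note cG = H.K.P_cl[OF G]
  obtain Z where Z: "\<And>m. cone (S m) n (Z m)"
    and Zlim: "\<And>i j. i < n \<Longrightarrow> j < n \<Longrightarrow> os_nlim Shat (\<lambda>m. \<phi>i m (Z m i j)) (G i j)"
    using cone_dense[OF G] by blast
  have "\<forall>i j. \<exists>f. i < n \<longrightarrow> j < n \<longrightarrow> (\<forall>m. f m \<in> carrier (A m)) \<and> c_nlim Ahat (\<lambda>m. \<pi>i m (f m)) (M i j)"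
    using c_dense[OF M] by blast
  then obtain f where f: "\<And>i j m. \<lbrakk>i < n; j < n\<rbrakk> \<Longrightarrow> f i j m \<in> carrier (A m)"
    and flim: "\<And>i j. \<lbrakk>i < n; j < n\<rbrakk> \<Longrightarrow> c_nlim Ahat (\<lambda>m. \<pi>i m (f i j m)) (M i j)"
    by metis
  define W where "W m = actF (X m) n (\<lambda>i j. f i j m) (Z m)" for m
  note cZ = X.S.K.P_cl[OF Z]
  have W: "cone (S m) n (W m)" for m
    unfolding W_def by (rule X.cone_actF[OF Z f])
  have lim: "os_nlim Shat (\<lambda>m. \<phi>i m (W m i j)) (actF L n M G i j)" if ij: "i < n" "j < n" for i j
  proof -
    let ?g = "\<lambda>m k. \<Oplus>\<^bsub>S m\<^esub>l\<in>{..<n}. lact (X m) (invol (A m) (f l i m)) (Z m l k)"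
    let ?h = "\<lambda>k. \<Oplus>\<^bsub>Shat\<^esub>l\<in>{..<n}. l.lim_act (invol Ahat (M l i)) (G l k)"
    have lcl: "lact (X m) (invol (A m) (f l i m)) (Z m l k) \<in> carrier (S m)" if "l < n" "k < n" for m l k
      by (rule X.l_closed[OF X.A.invol_closed[OF f[OF that(1) ij(1)]] cZ[OF that]])
    have Lcl: "l.lim_act (invol Ahat (M l i)) (G l k) \<in> carrier Shat" if "l < n" "k < n" for l k
      by (rule l.lim_act_cl[OF C.invol_closed[OF M[OF that(1) ij(1)]] cG[OF that]])
    have gcl: "?g m k \<in> carrier (S m)" and hcl: "?h k \<in> carrier Shat" if "k < n" for m k
      using lcl Lcl that by (auto intro!: X.S.v_finsum_closed H.v_finsum_closed)
    have glim: "os_nlim Shat (\<lambda>m. \<phi>i m (?g m k)) (?h k)" if k: "k < n" for k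
    proof -
      have "\<phi>i m (?g m k) = (\<Oplus>\<^bsub>Shat\<^esub>l\<in>{..<n}. \<phi>i m (lact (X m) (invol (A m) (f l i m)) (Z m l k)))" for m
        by (rule \<phi>i.finsum) (use lcl k in auto)
      moreover have "os_nlim Shat (\<lambda>m. \<Oplus>\<^bsub>Shat\<^esub>l\<in>{..<n}. \<phi>i m (lact (X m) (invol (A m) (f l i m)) (Z m l k))) (?h k)"
      proof (rule H.nlim_finsum)
        fix l assume "l \<in> {..<n}"
        then have l: "l < n" by simp
        show "\<phi>i m (lact (X m) (invol (A m) (f l i m)) (Z m l k)) \<in> carrier Shat" for m
          by (rule \<phi>i.closed[OF lcl[OF l k]])
        show "l.lim_act (invol Ahat (M l i)) (G l k) \<in> carrier Shat" by (rule Lcl[OF l k])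
        show "os_nlim Shat (\<lambda>m. \<phi>i m (lact (X m) (invol (A m) (f l i m)) (Z m l k))) (l.lim_act (invol Ahat (M l i)) (G l k))"
          by (rule l.act_lim[OF X.A.invol_closed[OF f[OF l ij(1)]] cZ[OF l k] C.invol_closed[OF M[OF l ij(1)]] cG[OF l k]
              a_invol_lim[OF f[OF l ij(1)] M[OF l ij(1)] flim[OF l ij(1)]] Zlim[OF l k]])
      qed simp
      ultimately show ?thesis by (simp only:)
    qed
    have "\<phi>i m (W m i j) = (\<Oplus>\<^bsub>Shat\<^esub>k\<in>{..<n}. \<phi>i m (ract (X m) (?g m k) (f k j m)))" for m
      unfolding W_def actF_def
      by (rule \<phi>i.finsum) (use gcl f ij in \<open>auto intro!: X.r_closed\<close>)
    moreover have "os_nlim Shat (\<lambda>m. \<Oplus>\<^bsub>Shat\<^esub>k\<in>{..<n}. \<phi>i m (ract (X m) (?g m k) (f k j m))) (actF L n M G i j)"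
      unfolding actF_def L_simps
    proof (rule H.nlim_finsum)
      fix k assume "k \<in> {..<n}"
      then have k: "k < n" by simp
      show "\<phi>i m (ract (X m) (?g m k) (f k j m)) \<in> carrier Shat" for m
        by (rule \<phi>i.closed[OF X.r_closed[OF f[OF k ij(2)] gcl[OF k]]])
      show "r.lim_act (M k j) (?h k) \<in> carrier Shat" by (rule r.lim_act_cl[OF M[OF k ij(2)] hcl[OF k]])
      show "os_nlim Shat (\<lambda>m. \<phi>i m (ract (X m) (?g m k) (f k j m))) (r.lim_act (M k j) (?h k))"
        by (rule r.act_lim[OF f[OF k ij(2)] gcl[OF k] M[OF k ij(2)] hcl[OF k] flim[OF k ij(2)] glim[OF k]])
    qed simp
    ultimately show ?thesis by (simp only:)
  qed
  have cl: "actF L n M G i j \<in> carrier Shat" if "i < n" "j < n" for i j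
    using L.actF_cl[of n M G i j] M cG that by (simp add: L_simps)
  have cones: "cone Shat n (\<lambda>i j. \<phi>i m (W m i j))" for m by (rule \<phi>i.cone[OF W])
  show ?thesis
    by (rule H.cone_limit[OF cones H.hermF_limit[OF H.K.P_hermF[OF cones] cl lim] lim])
qed

lemma ocs_L: "ocs L"
  by (rule ocsI, unfold L_simps)
    (rule H.operator_system_axioms completion_complete[OF Sinf_opsys compl] Ahat_cstar bimodule_L act_unit
      cone_actF_L; assumption)+

lemma ocs_hom_L: "ocs_hom (X k) L (\<phi>i k) (\<pi>i k)"
proof (rule ocs_homI[OF _ _ objs], unfold L_simps)
  show "ucp (S k) Shat (\<phi>i k)" by (rule \<phi>i_ucp)
  show "cstar_hom (A k) Ahat (\<pi>i k)" by (rule \<pi>i_hom)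
  fix a s assume a: "a \<in> carrier (A k)" and s: "s \<in> carrier (S k)"
  note ca = \<pi>i.closed[OF a] and cs = \<phi>i.closed[OF s]
  \<comment> \<open>Approximations may stay at one level, so constant sequences at level
    \<open>k\<close> compute the limit action on canonical images.\<close>
  have ap: "approximates X Shat \<phi>i Ahat \<pi>i (\<lambda>_. k) (\<lambda>_. a) (\<lambda>_. s) (\<pi>i k a) (\<phi>i k s)"
    unfolding approximates_def cstar_lim_nlim os_lim_nlim
    using a s C.nlim_const[OF ca] H.nlim_const[OF cs] by blast
  note cl = \<phi>i.closed[OF X.l_closed[OF a s]] and cr = \<phi>i.closed[OF X.r_closed[OF a s]]
  show "\<phi>i k (lact (X k) a s) = l.lim_act (\<pi>i k a) (\<phi>i k s)"
    by (rule H.nlim_unique[OF cl cl l.lim_act_cl[OF ca cs] H.nlim_const[OF cl] l.act_approx(2)[OF ca cs ap]])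
  show "\<phi>i k (ract (X k) s a) = r.lim_act (\<pi>i k a) (\<phi>i k s)"
    by (rule H.nlim_unique[OF cr cr r.lim_act_cl[OF ca cs] H.nlim_const[OF cr] r.act_approx(2)[OF ca cs ap]])
qed

end

section \<open>The universal property of the limit object\<close>

locale ocs_limit_cocone = ocs_limit_data X \<phi> \<pi> Sinf \<phi>inf Shat \<iota> Ahat \<pi>i + Y: ocs_obj Y
  for X :: "nat \<Rightarrow> ('s, 'a) ocsys" and \<phi> :: "nat \<Rightarrow> 's \<Rightarrow> 's" and \<pi> :: "nat \<Rightarrow> 'a \<Rightarrow> 'a"
    and Sinf :: "'u opsys" and \<phi>inf :: "nat \<Rightarrow> 's \<Rightarrow> 'u"
    and Shat :: "'v opsys" and \<iota> :: "'u \<Rightarrow> 'v"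
    and Ahat :: "'w cstar" and \<pi>i :: "nat \<Rightarrow> 'a \<Rightarrow> 'w" and Y :: "('t, 'b) ocsys" +
  fixes \<beta> :: "nat \<Rightarrow> 's \<Rightarrow> 't" and \<rho> :: "nat \<Rightarrow> 'a \<Rightarrow> 'b"
  assumes cocone_hom: "ocs_hom (X k) Y (\<beta> k) (\<rho> k)"
    and \<beta>_compat: "s \<in> carrier (osys (X k)) \<Longrightarrow> \<beta> (Suc k) (\<phi> k s) = \<beta> k s"
    and \<rho>_compat: "a \<in> carrier (calg (X k)) \<Longrightarrow> \<rho> (Suc k) (\<pi> k a) = \<rho> k a"
begin

sublocale c: ocs_morphism "X k" Y "\<beta> k" "\<rho> k" for k
  by (rule ocs_morphismI[OF objs Y.ocs cocone_hom])

text \<open>The cocone factors through \<open>Sinf\<close> by a contractive map, and the embedding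
  \<iota> into the completion is isometric. This makes extension by continuity possible although the
  \<beta> act on different levels.\<close>

lemma \<beta>_dist:
  assumes x: "x \<in> carrier (S n)" and y: "y \<in> carrier (S m)"
  shows "os_norm (osys Y) (\<beta> n x \<ominus>\<^bsub>osys Y\<^esub> \<beta> m y) \<le> os_norm Shat (\<phi>i n x \<ominus>\<^bsub>Shat\<^esub> \<phi>i m y)"
proof -
  obtain \<mu> where \<mu>: "ucp Sinf (osys Y) \<mu>" "\<And>k s. s \<in> carrier (S k) \<Longrightarrow> \<mu> (\<phi>inf k s) = \<beta> k s"
    using os_factor[OF Y.S.operator_system_axioms c.p.ucp \<beta>_compat] by blast
  interpret \<mu>: ucp_map Sinf "osys Y" \<mu> by (rule ucp_mapI[OF Sinf_opsys Y.S.operator_system_axioms \<mu>(1)])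
  let ?d = "\<phi>inf n x \<ominus>\<^bsub>Sinf\<^esub> \<phi>inf m y"
  have cl: "\<phi>inf n x \<in> carrier Sinf" "\<phi>inf m y \<in> carrier Sinf" using inf.closed[OF x] inf.closed[OF y] .
  have d: "?d \<in> carrier Sinf" by (rule I.v_minus_cl[OF cl])
  have "\<beta> n x \<ominus>\<^bsub>osys Y\<^esub> \<beta> m y = \<mu> ?d"
    unfolding \<mu>.diff[OF cl] \<mu>(2)[OF x] \<mu>(2)[OF y] ..
  then have "os_norm (osys Y) (\<beta> n x \<ominus>\<^bsub>osys Y\<^esub> \<beta> m y) \<le> os_norm Sinf ?d"
    using \<mu>.contractive[OF d] by simp
  also have "\<dots> = os_norm Shat (\<iota> ?d)" using completion_norm[OF Sinf_opsys compl d] by simp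
  also have "\<iota> ?d = \<phi>i n x \<ominus>\<^bsub>Shat\<^esub> \<phi>i m y" using \<iota>.diff[OF cl] by simp
  finally show ?thesis .
qed

text \<open>The second sequence may visit levels in any order, as is needed to evaluate the
  extension on constant sequences at one level.\<close>

lemma \<beta>_transfer:
  assumes g: "\<And>n. g n \<in> carrier (S n)" and h: "\<And>n. h n \<in> carrier (S (m n))" and s: "s \<in> carrier Shat" and t: "t \<in> carrier (osys Y)"
    and "os_nlim Shat (\<lambda>n. \<phi>i n (g n)) s" "os_nlim Shat (\<lambda>n. \<phi>i (m n) (h n)) s"
    and lim: "os_nlim (osys Y) (\<lambda>n. \<beta> n (g n)) t"
  shows "os_nlim (osys Y) (\<lambda>n. \<beta> (m n) (h n)) t"
proof (rule Y.S.nlim_transfer[OF c.p.closed[OF g] c.p.closed[OF h] t lim])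
  have "(\<lambda>n. os_norm Shat (\<phi>i (m n) (h n) \<ominus>\<^bsub>Shat\<^esub> \<phi>i n (g n))) \<longlonglongrightarrow> 0"
    by (rule H.nlim_diff_null[OF \<phi>i.closed[OF h] \<phi>i.closed[OF g] s assms(6,5)])
  then show "(\<lambda>n. os_norm (osys Y) (\<beta> (m n) (h n) \<ominus>\<^bsub>osys Y\<^esub> \<beta> n (g n))) \<longlonglongrightarrow> 0"
  proof (rule tendsto_0_le[where K = 1], intro always_eventually allI)
    fix n
    have "0 \<le> os_norm (osys Y) (\<beta> (m n) (h n) \<ominus>\<^bsub>osys Y\<^esub> \<beta> n (g n))"
      by (rule Y.S.N_nonneg[OF Y.S.v_minus_cl[OF c.p.closed[OF h] c.p.closed[OF g]]])
    then show "norm (os_norm (osys Y) (\<beta> (m n) (h n) \<ominus>\<^bsub>osys Y\<^esub> \<beta> n (g n))) \<le> norm (os_norm Shat (\<phi>i (m n) (h n) \<ominus>\<^bsub>Shat\<^esub> \<phi>i n (g n))) * 1"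
      using \<beta>_dist[OF h g, of n n] by (simp only: real_norm_def abs_of_nonneg mult_1_right)
  qed
qed

text \<open>Extension by continuity, formulated with sequences at the levels so that it refers to
  the cocone directly instead of a map on \<open>Sinf\<close>.\<close>

definition ext :: "'v \<Rightarrow> 't" where
  "ext s = (SOME t. t \<in> carrier (osys Y) \<and> (\<exists>g. (\<forall>n. g n \<in> carrier (S n)) \<and>
     os_nlim Shat (\<lambda>n. \<phi>i n (g n)) s \<and> os_nlim (osys Y) (\<lambda>n. \<beta> n (g n)) t))"

lemma ext_props:
  assumes s: "s \<in> carrier Shat"
  shows ext_cl: "ext s \<in> carrier (osys Y)"
    and ext_lim: "\<lbrakk>\<And>n. h n \<in> carrier (S (m n)); os_nlim Shat (\<lambda>n. \<phi>i (m n) (h n)) s\<rbrakk>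
      \<Longrightarrow> os_nlim (osys Y) (\<lambda>n. \<beta> (m n) (h n)) (ext s)"
proof -
  obtain g where g: "\<And>n. g n \<in> carrier (S n)" "os_nlim Shat (\<lambda>n. \<phi>i n (g n)) s" using s_dense[OF s] by blast
  have "\<exists>t\<in>carrier (osys Y). os_nlim (osys Y) (\<lambda>n. \<beta> n (g n)) t"
  proof (rule Y.S.nlim_os_complete[OF Y.complete c.p.closed[OF g(1)]])
    fix \<epsilon> :: real assume \<epsilon>: "0 < \<epsilon>"
    obtain k where k: "\<forall>m\<ge>k. \<forall>n\<ge>k. os_norm Shat (\<phi>i m (g m) \<ominus>\<^bsub>Shat\<^esub> \<phi>i n (g n)) < \<epsilon>"
      using H.nlim_Cauchy[OF \<phi>i.closed[OF g(1)] s g(2) \<epsilon>] by blast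
    have "os_norm (osys Y) (\<beta> m (g m) \<ominus>\<^bsub>osys Y\<^esub> \<beta> n (g n)) < \<epsilon>" if "m \<ge> k" "n \<ge> k" for m n
      by (rule le_less_trans[OF \<beta>_dist[OF g(1) g(1)] k[rule_format, OF that]])
    then show "\<exists>k. \<forall>m\<ge>k. \<forall>n\<ge>k. os_norm (osys Y) (\<beta> m (g m) \<ominus>\<^bsub>osys Y\<^esub> \<beta> n (g n)) < \<epsilon>" by blast
  qed
  then have "\<exists>t. t \<in> carrier (osys Y) \<and> (\<exists>g. (\<forall>n. g n \<in> carrier (S n)) \<and>
     os_nlim Shat (\<lambda>n. \<phi>i n (g n)) s \<and> os_nlim (osys Y) (\<lambda>n. \<beta> n (g n)) t)"
    using g by blast
  then have e: "ext s \<in> carrier (osys Y) \<and> (\<exists>g. (\<forall>n. g n \<in> carrier (S n)) \<and>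
     os_nlim Shat (\<lambda>n. \<phi>i n (g n)) s \<and> os_nlim (osys Y) (\<lambda>n. \<beta> n (g n)) (ext s))"
    unfolding ext_def by (rule someI_ex)
  then show cl: "ext s \<in> carrier (osys Y)" by (rule conjunct1)
  obtain g' where g': "\<And>n. g' n \<in> carrier (S n)" "os_nlim Shat (\<lambda>n. \<phi>i n (g' n)) s"
    "os_nlim (osys Y) (\<lambda>n. \<beta> n (g' n)) (ext s)" using e by blast
  show "os_nlim (osys Y) (\<lambda>n. \<beta> (m n) (h n)) (ext s)"
    if h: "\<And>n. h n \<in> carrier (S (m n))" "os_nlim Shat (\<lambda>n. \<phi>i (m n) (h n)) s" for m :: "nat \<Rightarrow> nat" and h
    by (rule \<beta>_transfer[OF g'(1) h(1) s cl g'(2) h(2) g'(3)])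
qed

lemma ext_eqI:
  assumes s: "s \<in> carrier Shat" and t: "t \<in> carrier (osys Y)" and h: "\<And>n. h n \<in> carrier (S (m n))"
    and "os_nlim Shat (\<lambda>n. \<phi>i (m n) (h n)) s" "os_nlim (osys Y) (\<lambda>n. \<beta> (m n) (h n)) t"
  shows "ext s = t"
  by (rule Y.S.nlim_unique[OF c.p.closed[OF h] ext_cl[OF s] t ext_lim[OF s h assms(4)] assms(5)])

lemma ext_\<phi>i:
  assumes s: "s \<in> carrier (S k)"
  shows "ext (\<phi>i k s) = \<beta> k s"
  by (rule ext_eqI[of _ _ "\<lambda>_. s" "\<lambda>_. k", OF \<phi>i.closed[OF s] c.p.closed[OF s] s
      H.nlim_const[OF \<phi>i.closed[OF s]] Y.S.nlim_const[OF c.p.closed[OF s]]])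

lemma ext_ucp: "ucp Shat (osys Y) ext"
proof (rule ucpI[OF H.operator_system_axioms])
  have add: "ext (s \<oplus>\<^bsub>Shat\<^esub> t) = ext s \<oplus>\<^bsub>osys Y\<^esub> ext t" if s: "s \<in> carrier Shat" and t: "t \<in> carrier Shat" for s t
  proof -
    obtain g where g: "\<And>n. g n \<in> carrier (S n)" "os_nlim Shat (\<lambda>n. \<phi>i n (g n)) s" using s_dense[OF s] by blast
    obtain h where h: "\<And>n. h n \<in> carrier (S n)" "os_nlim Shat (\<lambda>n. \<phi>i n (h n)) t" using s_dense[OF t] by blast
    have "os_nlim (osys Y) (\<lambda>n. \<beta> n (g n \<oplus>\<^bsub>S n\<^esub> h n)) (ext s \<oplus>\<^bsub>osys Y\<^esub> ext t)"
      unfolding c.p.add[OF g(1) h(1)]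
      by (rule Y.S.nlim_add[OF c.p.closed[OF g(1)] c.p.closed[OF h(1)] ext_cl[OF s] ext_cl[OF t] ext_lim[OF s g] ext_lim[OF t h]])
    then show ?thesis
      by (rule ext_eqI[of _ _ "\<lambda>n. g n \<oplus>\<^bsub>S n\<^esub> h n" "\<lambda>n. n", OF H.v_add_cl[OF s t] Y.S.v_add_cl[OF ext_cl[OF s] ext_cl[OF t]]
          X.S.v_add_cl[OF g(1) h(1)] s_add_lim[OF g(1) h(1) s t g(2) h(2)]])
  qed
  have smult: "ext (c \<odot>\<^bsub>Shat\<^esub> s) = c \<odot>\<^bsub>osys Y\<^esub> ext s" if s: "s \<in> carrier Shat" for c s
  proof -
    obtain g where g: "\<And>n. g n \<in> carrier (S n)" "os_nlim Shat (\<lambda>n. \<phi>i n (g n)) s" using s_dense[OF s] by blast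
    have "os_nlim (osys Y) (\<lambda>n. \<beta> n (c \<odot>\<^bsub>S n\<^esub> g n)) (c \<odot>\<^bsub>osys Y\<^esub> ext s)"
      unfolding c.p.smult[OF g(1)]
      by (rule Y.S.nlim_smult[OF c.p.closed[OF g(1)] ext_cl[OF s] ext_lim[OF s g]])
    then show ?thesis
      by (rule ext_eqI[of _ _ "\<lambda>n. c \<odot>\<^bsub>S n\<^esub> g n" "\<lambda>n. n", OF H.smult_cl[OF s] Y.S.smult_cl[OF ext_cl[OF s]]
          X.S.smult_cl[OF g(1)] s_smult_lim[OF g(1) s g(2)]])
  qed
  show "complex_linear Shat (osys Y) ext"
    unfolding complex_linear_def using add smult ext_cl by blast
  show "ext (ounit Shat) = ounit (osys Y)"
    using ext_\<phi>i[OF X.S.ounit_closed, of 0] unfolding \<phi>i.unit c.p.unit .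
  \<comment> \<open>Complete positivity extends because \<open>cone_dense\<close> approximates
    \<open>G\<close> by positive matrices at the levels; density of elements alone would not
    suffice.\<close>
  fix n G assume G: "cone Shat n G"
  obtain Z where Z: "\<And>m. cone (S m) n (Z m)"
    and Zlim: "\<And>i j. i < n \<Longrightarrow> j < n \<Longrightarrow> os_nlim Shat (\<lambda>m. \<phi>i m (Z m i j)) (G i j)"
    using cone_dense[OF G] by blast
  note cG = H.K.P_cl[OF G] and cones = c.p.cone[OF Z]
  have lim: "os_nlim (osys Y) (\<lambda>m. \<beta> m (Z m i j)) (ext (G i j))" if "i < n" "j < n" for i j
    by (rule ext_lim[OF cG[OF that] X.S.K.P_cl[OF Z that] Zlim[OF that]])
  show "cone (osys Y) n (\<lambda>i j. ext (G i j))"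
    by (rule Y.S.cone_limit[OF cones Y.S.hermF_limit[OF Y.S.K.P_hermF[OF cones] ext_cl[OF cG] lim] lim])
qed

text \<open>On the algebra the map comes from the limit of C*-algebras. Compatibility with the
  actions holds along common level approximations, and both actions of \<open>Y\<close> are jointly
  continuous.\<close>

lemma ex_mediating:
  "\<exists>\<mu> \<nu>. ocs_hom L Y \<mu> \<nu> \<and>
     (\<forall>k. (\<forall>s\<in>carrier (S k). \<mu> (\<phi>i k s) = \<beta> k s) \<and> (\<forall>a\<in>carrier (A k). \<nu> (\<pi>i k a) = \<rho> k a))"
proof -
  obtain \<nu> where \<nu>: "cstar_hom Ahat (calg Y) \<nu>" "\<And>k a. a \<in> carrier (A k) \<Longrightarrow> \<nu> (\<pi>i k a) = \<rho> k a"
    using c_factor[OF Y.A.cstar_algebra_axioms c.h.hom \<rho>_compat] by blast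
  interpret \<nu>: cstar_morphism Ahat "calg Y" \<nu> by (rule cstar_morphismI[OF Ahat_cstar Y.A.cstar_algebra_axioms \<nu>(1)])
  have "ocs_hom L Y ext \<nu>"
  proof (rule ocs_homI[OF _ _ ocs_L], unfold L_simps)
    fix a s assume a: "a \<in> carrier Ahat" and s: "s \<in> carrier Shat"
    obtain f where f: "\<And>n. f n \<in> carrier (A n)" "c_nlim Ahat (\<lambda>n. \<pi>i n (f n)) a" using c_dense[OF a] by blast
    obtain g where g: "\<And>n. g n \<in> carrier (S n)" "os_nlim Shat (\<lambda>n. \<phi>i n (g n)) s" using s_dense[OF s] by blast
    have \<rho>lim: "c_nlim (calg Y) (\<lambda>n. \<rho> n (f n)) (\<nu> a)"
      using \<nu>.nlim_hom[OF \<pi>i.closed[OF f(1)] a f(2)] unfolding \<nu>(2)[OF f(1)] .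
    note \<beta>lim = ext_lim[OF s g] and ce = ext_cl[OF s] and cn = \<nu>.closed[OF a]
    have l: "os_nlim (osys Y) (\<lambda>n. \<beta> n (lact (X n) (f n) (g n))) (lact Y (\<nu> a) (ext s))"
      unfolding c.lact[OF f(1) g(1)] by (rule Y.l.nlim_act[OF c.h.closed[OF f(1)] c.p.closed[OF g(1)] cn ce \<rho>lim \<beta>lim])
    show "ext (l.lim_act a s) = lact Y (\<nu> a) (ext s)"
      by (rule ext_eqI[of _ _ "\<lambda>n. lact (X n) (f n) (g n)" "\<lambda>n. n", OF l.lim_act_cl[OF a s] Y.l_closed[OF cn ce]
          X.l_closed[OF f(1) g(1)] l.act_lim[OF f(1) g(1) a s f(2) g(2)] l])
    have r: "os_nlim (osys Y) (\<lambda>n. \<beta> n (ract (X n) (g n) (f n))) (ract Y (ext s) (\<nu> a))"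
      unfolding c.ract[OF f(1) g(1)] by (rule Y.r.nlim_act[OF c.h.closed[OF f(1)] c.p.closed[OF g(1)] cn ce \<rho>lim \<beta>lim])
    show "ext (r.lim_act a s) = ract Y (ext s) (\<nu> a)"
      by (rule ext_eqI[of _ _ "\<lambda>n. ract (X n) (g n) (f n)" "\<lambda>n. n", OF r.lim_act_cl[OF a s] Y.r_closed[OF cn ce]
          X.r_closed[OF f(1) g(1)] r.act_lim[OF f(1) g(1) a s f(2) g(2)] r])
  qed (rule ext_ucp \<nu>(1))+
  then show ?thesis using ext_\<phi>i \<nu>(2) by blast
qed

text \<open>All four maps are contractive, and the canonical images are dense in the completed
  system and in the limit algebra.\<close>

lemma mediating_unique:
  assumes h: "ocs_hom L Y \<mu> \<nu>" "ocs_hom L Y \<mu>' \<nu>'"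
    and \<mu>: "\<And>k s. s \<in> carrier (S k) \<Longrightarrow> \<mu> (\<phi>i k s) = \<mu>' (\<phi>i k s)"
    and \<nu>: "\<And>k a. a \<in> carrier (A k) \<Longrightarrow> \<nu> (\<pi>i k a) = \<nu>' (\<pi>i k a)"
  shows "x \<in> carrier Shat \<Longrightarrow> \<mu> x = \<mu>' x" and "a \<in> carrier Ahat \<Longrightarrow> \<nu> a = \<nu>' a"
proof -
  have u: "ucp Shat (osys Y) \<mu>" "ucp Shat (osys Y) \<mu>'" "cstar_hom Ahat (calg Y) \<nu>" "cstar_hom Ahat (calg Y) \<nu>'"
    using h by (simp_all add: ocs_hom_def L_simps)
  interpret \<mu>: ucp_map Shat "osys Y" \<mu> by (rule ucp_mapI[OF H.operator_system_axioms Y.S.operator_system_axioms u(1)])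
  interpret \<mu>': ucp_map Shat "osys Y" \<mu>' by (rule ucp_mapI[OF H.operator_system_axioms Y.S.operator_system_axioms u(2)])
  interpret \<nu>: cstar_morphism Ahat "calg Y" \<nu> by (rule cstar_morphismI[OF Ahat_cstar Y.A.cstar_algebra_axioms u(3)])
  interpret \<nu>': cstar_morphism Ahat "calg Y" \<nu>' by (rule cstar_morphismI[OF Ahat_cstar Y.A.cstar_algebra_axioms u(4)])
  show "\<mu> x = \<mu>' x" if x: "x \<in> carrier Shat"
  proof -
    obtain g where g: "\<And>n. g n \<in> carrier (S n)" "os_nlim Shat (\<lambda>n. \<phi>i n (g n)) x" using s_dense[OF x] by blast
    note cl = \<phi>i.closed[OF g(1)]
    show ?thesis
      by (rule Y.S.nlim_unique[OF \<mu>.closed[OF cl] \<mu>.closed[OF x] \<mu>'.closed[OF x] \<mu>.nlim_ucp[OF cl x g(2)]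
          \<mu>'.nlim_ucp[OF cl x g(2), folded \<mu>[OF g(1)]]])
  qed
  show "\<nu> a = \<nu>' a" if a: "a \<in> carrier Ahat"
  proof -
    obtain f where f: "\<And>n. f n \<in> carrier (A n)" "c_nlim Ahat (\<lambda>n. \<pi>i n (f n)) a" using c_dense[OF a] by blast
    note cl = \<pi>i.closed[OF f(1)]
    show ?thesis
      by (rule Y.A.nlim_unique[OF \<nu>.closed[OF cl] \<nu>.closed[OF a] \<nu>'.closed[OF a] \<nu>.nlim_hom[OF cl a f(2)]
          \<nu>'.nlim_hom[OF cl a f(2), folded \<nu>[OF f(1)]]])
  qed
qed

end

theorem theorem5p7:
  fixes X :: "nat \<Rightarrow> ('s, 'a) ocsys"
    and \<phi> :: "nat \<Rightarrow> 's \<Rightarrow> 's" and \<pi> :: "nat \<Rightarrow> 'a \<Rightarrow> 'a"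
    and Sinf :: "'u opsys" and \<phi>inf :: "nat \<Rightarrow> 's \<Rightarrow> 'u"
    and Shat :: "'v opsys" and \<iota> :: "'u \<Rightarrow> 'v"
    and Ahat :: "'w cstar" and \<pi>inf :: "nat \<Rightarrow> 'a \<Rightarrow> 'w"
  assumes "ocs_inductive_system X \<phi> \<pi>"
    and "os_inductive_limit TYPE('u) (\<lambda>k. osys (X k)) \<phi> Sinf \<phi>inf"
    and "os_inductive_limit TYPE((nat \<Rightarrow> 's) set) (\<lambda>k. osys (X k)) \<phi> Sinf \<phi>inf"
    and "os_completion Sinf \<iota> Shat"
    and "cstar_inductive_limit TYPE('w) (\<lambda>k. calg (X k)) \<pi> Ahat \<pi>inf"
    and "cstar_inductive_limit TYPE((nat \<Rightarrow> 'a) set) (\<lambda>k. calg (X k)) \<pi> Ahat \<pi>inf"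
  shows "ocs_inductive_limit TYPE('t) TYPE('b) X \<phi> \<pi>
           (ocs_limit_object X Shat (\<lambda>k. \<iota> \<circ> \<phi>inf k) Ahat \<pi>inf)
           (\<lambda>k. \<iota> \<circ> \<phi>inf k) \<pi>inf"
proof -
  interpret ocs_limit_data X \<phi> \<pi> Sinf \<phi>inf Shat \<iota> Ahat \<pi>inf
    by (intro ocs_limit_data.intro ocs_system.intro ocs_limit_data_axioms.intro assms)
  show ?thesis
    unfolding ocs_inductive_limit_def
  proof (intro conjI allI impI ballI)
    show "ocs L" by (rule ocs_L)
    show "ocs_hom (X k) L (\<phi>i k) (\<pi>inf k)" for k by (rule ocs_hom_L)
    show "\<phi>i (Suc k) (\<phi> k s) = \<phi>i k s" if "s \<in> carrier (S k)" for k s using that by (rule \<phi>i_compat)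
    show "\<pi>inf (Suc k) (\<pi> k a) = \<pi>inf k a" if "a \<in> carrier (A k)" for k a using that by (rule \<pi>i_compat)
    fix Y :: "('t, 'b) ocsys" and \<beta> \<rho>
    assume Y: "ocs Y \<and> (\<forall>k. ocs_hom (X k) Y (\<beta> k) (\<rho> k)) \<and>
        (\<forall>k. (\<forall>s\<in>carrier (osys (X k)). \<beta> (Suc k) (\<phi> k s) = \<beta> k s) \<and>
             (\<forall>a\<in>carrier (calg (X k)). \<rho> (Suc k) (\<pi> k a) = \<rho> k a))"
    interpret ocs_limit_cocone X \<phi> \<pi> Sinf \<phi>inf Shat \<iota> Ahat \<pi>inf Y \<beta> \<rho>
      using Y by unfold_locales blast+
    obtain \<mu> \<nu> where m: "ocs_hom L Y \<mu> \<nu>" "\<And>k s. s \<in> carrier (S k) \<Longrightarrow> \<mu> (\<phi>i k s) = \<beta> k s"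
      "\<And>k a. a \<in> carrier (A k) \<Longrightarrow> \<nu> (\<pi>inf k a) = \<rho> k a"
      using ex_mediating by blast
    show "\<exists>\<mu> \<nu>. ocs_hom L Y \<mu> \<nu> \<and>
        (\<forall>k. (\<forall>s\<in>carrier (S k). \<mu> (\<phi>i k s) = \<beta> k s) \<and> (\<forall>a\<in>carrier (A k). \<nu> (\<pi>inf k a) = \<rho> k a)) \<and>
        (\<forall>\<mu>' \<nu>'. ocs_hom L Y \<mu>' \<nu>' \<and>
            (\<forall>k. (\<forall>s\<in>carrier (S k). \<mu>' (\<phi>i k s) = \<beta> k s) \<and> (\<forall>a\<in>carrier (A k). \<nu>' (\<pi>inf k a) = \<rho> k a)) \<longrightarrow>
            (\<forall>x\<in>carrier (osys L). \<mu>' x = \<mu> x) \<and> (\<forall>a\<in>carrier (calg L). \<nu>' a = \<nu> a))"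
    proof (intro exI conjI allI impI ballI)
      fix \<mu>' \<nu>'
      assume m': "ocs_hom L Y \<mu>' \<nu>' \<and>
        (\<forall>k. (\<forall>s\<in>carrier (S k). \<mu>' (\<phi>i k s) = \<beta> k s) \<and> (\<forall>a\<in>carrier (A k). \<nu>' (\<pi>inf k a) = \<rho> k a))"
      have 1: "\<mu>' (\<phi>i k s) = \<mu> (\<phi>i k s)" if "s \<in> carrier (S k)" for k s
        using m' m(2)[OF that] that by auto
      have 2: "\<nu>' (\<pi>inf k a) = \<nu> (\<pi>inf k a)" if "a \<in> carrier (A k)" for k a
        using m' m(3)[OF that] that by auto
      show "\<mu>' x = \<mu> x" if "x \<in> carrier (osys L)" for x
        using mediating_unique(1)[OF conjunct1[OF m'] m(1) 1 2] that by (simp add: L_simps)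
      show "\<nu>' a = \<nu> a" if "a \<in> carrier (calg L)" for a
        using mediating_unique(2)[OF conjunct1[OF m'] m(1) 1 2] that by (simp add: L_simps)
    qed (rule m; assumption)+
  qed
qed

end
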